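(* Let $q\in L^\infty((0,T)\times\Omega)$ be a fixed potential and let $\omega\subset\Omega$ be a closed subset of $\Omega$ with positive measure. Assume that for any $r\in[1,+\infty)$, $$\partial_t q-\Delta q\in L^r(0,T;L^r(\Omega)),\qquad \nabla q\in L^r(0,T;L^r(\Omega)).$$ Additionally, if $\mathcal B$ is of Neumann type, assume that $\mathcal Bq=0$ on $(0,T)\times\partial\Omega$. Let $(h_K)_{K\in\mathbb N}$ be a sequence in $L^2(\Omega)$ such that, for any $K\in\mathbb N$, $$h_K=\sum_{k=K}^\infty a_{K,k}\varphi_{k,\mathcal B},\qquad \sum_{k=K}^\infty a_{K,k}^2=1,$$ and such that $\mathrm{supp}(h_K)\subset\omega$ in the sense that $h_K\mathbf 1_\omega=h_K$. Let $v_K$ be the solution of $$\frac{\partial v_K}{\partial t}-\Delta v_K=qv_K\ \text{ in }(0,T)\times\Omega,\qquad \mathcal Bv_K=0\ \text{ on }(0,T)\times\partial\Omega,\qquad v_K(0,\cdot)=h_K\ \text{ in }\Omega.$$ Let $X$ be the unit ball of the space of Radon measures on $[0,T]\times\overline\Omega$, and define the sequence of probability measures $\{\nu_K\}_{K\in\mathbb N}\in X^{\mathbb N}$ by $$\nu_K:=\frac{v_K^2}{\iint_{(0,T)\times\Omega}v_K^2}.$$ Then any closure point $\nu_\infty\in X$ of the sequence $\{\nu_K\}_{K\in\mathbb N}$ (for the weak-$*$ topology, in duality with $\mathscr C^0([0,T]\times\overline\Omega)$) satisfies $$\mathrm{supp}(\nu_\infty)\subset\{t=0\}\times\omega,\qquad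 \nu_\infty([0,T]\times\overline\Omega)=1,\qquad \nu_\infty\ge 0\text{ in the sense of measures}.$$ Here $\mathrm{supp}(\nu_\infty)\subset\{t=0\}\times\omega$ means: for any $\phi\in\mathscr C^0([0,T]\times\overline\Omega)$ such that $\mathrm{supp}(\phi)\subset(\{t=0\}\times\omega)^c$, one has $\langle\nu_\infty,\phi\rangle=0$.
   Context: $\Omega\subset\mathbb R^d$ is a bounded open set with $\mathscr C^2$ boundary, $T>0$ is fixed, and $\mathcal B$ is a boundary operator which is either $\mathcal Bu=u$ (Dirichlet case) or $\mathcal Bu=\frac{\partial u}{\partial\nu}$ (Neumann case, $\nu$ being the outward unit normal). $\{\lambda_{k,\mathcal B}\}_{k\ge1}$ and $\{\varphi_{k,\mathcal B}\}_{k\ge1}$ denote the eigenvalues (in increasing order, counted with multiplicity, $0\le\lambda_{1,\mathcal B}\le\lambda_{2,\mathcal B}\le\dots\to\infty$) and associated eigenfunctions, forming an orthonormal basis of $L^2(\Omega)$, of the Laplacian: $-\Delta\varphi_{k,\mathcal B}=\lambda_{k,\mathcal B}\varphi_{k,\mathcal B}$ in $\Omega$, $\mathcal B\varphi_{k,\mathcal B}=0$ on $\partial\Omega$, $\int_\Omega\varphi_{k,\mathcal B}^2=1$. Indices $K,k\in\mathbb N$ start at $1$. The function $v_K^2/\iint v_K^2$ is identified with the measure on $[0,T]\times\overline\Omega$ having it as density with respect to Lebesgue measure; $\langle\cdot,\cdot\rangle$ is the duality bracket between Radon measures on, and continuous functions on, $[0,T]\times\overline\Omega$. *)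

theory Defs
  imports "HOL-Analysis.Analysis"
begin

section \<open>Smooth functions and domains\<close>

primrec cont_diff :: "nat \<Rightarrow> ('a::euclidean_space \<Rightarrow> real) \<Rightarrow> bool" where
  "cont_diff 0 f \<longleftrightarrow> continuous_on UNIV f"
| "cont_diff (Suc k) f \<longleftrightarrow>
     (\<forall>x. f differentiable (at x)) \<and> (\<forall>v. cont_diff k (\<lambda>x. frechet_derivative f (at x) v))"

definition test_functions :: "'a::euclidean_space set \<Rightarrow> ('a \<Rightarrow> real) set" where
  "test_functions U = {\<psi>. (\<forall>k. cont_diff k \<psi>) \<and> compact (closure {x. \<psi> x \<noteq> 0}) \<and>
                            closure {x. \<psi> x \<noteq> 0} \<subseteq> U}"

text \<open>Near each boundary point the set is the strict epigraph, in a direction \<open>e\<close>, of a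
  \<open>C\<^sup>2\<close> function of the coordinates orthogonal to \<open>e\<close>.\<close>

definition C2_boundary :: "'a::euclidean_space set \<Rightarrow> bool" where
  "C2_boundary \<Omega> \<longleftrightarrow>
     (\<forall>x0\<in>frontier \<Omega>. \<exists>r>0. \<exists>e \<gamma>. norm e = 1 \<and> cont_diff 2 \<gamma> \<and>
        \<Omega> \<inter> ball x0 r = {x \<in> ball x0 r. \<gamma> (x - (x \<bullet> e) *\<^sub>R e) < x \<bullet> e})"

definition dderiv :: "'a::euclidean_space \<Rightarrow> ('a \<Rightarrow> real) \<Rightarrow> 'a \<Rightarrow> real" where
  "dderiv v \<psi> x = frechet_derivative \<psi> (at x) v"

definition grad :: "('a::euclidean_space \<Rightarrow> real) \<Rightarrow> 'a \<Rightarrow> 'a" where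
  "grad \<psi> x = (\<Sum>b\<in>Basis. dderiv b \<psi> x *\<^sub>R b)"

definition laplacian :: "('a::euclidean_space \<Rightarrow> real) \<Rightarrow> 'a \<Rightarrow> real" where
  "laplacian \<psi> x = (\<Sum>b\<in>Basis. dderiv b (dderiv b \<psi>) x)"

text \<open>Functions of time and space live on \<^typ>\<open>real \<times> 'a\<close>, time being the first component.\<close>

definition time_deriv :: "(real \<times> 'a::euclidean_space \<Rightarrow> real) \<Rightarrow> real \<times> 'a \<Rightarrow> real" where
  "time_deriv \<psi> = dderiv (1, 0) \<psi>"

definition space_grad :: "(real \<times> 'a::euclidean_space \<Rightarrow> real) \<Rightarrow> real \<times> 'a \<Rightarrow> 'a" where
  "space_grad \<psi> z = grad (\<lambda>x. \<psi> (fst z, x)) (snd z)"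

definition space_laplacian :: "(real \<times> 'a::euclidean_space \<Rightarrow> real) \<Rightarrow> real \<times> 'a \<Rightarrow> real" where
  "space_laplacian \<psi> z = laplacian (\<lambda>x. \<psi> (fst z, x)) (snd z)"


section \<open>Lebesgue spaces and weak derivatives\<close>

definition Lp :: "real \<Rightarrow> 'a::euclidean_space set \<Rightarrow> ('a \<Rightarrow> 'b::euclidean_space) \<Rightarrow> bool" where
  "Lp r U f \<longleftrightarrow> f \<in> borel_measurable (lebesgue_on U) \<and>
                integrable (lebesgue_on U) (\<lambda>x. norm (f x) powr r)"

definition Linfty :: "'a::euclidean_space set \<Rightarrow> ('a \<Rightarrow> real) \<Rightarrow> bool" where
  "Linfty U f \<longleftrightarrow> f \<in> borel_measurable (lebesgue_on U) \<and>
                  (\<exists>C. AE x in lebesgue_on U. \<bar>f x\<bar> \<le> C)"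

definition L1_loc :: "'a::euclidean_space set \<Rightarrow> ('a \<Rightarrow> real) \<Rightarrow> bool" where
  "L1_loc U f \<longleftrightarrow> (\<forall>K. compact K \<and> K \<subseteq> U \<longrightarrow> integrable (lebesgue_on K) f)"

definition weak_dderiv ::
    "'a::euclidean_space set \<Rightarrow> 'a \<Rightarrow> ('a \<Rightarrow> real) \<Rightarrow> ('a \<Rightarrow> real) \<Rightarrow> bool" where
  "weak_dderiv U v f g \<longleftrightarrow> L1_loc U f \<and> L1_loc U g \<and>
     (\<forall>\<psi>\<in>test_functions U.
        (LINT x|lebesgue_on U. f x * dderiv v \<psi> x) = - (LINT x|lebesgue_on U. g x * \<psi> x))"

definition weak_grad :: "'a::euclidean_space set \<Rightarrow> ('a \<Rightarrow> real) \<Rightarrow> ('a \<Rightarrow> 'a) \<Rightarrow> bool" where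
  "weak_grad U f G \<longleftrightarrow> (\<forall>b\<in>Basis. weak_dderiv U b f (\<lambda>x. G x \<bullet> b))"

definition weak_laplacian :: "'a::euclidean_space set \<Rightarrow> ('a \<Rightarrow> real) \<Rightarrow> ('a \<Rightarrow> real) \<Rightarrow> bool" where
  "weak_laplacian U f g \<longleftrightarrow> L1_loc U f \<and> L1_loc U g \<and>
     (\<forall>\<psi>\<in>test_functions U.
        (LINT x|lebesgue_on U. f x * laplacian \<psi> x) = (LINT x|lebesgue_on U. g x * \<psi> x))"

definition weak_space_grad ::
    "(real \<times> 'a::euclidean_space) set \<Rightarrow> (real \<times> 'a \<Rightarrow> real) \<Rightarrow> (real \<times> 'a \<Rightarrow> 'a) \<Rightarrow> bool" where
  "weak_space_grad Q u G \<longleftrightarrow> (\<forall>b\<in>Basis. weak_dderiv Q (0, b) u (\<lambda>z. G z \<bullet> b))"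

text \<open>\<open>\<partial>\<^sub>t u - \<Delta> u = F\<close> in the sense of distributions on \<open>Q\<close>.\<close>

definition weak_heat_op ::
    "(real \<times> 'a::euclidean_space) set \<Rightarrow> (real \<times> 'a \<Rightarrow> real) \<Rightarrow> (real \<times> 'a \<Rightarrow> real) \<Rightarrow> bool" where
  "weak_heat_op Q u F \<longleftrightarrow> L1_loc Q u \<and> L1_loc Q F \<and>
     (\<forall>\<psi>\<in>test_functions Q.
        (LINT z|lebesgue_on Q. u z * (- time_deriv \<psi> z - space_laplacian \<psi> z)) =
        (LINT z|lebesgue_on Q. F z * \<psi> z))"

definition H1 :: "'a::euclidean_space set \<Rightarrow> ('a \<Rightarrow> real) \<Rightarrow> bool" where
  "H1 U f \<longleftrightarrow> Lp 2 U f \<and> (\<exists>G. weak_grad U f G \<and> Lp 2 U G)"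

definition H10 :: "'a::euclidean_space set \<Rightarrow> ('a \<Rightarrow> real) \<Rightarrow> bool" where
  "H10 U f \<longleftrightarrow> Lp 2 U f \<and> (\<exists>G. weak_grad U f G \<and> Lp 2 U G \<and>
     (\<exists>\<psi>. (\<forall>n::nat. \<psi> n \<in> test_functions U) \<and>
          (\<lambda>n. LINT x|lebesgue_on U. (f x - \<psi> n x)\<^sup>2 + (norm (G x - grad (\<psi> n) x))\<^sup>2)
            \<longlonglongrightarrow> 0))"


section \<open>Boundary conditions, eigenfunctions and the heat equation\<close>

datatype boundary_operator = Dirichlet | Neumann

text \<open>Homogeneous boundary conditions are understood in the trace sense. The trace of an \<open>H\<^sup>1\<close>
  function vanishes iff the function is in \<^const>\<open>H10\<close>. The normal derivative of \<open>f\<close> is the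
  distribution on the boundary given by Green's formula,
  \<open>\<integral>\<^bsub>\<partial>\<Omega>\<^esub> (\<partial>f/\<partial>\<nu>) \<psi> = \<integral>\<^bsub>\<Omega>\<^esub> \<nabla>f \<bullet> \<nabla>\<psi> + (\<Delta> f) \<psi>\<close>,
  where \<open>\<psi>\<close> ranges over restrictions to \<open>\<Omega>\<close> of test functions on the whole space; the test
  functions need not vanish on the boundary of \<open>\<Omega>\<close>.\<close>

definition normal_deriv_zero :: "'a::euclidean_space set \<Rightarrow> ('a \<Rightarrow> real) \<Rightarrow> bool" where
  "normal_deriv_zero \<Omega> f \<longleftrightarrow>
     (\<exists>G g. weak_grad \<Omega> f G \<and> Lp 2 \<Omega> G \<and> weak_laplacian \<Omega> f g \<and> Lp 2 \<Omega> g \<and>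
        (\<forall>\<psi>\<in>test_functions UNIV. (LINT x|lebesgue_on \<Omega>. G x \<bullet> grad \<psi> x + g x * \<psi> x) = 0))"

fun boundary_cond :: "boundary_operator \<Rightarrow> 'a::euclidean_space set \<Rightarrow> ('a \<Rightarrow> real) \<Rightarrow> bool" where
  "boundary_cond Dirichlet \<Omega> f \<longleftrightarrow> H10 \<Omega> f"
| "boundary_cond Neumann \<Omega> f \<longleftrightarrow> normal_deriv_zero \<Omega> f"

definition cylinder :: "real \<Rightarrow> 'a set \<Rightarrow> (real \<times> 'a) set" where
  "cylinder T \<Omega> = {0<..<T} \<times> \<Omega>"

text \<open>On the lateral boundary, Green's formula reads
  \<open>\<integral>\<integral> (\<partial>u/\<partial>\<nu>) \<psi> = \<integral>\<integral> \<nabla>u \<bullet> \<nabla>\<psi> - u \<partial>\<^sub>t\<psi> - (\<partial>\<^sub>t u - \<Delta> u) \<psi>\<close>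
  for \<open>\<psi>\<close> vanishing near \<open>t = 0\<close> and \<open>t = T\<close>.\<close>

definition lateral_normal_deriv_zero ::
    "real \<Rightarrow> 'a::euclidean_space set \<Rightarrow> (real \<times> 'a \<Rightarrow> real) \<Rightarrow> bool" where
  "lateral_normal_deriv_zero T \<Omega> u \<longleftrightarrow>
     Lp 1 (cylinder T \<Omega>) u \<and>
     (\<exists>G F. weak_space_grad (cylinder T \<Omega>) u G \<and> Lp 1 (cylinder T \<Omega>) G \<and>
        weak_heat_op (cylinder T \<Omega>) u F \<and> Lp 1 (cylinder T \<Omega>) F \<and>
        (\<forall>\<psi>\<in>test_functions (cylinder T UNIV).
          (LINT z|lebesgue_on (cylinder T \<Omega>).
             G z \<bullet> space_grad \<psi> z - u z * time_deriv \<psi> z - F z * \<psi> z) = 0))"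

fun lateral_boundary_cond ::
    "boundary_operator \<Rightarrow> real \<Rightarrow> 'a::euclidean_space set \<Rightarrow> (real \<times> 'a \<Rightarrow> real) \<Rightarrow> bool" where
  "lateral_boundary_cond Dirichlet T \<Omega> u \<longleftrightarrow>
     (AE t in lebesgue_on {0<..<T}. H10 \<Omega> (\<lambda>x. u (t, x)))"
| "lateral_boundary_cond Neumann T \<Omega> u \<longleftrightarrow> lateral_normal_deriv_zero T \<Omega> u"

definition laplace_eigenfunction ::
    "boundary_operator \<Rightarrow> 'a::euclidean_space set \<Rightarrow> real \<Rightarrow> ('a \<Rightarrow> real) \<Rightarrow> bool" where
  "laplace_eigenfunction B \<Omega> l f \<longleftrightarrow>
     H1 \<Omega> f \<and> weak_laplacian \<Omega> f (\<lambda>x. - l * f x) \<and> boundary_cond B \<Omega> f"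

text \<open>All sequences are indexed from \<open>1\<close>; their value at \<open>0\<close> is irrelevant.\<close>

definition orthonormal_basis_L2 ::
    "'a::euclidean_space set \<Rightarrow> (nat \<Rightarrow> 'a \<Rightarrow> real) \<Rightarrow> bool" where
  "orthonormal_basis_L2 \<Omega> \<phi> \<longleftrightarrow>
     (\<forall>k\<ge>1. Lp 2 \<Omega> (\<phi> k)) \<and>
     (\<forall>j\<ge>1. \<forall>k\<ge>1. (LINT x|lebesgue_on \<Omega>. \<phi> j x * \<phi> k x) = (if j = k then 1 else 0)) \<and>
     (\<forall>f. Lp 2 \<Omega> f \<longrightarrow>
        (\<lambda>n. LINT x|lebesgue_on \<Omega>.
           (f x - (\<Sum>k=1..n. (LINT y|lebesgue_on \<Omega>. f y * \<phi> k y) * \<phi> k x))\<^sup>2) \<longlonglongrightarrow> 0)"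

definition laplace_eigenbasis ::
    "boundary_operator \<Rightarrow> 'a::euclidean_space set \<Rightarrow> (nat \<Rightarrow> real) \<Rightarrow> (nat \<Rightarrow> 'a \<Rightarrow> real) \<Rightarrow> bool" where
  "laplace_eigenbasis B \<Omega> l \<phi> \<longleftrightarrow>
     (\<forall>k\<ge>1. laplace_eigenfunction B \<Omega> (l k) (\<phi> k)) \<and> orthonormal_basis_L2 \<Omega> \<phi> \<and>
     0 \<le> l 1 \<and> (\<forall>j k. 1 \<le> j \<and> j \<le> k \<longrightarrow> l j \<le> l k) \<and> filterlim l at_top sequentially"

text \<open>Weak solutions in \<open>C([0,T]; L\<^sup>2(\<Omega>)) \<inter> L\<^sup>2(0,T; H\<^sup>1(\<Omega>))\<close>; \<open>v\<close> denotes the representative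
  whose time slices are continuous in \<open>L\<^sup>2(\<Omega>)\<close>.\<close>

definition heat_solution ::
    "boundary_operator \<Rightarrow> real \<Rightarrow> 'a::euclidean_space set \<Rightarrow> (real \<times> 'a \<Rightarrow> real) \<Rightarrow>
      ('a \<Rightarrow> real) \<Rightarrow> (real \<times> 'a \<Rightarrow> real) \<Rightarrow> bool" where
  "heat_solution B T \<Omega> q h v \<longleftrightarrow>
     (\<forall>t\<in>{0..T}. Lp 2 \<Omega> (\<lambda>x. v (t, x))) \<and>
     (\<forall>s\<in>{0..T}. ((\<lambda>t. LINT x|lebesgue_on \<Omega>. (v (t, x) - v (s, x))\<^sup>2) \<longlongrightarrow> 0)
                    (at s within {0..T})) \<and>
     Lp 2 (cylinder T \<Omega>) v \<and>
     (\<exists>G. weak_space_grad (cylinder T \<Omega>) v G \<and> Lp 2 (cylinder T \<Omega>) G) \<and>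
     weak_heat_op (cylinder T \<Omega>) v (\<lambda>z. q z * v z) \<and>
     lateral_boundary_cond B T \<Omega> v \<and>
     (AE x in lebesgue_on \<Omega>. v (0, x) = h x)"


section \<open>Signed Radon measures on a compact set\<close>

text \<open>A signed measure is a real-valued countably additive function on the Borel subsets of \<open>S\<close>
  (its values on other sets are irrelevant). On a compact subset of a Euclidean space every such
  measure is Radon.\<close>

definition borel_sets_on :: "'b::topological_space set \<Rightarrow> 'b set set" where
  "borel_sets_on S = sets (restrict_space borel S)"

definition signed_measure :: "'b::topological_space set \<Rightarrow> ('b set \<Rightarrow> real) \<Rightarrow> bool" where
  "signed_measure S \<mu> \<longleftrightarrow>
     (\<forall>A::nat \<Rightarrow> 'b set. range A \<subseteq> borel_sets_on S \<and> disjoint_family A \<longrightarrow>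
        (\<lambda>i. \<mu> (A i)) sums \<mu> (\<Union>i. A i))"

definition measure_unit_ball :: "'b::topological_space set \<Rightarrow> ('b set \<Rightarrow> real) set" where
  "measure_unit_ball S = {\<mu>. signed_measure S \<mu> \<and>
     (\<forall>\<A>. finite \<A> \<and> \<A> \<subseteq> borel_sets_on S \<and> disjoint \<A> \<longrightarrow> (\<Sum>A\<in>\<A>. \<bar>\<mu> A\<bar>) \<le> 1)}"

definition positive_variation ::
    "'b::topological_space set \<Rightarrow> ('b set \<Rightarrow> real) \<Rightarrow> 'b measure" where
  "positive_variation S \<mu> =
     measure_of S (borel_sets_on S)
       (\<lambda>A. SUP E\<in>{E \<in> borel_sets_on S. E \<subseteq> A}. ennreal (\<mu> E))"

text \<open>Integration against the Jordan decomposition.\<close>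

definition bracket ::
    "'b::topological_space set \<Rightarrow> ('b set \<Rightarrow> real) \<Rightarrow> ('b \<Rightarrow> real) \<Rightarrow> real" where
  "bracket S \<mu> \<phi> = (LINT z|positive_variation S \<mu>. \<phi> z) -
                   (LINT z|positive_variation S (\<lambda>A. - \<mu> A). \<phi> z)"

definition weak_star_ball :: "'b::topological_space set \<Rightarrow> ('b set \<Rightarrow> real) topology" where
  "weak_star_ball S =
     pullback_topology (measure_unit_ball S)
       (\<lambda>\<mu>. \<lambda>\<phi>\<in>{\<phi>. continuous_on S \<phi>}. bracket S \<mu> \<phi>)
       (product_topology (\<lambda>_. euclideanreal) {\<phi>. continuous_on S \<phi>})"

text \<open>Closure points of a sequence are its cluster points, not the points of the closure of its
  range.\<close>

definition sequence_closure_point :: "'c topology \<Rightarrow> (nat \<Rightarrow> 'c) \<Rightarrow> 'c \<Rightarrow> bool" where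
  "sequence_closure_point X s x \<longleftrightarrow>
     x \<in> topspace X \<and> (\<forall>U. openin X U \<and> x \<in> U \<longrightarrow> (\<exists>\<^sub>F n in sequentially. s n \<in> U))"

definition closed_cylinder :: "real \<Rightarrow> 'a::topological_space set \<Rightarrow> (real \<times> 'a) set" where
  "closed_cylinder T \<Omega> = {0..T} \<times> closure \<Omega>"

text \<open>The density is extended by \<open>0\<close> to the boundary of the cylinder, which is a null set when
  \<open>\<Omega>\<close> has a \<open>C\<^sup>2\<close> boundary.\<close>

definition normalized_square_measure ::
    "real \<Rightarrow> 'a::euclidean_space set \<Rightarrow> (real \<times> 'a \<Rightarrow> real) \<Rightarrow> (real \<times> 'a) set \<Rightarrow> real" where
  "normalized_square_measure T \<Omega> v A =
     (LINT z|lebesgue_on (A \<inter> cylinder T \<Omega>). (v z)\<^sup>2) / (LINT z|lebesgue_on (cylinder T \<Omega>). (v z)\<^sup>2)"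

end

theory Submission
  imports Defs "HOL-Real_Asymp.Real_Asymp"
begin

text \<open>
  The mechanism is parabolic smoothing at high frequency. Expand the solution in the eigenbasis,
  \<open>v\<^sub>K(t) = \<Sum>\<^sub>k c\<^sub>k(t) \<phi>\<^sub>k\<close>; then \<open>c\<^sub>k' = - \<Lambda>\<^sub>k c\<^sub>k + f\<^sub>k\<close>, where \<open>f\<^sub>k\<close> are the coefficients of \<open>q v\<^sub>K\<close>,
  and \<open>c\<^sub>k(0) = 0\<close> for \<open>k < K\<close>. All bounds below are relative to the total mass
  \<open>S = \<integral>\<integral> v\<^sub>K\<^sup>2\<close>, so it suffices to show two things.

  \<^item> Every fixed mode carries a vanishing fraction of the mass: \<open>\<integral> c\<^sub>j\<^sup>2 = o(S)\<close> as \<open>K \<rightarrow> \<infinity>\<close>. The modes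
    in \<open>{n<..<K}\<close> start from \<open>0\<close> and satisfy \<open>\<Lambda>\<^sub>k\<^sup>2 \<integral> c\<^sub>k\<^sup>2 \<le> \<integral> f\<^sub>k\<^sup>2\<close> (\<open>mode_estimate\<close>), hence are small when
    \<open>\<Lambda>\<^sub>n\<close> is large. The modes up to \<open>n\<close> are driven by themselves, by those middle modes, and by the modes
    from \<open>K\<close> on; the last influence goes through the tails of \<open>q \<phi>\<^sub>j\<close>, \<open>j \<le> n\<close>, which tend to \<open>0\<close> by Parseval.
    Gronwall's inequality concludes (\<open>low_modes_estimate\<close>).

  \<^item> Away from \<open>{0} \<times> \<omega>\<close> the high modes are controlled as well. Multiply by a weight
    \<open>\<theta>(t) \<zeta>(x)\<close> such that \<open>\<theta>(0) \<zeta> h\<^sub>K = 0\<close>. The energy identity for \<open>\<theta>\<^sup>2 \<integral> (\<zeta> v\<^sub>K)\<^sup>2\<close>, in which the commutator of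
    the Laplacian with \<open>\<zeta>\<close> costs only \<open>\<integral> |\<nabla>\<zeta>|\<^sup>2 v\<^sub>K\<^sup>2\<close>, bounds \<open>\<Sum>\<^sub>m \<Lambda>\<^sub>m \<integral> \<theta>\<^sup>2 (\<zeta> v\<^sub>K, \<phi>\<^sub>m)\<^sup>2\<close> by a constant
    times \<open>S\<close>, with a constant that does not depend on \<open>K\<close> (\<open>weighted_energy\<close>). Since \<open>\<Lambda>\<^sub>m \<rightarrow> \<infinity>\<close>, the
    coefficients with large \<open>m\<close> of \<open>\<theta> \<zeta> v\<^sub>K\<close> are negligible; those with small \<open>m\<close> are negligible by the first point.
    So \<open>\<integral>\<integral> \<theta>\<^sup>2 \<zeta>\<^sup>2 v\<^sub>K\<^sup>2 = o(S)\<close> (\<open>weighted_mass_small\<close>).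

  A continuous \<open>f\<close> vanishing on \<open>{0} \<times> \<omega>\<close> is bounded by \<open>\<epsilon> + M \<zeta>\<^sup>2 + M t\<^sup>2\<close> with \<open>\<zeta>\<close> supported away from
  \<open>\<omega>\<close> (\<open>concentration_majorant\<close>); applying the second point to the weights \<open>\<zeta>\<close> and \<open>t\<close> gives \<open>\<integral> f d\<nu>\<^sub>K \<rightarrow> 0\<close>. The
  total mass and positivity of a closure point follow from those of \<open>\<nu>\<^sub>K\<close>, because all three properties
  can be read off the brackets with continuous functions; positivity uses the Jordan decomposition
  and inner regularity (\<open>nonneg_bracket_imp_nonneg\<close>).

  Two further parts of the text make this rigorous for weak solutions. The mode equations must be
  extracted from the distributional formulation (\<open>heat_solution_modes\<close>); and, for this and for the
  commutator estimate, products \<open>\<zeta> \<phi>\<^sub>k\<close> and time averages of the solution must be admissible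
  in the weak eigenvalue equation. In the Neumann case this rests on the fact that test functions
  on the whole space are weakly dense in \<open>H\<^sup>1(\<Omega>)\<close> (\<open>Neumann_form_closure\<close>).
\<close>

section \<open>Smooth functions and test functions\<close>

text \<open>\<open>cont_diff\<close> is a recursion on the order of differentiability, which does not compose well
  with products; smoothness has a coinductive characterization instead: a class of functions that is
  stable under directional derivatives consists of smooth functions.\<close>

definition smooth :: "('a::euclidean_space \<Rightarrow> real) \<Rightarrow> bool" where
  "smooth f \<longleftrightarrow> (\<forall>k. cont_diff k f)"

lemma smooth_coinduct:
  assumes "P f"
    and step: "\<And>f. P f \<Longrightarrow> (\<forall>x. f differentiable (at x)) \<and> (\<forall>v. P (dderiv v f))"
  shows "smooth f"
proof -
  have "\<forall>f. P f \<longrightarrow> cont_diff k f" for k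
  proof (induction k)
    case 0
    have "continuous_on UNIV f" if "P f" for f
      using step[OF that] by (intro differentiable_imp_continuous_on) (simp add: differentiable_on_def)
    then show ?case by simp
  next
    case (Suc k)
    have "cont_diff (Suc k) f" if "P f" for f
      using step[OF that] Suc by (simp add: dderiv_def[abs_def])
    then show ?case by blast
  qed
  with assms(1) show ?thesis by (auto simp: smooth_def)
qed

lemma smooth_differentiable: "smooth f \<Longrightarrow> f differentiable (at x)"
  unfolding smooth_def by (drule spec[of _ "Suc 0"]) simp

lemma smooth_has_derivative: "smooth f \<Longrightarrow> (f has_derivative (\<lambda>v. dderiv v f x)) (at x)"
  using smooth_differentiable[of f x] by (simp add: dderiv_def frechet_derivative_works)

lemma smooth_dderiv: "smooth f \<Longrightarrow> smooth (dderiv v f)"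
  unfolding smooth_def dderiv_def[abs_def] by (metis cont_diff.simps(2))

lemma smooth_continuous: "smooth f \<Longrightarrow> continuous_on S f"
  unfolding smooth_def by (metis cont_diff.simps(1) continuous_on_subset subset_UNIV)

lemma dderivI: "(f has_derivative D) (at x) \<Longrightarrow> dderiv v f x = D v"
  unfolding dderiv_def by (metis frechet_derivative_at)

lemma dderiv_const [simp]: "dderiv v (\<lambda>x. c) = (\<lambda>x. 0)"
  using dderivI[OF has_derivative_const] by (intro ext)

lemma dderiv_add:
  "smooth f \<Longrightarrow> smooth g \<Longrightarrow> dderiv v (\<lambda>x. f x + g x) = (\<lambda>x. dderiv v f x + dderiv v g x)"
  using dderivI[OF has_derivative_add[OF smooth_has_derivative smooth_has_derivative, of f g]] by (intro ext)

lemma dderiv_mult: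
  "smooth f \<Longrightarrow> smooth g \<Longrightarrow> dderiv v (\<lambda>x. f x * g x) = (\<lambda>x. f x * dderiv v g x + dderiv v f x * g x)"
  using dderivI[OF has_derivative_mult[OF smooth_has_derivative smooth_has_derivative, of f g]] by (intro ext)

lemma has_derivative_smooth_comp:
  fixes F :: "real \<Rightarrow> real"
  assumes "smooth F" "smooth g"
  shows "((\<lambda>x. F (g x)) has_derivative (\<lambda>v. dderiv 1 F (g x) * dderiv v g x)) (at x)"
proof -
  have D: "(F has_derivative (\<lambda>h. dderiv h F (g x))) (at (g x))"
    using assms(1) by (rule smooth_has_derivative)
  have "dderiv h F (g x) = h * dderiv 1 F (g x)" for h
    using linear_scale[OF has_derivative_linear[OF D], of h 1] by simp
  then have "(F has_derivative (\<lambda>h. h * dderiv 1 F (g x))) (at (g x))"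
    by (intro has_derivative_eq_rhs[OF D] ext)
  from diff_chain_at[OF smooth_has_derivative[OF assms(2)] this]
  have "((F \<circ> g) has_derivative ((\<lambda>h. h * dderiv 1 F (g x)) \<circ> (\<lambda>v. dderiv v g x))) (at x)" .
  then show ?thesis by (simp add: o_def mult.commute)
qed

text \<open>The expressions built from smooth functions by sums, products, inversion and composition form such a
  stable class. This gives all closure properties of smoothness at once.\<close>

inductive smooth_expr :: "('a::euclidean_space \<Rightarrow> real) \<Rightarrow> bool" where
  base: "smooth f \<Longrightarrow> smooth_expr f"
| add: "smooth_expr f \<Longrightarrow> smooth_expr g \<Longrightarrow> smooth_expr (\<lambda>x. f x + g x)"
| mult: "smooth_expr f \<Longrightarrow> smooth_expr g \<Longrightarrow> smooth_expr (\<lambda>x. f x * g x)"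
| inv: "smooth g \<Longrightarrow> (\<And>x. g x \<noteq> 0) \<Longrightarrow> smooth_expr (\<lambda>x. inverse (g x))"
| comp: "smooth (F::real \<Rightarrow> real) \<Longrightarrow> smooth g \<Longrightarrow> smooth_expr (\<lambda>x. F (g x))"

lemma smooth_const [simp]: "smooth (\<lambda>x. c)"
  by (rule smooth_coinduct[where P="\<lambda>f. \<exists>c. f = (\<lambda>x. c)"]) auto

lemma smooth_expr_imp_smooth: "smooth_expr f \<Longrightarrow> smooth f"
proof (erule smooth_coinduct)
  fix f :: "'a \<Rightarrow> real" assume "smooth_expr f"
  then have "\<exists>D. (\<forall>x. (f has_derivative (\<lambda>v. D v x)) (at x)) \<and> (\<forall>v. smooth_expr (D v))"
  proof induction
    case (base f)
    then show ?case
      by (intro exI[of _ "\<lambda>v. dderiv v f"]) (auto intro: smooth_has_derivative smooth_dderiv smooth_expr.base)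
  next
    case (add f g)
    from add.IH(1) obtain D where D: "\<forall>x. (f has_derivative (\<lambda>v. D v x)) (at x)" "\<forall>v. smooth_expr (D v)" by (elim exE conjE)
    from add.IH(2) obtain E where E: "\<forall>x. (g has_derivative (\<lambda>v. E v x)) (at x)" "\<forall>v. smooth_expr (E v)" by (elim exE conjE)
    from D E show ?case
      by (intro exI[of _ "\<lambda>v x. D v x + E v x"]) (auto intro!: has_derivative_add smooth_expr.add)
  next
    case (mult f g)
    from mult.IH(1) obtain D where D: "\<forall>x. (f has_derivative (\<lambda>v. D v x)) (at x)" "\<forall>v. smooth_expr (D v)" by (elim exE conjE)
    from mult.IH(2) obtain E where E: "\<forall>x. (g has_derivative (\<lambda>v. E v x)) (at x)" "\<forall>v. smooth_expr (E v)" by (elim exE conjE)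
    from D E mult.hyps show ?case
      by (intro exI[of _ "\<lambda>v x. f x * E v x + D v x * g x"])
         (auto intro!: has_derivative_mult smooth_expr.add smooth_expr.mult)
  next
    case (inv g)
    have "((\<lambda>x. inverse (g x)) has_derivative (\<lambda>v. - 1 * (inverse (g x) * dderiv v g x * inverse (g x)))) (at x)" for x
      using Deriv.has_derivative_inverse[OF inv(2) smooth_has_derivative[OF inv(1)]] by simp
    then show ?case
      using inv by (intro exI[of _ "\<lambda>v x. - 1 * (inverse (g x) * dderiv v g x * inverse (g x))"])
         (intro conjI allI smooth_expr.mult smooth_expr.base[OF smooth_const] smooth_expr.inv
            smooth_expr.base[OF smooth_dderiv])
  next
    case (comp F g)
    then show ?case
      by (intro exI[of _ "\<lambda>v x. dderiv 1 F (g x) * dderiv v g x"])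
         (auto intro!: has_derivative_smooth_comp smooth_expr.mult smooth_expr.comp[of "dderiv 1 F"]
            smooth_expr.base[OF smooth_dderiv] smooth_dderiv)
  qed
  then obtain D where D: "\<forall>x. (f has_derivative (\<lambda>v. D v x)) (at x)" "\<forall>v. smooth_expr (D v)"
    by (elim exE conjE)
  have "dderiv v f = D v" for v
    using dderivI[OF D(1)[rule_format]] by (intro ext)
  with D show "(\<forall>x. f differentiable at x) \<and> (\<forall>v. smooth_expr (dderiv v f))"
    unfolding differentiable_def by auto
qed

lemma smooth_add [intro]: "smooth f \<Longrightarrow> smooth g \<Longrightarrow> smooth (\<lambda>x. f x + g x)"
  and smooth_mult [intro]: "smooth f \<Longrightarrow> smooth g \<Longrightarrow> smooth (\<lambda>x. f x * g x)"
  and smooth_inverse: "smooth g \<Longrightarrow> (\<And>x. g x \<noteq> 0) \<Longrightarrow> smooth (\<lambda>x. inverse (g x))"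
  and smooth_comp: "smooth (F::real \<Rightarrow> real) \<Longrightarrow> smooth g \<Longrightarrow> smooth (\<lambda>x. F (g x))"
  by (auto intro!: smooth_expr_imp_smooth intro: smooth_expr.add smooth_expr.mult smooth_expr.inv
      smooth_expr.comp smooth_expr.base)

lemma smooth_cmult: "smooth f \<Longrightarrow> smooth (\<lambda>x. c * f x)"
  by (intro smooth_mult smooth_const)

lemma smooth_diff: "smooth f \<Longrightarrow> smooth g \<Longrightarrow> smooth (\<lambda>x. f x - g x)"
  using smooth_add[OF _ smooth_cmult[of g "-1"], of f] by simp

lemma smooth_sum: "(\<And>i. i \<in> I \<Longrightarrow> smooth (f i)) \<Longrightarrow> smooth (\<lambda>x. \<Sum>i\<in>I. f i x)"
  by (induction I rule: infinite_finite_induct) auto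

lemma smooth_affine_comp:
  fixes L :: "'a::euclidean_space \<Rightarrow> 'b::euclidean_space"
  assumes "bounded_linear L" "smooth f"
  shows "smooth (\<lambda>x. f (L x + c))" and "dderiv v (\<lambda>x. f (L x + c)) = (\<lambda>x. dderiv (L v) f (L x + c))"
proof -
  have D: "((\<lambda>x. f (L x + c)) has_derivative (\<lambda>v. dderiv (L v) f (L x + c))) (at x)"
    if "smooth f" for f x
  proof -
    have "((\<lambda>x. L x + c) has_derivative L) (at x)"
      using has_derivative_add[OF bounded_linear_imp_has_derivative[OF assms(1)] has_derivative_const]
      by simp
    from diff_chain_at[OF this smooth_has_derivative[OF that]] show ?thesis by (simp add: o_def)
  qed
  then show "dderiv v (\<lambda>x. f (L x + c)) = (\<lambda>x. dderiv (L v) f (L x + c))"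
    using dderivI[OF D[OF assms(2)]] by (intro ext)
  have *: "dderiv v (\<lambda>x. f (L x + c)) = (\<lambda>x. dderiv (L v) f (L x + c))" if "smooth f" for f v
    using dderivI[OF D[OF that]] by (intro ext)
  then show "smooth (\<lambda>x. f (L x + c))"
  proof (intro smooth_coinduct[where P="\<lambda>g. \<exists>f. smooth f \<and> g = (\<lambda>x. f (L x + c))"], goal_cases)
    case (2 g)
    then obtain f where f: "smooth f" "g = (\<lambda>x. f (L x + c))" by blast
    show ?case
    proof (intro conjI allI)
      show "g differentiable at x" for x
        unfolding f(2) differentiable_def using D[OF f(1)] by blast
      show "\<exists>f. smooth f \<and> dderiv v g = (\<lambda>x. f (L x + c))" for v
        unfolding f(2) by (intro exI[of _ "dderiv (L v) f"] conjI smooth_dderiv f(1) *)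
    qed
  qed (use assms(2) in blast)
qed

lemma smooth_inner: "smooth (\<lambda>x. x \<bullet> b)"
proof -
  have "smooth (\<lambda>x::real. x)"
  proof (rule smooth_coinduct[where P="\<lambda>f. f = (\<lambda>x. x) \<or> (\<exists>c. f = (\<lambda>x. c))"])
    have "dderiv v (\<lambda>x::real. x) = (\<lambda>x. v)" for v
      using dderivI[OF has_derivative_ident] by (intro ext)
    then show "(\<forall>x. f differentiable at x) \<and> (\<forall>v. dderiv v f = (\<lambda>x. x) \<or> (\<exists>c. dderiv v f = (\<lambda>x. c)))"
      if "f = (\<lambda>x. x) \<or> (\<exists>c. f = (\<lambda>x. c))" for f :: "real \<Rightarrow> real"
      using that by auto
  qed simp
  from smooth_affine_comp(1)[OF bounded_linear_inner_left this, of b 0] show ?thesis by simp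
qed

lemma smooth_sqnorm: "smooth (\<lambda>x::'a::euclidean_space. (x - a) \<bullet> (x - a))"
proof -
  have "(\<lambda>x. (x - a) \<bullet> (x - a)) = (\<lambda>x. \<Sum>b\<in>Basis. (x \<bullet> b - a \<bullet> b) * (x \<bullet> b - a \<bullet> b))"
    by (rule ext, subst euclidean_inner) (simp add: inner_diff_left)
  then show ?thesis
    by (auto intro!: smooth_sum smooth_mult smooth_diff smooth_inner)
qed

text \<open>The function \<open>exp (- 1 / x)\<close>, continued by \<open>0\<close>, together with its products with polynomials
  in \<open>1 / x\<close>: this class is closed under differentiation.\<close>

definition flat :: "real poly \<Rightarrow> real \<Rightarrow> real" where
  "flat p x = (if x > 0 then poly p (inverse x) * exp (- inverse x) else 0)"

text \<open>The exponential beats every polynomial; this makes all derivatives vanish at \<open>0\<close>.\<close>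

lemma flat_tendsto: "((\<lambda>x. flat p x) \<longlongrightarrow> 0) (at_right 0)"
proof -
  have "((\<lambda>y. poly p y * exp (- y)) \<longlongrightarrow> 0) at_top"
  proof -
    have "((\<lambda>y. \<Sum>i\<le>degree p. coeff p i * (y ^ i / exp y)) \<longlongrightarrow> (\<Sum>i\<le>degree p. coeff p i * 0)) at_top"
      by (intro tendsto_sum tendsto_mult tendsto_const tendsto_power_div_exp_0)
    then show ?thesis
      by (simp add: poly_altdef exp_minus sum_distrib_right divide_inverse mult.assoc)
  qed
  then have "((\<lambda>x. poly p (inverse x) * exp (- inverse x)) \<longlongrightarrow> 0) (at_right 0)"
    by (rule filterlim_compose) (rule filterlim_inverse_at_top_right)
  moreover have "\<forall>\<^sub>F x in at_right 0. poly p (inverse x) * exp (- inverse x) = flat p x"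
    using eventually_at_right_less[of "0::real"] by eventually_elim (simp add: flat_def)
  ultimately show ?thesis by (rule Lim_transform_eventually)
qed

lemma flat_has_derivative:
  "(flat p has_field_derivative flat ([:0, 0, 1:] * (p - pderiv p)) x) (at x)"
proof -
  consider "x < 0" | "x > 0" | "x = 0" by linarith
  then show ?thesis
  proof cases
    case 1
    have "(flat p has_field_derivative 0) (at x)"
      by (rule has_field_derivative_transform_within_open[of "\<lambda>x. 0" _ _ "{..<0}"])
         (use 1 in \<open>auto simp: flat_def\<close>)
    with 1 show ?thesis by (simp add: flat_def)
  next
    case 2
    have "((\<lambda>x. poly p (inverse x) * exp (- inverse x)) has_field_derivative
      poly ([:0, 0, 1:] * (p - pderiv p)) (inverse x) * exp (- inverse x)) (at x)"
    proof -
      have i: "(inverse has_field_derivative - (inverse x ^ 2)) (at x)"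
        using DERIV_inverse[of x UNIV] 2 by (simp add: numeral_2_eq_2)
      have e: "((\<lambda>x. exp (- inverse x)) has_field_derivative exp (- inverse x) * (- (- (inverse x ^ 2)))) (at x)"
        by (rule DERIV_fun_exp[OF DERIV_minus[OF i]])
      have "((\<lambda>x. poly p (inverse x)) has_field_derivative poly (pderiv p) (inverse x) * (- (inverse x ^ 2))) (at x)"
        by (rule DERIV_chain2[OF poly_DERIV i])
      from DERIV_mult[OF this e] show ?thesis
        by (rule DERIV_cong) (simp add: algebra_simps power2_eq_square)
    qed
    then have "(flat p has_field_derivative
      poly ([:0, 0, 1:] * (p - pderiv p)) (inverse x) * exp (- inverse x)) (at x)"
      by (rule has_field_derivative_transform_within_open[where S="{0<..}"])
         (use 2 in \<open>simp_all add: flat_def\<close>)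
    with 2 show ?thesis by (simp add: flat_def)
  next
    case 3
    have "((\<lambda>y. (flat p y - flat p 0) / (y - 0)) \<longlongrightarrow> 0) (at 0)"
    proof (rule filterlim_split_at_real)
      have "\<forall>\<^sub>F y in at_left 0. 0 = (flat p y - flat p 0) / (y - 0)"
        using eventually_at_left_real[of "-1::real" 0, simplified]
        by eventually_elim (simp add: flat_def)
      then show "((\<lambda>y. (flat p y - flat p 0) / (y - 0)) \<longlongrightarrow> 0) (at_left 0)"
        by (rule Lim_transform_eventually[OF tendsto_const])
      have "\<forall>\<^sub>F y in at_right 0. flat ([:0, 1:] * p) y = (flat p y - flat p 0) / (y - 0)"
        using eventually_at_right_less[of "0::real"]
        by eventually_elim (simp add: flat_def divide_inverse)
      then show "((\<lambda>y. (flat p y - flat p 0) / (y - 0)) \<longlongrightarrow> 0) (at_right 0)"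
        by (rule Lim_transform_eventually[OF flat_tendsto])
    qed
    with 3 show ?thesis
      by (simp add: has_field_derivative_iff flat_def)
  qed
qed

lemma smooth_flat: "smooth (flat p)"
proof (rule smooth_coinduct[where P="\<lambda>f. \<exists>p. f = flat p"])
  fix f :: "real \<Rightarrow> real" assume "\<exists>p. f = flat p"
  then obtain p where f: "f = flat p" by blast
  let ?p' = "[:0, 0, 1:] * (p - pderiv p)"
  have D: "(f has_derivative (\<lambda>v. flat ?p' x * v)) (at x)" for x
    using flat_has_derivative[of p x] f by (simp add: has_field_derivative_def)
  have "dderiv v f = flat (smult v ?p')" for v
    using dderivI[OF D] by (auto simp: flat_def fun_eq_iff)
  with D show "(\<forall>x. f differentiable at x) \<and> (\<forall>v. \<exists>p. dderiv v f = flat p)"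
    unfolding differentiable_def by blast
qed blast

definition bump :: "real \<Rightarrow> real" where "bump = flat 1"

lemma smooth_bump: "smooth bump"
  and bump_pos_iff [simp]: "0 < bump x \<longleftrightarrow> 0 < x"
  and bump_nonneg [simp]: "0 \<le> bump x"
  and bump_zero: "x \<le> 0 \<Longrightarrow> bump x = 0"
  unfolding bump_def by (auto simp: smooth_flat flat_def)

text \<open>A smooth transition from \<open>0\<close> on the negative axis to \<open>1\<close> on \<open>{1..}\<close>.\<close>

definition smooth_step :: "real \<Rightarrow> real" where
  "smooth_step x = bump x * inverse (bump x + bump (1 - x))"

lemma bump_sum_pos: "0 < bump x + bump (1 - x)"
proof (cases "0 < x")
  case False
  then have "0 < bump (1 - x)" by simp
  then show ?thesis by (rule add_nonneg_pos[OF bump_nonneg])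
qed (intro add_pos_nonneg bump_nonneg, simp)

lemma smooth_step:
  shows "smooth smooth_step" and "0 \<le> smooth_step x" and "smooth_step x \<le> 1"
    and "x \<le> 0 \<Longrightarrow> smooth_step x = 0" and "x \<ge> 1 \<Longrightarrow> smooth_step x = 1"
proof -
  have "smooth (\<lambda>x. bump ((-1) *\<^sub>R x + 1))"
    by (rule smooth_affine_comp(1)) (auto intro: smooth_bump bounded_linear_minus bounded_linear_ident)
  then have "smooth (\<lambda>x. bump (1 - x))" by simp
  then have "smooth (\<lambda>x. bump x * inverse (bump x + bump (1 - x)))"
    using bump_sum_pos by (intro smooth_mult smooth_inverse smooth_add smooth_bump) (simp_all add: less_imp_neq[THEN not_sym])
  then show "smooth smooth_step" by (simp add: smooth_step_def[abs_def])
  show "0 \<le> smooth_step x" "smooth_step x \<le> 1"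
    using bump_sum_pos[of x] by (auto simp: smooth_step_def field_simps)
  show "x \<le> 0 \<Longrightarrow> smooth_step x = 0"
    by (simp add: smooth_step_def bump_zero)
  show "smooth_step x = 1" if "x \<ge> 1"
    using bump_pos_iff[of x] bump_zero[of "1 - x"] that by (simp add: smooth_step_def del: bump_pos_iff)
qed

lemma test_functions_iff:
  "\<psi> \<in> test_functions U \<longleftrightarrow> smooth \<psi> \<and> compact (closure {x. \<psi> x \<noteq> 0}) \<and> closure {x. \<psi> x \<noteq> 0} \<subseteq> U"
  by (simp add: test_functions_def smooth_def)

lemma test_functionI:
  assumes "smooth \<psi>" "compact C" "C \<subseteq> U" "\<And>x. x \<notin> C \<Longrightarrow> \<psi> x = 0"
  shows "\<psi> \<in> test_functions U"
proof -
  have "closure {x. \<psi> x \<noteq> 0} \<subseteq> C"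
    using assms by (intro closure_minimal compact_imp_closed) auto
  with assms show ?thesis
    unfolding test_functions_iff using compact_Int_closed[OF assms(2) closed_closure[of "{x. \<psi> x \<noteq> 0}"]]
    by (auto simp: inf.absorb2)
qed

lemma test_functionE:
  assumes "\<psi> \<in> test_functions U"
  obtains C where "compact C" "C \<subseteq> U" "\<And>x. x \<notin> C \<Longrightarrow> \<psi> x = 0" "\<And>v x. x \<notin> C \<Longrightarrow> dderiv v \<psi> x = 0"
proof
  let ?C = "closure {x. \<psi> x \<noteq> 0}"
  show "compact ?C" "?C \<subseteq> U" using assms by (auto simp: test_functions_iff)
  show out: "\<psi> x = 0" if "x \<notin> ?C" for x
    using that closure_subset[of "{x. \<psi> x \<noteq> 0}"] by blast
  show "dderiv v \<psi> x = 0" if "x \<notin> ?C" for v x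
  proof (rule dderivI[where D="\<lambda>v. 0"])
    show "(\<psi> has_derivative (\<lambda>v. 0)) (at x)"
    proof (rule has_derivative_transform_within_open[where f="\<lambda>x. 0" and s="- ?C"])
      show "0 = \<psi> y" if "y \<in> - ?C" for y using out[of y] that by simp
    qed (use that in \<open>simp_all add: open_Compl\<close>)
  qed
qed

lemma test_function_smooth: "\<psi> \<in> test_functions U \<Longrightarrow> smooth \<psi>"
  by (simp add: test_functions_iff)

lemma test_functions_mono: "\<psi> \<in> test_functions U \<Longrightarrow> U \<subseteq> V \<Longrightarrow> \<psi> \<in> test_functions V"
  by (auto simp: test_functions_iff)

lemma test_dderiv: "\<psi> \<in> test_functions U \<Longrightarrow> dderiv v \<psi> \<in> test_functions U"
  by (rule test_functionE, assumption) (rule test_functionI, auto simp: smooth_dderiv test_functions_iff)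

lemma test_mult_smooth: "\<psi> \<in> test_functions U \<Longrightarrow> smooth \<zeta> \<Longrightarrow> (\<lambda>x. \<zeta> x * \<psi> x) \<in> test_functions U"
  by (rule test_functionE, assumption) (rule test_functionI, auto simp: test_functions_iff)

lemma test_add:
  assumes "\<psi> \<in> test_functions U" "\<zeta> \<in> test_functions U"
  shows "(\<lambda>x. \<zeta> x + \<psi> x) \<in> test_functions U"
proof -
  obtain C where C: "compact C" "C \<subseteq> U" "\<And>x. x \<notin> C \<Longrightarrow> \<psi> x = 0" using assms test_functionE by metis
  obtain D where D: "compact D" "D \<subseteq> U" "\<And>x. x \<notin> D \<Longrightarrow> \<zeta> x = 0" using assms test_functionE by metis
  show ?thesis
    by (rule test_functionI[of _ "C \<union> D"])
       (use C D assms in \<open>auto intro: test_function_smooth\<close>)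
qed

text \<open>Finitely many smooth bumps, each supported in \<open>V\<close>, have a sum bounded below on \<open>K\<close>; a smooth step
  function applied to a multiple of this sum is a cut-off function.\<close>

lemma smooth_urysohn:
  fixes K :: "'a::euclidean_space set"
  assumes "compact K" "open V" "K \<subseteq> V"
  obtains \<zeta> where "\<zeta> \<in> test_functions V" "\<And>x. 0 \<le> \<zeta> x" "\<And>x. \<zeta> x \<le> 1" "\<And>x. x \<in> K \<Longrightarrow> \<zeta> x = 1"
proof -
  have "\<exists>r>0. cball x r \<subseteq> V" if "x \<in> K" for x
    using assms that open_contains_cball by blast
  then obtain r where r: "\<And>x. x \<in> K \<Longrightarrow> r x > 0 \<and> cball x (r x) \<subseteq> V" by metis
  obtain I where I: "I \<subseteq> K" "finite I" "K \<subseteq> (\<Union>x\<in>I. ball x (r x))"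
    using compactE_image[OF assms(1), of K "\<lambda>x. ball x (r x)"] r
    by (metis (no_types, lifting) UN_I centre_in_ball open_ball subsetI)
  define S where "S y = (\<Sum>x\<in>I. bump (- 1 * ((y - x) \<bullet> (y - x)) + (r x)\<^sup>2))" for y
  have dist: "(y - x) \<bullet> (y - x) = (dist x y)\<^sup>2" for x y :: 'a
    by (simp add: dist_norm norm_minus_commute flip: power2_norm_eq_inner)
  have S: "smooth S"
    unfolding S_def
    by (intro smooth_sum smooth_comp[OF smooth_bump] smooth_add smooth_const smooth_cmult smooth_sqnorm)
  have S0: "S y = 0" if "y \<notin> (\<Union>x\<in>I. cball x (r x))" for y
    unfolding S_def dist using that I r
    by (intro sum.neutral) (fastforce intro!: bump_zero power_mono simp: less_imp_le subset_iff)
  have Spos: "S y > 0" if "y \<in> K" for y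
  proof -
    have "y \<in> (\<Union>x\<in>I. ball x (r x))" using that I(3) by (rule subsetD[rotated])
    then obtain x where x: "x \<in> I" "dist x y < r x" by auto
    then have "0 < bump (- 1 * ((y - x) \<bullet> (y - x)) + (r x)\<^sup>2)"
      by (simp add: dist power_strict_mono)
    also have "\<dots> \<le> S y"
      unfolding S_def using x(1) I by (intro member_le_sum) auto
    finally show ?thesis .
  qed
  obtain m where m: "m > 0" "\<And>y. y \<in> K \<Longrightarrow> m \<le> S y"
  proof (cases "K = {}")
    case False
    from continuous_attains_inf[OF assms(1) this smooth_continuous[OF S]]
    show ?thesis using that Spos by blast
  qed (use that[of 1] in auto)
  show thesis
  proof
    show "(\<lambda>y. smooth_step (inverse m * S y)) \<in> test_functions V"
    proof (rule test_functionI)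
      show "smooth (\<lambda>y. smooth_step (inverse m * S y))"
        by (intro smooth_comp[OF smooth_step(1)] smooth_cmult S)
      show "compact (\<Union>x\<in>I. cball x (r x))" using I by (intro compact_UN) auto
      show "(\<Union>x\<in>I. cball x (r x)) \<subseteq> V" using r I by blast
      show "smooth_step (inverse m * S y) = 0" if "y \<notin> (\<Union>x\<in>I. cball x (r x))" for y
        using S0[OF that] by (simp add: smooth_step)
    qed
    show "smooth_step (inverse m * S x) = 1" if "x \<in> K" for x
      using m that by (intro smooth_step) (simp add: field_simps)
  qed (rule smooth_step)+
qed

lemma smooth_fst: "smooth (f :: real \<Rightarrow> real) \<Longrightarrow> smooth (\<lambda>z::real \<times> 'a::euclidean_space. f (fst z))"
  and smooth_snd: "smooth (g :: 'a::euclidean_space \<Rightarrow> real) \<Longrightarrow> smooth (\<lambda>z::real \<times> 'a. g (snd z))"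
  using smooth_affine_comp(1)[OF bounded_linear_fst, of f 0]
    smooth_affine_comp(1)[OF bounded_linear_snd, of g 0] by simp_all

text \<open>Tensor products as test functions turn the weak formulation in space-time into equations in
  time for pairings in space.\<close>

lemma test_tensor:
  fixes \<zeta> :: "'a::euclidean_space \<Rightarrow> real"
  assumes "\<psi> \<in> test_functions {0<..<T}" "\<zeta> \<in> test_functions U"
  shows "(\<lambda>z. \<psi> (fst z) * \<zeta> (snd z)) \<in> test_functions (cylinder T U)"
proof -
  obtain C where C: "compact C" "C \<subseteq> {0<..<T}" "\<And>x. x \<notin> C \<Longrightarrow> \<psi> x = 0" using assms test_functionE by metis
  obtain D where D: "compact D" "D \<subseteq> U" "\<And>x. x \<notin> D \<Longrightarrow> \<zeta> x = 0" using assms test_functionE by metis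
  show ?thesis
  proof (rule test_functionI[of _ "C \<times> D"])
    show "smooth (\<lambda>z. \<psi> (fst z) * \<zeta> (snd z))"
      using assms by (intro smooth_mult smooth_fst smooth_snd test_function_smooth)
    show "compact (C \<times> D)" "C \<times> D \<subseteq> cylinder T U"
      using C D by (auto simp: cylinder_def compact_Times)
    show "\<psi> (fst z) * \<zeta> (snd z) = 0" if "z \<notin> C \<times> D" for z
      using that C(3) D(3) by (metis mem_Times_iff mult_eq_0_iff)
  qed
qed

lemma
  fixes \<zeta> :: "'a::euclidean_space \<Rightarrow> real"
  assumes "smooth \<psi>" "smooth \<zeta>"
  shows dderiv_tensor: "dderiv (0, b) (\<lambda>z. \<psi> (fst z) * \<zeta> (snd z)) = (\<lambda>z. \<psi> (fst z) * dderiv b \<zeta> (snd z))"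
    and time_deriv_tensor: "time_deriv (\<lambda>z. \<psi> (fst z) * \<zeta> (snd z)) = (\<lambda>z. dderiv 1 \<psi> (fst z) * \<zeta> (snd z))"
    and space_laplacian_tensor:
      "space_laplacian (\<lambda>z. \<psi> (fst z) * \<zeta> (snd z)) = (\<lambda>z. \<psi> (fst z) * laplacian \<zeta> (snd z))"
    and space_grad_tensor:
      "space_grad (\<lambda>z. \<psi> (fst z) * \<zeta> (snd z)) = (\<lambda>z. \<psi> (fst z) *\<^sub>R grad \<zeta> (snd z))"
proof -
  have f: "dderiv v (\<lambda>z::real \<times> 'a. \<psi> (fst z)) = (\<lambda>z. dderiv (fst v) \<psi> (fst z))" for v
    using smooth_affine_comp(2)[OF bounded_linear_fst assms(1), of v 0] by simp
  have s: "dderiv v (\<lambda>z::real \<times> 'a. \<zeta> (snd z)) = (\<lambda>z. dderiv (snd v) \<zeta> (snd z))" for v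
    using smooth_affine_comp(2)[OF bounded_linear_snd assms(2), of v 0] by simp
  have zero: "dderiv 0 \<psi> t = 0" "dderiv 0 \<zeta> x = 0" for t x
    using linear_0[OF has_derivative_linear[OF smooth_has_derivative]] assms by blast+
  show "dderiv (0, b) (\<lambda>z. \<psi> (fst z) * \<zeta> (snd z)) = (\<lambda>z. \<psi> (fst z) * dderiv b \<zeta> (snd z))"
    "time_deriv (\<lambda>z. \<psi> (fst z) * \<zeta> (snd z)) = (\<lambda>z. dderiv 1 \<psi> (fst z) * \<zeta> (snd z))"
    using assms zero unfolding time_deriv_def
    by (simp_all add: dderiv_mult[OF smooth_fst smooth_snd] f s fun_eq_iff)
  have c: "dderiv v (\<lambda>x. c * \<zeta>' x) = (\<lambda>x. c * dderiv v \<zeta>' x)" if "smooth \<zeta>'" for c v and \<zeta>' :: "'a \<Rightarrow> real"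
    using dderiv_mult[OF smooth_const that] by simp
  show "space_laplacian (\<lambda>z. \<psi> (fst z) * \<zeta> (snd z)) = (\<lambda>z. \<psi> (fst z) * laplacian \<zeta> (snd z))"
    "space_grad (\<lambda>z. \<psi> (fst z) * \<zeta> (snd z)) = (\<lambda>z. \<psi> (fst z) *\<^sub>R grad \<zeta> (snd z))"
    using assms unfolding space_laplacian_def space_grad_def laplacian_def grad_def
    by (simp_all add: fun_eq_iff c smooth_dderiv sum_distrib_left scaleR_sum_right)
qed

lemma grad_inner: "b \<in> Basis \<Longrightarrow> grad f x \<bullet> b = dderiv b f x"
  by (simp add: grad_def inner_sum_left inner_Basis if_distrib cong: if_cong)

lemma grad_mult: "smooth f \<Longrightarrow> smooth g \<Longrightarrow> grad (\<lambda>x. f x * g x) x = f x *\<^sub>R grad g x + g x *\<^sub>R grad f x"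
  by (simp add: grad_def dderiv_mult sum.distrib scaleR_add_left scaleR_sum_right algebra_simps)

lemma grad_add: "smooth f \<Longrightarrow> smooth g \<Longrightarrow> grad (\<lambda>x. f x + g x) x = grad f x + grad g x"
  by (simp add: grad_def dderiv_add sum.distrib scaleR_add_left)

lemma smooth_grad_continuous: "smooth f \<Longrightarrow> continuous_on S (grad f)"
  unfolding grad_def[abs_def] by (intro continuous_intros smooth_continuous smooth_dderiv)

lemma test_grad_bounded:
  assumes "\<psi> \<in> test_functions U"
  obtains B where "\<And>x. \<bar>\<psi> x\<bar> \<le> B" "\<And>x. norm (grad \<psi> x) \<le> B" "B \<ge> 0"
proof -
  obtain C where C: "compact C" "\<And>x. x \<notin> C \<Longrightarrow> \<psi> x = 0" "\<And>v x. x \<notin> C \<Longrightarrow> dderiv v \<psi> x = 0"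
    using assms test_functionE by metis
  have s: "smooth \<psi>" using assms by (rule test_function_smooth)
  have "bounded (\<psi> ` C)" "bounded (grad \<psi> ` C)"
    using C(1) s by (auto intro!: compact_imp_bounded compact_continuous_image smooth_continuous smooth_grad_continuous)
  then obtain B1 B2 where B: "\<And>x. x \<in> C \<Longrightarrow> \<bar>\<psi> x\<bar> \<le> B1" "\<And>x. x \<in> C \<Longrightarrow> norm (grad \<psi> x) \<le> B2"
    unfolding bounded_iff by (auto simp: real_norm_def)
  have g0: "grad \<psi> x = 0" if "x \<notin> C" for x using C(3)[OF that] by (simp add: grad_def)
  show thesis
  proof (rule that[of "\<bar>B1\<bar> + \<bar>B2\<bar>"])
    show "\<bar>\<psi> x\<bar> \<le> \<bar>B1\<bar> + \<bar>B2\<bar>" for x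
      using B(1)[of x] C(2)[of x] by (cases "x \<in> C") auto
    show "norm (grad \<psi> x) \<le> \<bar>B1\<bar> + \<bar>B2\<bar>" for x
      using B(2)[of x] g0[of x] by (cases "x \<in> C") auto
  qed simp
qed

section \<open>Square integrable functions\<close>

text \<open>Short names that separate the rules for the Lebesgue integral from their namesakes for the
  gauge integral.\<close>

lemmas LINT_sum = Bochner_Integration.integral_sum
  and LINT_add = Bochner_Integration.integral_add
  and LINT_diff = Bochner_Integration.integral_diff
  and LINT_cong = Bochner_Integration.integral_cong
  and HK_add = Henstock_Kurzweil_Integration.integral_add
  and HK_diff = Henstock_Kurzweil_Integration.integral_diff
  and HK_combine = Henstock_Kurzweil_Integration.integral_combine
  and HK_cong = Henstock_Kurzweil_Integration.integral_cong

definition L2 :: "'m measure \<Rightarrow> ('m \<Rightarrow> 'b::euclidean_space) \<Rightarrow> bool" where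
  "L2 M f \<longleftrightarrow> f \<in> borel_measurable M \<and> integrable M (\<lambda>x. (norm (f x))\<^sup>2)"

lemma Lp2_iff_L2: "Lp 2 U f \<longleftrightarrow> L2 (lebesgue_on U) f"
  by (simp add: Lp_def L2_def)

lemma L2_measurable [measurable_dest]: "L2 M f \<Longrightarrow> f \<in> borel_measurable M"
  and L2_integrable_sq: "L2 M f \<Longrightarrow> integrable M (\<lambda>x. (norm (f x))\<^sup>2)"
  by (auto simp: L2_def)

lemma L2_real_sq: "L2 M f \<Longrightarrow> integrable M (\<lambda>x. (f x :: real)\<^sup>2)"
  by (simp add: L2_def)

lemma L2_cmult: "L2 M f \<Longrightarrow> L2 M (\<lambda>x. c *\<^sub>R f x)"
  by (auto simp: L2_def power_mult_distrib)

lemma integrable_bound_real: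
  fixes f :: "'m \<Rightarrow> 'b::{banach, second_countable_topology}"
  assumes "integrable M g" "f \<in> borel_measurable M" "\<And>x. x \<in> space M \<Longrightarrow> norm (f x) \<le> g x"
  shows "integrable M f"
proof (rule Bochner_Integration.integrable_bound[OF assms(1,2)])
  show "AE x in M. norm (f x) \<le> norm (g x)"
    using assms(3) by (intro AE_I2) (metis abs_ge_self order_trans real_norm_def)
qed

lemma L2_add:
  assumes "L2 M f" "L2 M g"
  shows "L2 M (\<lambda>x. f x + g x)"
proof -
  have [measurable]: "f \<in> borel_measurable M" "g \<in> borel_measurable M" using assms by (auto simp: L2_def)
  have le: "(norm (f x + g x))\<^sup>2 \<le> 2 * (norm (f x))\<^sup>2 + 2 * (norm (g x))\<^sup>2" for x
  proof -
    have "(norm (f x + g x))\<^sup>2 \<le> (norm (f x) + norm (g x))\<^sup>2"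
      by (intro power_mono norm_triangle_ineq) simp
    then show ?thesis using sum_squares_bound[of "norm (f x)" "norm (g x)"]
      by (simp add: power2_sum)
  qed
  have "integrable M (\<lambda>x. (norm (f x + g x))\<^sup>2)"
  proof (rule integrable_bound_real)
    show "integrable M (\<lambda>x. 2 * (norm (f x))\<^sup>2 + 2 * (norm (g x))\<^sup>2)"
      using assms[THEN L2_integrable_sq] by simp
    show "norm ((norm (f x + g x))\<^sup>2) \<le> 2 * (norm (f x))\<^sup>2 + 2 * (norm (g x))\<^sup>2" for x
      using le[of x] by simp
  qed measurable
  then show ?thesis by (simp add: L2_def)
qed

lemma L2_diff: "L2 M f \<Longrightarrow> L2 M g \<Longrightarrow> L2 M (\<lambda>x. f x - g x)"
  using L2_add[of M f "\<lambda>x. (-1) *\<^sub>R g x"] L2_cmult[of M g "-1"] by simp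

lemma L2_zero [simp]: "L2 M (\<lambda>x. 0)" by (simp add: L2_def)

lemma L2_sum: "(\<And>i. i \<in> I \<Longrightarrow> L2 M (f i)) \<Longrightarrow> L2 M (\<lambda>x. \<Sum>i\<in>I. f i x)"
  by (induction I rule: infinite_finite_induct) (auto intro: L2_add)

lemma L2_rcmult: "L2 M f \<Longrightarrow> L2 M (\<lambda>x. c * f x :: real)"
  using L2_cmult[of M f c] by simp

lemma L2_inner_integrable:
  assumes "L2 M f" "L2 M g"
  shows "integrable M (\<lambda>x. f x \<bullet> g x)"
proof -
  have [measurable]: "f \<in> borel_measurable M" "g \<in> borel_measurable M" using assms by (auto simp: L2_def)
  have le: "\<bar>f x \<bullet> g x\<bar> \<le> (norm (f x))\<^sup>2 + (norm (g x))\<^sup>2" for x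
  proof -
    have "\<bar>f x \<bullet> g x\<bar> \<le> norm (f x) * norm (g x)" by (rule Cauchy_Schwarz_ineq2)
    moreover have "2 * (norm (f x) * norm (g x)) \<le> (norm (f x))\<^sup>2 + (norm (g x))\<^sup>2"
      using sum_squares_bound[of "norm (f x)" "norm (g x)"] by (simp add: mult.assoc)
    moreover have "0 \<le> norm (f x) * norm (g x)" by simp
    ultimately show ?thesis by linarith
  qed
  show ?thesis
  proof (rule integrable_bound_real)
    show "integrable M (\<lambda>x. (norm (f x))\<^sup>2 + (norm (g x))\<^sup>2)"
      using assms[THEN L2_integrable_sq] by simp
    show "norm (f x \<bullet> g x) \<le> (norm (f x))\<^sup>2 + (norm (g x))\<^sup>2" for x
      using le[of x] by simp
  qed measurable
qed

lemma L2_mult_integrable: "L2 M f \<Longrightarrow> L2 M g \<Longrightarrow> integrable M (\<lambda>x. f x * g x :: real)"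
  using L2_inner_integrable[of M f g] by simp

lemma L2_bounded_scaleR:
  assumes "L2 M f" "h \<in> borel_measurable M" "\<And>x. x \<in> space M \<Longrightarrow> \<bar>h x\<bar> \<le> B"
  shows "L2 M (\<lambda>x. h x *\<^sub>R f x)"
proof -
  have [measurable]: "f \<in> borel_measurable M" "h \<in> borel_measurable M" using assms by (auto simp: L2_def)
  have "integrable M (\<lambda>x. (norm (h x *\<^sub>R f x))\<^sup>2)"
  proof (rule integrable_bound_real[of M "\<lambda>x. B\<^sup>2 * (norm (f x))\<^sup>2"])
    fix x assume "x \<in> space M"
    from power_mono[OF assms(3)[OF this], of 2] have "(h x)\<^sup>2 \<le> B\<^sup>2" by simp
    then show "norm ((norm (h x *\<^sub>R f x))\<^sup>2) \<le> B\<^sup>2 * (norm (f x))\<^sup>2"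
      by (simp add: power_mult_distrib mult_right_mono)
  qed (use assms in \<open>auto intro!: integrable_mult_right L2_integrable_sq\<close>)
  then show ?thesis by (simp add: L2_def)
qed

lemma L2_bounded_mult:
  "L2 M f \<Longrightarrow> h \<in> borel_measurable M \<Longrightarrow> (\<And>x. x \<in> space M \<Longrightarrow> \<bar>h x\<bar> \<le> B) \<Longrightarrow> L2 M (\<lambda>x. h x * f x :: real)"
  using L2_bounded_scaleR[of M f h B] by simp

lemma L2_component: "L2 M f \<Longrightarrow> L2 M (\<lambda>x. f x \<bullet> b)"
proof -
  assume "L2 M f"
  then have [measurable]: "f \<in> borel_measurable M" and i: "integrable M (\<lambda>x. (norm b)\<^sup>2 * (norm (f x))\<^sup>2)"
    by (auto simp: L2_def)
  have "\<bar>f x \<bullet> b\<bar>\<^sup>2 \<le> (norm b)\<^sup>2 * (norm (f x))\<^sup>2" for x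
    using power_mono[OF Cauchy_Schwarz_ineq2[of "f x" b], of 2] by (simp add: power_mult_distrib mult.commute)
  then have "integrable M (\<lambda>x. (f x \<bullet> b)\<^sup>2)"
    by (intro integrable_bound_real[OF i]) auto
  then show ?thesis by (simp add: L2_def)
qed

lemma L2_components:
  fixes f :: "'m \<Rightarrow> 'b::euclidean_space"
  assumes "\<And>b. b \<in> Basis \<Longrightarrow> L2 M (\<lambda>x. f x \<bullet> b)"
  shows "L2 M f"
proof -
  have "L2 M (\<lambda>x. \<Sum>b\<in>Basis. (f x \<bullet> b) *\<^sub>R b)"
  proof (rule L2_sum)
    fix b :: 'b assume b: "b \<in> Basis"
    from assms[OF this] show "L2 M (\<lambda>x. (f x \<bullet> b) *\<^sub>R b)"
      using b by (auto simp: L2_def)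
  qed
  then show ?thesis by (simp add: euclidean_representation)
qed

lemma L2_continuous_test:
  assumes "\<psi> \<in> test_functions U" "S \<in> sets lebesgue"
  shows "L2 (lebesgue_on S) \<psi>" and "L2 (lebesgue_on S) (grad \<psi>)"
proof -
  have *: "L2 (lebesgue_on S) f" if f: "f \<in> test_functions U" for f :: "'a \<Rightarrow> real"
  proof -
    have c: "continuous_on UNIV f" using f by (intro smooth_continuous test_function_smooth)
    then have m: "f \<in> borel_measurable borel" by (rule borel_measurable_continuous_onI)
    obtain C where C: "compact C" "\<And>x. x \<notin> C \<Longrightarrow> f x = 0" using f test_functionE by metis
    have "integrable lborel (\<lambda>x. indicator C x *\<^sub>R (f x)\<^sup>2)"
      using C c by (intro borel_integrable_compact continuous_intros) (auto intro: continuous_on_subset)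
    also have "(\<lambda>x. indicator C x *\<^sub>R (f x)\<^sup>2) = (\<lambda>x. (f x)\<^sup>2)"
      using C(2) by (auto simp: indicator_def fun_eq_iff)
    finally have "integrable lebesgue (\<lambda>x. (f x)\<^sup>2)"
      using m by (subst integrable_completion) auto
    then have "integrable (lebesgue_on S) (\<lambda>x. (f x)\<^sup>2)"
      using assms(2) integrable_mult_indicator[of S lebesgue "\<lambda>x. (f x)\<^sup>2"] by (simp add: integrable_restrict_space)
    moreover have "f \<in> borel_measurable (lebesgue_on S)"
      using m by (intro measurable_restrict_space1 measurable_completion) simp
    ultimately show ?thesis by (simp add: L2_def)
  qed
  then show "L2 (lebesgue_on S) \<psi>" using assms by blast
  show "L2 (lebesgue_on S) (grad \<psi>)"
  proof (rule L2_components)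
    show "L2 (lebesgue_on S) (\<lambda>x. grad \<psi> x \<bullet> b)" if "b \<in> Basis" for b
      using *[OF test_dderiv[OF assms(1)], of b] by (simp add: grad_inner[OF that])
  qed
qed

text \<open>The quadratic \<open>s \<mapsto> \<integral> |f - s g|\<^sup>2\<close> is nonnegative, so its discriminant is not positive.\<close>

lemma L2_Cauchy_Schwarz:
  assumes "L2 M f" "L2 M g"
  shows "(LINT x|M. f x \<bullet> g x)\<^sup>2 \<le> (LINT x|M. (norm (f x))\<^sup>2) * (LINT x|M. (norm (g x))\<^sup>2)"
proof -
  define A B C where "A = (LINT x|M. (norm (f x))\<^sup>2)" and "B = (LINT x|M. f x \<bullet> g x)"
    and "C = (LINT x|M. (norm (g x))\<^sup>2)"
  have pos: "0 \<le> A - 2 * s * B + s\<^sup>2 * C" for s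
  proof -
    have "0 \<le> (LINT x|M. (norm (f x - s *\<^sub>R g x))\<^sup>2)" by simp
    also have "\<dots> = (LINT x|M. (norm (f x))\<^sup>2 - 2 * s * (f x \<bullet> g x) + s\<^sup>2 * (norm (g x))\<^sup>2)"
      by (intro LINT_cong refl)
         (simp only: power2_norm_eq_inner inner_diff_left inner_diff_right inner_commute[of "g _" "f _"]
            inner_scaleR_left inner_scaleR_right, simp add: algebra_simps power2_eq_square)
    also have "\<dots> = A - 2 * s * B + s\<^sup>2 * C"
      using L2_integrable_sq[OF assms(1)] L2_integrable_sq[OF assms(2)] L2_inner_integrable[OF assms]
      by (simp add: A_def B_def C_def)
    finally show ?thesis .
  qed
  have C0: "0 \<le> C" "0 \<le> A" by (simp_all add: C_def A_def)
  show "B\<^sup>2 \<le> A * C"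
  proof (cases "C = 0")
    case True
    then have "0 \<le> A - 2 * ((A + 1) / (2 * B)) * B" if "B \<noteq> 0" using pos[of "(A + 1) / (2 * B)"] by simp
    moreover have "A - 2 * ((A + 1) / (2 * B)) * B = - 1" if "B \<noteq> 0"
    proof -
      have "2 * ((A + 1) / (2 * B)) * B = A + 1" using that by (simp add: field_simps)
      then show ?thesis by simp
    qed
    ultimately have "B = 0" by (metis neg_0_le_iff_le not_one_le_zero)
    then show ?thesis using True by simp
  next
    case False
    then have "0 \<le> (A - 2 * (B / C) * B + (B / C)\<^sup>2 * C) * C" using pos[of "B / C"] C0 by (intro mult_nonneg_nonneg)
    also have "\<dots> = A * C - B\<^sup>2" using False by (simp add: field_simps power2_eq_square)
    finally show ?thesis by simp
  qed
qed

lemma L2_Cauchy_Schwarz_real: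
  assumes "L2 M f" "L2 M (g :: _ \<Rightarrow> real)"
  shows "(LINT x|M. f x * g x)\<^sup>2 \<le> (LINT x|M. (f x)\<^sup>2) * (LINT x|M. (g x)\<^sup>2)"
  using L2_Cauchy_Schwarz[OF assms] by simp

lemma L2_Cauchy_Schwarz_sqrt:
  assumes "L2 M f" "L2 M (g :: _ \<Rightarrow> real)"
  shows "\<bar>LINT x|M. f x * g x\<bar> \<le> sqrt (LINT x|M. (f x)\<^sup>2) * sqrt (LINT x|M. (g x)\<^sup>2)"
  using real_sqrt_le_mono[OF L2_Cauchy_Schwarz_real[OF assms]] by (simp add: real_sqrt_mult)

lemma L2_pairing_tendsto:
  assumes "\<And>n. L2 M (f n)" "L2 M f0" "L2 M g"
    and "(\<lambda>n::nat. LINT x|M. (norm (f n x - f0 x))\<^sup>2) \<longlonglongrightarrow> 0"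
  shows "(\<lambda>n. LINT x|M. f n x \<bullet> g x) \<longlonglongrightarrow> (LINT x|M. f0 x \<bullet> g x)"
proof -
  let ?d = "\<lambda>n. sqrt ((LINT x|M. (norm (f n x - f0 x))\<^sup>2) * (LINT x|M. (norm (g x))\<^sup>2))"
  have "?d \<longlonglongrightarrow> sqrt (0 * (LINT x|M. (norm (g x))\<^sup>2))"
    by (intro tendsto_real_sqrt tendsto_mult tendsto_const assms)
  then have d: "?d \<longlonglongrightarrow> 0" by simp
  have le: "norm ((LINT x|M. f n x \<bullet> g x) - (LINT x|M. f0 x \<bullet> g x)) \<le> ?d n" for n
  proof -
    have "(LINT x|M. f n x \<bullet> g x) - (LINT x|M. f0 x \<bullet> g x) = (LINT x|M. (f n x - f0 x) \<bullet> g x)"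
      using assms by (simp add: inner_diff_left L2_inner_integrable)
    moreover have "\<bar>LINT x|M. (f n x - f0 x) \<bullet> g x\<bar> \<le> ?d n"
      using L2_Cauchy_Schwarz[OF L2_diff[OF assms(1,2)] assms(3), of n] by (intro real_le_rsqrt) simp
    ultimately show ?thesis by simp
  qed
  have "(\<lambda>n. (LINT x|M. f n x \<bullet> g x) - (LINT x|M. f0 x \<bullet> g x)) \<longlonglongrightarrow> 0"
    by (rule Lim_null_comparison[OF always_eventually d]) (rule allI, rule le)
  then show ?thesis by (rule LIM_zero_cancel)
qed

section \<open>The fundamental lemma of the calculus of variations\<close>

lemma integral_lebesgue_on_superset:
  fixes f :: "'a::euclidean_space \<Rightarrow> real"
  assumes "C \<in> sets lebesgue" "U \<in> sets lebesgue" "C \<subseteq> U" "\<And>x. x \<in> U - C \<Longrightarrow> f x = 0"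
  shows "(LINT x|lebesgue_on U. f x) = (LINT x|lebesgue_on C. f x)"
    and "integrable (lebesgue_on U) f \<longleftrightarrow> integrable (lebesgue_on C) f"
proof -
  have e: "(\<lambda>x. indicator U x *\<^sub>R f x) = (\<lambda>x. indicator C x *\<^sub>R f x)"
    using assms(3,4) by (force simp: indicator_def fun_eq_iff)
  show "(LINT x|lebesgue_on U. f x) = (LINT x|lebesgue_on C. f x)"
    and "integrable (lebesgue_on U) f \<longleftrightarrow> integrable (lebesgue_on C) f"
    using assms(1,2) by (simp_all add: integral_restrict_space integrable_restrict_space e del: real_scaleR_def)
qed

lemma integrable_lebesgue_on_subset:
  fixes f :: "'a::euclidean_space \<Rightarrow> 'b::euclidean_space"
  assumes "integrable (lebesgue_on S) f" "K \<subseteq> S" "K \<in> sets lebesgue" "S \<in> sets lebesgue"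
  shows "integrable (lebesgue_on K) f"
proof -
  have "integrable lebesgue (\<lambda>x. indicator S x *\<^sub>R f x)"
    using integrable_restrict_space[of S lebesgue f] assms(1,4) by simp
  then have "integrable lebesgue (\<lambda>x. indicator K x *\<^sub>R (indicator S x *\<^sub>R f x))"
    by (rule integrable_mult_indicator[OF assms(3)])
  moreover have "(\<lambda>x. indicator K x *\<^sub>R (indicator S x *\<^sub>R f x)) = (\<lambda>x. indicator K x *\<^sub>R f x)"
    using assms(2) by (auto simp: indicator_def fun_eq_iff)
  ultimately show ?thesis using integrable_restrict_space[of K lebesgue f] assms(3) by simp
qed

text \<open>Squeeze \<open>A\<close> between closed and open sets whose measures differ from that of \<open>A\<close> by less than
  \<open>2\<^sup>-\<^sup>n\<close>, and take cut-off functions. By Borel-Cantelli almost every point is eventually classified correctly.\<close>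

lemma indicator_approx_test:
  fixes A :: "'a::euclidean_space set"
  assumes "A \<in> sets lebesgue" "bounded A" "A \<subseteq> V" "open V"
  obtains \<psi> where "\<And>n::nat. \<psi> n \<in> test_functions V" "\<And>n x. 0 \<le> \<psi> n x" "\<And>n x. \<psi> n x \<le> 1"
    "AE x in lebesgue. (\<lambda>n. \<psi> n x) \<longlonglongrightarrow> indicator A x"
proof -
  have "\<exists>T C. open T \<and> A \<subseteq> T \<and> T - A \<in> lmeasurable \<and> emeasure lebesgue (T - A) < ennreal ((1/2)^n)
      \<and> closed C \<and> C \<subseteq> A \<and> A - C \<in> lmeasurable \<and> emeasure lebesgue (A - C) < ennreal ((1/2)^n)" for n :: nat
    using sets_lebesgue_outer_open[OF assms(1), of "(1/2)^n"] sets_lebesgue_inner_closed[OF assms(1), of "(1/2)^n"]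
    by (metis zero_less_power half_gt_zero zero_less_one)
  then obtain T C where T: "\<And>n. open (T n)" "\<And>n. A \<subseteq> T n" "\<And>n. T n - A \<in> lmeasurable"
      "\<And>n. emeasure lebesgue (T n - A) < ennreal ((1/2)^n)"
    and C: "\<And>n. closed (C n)" "\<And>n. C n \<subseteq> A" "\<And>n. A - C n \<in> lmeasurable"
      "\<And>n. emeasure lebesgue (A - C n) < ennreal ((1/2)^n)"
    by metis
  have "\<exists>\<psi>. \<psi> \<in> test_functions (T n \<inter> V) \<and> (\<forall>x. 0 \<le> \<psi> x) \<and> (\<forall>x. \<psi> x \<le> 1) \<and> (\<forall>x\<in>C n. \<psi> x = 1)" for n
  proof -
    have "compact (C n)"
      using C assms bounded_subset by (metis compact_eq_bounded_closed)
    moreover have "C n \<subseteq> T n \<inter> V" using C(2)[of n] T(2)[of n] assms by blast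
    ultimately show ?thesis
      using smooth_urysohn[of "C n" "T n \<inter> V"] T(1)[of n] assms(4) by (metis open_Int)
  qed
  then obtain \<psi> where \<psi>: "\<And>n. \<psi> n \<in> test_functions (T n \<inter> V)" "\<And>n x. 0 \<le> \<psi> n x" "\<And>n x. \<psi> n x \<le> 1"
    "\<And>n x. x \<in> C n \<Longrightarrow> \<psi> n x = 1" by metis
  show thesis
  proof
    show "\<psi> n \<in> test_functions V" for n using \<psi>(1) by (rule test_functions_mono) simp
    define D where "D n = (T n - A) \<union> (A - C n)" for n
    have D: "D n \<in> lmeasurable" for n unfolding D_def using T C by (intro fmeasurable.Un) auto
    have Dle: "measure lebesgue (D n) \<le> 2 * (1/2)^n" for n
    proof -
      have "measure lebesgue (D n) \<le> measure lebesgue (T n - A) + measure lebesgue (A - C n)"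
        unfolding D_def using T C by (intro measure_Un_le) (auto dest: fmeasurableD)
      moreover have "measure lebesgue (T n - A) \<le> (1/2)^n" "measure lebesgue (A - C n) \<le> (1/2)^n"
        using T(4)[of n] C(4)[of n] unfolding measure_def
        by (intro enn2real_leI less_imp_le; simp)+
      ultimately show ?thesis by simp
    qed
    have "summable (\<lambda>n. 2 * (1/2::real)^n)" by (intro summable_mult summable_geometric) simp
    then have "summable (\<lambda>n. measure lebesgue (D n))"
      by (rule summable_comparison_test'[of _ 0]) (use Dle in simp)
    then have "AE x in lebesgue. eventually (\<lambda>n. x \<in> space lebesgue - D n) sequentially"
      using D by (intro borel_cantelli_AE1) (auto simp: fmeasurable_def less_top simp del: emeasure_completion)
    then show "AE x in lebesgue. (\<lambda>n. \<psi> n x) \<longlonglongrightarrow> indicator A x"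
    proof eventually_elim
      case (elim x)
      have "\<psi> n x = indicator A x" if "x \<notin> D n" for n
      proof -
        have "x \<in> C n \<or> x \<notin> T n" using that T(2)[of n] by (auto simp: D_def)
        moreover have "\<psi> n x = 0" if x: "x \<notin> T n"
          by (rule test_functionE[OF \<psi>(1)[of n]]) (use x in auto)
        ultimately show ?thesis using \<psi>(4)[of x n] C(2)[of n] T(2)[of n] by (auto simp: indicator_def)
      qed
      with elim show ?case
        by (intro tendsto_eventually) (auto elim: eventually_mono)
    qed
  qed (fact \<psi>)+
qed

text \<open>Indicators of measurable subsets of a compact set are limits of test functions, so
  dominated convergence allows to test with the indicators of \<open>{g > 0}\<close> and \<open>{g < 0}\<close>.\<close>

lemma fundamental_lemma:
  fixes g :: "'a::euclidean_space \<Rightarrow> real"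
  assumes "open U" "L1_loc U g"
    and zero: "\<And>\<psi>. \<psi> \<in> test_functions U \<Longrightarrow> (LINT x|lebesgue_on U. g x * \<psi> x) = 0"
  shows "AE x in lebesgue_on U. g x = 0"
proof -
  have U: "U \<in> sets lebesgue" using assms(1) by auto
  have int0: "(LINT x|lebesgue_on C. g x * indicator A x) = 0"
    if A: "A \<in> sets lebesgue" "A \<subseteq> V" and V: "open V" "V \<subseteq> C" and C: "compact C" "C \<subseteq> U" for A V C
  proof -
    have Cs: "C \<in> sets lebesgue" using C by (simp add: lmeasurable_compact fmeasurableD)
    have gi: "integrable (lebesgue_on C) g" using assms(2) C by (simp add: L1_loc_def)
    have "A \<subseteq> C" using A V by simp
    then have bA: "bounded A" using compact_imp_bounded[OF C(1)] by (rule bounded_subset[rotated])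
    obtain \<psi> where \<psi>: "\<And>n::nat. \<psi> n \<in> test_functions V" "\<And>n x. 0 \<le> \<psi> n x" "\<And>n x. \<psi> n x \<le> 1"
      "AE x in lebesgue. (\<lambda>n. \<psi> n x) \<longlonglongrightarrow> indicator A x"
      by (rule indicator_approx_test[OF A(1) bA A(2) V(1)]) (rule that)
    have [measurable]: "g \<in> borel_measurable (lebesgue_on C)" using gi by auto
    have [measurable]: "\<psi> n \<in> borel_measurable (lebesgue_on C)" for n
      using L2_continuous_test(1)[OF \<psi>(1) Cs] by (simp add: L2_def)
    have [measurable]: "indicat_real A \<in> borel_measurable (lebesgue_on C)"
      using A by (intro measurable_restrict_space1) auto
    have "(\<lambda>n. LINT x|lebesgue_on C. g x * \<psi> n x) \<longlonglongrightarrow> (LINT x|lebesgue_on C. g x * indicator A x)"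
    proof (rule integral_dominated_convergence[where w="\<lambda>x. \<bar>g x\<bar>"])
      have "AE x in lebesgue_on C. (\<lambda>n. \<psi> n x) \<longlonglongrightarrow> indicator A x"
        using \<psi>(4) Cs by (subst AE_restrict_space_iff) (auto elim: eventually_mono)
      then show "AE x in lebesgue_on C. (\<lambda>n. g x * \<psi> n x) \<longlonglongrightarrow> g x * indicator A x"
        by eventually_elim (intro tendsto_intros)
      show "AE x in lebesgue_on C. norm (g x * \<psi> n x) \<le> \<bar>g x\<bar>" for n
        using \<psi>(2,3) by (intro AE_I2) (simp add: abs_mult mult_left_le)
    qed (use gi in auto)
    moreover have "(LINT x|lebesgue_on C. g x * \<psi> n x) = 0" for n
    proof -
      have "\<psi> n x = 0" if x: "x \<in> U - C" for x
        by (rule test_functionE[OF \<psi>(1)[of n]]) (use x V in blast)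
      then have "(LINT x|lebesgue_on U. g x * \<psi> n x) = (LINT x|lebesgue_on C. g x * \<psi> n x)"
        using Cs U C by (intro integral_lebesgue_on_superset) auto
      then show ?thesis using zero[of "\<psi> n"] test_functions_mono[OF \<psi>(1)] V C by auto
    qed
    ultimately show ?thesis by (simp add: LIMSEQ_const_iff)
  qed
  have AE0: "AE x in lebesgue_on K. g x = 0" if K: "compact K" "K \<subseteq> U" for K
  proof -
    obtain \<zeta> where \<zeta>: "\<zeta> \<in> test_functions U" "\<And>x. x \<in> K \<Longrightarrow> \<zeta> x = 1"
      using smooth_urysohn[OF K(1) assms(1) K(2)] by metis
    obtain C where C: "compact C" "C \<subseteq> U" "\<And>x. x \<notin> C \<Longrightarrow> \<zeta> x = 0" using test_functionE[OF \<zeta>(1)] by metis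
    define V where "V = {x. \<zeta> x > 1/2}"
    have V: "open V" "V \<subseteq> C" "K \<subseteq> V"
      using open_Collect_less[OF continuous_on_const smooth_continuous[OF test_function_smooth[OF \<zeta>(1)]], of "1/2"]
        C(3) \<zeta>(2) by (force simp: V_def)+
    have Cs: "C \<in> sets lebesgue" "K \<in> sets lebesgue" using C K by (simp_all add: lmeasurable_compact fmeasurableD)
    have gi: "integrable (lebesgue_on C) g" using assms(2) C by (simp add: L1_loc_def)
    have meas: "{x \<in> K. P (g x)} \<in> sets lebesgue" if "{x. P x} \<in> sets borel" for P
    proof -
      have "g -` {x. P x} \<inter> space (lebesgue_on C) \<in> sets (lebesgue_on C)"
        using gi that by (intro measurable_sets) auto
      then have "(g -` {x. P x} \<inter> C) \<in> sets lebesgue"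
        using Cs by (auto simp: sets_restrict_space_iff)
      moreover have "{x \<in> K. P (g x)} = (g -` {x. P x} \<inter> C) \<inter> K" using V by auto
      ultimately show ?thesis using Cs by auto
    qed
    have *: "AE x in lebesgue_on C. s * (g x * indicator {x \<in> K. s * g x > 0} x) = 0" for s
    proof -
      let ?A = "{x \<in> K. s * g x > 0}"
      have A: "?A \<in> sets lebesgue" by (rule meas) measurable
      have "integrable (lebesgue_on C) (\<lambda>x. indicator ?A x *\<^sub>R g x)"
        using A gi by (intro integrable_mult_indicator)
           (auto simp: sets_restrict_space_iff Cs intro: subsetD[OF V(2)] subsetD[OF V(3)])
      then have "integrable (lebesgue_on C) (\<lambda>x. s * (g x * indicator ?A x))" by (simp add: mult.commute)
      moreover have "(LINT x|lebesgue_on C. s * (g x * indicator ?A x)) = 0"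
        using int0[OF A _ V(1,2) C(1,2)] V(3) by auto
      ultimately show ?thesis
        by (subst (asm) integral_nonneg_eq_0_iff_AE) (auto simp: indicator_def)
    qed
    have "AE x in lebesgue_on C. x \<in> K \<longrightarrow> g x = 0"
      using *[of 1] *[of "-1"] by eventually_elim (auto simp: indicator_def split: if_splits)
    then show ?thesis using Cs V by (auto simp: AE_restrict_space_iff elim: eventually_mono)
  qed
  obtain C where C: "\<And>n::nat. compact (C n)" "\<And>n. C n \<subseteq> U" "U = (\<Union>n. C n)"
    using open_Union_compact_subsets[OF assms(1)] by metis
  have "AE x in lebesgue. x \<in> C n \<longrightarrow> g x = 0" for n
    using AE0[OF C(1,2), of n] lmeasurable_compact[OF C(1), of n]
    by (subst (asm) AE_restrict_space_iff) (auto dest: fmeasurableD)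
  then have ae: "AE x in lebesgue. \<forall>n. x \<in> C n \<longrightarrow> g x = 0" by (intro AE_all_countable[THEN iffD2] allI)
  have "AE x in lebesgue. x \<in> U \<longrightarrow> g x = 0"
    by (rule eventually_mono[OF ae]) (use C(3) in blast)
  then show ?thesis using U by (simp add: AE_restrict_space_iff)
qed

section \<open>Integration over cylinders\<close>

text \<open>On a product space \<^const>\<open>lborel\<close> is the product measure, whereas its completion is larger than the
  product of the completions. Borel representatives transfer Fubini's
  theorem to Lebesgue measurable functions on a cylinder.\<close>

lemma lebesgue_on_borel_representative:
  fixes f :: "'a::euclidean_space \<Rightarrow> real"
  assumes "S \<in> sets borel" "f \<in> borel_measurable (lebesgue_on S)"
  obtains g where "g \<in> borel_measurable borel" "AE x in lborel. indicator S x * f x = g x"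
    "\<And>x. x \<notin> S \<Longrightarrow> g x = 0"
proof -
  have "(\<lambda>x. if x \<in> S then f x else 0) \<in> borel_measurable (completion lborel)"
    using assms by (intro borel_measurable_if_I) auto
  then obtain g where g: "g \<in> borel_measurable lborel" "AE x in lborel. (if x \<in> S then f x else 0) = g x"
    using completion_ex_borel_measurable_real by blast
  show thesis
  proof
    show "(\<lambda>x. indicator S x * g x) \<in> borel_measurable borel" using g(1) assms by measurable
    show "AE x in lborel. indicator S x * f x = indicator S x * g x"
      using g(2) by eventually_elim (auto simp: indicator_def)
  qed simp
qed

lemma AE_lebesgue_on_iff:
  assumes "S \<in> sets borel"
  shows "(AE x in lebesgue_on S. P x) \<longleftrightarrow> (AE x in lborel. x \<in> S \<longrightarrow> P x)"
  using assms by (subst AE_restrict_space_iff) (auto simp: AE_completion_iff)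

lemma integral_lebesgue_on_representative:
  fixes f g :: "'a::euclidean_space \<Rightarrow> real"
  assumes "S \<in> sets borel" "g \<in> borel_measurable borel" "AE x in lborel. indicator S x * f x = g x"
  shows "f \<in> borel_measurable (lebesgue_on S)"
    "integrable (lebesgue_on S) f \<longleftrightarrow> integrable lborel g"
    "(LINT x|lebesgue_on S. f x) = (LINT x|lborel. g x)"
proof -
  have ae: "AE x in lebesgue. g x = (if x \<in> S then f x else 0)"
    using assms(3) by (auto simp: AE_completion_iff indicator_def elim!: eventually_mono)
  have g: "g \<in> borel_measurable lebesgue" using assms(2) by (simp add: measurable_completion)
  have m: "(\<lambda>x. if x \<in> S then f x else 0) \<in> borel_measurable lebesgue"
    by (rule borel_measurable_AE[OF g ae])
  then show f: "f \<in> borel_measurable (lebesgue_on S)"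
    using assms(1) by (subst borel_measurable_if[symmetric]) auto
  have "integrable (lebesgue_on S) f \<longleftrightarrow> integrable lebesgue (\<lambda>x. if x \<in> S then f x else 0)"
    using assms(1) by (subst Lebesgue_Measure.integrable_restrict_UNIV) auto
  also have "\<dots> \<longleftrightarrow> integrable lebesgue g"
    by (rule integrable_cong_AE[OF m g]) (use ae in \<open>auto elim: eventually_mono\<close>)
  also have "\<dots> \<longleftrightarrow> integrable lborel g" using assms(2) by (simp add: integrable_completion)
  finally show "integrable (lebesgue_on S) f \<longleftrightarrow> integrable lborel g" .
  have "(LINT x|lebesgue_on S. f x) = (LINT x|lebesgue. (if x \<in> S then f x else 0))"
    using assms(1) by (subst Lebesgue_Measure.integral_restrict_UNIV) auto
  also have "\<dots> = (LINT x|lebesgue. g x)"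
    by (rule integral_cong_AE[OF m g]) (use ae in \<open>auto elim: eventually_mono\<close>)
  also have "\<dots> = (LINT x|lborel. g x)" using assms(2) by (simp add: integral_completion)
  finally show "(LINT x|lebesgue_on S. f x) = (LINT x|lborel. g x)" .
qed

context
  fixes I :: "'b::euclidean_space set" and \<Omega> :: "'a::euclidean_space set"
  assumes I: "I \<in> sets borel" and \<Omega>: "\<Omega> \<in> sets borel"
begin

lemma Times_borel: "I \<times> \<Omega> \<in> sets borel"
  using I \<Omega> by (simp add: borel_prod[symmetric])

lemma lborel_product: "(lborel :: ('b \<times> 'a) measure) = lborel \<Otimes>\<^sub>M lborel"
  by (rule lborel_prod[symmetric])

lemma AE_lborel_slices:
  assumes "AE z in (lborel :: ('b \<times> 'a) measure). P z"
  shows "AE t in lborel. AE x in lborel. P (t, x)" and "AE x in lborel. AE t in lborel. P (t, x)"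
proof -
  have P: "AE z in lborel \<Otimes>\<^sub>M lborel. P z" using assms unfolding lborel_product .
  from lborel_pair.AE_pair[OF P] show "AE t in lborel. AE x in lborel. P (t, x)" .
  have "AE z in distr ((lborel :: 'a measure) \<Otimes>\<^sub>M (lborel :: 'b measure)) (lborel \<Otimes>\<^sub>M lborel) (\<lambda>(x, t). (t, x)). P z"
    using P by (subst (asm) lborel_pair.distr_pair_swap)
  from AE_distrD[OF measurable_pair_swap' this]
  have "AE z in (lborel :: 'a measure) \<Otimes>\<^sub>M (lborel :: 'b measure). P (snd z, fst z)"
    by (simp add: case_prod_beta)
  from lborel_pair.AE_pair[OF this] show "AE x in lborel. AE t in lborel. P (t, x)" by simp
qed

lemma AE_lborel_product:
  shows "AE t in lborel. P t \<Longrightarrow> AE z in (lborel :: 'b measure) \<Otimes>\<^sub>M (lborel :: 'a measure). P (fst z)"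
    and "AE x in lborel. Q x \<Longrightarrow> AE z in (lborel :: 'b measure) \<Otimes>\<^sub>M (lborel :: 'a measure). Q (snd z)"
proof -
  assume "AE t in lborel. P t"
  then obtain N where N: "N \<in> null_sets lborel" "{t. \<not> P t} \<subseteq> N" by (auto simp: eventually_ae_filter)
  have "N \<times> UNIV \<in> null_sets ((lborel :: 'b measure) \<Otimes>\<^sub>M (lborel :: 'a measure))"
    using N by (auto simp: null_sets_def lborel.emeasure_pair_measure_Times)
  then show "AE z in (lborel :: 'b measure) \<Otimes>\<^sub>M (lborel :: 'a measure). P (fst z)"
    using N by (intro AE_I') auto
next
  assume "AE x in lborel. Q x"
  then obtain N where N: "N \<in> null_sets lborel" "{t. \<not> Q t} \<subseteq> N" by (auto simp: eventually_ae_filter)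
  have "UNIV \<times> N \<in> null_sets ((lborel :: 'b measure) \<Otimes>\<^sub>M (lborel :: 'a measure))"
    using N by (auto simp: null_sets_def lborel.emeasure_pair_measure_Times)
  then show "AE z in (lborel :: 'b measure) \<Otimes>\<^sub>M (lborel :: 'a measure). Q (snd z)"
    using N by (intro AE_I') auto
qed

lemma borel_slices:
  assumes "g \<in> borel_measurable (borel :: ('b \<times> 'a) measure)"
  shows "(\<lambda>x. g (t, x)) \<in> borel_measurable borel" and "(\<lambda>t. g (t, x)) \<in> borel_measurable borel"
  using assms by (auto simp flip: borel_prod)

lemma Fubini_cylinder:
  fixes f :: "'b \<times> 'a \<Rightarrow> real"
  assumes "integrable (lebesgue_on (I \<times> \<Omega>)) f"
  shows "AE t in lebesgue_on I. integrable (lebesgue_on \<Omega>) (\<lambda>x. f (t, x))"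
    and "integrable (lebesgue_on I) (\<lambda>t. LINT x|lebesgue_on \<Omega>. f (t, x))"
    and "(LINT t|lebesgue_on I. LINT x|lebesgue_on \<Omega>. f (t, x)) = (LINT z|lebesgue_on (I \<times> \<Omega>). f z)"
    and "AE x in lebesgue_on \<Omega>. integrable (lebesgue_on I) (\<lambda>t. f (t, x))"
    and "integrable (lebesgue_on \<Omega>) (\<lambda>x. LINT t|lebesgue_on I. f (t, x))"
    and "(LINT x|lebesgue_on \<Omega>. LINT t|lebesgue_on I. f (t, x)) = (LINT z|lebesgue_on (I \<times> \<Omega>). f z)"
proof -
  have fm: "f \<in> borel_measurable (lebesgue_on (I \<times> \<Omega>))" using assms by auto
  obtain g where g: "g \<in> borel_measurable borel" "AE z in lborel. indicator (I \<times> \<Omega>) z * f z = g z"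
    and g0: "\<And>z. z \<notin> I \<times> \<Omega> \<Longrightarrow> g z = 0"
    by (rule lebesgue_on_borel_representative[OF Times_borel fm]) (rule that)
  note rep = integral_lebesgue_on_representative[OF Times_borel g]
  have gi: "integrable (lborel \<Otimes>\<^sub>M lborel) g" using rep(2) assms unfolding lborel_product by simp
  have gi': "integrable (lborel \<Otimes>\<^sub>M lborel) (\<lambda>(t, x). g (t, x))" using gi by simp
  note gt = borel_slices(1)[OF g(1)] and gx = borel_slices(2)[OF g(1)]
  note sl = AE_lborel_slices[OF g(2)]
  have A: "(integrable (lebesgue_on \<Omega>) (\<lambda>x. f (t, x)) \<longleftrightarrow> integrable lborel (\<lambda>x. g (t, x))) \<and>
      (LINT x|lebesgue_on \<Omega>. f (t, x)) = (LINT x|lborel. g (t, x))"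
    if "AE x in lborel. indicator (I \<times> \<Omega>) (t, x) * f (t, x) = g (t, x)" "t \<in> I" for t
  proof -
    have "AE x in lborel. indicator \<Omega> x * f (t, x) = g (t, x)"
      using that by (simp add: indicator_times)
    from integral_lebesgue_on_representative[OF \<Omega> gt this] show ?thesis by simp
  qed
  have B: "(integrable (lebesgue_on I) (\<lambda>t. f (t, x)) \<longleftrightarrow> integrable lborel (\<lambda>t. g (t, x))) \<and>
      (LINT t|lebesgue_on I. f (t, x)) = (LINT t|lborel. g (t, x))"
    if "AE t in lborel. indicator (I \<times> \<Omega>) (t, x) * f (t, x) = g (t, x)" "x \<in> \<Omega>" for x
  proof -
    have "AE t in lborel. indicator I t * f (t, x) = g (t, x)"
      using that by (simp add: indicator_times)
    from integral_lebesgue_on_representative[OF I gx this] show ?thesis by simp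
  qed
  have z1: "(LINT x|lborel. g (t, x)) = 0" if "t \<notin> I" for t using g0 that by simp
  have z2: "(LINT t|lborel. g (t, x)) = 0" if "x \<notin> \<Omega>" for x using g0 that by simp
  have A2: "AE t in lborel. indicator I t * (LINT x|lebesgue_on \<Omega>. f (t, x)) = (LINT x|lborel. g (t, x))"
    using sl(1)
  proof eventually_elim
    case (elim t)
    then show ?case using A[OF elim] z1[of t] by (cases "t \<in> I") simp_all
  qed
  have B2: "AE x in lborel. indicator \<Omega> x * (LINT t|lebesgue_on I. f (t, x)) = (LINT t|lborel. g (t, x))"
    using sl(2)
  proof eventually_elim
    case (elim x)
    then show ?case using B[OF elim] z2[of x] by (cases "x \<in> \<Omega>") simp_all
  qed
  have mA: "(\<lambda>t. LINT x|lborel. g (t, x)) \<in> borel_measurable borel"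
    using lborel_pair.integrable_fst'[OF gi] by auto
  have mB: "(\<lambda>x. LINT t|lborel. g (t, x)) \<in> borel_measurable borel"
    using lborel_pair.integrable_snd[OF gi'] by auto
  show "AE t in lebesgue_on I. integrable (lebesgue_on \<Omega>) (\<lambda>x. f (t, x))"
    unfolding AE_lebesgue_on_iff[OF I] using lborel_pair.AE_integrable_fst'[OF gi] sl(1)
    by eventually_elim (use A in blast)
  show "AE x in lebesgue_on \<Omega>. integrable (lebesgue_on I) (\<lambda>t. f (t, x))"
    unfolding AE_lebesgue_on_iff[OF \<Omega>] using lborel_pair.AE_integrable_snd[OF gi'] sl(2)
    by eventually_elim (use B in blast)
  show "integrable (lebesgue_on I) (\<lambda>t. LINT x|lebesgue_on \<Omega>. f (t, x))"
    using integral_lebesgue_on_representative(2)[OF I mA A2] lborel_pair.integrable_fst'[OF gi] by simp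
  show "integrable (lebesgue_on \<Omega>) (\<lambda>x. LINT t|lebesgue_on I. f (t, x))"
    using integral_lebesgue_on_representative(2)[OF \<Omega> mB B2] lborel_pair.integrable_snd[OF gi'] by simp
  have r: "(LINT z|lebesgue_on (I \<times> \<Omega>). f z) = integral\<^sup>L (lborel \<Otimes>\<^sub>M lborel) g"
    using rep(3) unfolding lborel_product .
  show "(LINT t|lebesgue_on I. LINT x|lebesgue_on \<Omega>. f (t, x)) = (LINT z|lebesgue_on (I \<times> \<Omega>). f z)"
    using integral_lebesgue_on_representative(3)[OF I mA A2] lborel_pair.integral_fst'[OF gi] r by simp
  show "(LINT x|lebesgue_on \<Omega>. LINT t|lebesgue_on I. f (t, x)) = (LINT z|lebesgue_on (I \<times> \<Omega>). f z)"
    using integral_lebesgue_on_representative(3)[OF \<Omega> mB B2] lborel_pair.integral_snd[OF gi'] r by simp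
qed

lemma integrable_tensor:
  fixes f :: "'b \<Rightarrow> real" and g :: "'a \<Rightarrow> real"
  assumes "integrable (lebesgue_on I) f" "integrable (lebesgue_on \<Omega>) g"
  shows "integrable (lebesgue_on (I \<times> \<Omega>)) (\<lambda>z. f (fst z) * g (snd z))"
proof -
  have "f \<in> borel_measurable (lebesgue_on I)" "g \<in> borel_measurable (lebesgue_on \<Omega>)" using assms by auto
  note m = this
  obtain f' where f': "f' \<in> borel_measurable borel" "AE x in lborel. indicator I x * f x = f' x"
    by (rule lebesgue_on_borel_representative[OF I m(1)]) (rule that)
  obtain g' where g': "g' \<in> borel_measurable borel" "AE x in lborel. indicator \<Omega> x * g x = g' x"
    by (rule lebesgue_on_borel_representative[OF \<Omega> m(2)]) (rule that)
  have fi: "integrable lborel f'" using integral_lebesgue_on_representative(2)[OF I f'] assms by simp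
  have gi: "integrable lborel g'" using integral_lebesgue_on_representative(2)[OF \<Omega> g'] assms by simp
  have m: "(\<lambda>z. f' (fst z) * g' (snd z)) \<in> borel_measurable borel"
    using f'(1) g'(1) unfolding borel_prod[symmetric] by measurable
  have "integrable (lborel \<Otimes>\<^sub>M lborel) (\<lambda>z. f' (fst z) * g' (snd z))"
  proof (rule lborel_pair.Fubini_integrable)
    show "(\<lambda>z. f' (fst z) * g' (snd z)) \<in> borel_measurable (lborel \<Otimes>\<^sub>M lborel)"
      using f'(1) g'(1) by measurable
    have "integrable lborel (\<lambda>t. \<bar>f' t\<bar> * (LINT x|lborel. \<bar>g' x\<bar>))"
      using fi by (intro integrable_mult_left) simp
    then show "integrable lborel (\<lambda>t. LINT x|lborel. norm (f' (fst (t, x)) * g' (snd (t, x))))"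
      by (simp add: abs_mult)
    show "AE t in lborel. integrable lborel (\<lambda>x. f' (fst (t, x)) * g' (snd (t, x)))"
      using gi by simp
  qed
  then have i: "integrable lborel (\<lambda>z. f' (fst z) * g' (snd z))" unfolding lborel_product .
  have af: "AE z in (lborel :: 'b measure) \<Otimes>\<^sub>M (lborel :: 'a measure). indicator I (fst z) * f (fst z) = f' (fst z)"
    by (rule AE_lborel_product(1)[where P="\<lambda>t. indicator I t * f t = f' t", OF f'(2)])
  have ag: "AE z in (lborel :: 'b measure) \<Otimes>\<^sub>M (lborel :: 'a measure). indicator \<Omega> (snd z) * g (snd z) = g' (snd z)"
    by (rule AE_lborel_product(2)[where Q="\<lambda>x. indicator \<Omega> x * g x = g' x", OF g'(2)])
  have "AE z in lborel. indicator (I \<times> \<Omega>) z * (f (fst z) * g (snd z)) = f' (fst z) * g' (snd z)"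
    unfolding lborel_product using af ag
  proof eventually_elim
    case (elim z)
    show ?case unfolding elim[symmetric] by (simp add: indicator_times mult_ac)
  qed
  from integral_lebesgue_on_representative(2)[OF Times_borel m this] i show ?thesis by simp
qed

end

section \<open>Primitives of bounded measurable functions\<close>

text \<open>The estimates of the modes use only functions of time that are measurable and bounded on the
  whole interval. This class is stable under every operation needed, which avoids integrability side conditions.\<close>

definition bdd_meas :: "real \<Rightarrow> (real \<Rightarrow> real) \<Rightarrow> bool" where
  "bdd_meas T g \<longleftrightarrow> g \<in> borel_measurable (lebesgue_on {0..T}) \<and> (\<exists>B. \<forall>t\<in>{0..T}. \<bar>g t\<bar> \<le> B)"

lemma bdd_meas_continuous: "continuous_on {0..T} g \<Longrightarrow> bdd_meas T g"
  unfolding bdd_meas_def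
  using compact_imp_bounded[OF compact_continuous_image[OF _ compact_Icc], of 0 T g]
  by (auto simp: bounded_iff continuous_imp_measurable_on_sets_lebesgue)

lemma bdd_meas_const [simp]: "bdd_meas T (\<lambda>t. c)"
  by (rule bdd_meas_continuous) (rule continuous_on_const)

lemma bdd_meas_add: "bdd_meas T f \<Longrightarrow> bdd_meas T g \<Longrightarrow> bdd_meas T (\<lambda>t. f t + g t)"
  unfolding bdd_meas_def
proof (elim conjE exE, intro conjI borel_measurable_add, assumption+)
  fix B C assume "\<forall>t\<in>{0..T}. \<bar>f t\<bar> \<le> B" "\<forall>t\<in>{0..T}. \<bar>g t\<bar> \<le> C"
  then show "\<exists>B. \<forall>t\<in>{0..T}. \<bar>f t + g t\<bar> \<le> B"
    by (intro exI[of _ "B + C"] ballI) (meson abs_triangle_ineq add_mono order_trans)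
qed

lemma bdd_meas_mult: "bdd_meas T f \<Longrightarrow> bdd_meas T g \<Longrightarrow> bdd_meas T (\<lambda>t. f t * g t)"
  unfolding bdd_meas_def
proof (elim conjE exE, intro conjI borel_measurable_times, assumption+)
  fix B C assume "\<forall>t\<in>{0..T}. \<bar>f t\<bar> \<le> B" "\<forall>t\<in>{0..T}. \<bar>g t\<bar> \<le> C"
  then show "\<exists>B. \<forall>t\<in>{0..T}. \<bar>f t * g t\<bar> \<le> B"
    unfolding abs_mult by (intro exI[of _ "B * C"] ballI mult_mono) (auto intro: order_trans[OF abs_ge_zero])
qed

lemma bdd_meas_cmult: "bdd_meas T g \<Longrightarrow> bdd_meas T (\<lambda>t. c * g t)"
  by (intro bdd_meas_mult bdd_meas_const)

lemma bdd_meas_minus: "bdd_meas T g \<Longrightarrow> bdd_meas T (\<lambda>t. - g t)"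
  using bdd_meas_cmult[of T g "-1"] by simp

lemma bdd_meas_diff: "bdd_meas T f \<Longrightarrow> bdd_meas T g \<Longrightarrow> bdd_meas T (\<lambda>t. f t - g t)"
  using bdd_meas_add[of T f "\<lambda>t. - g t"] bdd_meas_minus[of T g] by simp

lemma bdd_meas_sum: "(\<And>i. i \<in> I \<Longrightarrow> bdd_meas T (f i)) \<Longrightarrow> bdd_meas T (\<lambda>t. \<Sum>i\<in>I. f i t)"
  by (induction I rule: infinite_finite_induct) (auto intro: bdd_meas_add)

lemma bdd_meas_power: "bdd_meas T g \<Longrightarrow> bdd_meas T (\<lambda>t. (g t)\<^sup>2)"
  using bdd_meas_mult[of T g g] by (simp add: power2_eq_square)

lemma bdd_meas_abs: "bdd_meas T g \<Longrightarrow> bdd_meas T (\<lambda>t. \<bar>g t\<bar>)"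
  unfolding bdd_meas_def by auto

lemma bdd_meas_sqrt:
  assumes "bdd_meas T g"
  shows "bdd_meas T (\<lambda>t. sqrt (g t))"
proof -
  obtain B where B: "\<forall>t\<in>{0..T}. \<bar>g t\<bar> \<le> B" and [measurable]: "g \<in> borel_measurable (lebesgue_on {0..T})"
    using assms by (auto simp: bdd_meas_def)
  have "\<bar>sqrt (g t)\<bar> \<le> sqrt B" if "t \<in> {0..T}" for t
    using B[rule_format, OF that]
  proof (cases "g t \<ge> 0")
    case False
    then have "\<bar>sqrt (g t)\<bar> = sqrt \<bar>g t\<bar>" using real_sqrt_minus[of "g t"] by simp
    with B that show ?thesis by simp
  qed (use B that in auto)
  moreover have "(\<lambda>t. sqrt (g t)) \<in> borel_measurable (lebesgue_on {0..T})" by measurable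
  ultimately show ?thesis unfolding bdd_meas_def by blast
qed

lemmas bdd_meas_intros = bdd_meas_const bdd_meas_add bdd_meas_mult bdd_meas_minus bdd_meas_diff
  bdd_meas_sum bdd_meas_power bdd_meas_abs bdd_meas_sqrt

lemma bdd_meas_absolutely_integrable:
  assumes "bdd_meas T g"
  shows "g absolutely_integrable_on {0..T}"
proof -
  obtain B where B: "\<forall>t\<in>{0..T}. \<bar>g t\<bar> \<le> B" and m: "g \<in> borel_measurable (lebesgue_on {0..T})"
    using assms by (auto simp: bdd_meas_def)
  show ?thesis
    by (rule measurable_bounded_by_integrable_imp_absolutely_integrable[OF m _ integrable_const_ivl, of B])
       (use B in auto)
qed

lemma bdd_meas_integrable_on:
  assumes "bdd_meas T g" "0 \<le> s" "t \<le> T"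
  shows "g integrable_on {s..t}"
  using bdd_meas_absolutely_integrable[OF assms(1)] assms(2,3)
  by (intro integrable_on_subinterval[OF set_lebesgue_integral_eq_integral(1)[of "{0..T}"]]) auto

lemma bdd_meas_LINT:
  assumes "bdd_meas T g"
  shows "integrable (lebesgue_on {0..T}) g" "(LINT t|lebesgue_on {0..T}. g t) = integral {0..T} g"
proof -
  show i: "integrable (lebesgue_on {0..T}) g"
    using bdd_meas_absolutely_integrable[OF assms] by (intro absolutely_integrable_imp_integrable) auto
  show "(LINT t|lebesgue_on {0..T}. g t) = integral {0..T} g"
    by (rule lebesgue_integral_eq_integral[OF i]) simp
qed

lemma LINT_open_interval:
  assumes "bdd_meas T g"
  shows "(LINT t|lebesgue_on {0<..<T}. g t) = integral {0..T} g"
proof -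
  have "integrable (lebesgue_on {0<..<T}) g"
    by (rule integrable_lebesgue_on_subset[OF bdd_meas_LINT(1)[OF assms]]) auto
  then have "(LINT t|lebesgue_on {0<..<T}. g t) = integral {0<..<T} g" by (rule lebesgue_integral_eq_integral) simp
  then show ?thesis by (simp add: integral_open_interval_real)
qed

lemma integral_bound_interval:
  fixes g :: "real \<Rightarrow> real"
  assumes "g integrable_on {s..t}" "\<And>r. r \<in> {s..t} \<Longrightarrow> norm (g r) \<le> B" "B \<ge> 0" "s \<le> t"
  shows "norm (integral {s..t} g) \<le> B * (t - s)"
  using has_integral_bound_real[OF assms(3) finite.emptyI integrable_integral[OF assms(1)]] assms(2,4) by simp

text \<open>\<open>c\<close> is absolutely continuous with bounded derivative \<open>g\<close>: differential equations for the
  modes hold only almost everywhere and are used in this integrated form.\<close>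

definition prim :: "real \<Rightarrow> (real \<Rightarrow> real) \<Rightarrow> (real \<Rightarrow> real) \<Rightarrow> bool" where
  "prim T c g \<longleftrightarrow> bdd_meas T g \<and> (\<forall>t\<in>{0..T}. c t = c 0 + integral {0..t} g)"

lemma primD: "prim T c g \<Longrightarrow> t \<in> {0..T} \<Longrightarrow> c t = c 0 + integral {0..t} g"
  unfolding prim_def by blast

lemma prim_diff:
  assumes "prim T c g" "0 \<le> s" "s \<le> t" "t \<le> T"
  shows "c t - c s = integral {s..t} g"
proof -
  have "integral {0..s} g + integral {s..t} g = integral {0..t} g"
    using assms bdd_meas_integrable_on[of T g 0 t] by (intro HK_combine) (auto simp: prim_def)
  moreover have "c t = c 0 + integral {0..t} g" "c s = c 0 + integral {0..s} g"
    using assms(2-4) by (intro primD[OF assms(1)]; simp)+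
  ultimately show ?thesis by linarith
qed

lemma bdd_meas_bound:
  assumes "bdd_meas T g"
  obtains B where "B \<ge> 0" "\<And>t. t \<in> {0..T} \<Longrightarrow> \<bar>g t\<bar> \<le> B"
proof -
  obtain B where "\<forall>t\<in>{0..T}. \<bar>g t\<bar> \<le> B" using assms by (auto simp: bdd_meas_def)
  then have "\<bar>g t\<bar> \<le> \<bar>B\<bar>" if "t \<in> {0..T}" for t using that by (meson abs_ge_self order_trans)
  then show thesis using abs_ge_zero by (rule that[rotated])
qed

lemma prim_Lipschitz:
  assumes "prim T c g" "\<And>t. t \<in> {0..T} \<Longrightarrow> \<bar>g t\<bar> \<le> B" "B \<ge> 0" "s \<in> {0..T}" "t \<in> {0..T}"
  shows "\<bar>c t - c s\<bar> \<le> B * \<bar>t - s\<bar>"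
proof -
  have *: "\<bar>c t - c s\<bar> \<le> B * (t - s)" if "s \<le> t" "0 \<le> s" "t \<le> T" for s t
  proof -
    have "norm (integral {s..t} g) \<le> B * (t - s)"
      using assms that by (intro integral_bound_interval[of g s t B] bdd_meas_integrable_on[of T]) (auto simp: prim_def)
    then show ?thesis using prim_diff[OF assms(1) that(2,1,3)] by simp
  qed
  show ?thesis using *[of s t] *[of t s] assms(4,5) by (cases "s \<le> t") (auto simp: abs_minus_commute)
qed

lemma prim_continuous_on:
  assumes "prim T c g"
  shows "continuous_on {0..T} c"
proof -
  obtain B where B: "B \<ge> 0" "\<And>t. t \<in> {0..T} \<Longrightarrow> \<bar>g t\<bar> \<le> B"
    by (rule bdd_meas_bound[of T g]) (use assms in \<open>auto simp: prim_def\<close>)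
  have "B-lipschitz_on {0..T} c"
    using prim_Lipschitz[OF assms B(2,1)] B(1) by (intro lipschitz_onI) (auto simp: dist_real_def)
  then show ?thesis by (rule lipschitz_on_continuous_on)
qed

lemma prim_bdd_meas: "prim T c g \<Longrightarrow> bdd_meas T c"
  by (intro bdd_meas_continuous prim_continuous_on)

text \<open>Such a function has derivative zero. The lemma reduces the product rule for primitives to an estimate of
  increments.\<close>

lemma quadratic_increments_imp_constant:
  fixes H :: "real \<Rightarrow> real"
  assumes "\<And>s t. a \<le> s \<Longrightarrow> s \<le> t \<Longrightarrow> t \<le> b \<Longrightarrow> \<bar>H t - H s\<bar> \<le> C * (t - s)\<^sup>2" "t \<in> {a..b}"
  shows "H t = H a"
proof -
  have le: "\<bar>H y - H x\<bar> \<le> C * (y - x)\<^sup>2" if "x \<in> {a..b}" "y \<in> {a..b}" for x y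
    using assms(1)[of x y] assms(1)[of y x] that
    by (cases "x \<le> y") (auto simp: abs_minus_commute[of "H y"] power2_commute[of y])
  have "(H has_field_derivative 0) (at x within {a..b})" if x: "x \<in> {a..b}" for x
  proof -
    have "((\<lambda>y. (H y - H x) / (y - x)) \<longlongrightarrow> 0) (at x within {a..b})"
    proof (rule Lim_null_comparison)
      have "norm ((H y - H x) / (y - x)) \<le> \<bar>C\<bar> * \<bar>y - x\<bar>" if "y \<in> {a..b}" for y
      proof (cases "y = x")
        case False
        have "\<bar>H y - H x\<bar> \<le> \<bar>C\<bar> * (y - x)\<^sup>2"
          using le[OF x that] by (meson abs_ge_self mult_right_mono order_trans zero_le_power2)
        also have "\<dots> = (\<bar>C\<bar> * \<bar>y - x\<bar>) * \<bar>y - x\<bar>" by (simp add: power2_eq_square)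
        finally have "\<bar>H y - H x\<bar> / \<bar>y - x\<bar> \<le> \<bar>C\<bar> * \<bar>y - x\<bar>" using False by (simp add: divide_le_eq)
        then show ?thesis by (simp add: abs_divide)
      qed simp
      then show "\<forall>\<^sub>F y in at x within {a..b}. norm ((H y - H x) / (y - x)) \<le> \<bar>C\<bar> * \<bar>y - x\<bar>"
        by (auto simp: eventually_at intro!: exI[of _ 1])
      have "((\<lambda>y. \<bar>C\<bar> * \<bar>y - x\<bar>) \<longlongrightarrow> \<bar>C\<bar> * \<bar>x - x\<bar>) (at x within {a..b})"
        by (intro tendsto_intros)
      then show "((\<lambda>y. \<bar>C\<bar> * \<bar>y - x\<bar>) \<longlongrightarrow> 0) (at x within {a..b})" by simp
    qed
    then show ?thesis by (simp add: has_field_derivative_iff)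
  qed
  then have "\<exists>c. \<forall>x\<in>{a..b}. H x = c"
    by (intro has_field_derivative_zero_constant) auto
  with assms(2) show ?thesis by auto
qed

text \<open>The product rule: the increments of the difference of both sides are quadratically small.\<close>

lemma prim_mult:
  assumes "prim T c f" "prim T d g"
  shows "prim T (\<lambda>t. c t * d t) (\<lambda>t. c t * g t + f t * d t)"
proof -
  have bf: "bdd_meas T f" "bdd_meas T g" using assms by (auto simp: prim_def)
  have bc: "bdd_meas T c" "bdd_meas T d" using assms prim_bdd_meas by auto
  have bm: "bdd_meas T (\<lambda>t. c t * g t + f t * d t)" by (intro bdd_meas_intros bf bc)
  obtain F where F: "F \<ge> 0" "\<And>t. t \<in> {0..T} \<Longrightarrow> \<bar>f t\<bar> \<le> F" by (rule bdd_meas_bound[OF bf(1)]) (rule that)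
  obtain G where G: "G \<ge> 0" "\<And>t. t \<in> {0..T} \<Longrightarrow> \<bar>g t\<bar> \<le> G" by (rule bdd_meas_bound[OF bf(2)]) (rule that)
  define H where "H t = c t * d t - integral {0..t} (\<lambda>t. c t * g t + f t * d t)" for t
  have "\<bar>H t - H s\<bar> \<le> (2 * F * G) * (t - s)\<^sup>2" if st: "0 \<le> s" "s \<le> t" "t \<le> T" for s t
  proof -
    have "integral {0..s} (\<lambda>t. c t * g t + f t * d t) + integral {s..t} (\<lambda>t. c t * g t + f t * d t)
      = integral {0..t} (\<lambda>t. c t * g t + f t * d t)"
      using st bdd_meas_integrable_on[OF bm] by (intro HK_combine) auto
    then have "H t - H s = c t * (d t - d s) + (c t - c s) * d s - integral {s..t} (\<lambda>t. c t * g t + f t * d t)"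
      by (simp add: H_def algebra_simps)
    also have "c t * (d t - d s) + (c t - c s) * d s = integral {s..t} (\<lambda>r. c t * g r + f r * d s)"
    proof -
      note h = integrable_integral[OF bdd_meas_integrable_on[OF _ st(1,3)]]
      have "((\<lambda>r. c t * g r + f r * d s) has_integral c t * integral {s..t} g + integral {s..t} f * d s) {s..t}"
        by (rule has_integral_add[OF has_integral_mult_right[OF h[OF bf(2)]] has_integral_mult_left[OF h[OF bf(1)]]])
      then show ?thesis unfolding prim_diff[OF assms(1) st] prim_diff[OF assms(2) st] by (simp add: integral_unique)
    qed
    also have "integral {s..t} (\<lambda>r. c t * g r + f r * d s) - integral {s..t} (\<lambda>t. c t * g t + f t * d t)
        = integral {s..t} (\<lambda>r. (c t * g r + f r * d s) - (c r * g r + f r * d r))"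
      using st by (intro HK_diff[symmetric] bdd_meas_integrable_on[of T] bdd_meas_intros bf bc) auto
    finally have eq: "H t - H s = integral {s..t} (\<lambda>r. (c t * g r + f r * d s) - (c r * g r + f r * d r))" .
    have "norm (integral {s..t} (\<lambda>r. (c t * g r + f r * d s) - (c r * g r + f r * d r))) \<le> (2 * F * G * (t - s)) * (t - s)"
    proof (rule integral_bound_interval)
      show "(\<lambda>r. (c t * g r + f r * d s) - (c r * g r + f r * d r)) integrable_on {s..t}"
        using st by (intro bdd_meas_integrable_on[of T] bdd_meas_intros bf bc) auto
      fix r assume r: "r \<in> {s..t}"
      have "\<bar>c t - c r\<bar> \<le> F * (t - s)"
        using prim_Lipschitz[OF assms(1) F(2,1), of r t] r st F(1)
        by (auto elim!: order_trans intro!: mult_left_mono)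
      moreover have "\<bar>d s - d r\<bar> \<le> G * (t - s)"
        using prim_Lipschitz[OF assms(2) G(2,1), of r s] r st G(1)
        by (auto elim!: order_trans intro!: mult_left_mono)
      moreover have "\<bar>f r\<bar> \<le> F" "\<bar>g r\<bar> \<le> G" using F G r st by auto
      ultimately have "\<bar>(c t - c r) * g r\<bar> + \<bar>f r * (d s - d r)\<bar> \<le> (F * (t - s)) * G + F * (G * (t - s))"
        unfolding abs_mult using st F(1) G(1) by (intro add_mono mult_mono) auto
      then show "norm ((c t * g r + f r * d s) - (c r * g r + f r * d r)) \<le> 2 * F * G * (t - s)"
        using abs_triangle_ineq[of "(c t - c r) * g r" "f r * (d s - d r)"] by (simp add: algebra_simps)
    qed (use st F(1) G(1) in auto)
    then show ?thesis unfolding eq by (simp add: power2_eq_square mult.assoc)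
  qed
  then have "H t = H 0" if "t \<in> {0..T}" for t
    using that by (rule quadratic_increments_imp_constant)
  then have "c t * d t = c 0 * d 0 + integral {0..t} (\<lambda>t. c t * g t + f t * d t)" if "t \<in> {0..T}" for t
    using that by (force simp: H_def)
  then show ?thesis unfolding prim_def using bm by blast
qed

lemma prim_add:
  assumes "prim T c f" "prim T d g"
  shows "prim T (\<lambda>t. c t + d t) (\<lambda>t. f t + g t)"
proof -
  have "integral {0..t} (\<lambda>t. f t + g t) = integral {0..t} f + integral {0..t} g" if "t \<in> {0..T}" for t
    using assms that by (intro HK_add bdd_meas_integrable_on[of T]) (auto simp: prim_def)
  note int = this
  have bm: "bdd_meas T (\<lambda>t. f t + g t)" using assms by (simp add: prim_def bdd_meas_add)
  have eq: "c t + d t = c 0 + d 0 + (integral {0..t} f + integral {0..t} g)" if "t \<in> {0..T}" for t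
    using primD[OF assms(1) that] primD[OF assms(2) that] by linarith
  show ?thesis
    unfolding prim_def
  proof (intro conjI bm ballI)
    fix t assume t: "t \<in> {0..T}"
    show "c t + d t = c 0 + d 0 + integral {0..t} (\<lambda>t. f t + g t)"
      unfolding int[OF t] by (rule eq[OF t])
  qed
qed

lemma prim_const: "prim T (\<lambda>t. c) (\<lambda>t. 0)"
  by (simp add: prim_def)

lemma prim_cmult: "prim T d g \<Longrightarrow> prim T (\<lambda>t. c * d t) (\<lambda>t. c * g t)"
  using prim_mult[OF prim_const, of T d g c] by simp

lemma prim_sum: "(\<And>i. i \<in> I \<Longrightarrow> prim T (c i) (f i)) \<Longrightarrow> prim T (\<lambda>t. \<Sum>i\<in>I. c i t) (\<lambda>t. \<Sum>i\<in>I. f i t)"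
  by (induction I rule: infinite_finite_induct) (auto intro: prim_add prim_const)

lemma prim_smooth:
  assumes "\<And>t. (c has_field_derivative c' t) (at t)" "continuous_on UNIV c'"
  shows "prim T c c'"
  unfolding prim_def
proof (intro conjI ballI)
  show "bdd_meas T c'" using assms(2) by (intro bdd_meas_continuous) (auto intro: continuous_on_subset)
  fix t assume "t \<in> {0..T}"
  then have "(c' has_integral c t - c 0) {0..t}"
    using assms(1) by (intro fundamental_theorem_of_calculus)
      (auto simp: has_real_derivative_iff_has_vector_derivative[symmetric] intro: has_field_derivative_at_within)
  then show "c t = c 0 + integral {0..t} c'" by (simp add: integral_unique)
qed

lemma integral_Gronwall:
  fixes y :: "real \<Rightarrow> real"
  assumes "continuous_on {0..T} y" "B \<ge> 0"
    and le: "\<And>t. t \<in> {0..T} \<Longrightarrow> y t \<le> A + B * integral {0..t} y" and t: "t \<in> {0..T}"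
  shows "y t \<le> A * exp (B * t)"
proof -
  define Z where "Z t = (A + B * integral {0..t} y) * exp (- B * t)" for t
  have "Z t \<le> Z 0"
  proof (rule DERIV_nonpos_imp_decreasing_open[of 0 t])
    show "continuous_on {0..t} Z"
      unfolding Z_def using t assms(1)
      by (intro continuous_intros indefinite_integral_continuous_1 integrable_continuous_real)
         (auto intro: continuous_on_subset)
    fix s assume s: "0 < s" "s < t"
    have "((\<lambda>s. integral {0..s} y) has_field_derivative y s) (at s within {0..T})"
      using s t assms(1) by (intro integral_has_real_derivative) auto
    moreover have "at s within {0..T} = at s" using s t by (intro at_within_interior) auto
    ultimately have "((\<lambda>s. integral {0..s} y) has_field_derivative y s) (at s)" by simp
    then have "(Z has_field_derivative (B * y s) * exp (- B * s) + (A + B * integral {0..s} y) * (exp (- B * s) * (- B))) (at s)"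
      unfolding Z_def by (auto intro!: derivative_eq_intros)
    moreover have "(B * y s) * exp (- B * s) + (A + B * integral {0..s} y) * (exp (- B * s) * (- B))
        = (B * exp (- B * s)) * (y s - (A + B * integral {0..s} y))" by (simp add: algebra_simps)
    moreover have "\<dots> \<le> 0" using le[of s] s t assms(2) by (intro mult_nonneg_nonpos) auto
    ultimately show "\<exists>y. (Z has_field_derivative y) (at s) \<and> y \<le> 0" by auto
  qed (use t in auto)
  then have "A + B * integral {0..t} y \<le> A * exp (B * t)"
    by (simp add: Z_def exp_minus field_simps)
  with le[OF t] show ?thesis by simp
qed

lemma smooth_primitive:
  assumes "\<And>t. (\<psi> has_field_derivative \<eta> t) (at t)" "smooth \<eta>"
  shows "smooth \<psi>"
proof (rule smooth_coinduct[where P="\<lambda>f. smooth f \<or> f = \<psi>"])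
  have D: "(\<psi> has_derivative (\<lambda>v. v * \<eta> x)) (at x)" for x
    using assms(1)[of x] by (simp add: has_field_derivative_def mult_commute_abs)
  then have "dderiv v \<psi> = (\<lambda>x. v * \<eta> x)" for v
    using dderivI[OF D] by (intro ext)
  then show "(\<forall>x. f differentiable at x) \<and> (\<forall>v. smooth (dderiv v f) \<or> dderiv v f = \<psi>)"
    if "smooth f \<or> f = \<psi>" for f
    using that D smooth_differentiable smooth_dderiv smooth_cmult[OF assms(2)]
    by (auto simp: differentiable_def)
qed simp

text \<open>Weak solutions satisfy the mode equations only in the distributional sense; the continuity of the
  modes in time upgrades this to an integral equation.\<close>

lemma weak_derivative_imp_prim:
  assumes T: "T > 0" and c: "continuous_on {0..T} c" and g: "bdd_meas T g"
    and weak: "\<And>\<psi>. \<psi> \<in> test_functions {0<..<T} \<Longrightarrow>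
      integral {0..T} (\<lambda>t. c t * dderiv 1 \<psi> t) = - integral {0..T} (\<lambda>t. g t * \<psi> t)"
  shows "prim T c g"
proof -
  define G where "G t = integral {0..t} g" for t
  have G: "prim T G g" using g T by (simp add: prim_def G_def)
  \<comment> \<open>The difference has vanishing distributional derivative; it is shown to be constant by
     testing against functions of mean zero, which are derivatives of test functions.\<close>
  define D where "D t = c t - G t" for t
  have Dc: "continuous_on {0..T} D"
    unfolding D_def by (intro continuous_intros c prim_continuous_on[OF G])
  have bD: "bdd_meas T D" by (rule bdd_meas_continuous[OF Dc])
  have test_bm: "bdd_meas T \<psi>" if "\<psi> \<in> test_functions U" for \<psi> U
    using that by (intro bdd_meas_continuous smooth_continuous test_function_smooth)
  have D0: "integral {0..T} (\<lambda>t. D t * dderiv 1 \<psi> t) = 0" if \<psi>: "\<psi> \<in> test_functions {0<..<T}" for \<psi>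
  proof -
    have der: "(\<psi> has_field_derivative dderiv 1 \<psi> t) (at t)" for t
    proof -
      note d = smooth_has_derivative[OF test_function_smooth[OF \<psi>], of t]
      have "dderiv h \<psi> t = dderiv 1 \<psi> t * h" for h
        using linear_scale[OF has_derivative_linear[OF d], of h 1] by simp
      then have "(\<lambda>h. dderiv h \<psi> t) = (*) (dderiv 1 \<psi> t)" by (intro ext)
      with d show ?thesis by (simp add: has_field_derivative_def)
    qed
    have "prim T \<psi> (dderiv 1 \<psi>)"
      using der smooth_continuous[OF smooth_dderiv[OF test_function_smooth[OF \<psi>]]] by (rule prim_smooth)
    from prim_mult[OF G this]
    have p: "prim T (\<lambda>t. G t * \<psi> t) (\<lambda>t. G t * dderiv 1 \<psi> t + g t * \<psi> t)" .
    have z: "\<psi> 0 = 0" "\<psi> T = 0"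
    proof -
      obtain C where C: "C \<subseteq> {0<..<T}" "\<And>x. x \<notin> C \<Longrightarrow> \<psi> x = 0" using test_functionE[OF \<psi>] by metis
      have "0 \<notin> C" "T \<notin> C" using C(1) by auto
      then show "\<psi> 0 = 0" "\<psi> T = 0" using C(2) by simp_all
    qed
    have "0 = integral {0..T} (\<lambda>t. G t * dderiv 1 \<psi> t + g t * \<psi> t)"
      using prim_diff[OF p, of 0 T] T z by simp
    also have "\<dots> = integral {0..T} (\<lambda>t. G t * dderiv 1 \<psi> t) + integral {0..T} (\<lambda>t. g t * \<psi> t)"
      by (intro HK_add bdd_meas_integrable_on[of T] bdd_meas_intros
            prim_bdd_meas[OF G] g test_bm[OF \<psi>] test_bm[OF test_dderiv[OF \<psi>]]) auto
    finally have "integral {0..T} (\<lambda>t. G t * dderiv 1 \<psi> t) = integral {0..T} (\<lambda>t. c t * dderiv 1 \<psi> t)"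
      using weak[OF \<psi>] by simp
    moreover have "integral {0..T} (\<lambda>t. c t * dderiv 1 \<psi> t - G t * dderiv 1 \<psi> t) =
        integral {0..T} (\<lambda>t. c t * dderiv 1 \<psi> t) - integral {0..T} (\<lambda>t. G t * dderiv 1 \<psi> t)"
      by (intro HK_diff bdd_meas_integrable_on[of T] bdd_meas_intros
            prim_bdd_meas[OF G] bdd_meas_continuous[OF c] test_bm[OF test_dderiv[OF \<psi>]]) auto
    ultimately show ?thesis by (simp add: D_def left_diff_distrib)
  qed
  have zero_mean: "integral {0..T} (\<lambda>t. D t * \<eta> t) = 0"
    if \<eta>: "\<eta> \<in> test_functions {0<..<T}" and mean: "integral {0..T} \<eta> = 0" for \<eta>
  proof -
    obtain C where C: "compact C" "C \<subseteq> {0<..<T}" "\<And>x. x \<notin> C \<Longrightarrow> \<eta> x = 0" using test_functionE[OF \<eta>] by metis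
    obtain a b where ab: "0 < a" "a \<le> b" "b < T" "C \<subseteq> {a..b}"
    proof (cases "C = {}")
      case False
      with C(1) obtain a b where "a \<in> C" "\<forall>x\<in>C. a \<le> x" "b \<in> C" "\<forall>x\<in>C. x \<le> b"
        using compact_attains_inf[OF C(1)] compact_attains_sup[OF C(1)] by metis
      then show ?thesis using that[of a b] C(2) by force
    qed (use that[of "T/2" "T/2"] T in auto)
    have \<eta>0: "\<eta> x = 0" if "x \<notin> {a..b}" for x using C(3) ab(4) that by blast
    define \<psi> where "\<psi> t = integral {0..t} \<eta>" for t
    have \<eta>c: "continuous_on S \<eta>" for S using \<eta> by (intro smooth_continuous test_function_smooth)
    have low: "\<psi> t = 0" if "t < a" for t
    proof -
      have "\<psi> t = integral {0..t} (\<lambda>x. 0)" unfolding \<psi>_def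
        using \<eta>0 that by (intro HK_cong) auto
      then show ?thesis by simp
    qed
    have high: "\<psi> t = 0" if "t > b" for t
    proof (cases "t \<le> T")
      case True
      have "integral {0..t} \<eta> + integral {t..T} \<eta> = integral {0..T} \<eta>"
        using True that ab by (intro HK_combine integrable_continuous_real \<eta>c) auto
      moreover have "integral {t..T} \<eta> = integral {t..T} (\<lambda>x. 0)"
        using \<eta>0 that by (intro HK_cong) auto
      ultimately show ?thesis using mean by (simp add: \<psi>_def)
    next
      case False
      then have "integral {0..T} \<eta> + integral {T..t} \<eta> = integral {0..t} \<eta>"
        using T by (intro HK_combine integrable_continuous_real \<eta>c) auto
      moreover have "integral {T..t} \<eta> = integral {T..t} (\<lambda>x. 0)"
        using \<eta>0 ab by (intro HK_cong) auto
      ultimately show ?thesis using mean by (simp add: \<psi>_def)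
    qed
    have der: "(\<psi> has_field_derivative \<eta> t) (at t)" for t
    proof (cases "t < a")
      case True
      have "(\<psi> has_field_derivative 0) (at t)"
        by (rule has_field_derivative_transform_within_open[of "\<lambda>_. 0" _ _ "{..<a}"]) (use True low in auto)
      then show ?thesis using \<eta>0 True by simp
    next
      case False
      have "(\<psi> has_field_derivative \<eta> t) (at t within {0..t+1})"
        unfolding \<psi>_def using False ab by (intro integral_has_real_derivative \<eta>c) auto
      moreover have "at t within {0..t+1} = at t" using False ab by (intro at_within_interior) auto
      ultimately show ?thesis by simp
    qed
    have "\<psi> \<in> test_functions {0<..<T}"
    proof (rule test_functionI)
      show "smooth \<psi>" using der test_function_smooth[OF \<eta>] by (rule smooth_primitive)
      show "compact {a..b}" "{a..b} \<subseteq> {0<..<T}" using ab by auto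
      show "\<psi> x = 0" if "x \<notin> {a..b}" for x using that low high by force
    qed
    moreover have "dderiv 1 \<psi> = \<eta>"
      using dderivI[OF der[unfolded has_field_derivative_def]] by (intro ext) simp
    ultimately show ?thesis using D0[of \<psi>] by simp
  qed
  obtain \<eta>0 where \<eta>0: "\<eta>0 \<in> test_functions {0<..<T}" "integral {0..T} \<eta>0 = 1"
  proof -
    obtain \<zeta> where \<zeta>: "\<zeta> \<in> test_functions {0<..<T}" "\<And>x. 0 \<le> \<zeta> x" "\<And>x. x \<in> {T/3..2*T/3} \<Longrightarrow> \<zeta> x = 1"
      by (rule smooth_urysohn[of "{T/3..2*T/3}" "{0<..<T}"]) (use T in auto)
    have bz: "bdd_meas T \<zeta>" using test_bm[OF \<zeta>(1)] .
    have "integral {T/3..2*T/3} \<zeta> \<le> integral {0..T} \<zeta>"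
      using T \<zeta>(2) by (intro integral_subset_le bdd_meas_integrable_on[OF bz]) auto
    moreover have "integral {T/3..2*T/3} \<zeta> = integral {T/3..2*T/3} (\<lambda>_. 1)"
      using \<zeta>(3) by (intro HK_cong) auto
    ultimately have pos: "integral {0..T} \<zeta> > 0" using T by simp
    show thesis
    proof
      show "(\<lambda>t. inverse (integral {0..T} \<zeta>) * \<zeta> t) \<in> test_functions {0<..<T}"
        by (intro test_mult_smooth \<zeta> smooth_const)
      show "integral {0..T} (\<lambda>t. inverse (integral {0..T} \<zeta>) * \<zeta> t) = 1" using pos by simp
    qed
  qed
  define m where "m = integral {0..T} (\<lambda>t. D t * \<eta>0 t)"
  have "AE t in lebesgue_on {0<..<T}. D t - m = 0"
  proof (rule fundamental_lemma)
    show "L1_loc {0<..<T} (\<lambda>t. D t - m)"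
      unfolding L1_loc_def
    proof (intro allI impI)
      fix K assume K: "compact K \<and> K \<subseteq> {0<..<T}"
      have "integrable (lebesgue_on {0..T}) (\<lambda>t. D t - m)"
        by (intro bdd_meas_LINT bdd_meas_diff bdd_meas_const bD)
      then show "integrable (lebesgue_on K) (\<lambda>t. D t - m)"
        using K by (rule_tac integrable_lebesgue_on_subset[of "{0..T}"]) (auto simp: lmeasurable_compact fmeasurableD)
    qed
    fix \<eta> :: "real \<Rightarrow> real" assume \<eta>: "\<eta> \<in> test_functions {0<..<T}"
    let ?I = "integral {0..T} \<eta>"
    have b: "bdd_meas T \<eta>" "bdd_meas T \<eta>0" using \<eta> \<eta>0 test_bm by auto
    have "(\<lambda>t. \<eta> t + (- ?I) * \<eta>0 t) \<in> test_functions {0<..<T}"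
      using \<eta> \<eta>0 by (intro test_add test_mult_smooth smooth_const)
    moreover have "integral {0..T} (\<lambda>t. \<eta> t + (- ?I) * \<eta>0 t) = 0"
      using \<eta>0(2) T b by (subst HK_add)
        (auto intro!: bdd_meas_integrable_on[of T] bdd_meas_minus bdd_meas_cmult)
    ultimately have "integral {0..T} (\<lambda>t. D t * (\<eta> t + (- ?I) * \<eta>0 t)) = 0" by (rule zero_mean)
    moreover have "integral {0..T} (\<lambda>t. D t * (\<eta> t + (- ?I) * \<eta>0 t)) =
        integral {0..T} (\<lambda>t. D t * \<eta> t + (- ?I) * (D t * \<eta>0 t))" by (simp add: algebra_simps)
    moreover have "\<dots> = integral {0..T} (\<lambda>t. D t * \<eta> t) + (- ?I) * m"
      using b bD by (subst HK_add)
        (auto simp: m_def intro!: bdd_meas_integrable_on[of T] bdd_meas_minus bdd_meas_cmult bdd_meas_mult)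
    moreover have "integral {0..T} (\<lambda>t. (D t - m) * \<eta> t) = integral {0..T} (\<lambda>t. D t * \<eta> t) - m * ?I"
      using b bD by (simp add: left_diff_distrib, subst HK_diff)
        (auto intro!: bdd_meas_integrable_on[of T] bdd_meas_cmult bdd_meas_mult)
    ultimately have "integral {0..T} (\<lambda>t. (D t - m) * \<eta> t) = 0" by simp
    moreover have "bdd_meas T (\<lambda>t. (D t - m) * \<eta> t)" by (intro bdd_meas_intros bD b)
    ultimately show "(LINT t|lebesgue_on {0<..<T}. (D t - m) * \<eta> t) = 0" by (simp add: LINT_open_interval)
  qed simp
  then have ae: "AE t in lebesgue. t \<in> {0<..<T} \<longrightarrow> D t = m" by (simp add: AE_restrict_space_iff)
  have Dm: "D t = m" if "t \<in> {0<..<T}" for t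
  proof (rule ccontr)
    assume "D t \<noteq> m"
    let ?S = "{t \<in> {0<..<T}. D t \<noteq> m}"
    have "?S = {0<..<T} \<inter> D -` (- {m})" by auto
    moreover have "open ({0<..<T} \<inter> D -` (- {m}))"
      using Dc by (intro continuous_open_preimage) (auto intro: continuous_on_subset)
    ultimately have "open ?S" by simp
    moreover have "negligible ?S"
      unfolding negligible_iff_null_sets
    proof (rule AE_iff_null_sets[THEN iffD2])
      show "?S \<in> sets lebesgue" using \<open>open ?S\<close> by simp
      show "AE t in lebesgue. t \<notin> ?S" using ae by (rule eventually_mono) simp
    qed
    ultimately show False using open_not_negligible[of ?S] that \<open>D t \<noteq> m\<close> by blast
  qed
  have "D t = m" if "t \<in> {0..T}" for t
    using continuous_constant_on_closure[of "{0<..<T}" D m t] Dc Dm that T by simp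
  note Dt = this
  have "c t = c 0 + integral {0..t} g" if "t \<in> {0..T}" for t
    using Dt[OF that] Dt[of 0] T by (simp add: D_def G_def)
  then show ?thesis using g unfolding prim_def by blast
qed

section \<open>Mollification\<close>

lemma dderiv_inner_grad: "smooth f \<Longrightarrow> dderiv v f x = grad f x \<bullet> v"
proof -
  assume f: "smooth f"
  interpret linear "\<lambda>v. dderiv v f x" by (rule has_derivative_linear[OF smooth_has_derivative[OF f]])
  have "dderiv v f x = dderiv (\<Sum>b\<in>Basis. (v \<bullet> b) *\<^sub>R b) f x" by (simp add: euclidean_representation)
  also have "\<dots> = (\<Sum>b\<in>Basis. (v \<bullet> b) * dderiv b f x)" by (simp add: sum scale)
  also have "\<dots> = grad f x \<bullet> v"
    by (simp only: grad_def inner_sum_left inner_scaleR_left inner_commute[of v] mult.commute)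
  finally show ?thesis .
qed

lemma test_Lipschitz:
  assumes "\<psi> \<in> test_functions U"
  obtains L where "L \<ge> 0" "\<And>x y. \<bar>\<psi> x - \<psi> y\<bar> \<le> L * norm (x - y)"
proof -
  obtain B where B: "\<And>x. norm (grad \<psi> x) \<le> B" "B \<ge> 0" using test_grad_bounded[OF assms] by metis
  have s: "smooth \<psi>" using assms by (rule test_function_smooth)
  have "norm (\<psi> x - \<psi> y) \<le> B * norm (x - y)" for x y
  proof (rule differentiable_bound[of UNIV \<psi> "\<lambda>x v. dderiv v \<psi> x"])
    show "onorm (\<lambda>v. dderiv v \<psi> x) \<le> B" for x
    proof (rule onorm_bound[OF B(2)])
      show "norm (dderiv v \<psi> x) \<le> B * norm v" for v
        unfolding dderiv_inner_grad[OF s] using Cauchy_Schwarz_ineq2[of "grad \<psi> x" v] B(1)[of x]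
        by (metis mult_right_mono norm_ge_zero order_trans real_norm_def)
    qed
  qed (use smooth_has_derivative[OF s] in auto)
  with B(2) show thesis using that by simp
qed

lemma test_grad_Lipschitz:
  assumes "\<psi> \<in> test_functions U"
  obtains L where "L \<ge> 0" "\<And>x y. norm (grad \<psi> x - grad \<psi> y) \<le> L * norm (x - y)"
proof -
  have "\<exists>L\<ge>0. \<forall>x y. \<bar>dderiv b \<psi> x - dderiv b \<psi> y\<bar> \<le> L * norm (x - y)" for b
    using test_Lipschitz[OF test_dderiv[OF assms]] by metis
  then obtain L where L: "\<And>b. L b \<ge> 0" "\<And>b x y. \<bar>dderiv b \<psi> x - dderiv b \<psi> y\<bar> \<le> L b * norm (x - y)"
    by metis
  show thesis
  proof
    show "0 \<le> (\<Sum>b\<in>Basis. L b)" using L(1) by (intro sum_nonneg)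
    show "norm (grad \<psi> x - grad \<psi> y) \<le> (\<Sum>b\<in>Basis. L b) * norm (x - y)" for x y
    proof -
      have "norm (grad \<psi> x - grad \<psi> y) \<le> (\<Sum>b\<in>Basis. \<bar>(grad \<psi> x - grad \<psi> y) \<bullet> b\<bar>)" by (rule norm_le_l1)
      also have "\<dots> \<le> (\<Sum>b\<in>Basis. L b * norm (x - y))"
        using L(2) by (intro sum_mono) (simp add: inner_diff_left grad_inner)
      finally show ?thesis by (simp add: sum_distrib_right)
    qed
  qed
qed

text \<open>The quadratic remainder is what allows to differentiate a convolution under the integral sign.\<close>

lemma test_Taylor:
  assumes "\<psi> \<in> test_functions U"
  obtains L where "L \<ge> 0" "\<And>y h. \<bar>\<psi> (y - h) - \<psi> y + dderiv h \<psi> y\<bar> \<le> L * (norm h)\<^sup>2"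
proof -
  obtain L where L: "L \<ge> 0" "\<And>x y. norm (grad \<psi> x - grad \<psi> y) \<le> L * norm (x - y)"
    using test_grad_Lipschitz[OF assms] by metis
  have s: "smooth \<psi>" using assms by (rule test_function_smooth)
  show thesis
  proof (rule that[OF L(1)])
    fix y h :: 'a
    let ?k = "\<lambda>h. \<psi> (y - h) + dderiv h \<psi> y"
    have "norm (?k h - ?k 0) \<le> (L * norm h) * norm (h - 0)"
    proof (rule differentiable_bound[of "cball 0 (norm h)" ?k "\<lambda>h v. - dderiv v \<psi> (y - h) + dderiv v \<psi> y"])
      fix x :: 'a assume x: "x \<in> cball 0 (norm h)"
      have "((\<lambda>h. y - h) has_derivative (\<lambda>v. - v)) (at x)" by (auto intro!: derivative_eq_intros)
      from diff_chain_at[OF this smooth_has_derivative[OF s]]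
      have "((\<lambda>h. \<psi> (y - h)) has_derivative (\<lambda>v. dderiv (- v) \<psi> (y - x))) (at x)" by (simp add: o_def)
      moreover have "((\<lambda>h. dderiv h \<psi> y) has_derivative (\<lambda>v. dderiv v \<psi> y)) (at x)"
        by (rule bounded_linear_imp_has_derivative[OF has_derivative_bounded_linear[OF smooth_has_derivative[OF s]]])
      ultimately have "(?k has_derivative (\<lambda>v. dderiv (- v) \<psi> (y - x) + dderiv v \<psi> y)) (at x)"
        by (rule has_derivative_add)
      then show "(?k has_derivative (\<lambda>v. - dderiv v \<psi> (y - x) + dderiv v \<psi> y)) (at x within cball 0 (norm h))"
        by (simp add: dderiv_inner_grad[OF s] has_derivative_at_withinI)
      show "onorm (\<lambda>v. - dderiv v \<psi> (y - x) + dderiv v \<psi> y) \<le> L * norm h"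
      proof (rule onorm_bound)
        fix v
        have "\<bar>(grad \<psi> y - grad \<psi> (y - x)) \<bullet> v\<bar> \<le> norm (grad \<psi> y - grad \<psi> (y - x)) * norm v"
          by (rule Cauchy_Schwarz_ineq2)
        also have "\<dots> \<le> (L * norm h) * norm v"
        proof (intro mult_right_mono)
          have "L * norm x \<le> L * norm h" using x L(1) by (intro mult_left_mono) auto
          then show "norm (grad \<psi> y - grad \<psi> (y - x)) \<le> L * norm h"
            using L(2)[of y "y - x"] by simp
        qed simp
        finally show "norm (- dderiv v \<psi> (y - x) + dderiv v \<psi> y) \<le> (L * norm h) * norm v"
          by (simp add: dderiv_inner_grad[OF s] inner_diff_left)
      qed (use L in simp)
    qed auto
    moreover have "dderiv 0 \<psi> y = 0" by (simp add: dderiv_inner_grad[OF s])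
    ultimately show "\<bar>\<psi> (y - h) - \<psi> y + dderiv h \<psi> y\<bar> \<le> L * (norm h)\<^sup>2"
      by (simp add: power2_eq_square algebra_simps)
  qed
qed

lemma test_translate:
  assumes "\<rho> \<in> test_functions V" "\<And>y. y \<in> V \<Longrightarrow> x + y \<in> U"
  shows "(\<lambda>z. \<rho> (z - x)) \<in> test_functions U" "dderiv b (\<lambda>z. \<rho> (z - x)) = (\<lambda>z. dderiv b \<rho> (z - x))"
proof -
  obtain C where C: "compact C" "C \<subseteq> V" "\<And>y. y \<notin> C \<Longrightarrow> \<rho> y = 0" using test_functionE[OF assms(1)] by metis
  note a = smooth_affine_comp[OF bounded_linear_ident test_function_smooth[OF assms(1)], where c="- x"]
  show "dderiv b (\<lambda>z. \<rho> (z - x)) = (\<lambda>z. dderiv b \<rho> (z - x))" using a(2)[where v=b] by simp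
  show "(\<lambda>z. \<rho> (z - x)) \<in> test_functions U"
  proof (rule test_functionI)
    show "smooth (\<lambda>z. \<rho> (z - x))" using a(1) by simp
    show "compact ((+) x ` C)" using C(1) by (rule compact_translation)
    show "(+) x ` C \<subseteq> U" using C(2) assms(2) by auto
    show "\<rho> (z - x) = 0" if "z \<notin> (+) x ` C" for z
      using that C(3)[of "z - x"] by (metis add_diff_cancel_left' diff_add_cancel add.commute imageI)
  qed
qed

text \<open>The convolution of \<open>g\<close> with the reflected kernel \<open>\<lambda>z. \<rho> (- z)\<close>. With this sign,
  \<open>\<rho>\<close> supported near a point \<open>y\<close> averages \<open>g\<close> over a neighbourhood of \<open>x + y\<close>.\<close>

definition conv :: "('a::euclidean_space \<Rightarrow> real) \<Rightarrow> ('a \<Rightarrow> real) \<Rightarrow> 'a \<Rightarrow> real" where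
  "conv \<rho> g x = (LINT z|lborel. \<rho> (z - x) * g z)"

lemma test_borel_measurable: "\<psi> \<in> test_functions U \<Longrightarrow> \<psi> \<in> borel_measurable borel"
  by (intro borel_measurable_continuous_onI smooth_continuous test_function_smooth)

lemma conv_integrable:
  assumes "\<rho> \<in> test_functions U" "integrable lborel g"
  shows "integrable lborel (\<lambda>z. \<rho> (z - x) * g z)"
proof -
  obtain B where B: "\<And>x. \<bar>\<rho> x\<bar> \<le> B" using test_grad_bounded[OF assms(1)] by metis
  have [measurable]: "\<rho> \<in> borel_measurable borel" using assms(1) by (rule test_borel_measurable)
  have [measurable]: "g \<in> borel_measurable borel" using assms(2) by auto
  have i: "integrable lborel (\<lambda>z. B * \<bar>g z\<bar>)" using assms(2) by simp
  show ?thesis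
    by (rule integrable_bound_real[OF i]) (use B in \<open>auto simp: abs_mult intro: mult_right_mono\<close>)
qed

lemma smooth_conv:
  fixes \<rho> :: "'a::euclidean_space \<Rightarrow> real"
  assumes "\<rho> \<in> test_functions U" "integrable lborel g"
  shows "smooth (conv \<rho> g)" and "dderiv v (conv \<rho> g) x = - conv (dderiv v \<rho>) g x"
proof -
  have D: "(conv \<rho> g has_derivative (\<lambda>v. - conv (dderiv v \<rho>) g x)) (at x)"
    if \<rho>: "\<rho> \<in> test_functions U" for \<rho> :: "'a \<Rightarrow> real" and x
  proof -
    obtain L where L: "L \<ge> 0" "\<And>y h. \<bar>\<rho> (y - h) - \<rho> y + dderiv h \<rho> y\<bar> \<le> L * (norm h)\<^sup>2"
      using test_Taylor[OF \<rho>] by metis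
    define I where "I = (LINT z|lborel. \<bar>g z\<bar>)"
    have I: "I \<ge> 0" by (simp add: I_def)
    note ci = conv_integrable[OF _ assms(2)]
    have s: "smooth \<rho>" using \<rho> by (rule test_function_smooth)
    have lin: "linear (\<lambda>v. - conv (dderiv v \<rho>) g x)"
    proof (rule linearI)
      show "- conv (dderiv (a + b) \<rho>) g x = - conv (dderiv a \<rho>) g x + - conv (dderiv b \<rho>) g x" for a b
      proof -
        have "dderiv (a + b) \<rho> = (\<lambda>x. dderiv a \<rho> x + dderiv b \<rho> x)"
          by (simp add: dderiv_inner_grad[OF s] inner_add_right fun_eq_iff)
        then show ?thesis
          using ci[OF test_dderiv[OF \<rho>]] by (simp add: conv_def distrib_right)
      qed
      show "- conv (dderiv (r *\<^sub>R a) \<rho>) g x = r *\<^sub>R (- conv (dderiv a \<rho>) g x)" for r a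
      proof -
        have "dderiv (r *\<^sub>R a) \<rho> = (\<lambda>x. r * dderiv a \<rho> x)"
          by (simp add: dderiv_inner_grad[OF s] fun_eq_iff)
        then show ?thesis by (simp add: conv_def mult.assoc)
      qed
    qed
    have est: "norm (conv \<rho> g (x + h) - conv \<rho> g x - (- conv (dderiv h \<rho>) g x)) \<le> (L * I) * (norm h)\<^sup>2" for h
    proof -
      have "conv \<rho> g (x + h) - conv \<rho> g x - (- conv (dderiv h \<rho>) g x) =
          (LINT z|lborel. \<rho> (z - (x + h)) * g z - \<rho> (z - x) * g z + dderiv h \<rho> (z - x) * g z)"
        using ci[OF \<rho>] ci[OF test_dderiv[OF \<rho>]] by (simp add: conv_def)
      moreover have "norm (LINT z|lborel. \<rho> (z - (x + h)) * g z - \<rho> (z - x) * g z + dderiv h \<rho> (z - x) * g z)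
          \<le> (LINT z|lborel. L * (norm h)\<^sup>2 * \<bar>g z\<bar>)"
      proof (rule order_trans[OF integral_norm_bound integral_mono])
        show "integrable lborel (\<lambda>z. norm (\<rho> (z - (x + h)) * g z - \<rho> (z - x) * g z + dderiv h \<rho> (z - x) * g z))"
          using ci[OF \<rho>] ci[OF test_dderiv[OF \<rho>]]
          by (intro integrable_norm Bochner_Integration.integrable_add Bochner_Integration.integrable_diff)
        show "integrable lborel (\<lambda>z. L * (norm h)\<^sup>2 * \<bar>g z\<bar>)" using assms(2) by simp
        fix z
        have "\<rho> (z - (x + h)) * g z - \<rho> (z - x) * g z + dderiv h \<rho> (z - x) * g z =
            (\<rho> ((z - x) - h) - \<rho> (z - x) + dderiv h \<rho> (z - x)) * g z" by (simp add: algebra_simps)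
        also have "norm \<dots> \<le> L * (norm h)\<^sup>2 * \<bar>g z\<bar>"
          using L(2)[of "z - x" h] by (simp add: abs_mult mult_right_mono)
        finally show "norm (\<rho> (z - (x + h)) * g z - \<rho> (z - x) * g z + dderiv h \<rho> (z - x) * g z)
          \<le> L * (norm h)\<^sup>2 * \<bar>g z\<bar>" .
      qed
      moreover have "(LINT z|lborel. L * (norm h)\<^sup>2 * \<bar>g z\<bar>) = (L * I) * (norm h)\<^sup>2"
        using assms(2) by (simp add: I_def)
      ultimately show ?thesis by metis
    qed
    show ?thesis
      unfolding has_derivative_at
    proof (intro conjI)
      show "bounded_linear (\<lambda>v. - conv (dderiv v \<rho>) g x)" using lin by (simp add: linear_conv_bounded_linear)
      show "(\<lambda>h. norm (conv \<rho> g (x + h) - conv \<rho> g x - (- conv (dderiv h \<rho>) g x)) / norm h) \<midarrow>0\<rightarrow> 0"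
      proof (rule Lim_null_comparison[OF always_eventually])
        show "\<forall>h. norm (norm (conv \<rho> g (x + h) - conv \<rho> g x - (- conv (dderiv h \<rho>) g x)) / norm h) \<le> (L * I) * norm h"
        proof
          fix h :: 'a
          have "norm (conv \<rho> g (x + h) - conv \<rho> g x - (- conv (dderiv h \<rho>) g x)) \<le> (L * I * norm h) * norm h"
            using est[of h] by (simp add: power2_eq_square mult_ac)
          then show "norm (norm (conv \<rho> g (x + h) - conv \<rho> g x - (- conv (dderiv h \<rho>) g x)) / norm h) \<le> (L * I) * norm h"
            by (cases "h = 0") (simp_all add: divide_le_eq)
        qed
        show "((\<lambda>h. (L * I) * norm h) \<longlongrightarrow> 0) (at (0::'a))"
          by (rule tendsto_eq_intros refl | simp)+
      qed
    qed
  qed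
  have dd: "dderiv v (conv \<rho> g) = conv (\<lambda>y. - 1 * dderiv v \<rho> y) g" if \<rho>: "\<rho> \<in> test_functions U" for \<rho> v
    using dderivI[OF D[OF \<rho>], of v] by (auto simp: fun_eq_iff conv_def)
  show "dderiv v (conv \<rho> g) x = - conv (dderiv v \<rho>) g x" using dderivI[OF D[OF assms(1)]] .
  show "smooth (conv \<rho> g)"
  proof (rule smooth_coinduct[where P="\<lambda>f. \<exists>\<rho>. \<rho> \<in> test_functions U \<and> f = conv \<rho> g"])
    show "\<exists>\<rho>'. \<rho>' \<in> test_functions U \<and> conv \<rho> g = conv \<rho>' g" using assms(1) by blast
    fix f assume "\<exists>\<rho>. \<rho> \<in> test_functions U \<and> f = conv \<rho> g"
    then obtain \<rho> where \<rho>: "\<rho> \<in> test_functions U" "f = conv \<rho> g" by blast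
    show "(\<forall>x. f differentiable at x) \<and> (\<forall>v. \<exists>\<rho>. \<rho> \<in> test_functions U \<and> dderiv v f = conv \<rho> g)"
    proof (intro conjI allI)
      show "f differentiable at x" for x using D[OF \<rho>(1)] \<rho>(2) by (auto simp: differentiable_def)
      show "\<exists>\<rho>. \<rho> \<in> test_functions U \<and> dderiv v f = conv \<rho> g" for v
        using dd[OF \<rho>(1)] test_mult_smooth[OF test_dderiv[OF \<rho>(1)] smooth_const] \<rho>(2) by blast
    qed
  qed
qed

lemma lborel_translation:
  fixes g :: "'a::euclidean_space \<Rightarrow> real"
  assumes [measurable]: "g \<in> borel_measurable borel"
  shows "(LINT x|lborel. g (x + y)) = (LINT x|lborel. g x)"
    "integrable lborel (\<lambda>x. g (x + y)) \<longleftrightarrow> integrable lborel g"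
proof -
  have "(LINT x|lborel. g x) = (LINT x|distr lborel borel ((+) y). g x)" by (simp add: lborel_distr_plus)
  also have "\<dots> = (LINT x|lborel. g (y + x))" by (rule integral_distr) auto
  finally show "(LINT x|lborel. g (x + y)) = (LINT x|lborel. g x)" by (simp add: add.commute)
  have "integrable lborel g \<longleftrightarrow> integrable (distr lborel borel ((+) y)) g" by (simp add: lborel_distr_plus)
  also have "\<dots> \<longleftrightarrow> integrable lborel (\<lambda>x. g (y + x))" by (rule integrable_distr_eq) auto
  finally show "integrable lborel (\<lambda>x. g (x + y)) \<longleftrightarrow> integrable lborel g" by (simp add: add.commute)
qed

lemma conv_translate:
  assumes [measurable]: "\<rho> \<in> borel_measurable borel" "g \<in> borel_measurable borel"
  shows "conv \<rho> g x = (LINT y|lborel. \<rho> y * g (x + y))"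
  using lborel_translation(1)[of "\<lambda>z. \<rho> (z - x) * g z" x] by (simp add: conv_def add.commute)

lemma L2_translate:
  fixes g :: "'a::euclidean_space \<Rightarrow> real"
  assumes "L2 lborel g"
  shows "L2 lborel (\<lambda>x. g (x + y))" "(LINT x|lborel. (g (x + y))\<^sup>2) = (LINT x|lborel. (g x)\<^sup>2)"
proof -
  have [measurable]: "g \<in> borel_measurable borel" using assms by (auto simp: L2_def)
  show "L2 lborel (\<lambda>x. g (x + y))"
    using assms lborel_translation(2)[of "\<lambda>x. (g x)\<^sup>2" y] by (simp add: L2_def)
  show "(LINT x|lborel. (g (x + y))\<^sup>2) = (LINT x|lborel. (g x)\<^sup>2)"
    by (rule lborel_translation) measurable
qed

definition clamp_real :: "real \<Rightarrow> real \<Rightarrow> real" where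
  "clamp_real m y = max (- m) (min m y)"

text \<open>Truncate in the values and in space; the truncated function is an almost everywhere limit of
  continuous functions, which are truncated in the same way to have a common square integrable bound.\<close>

lemma L2_dense_continuous:
  fixes p :: "'a::euclidean_space \<Rightarrow> real"
  assumes p: "L2 lborel p" and e: "e > 0"
  obtains k C B where "continuous_on UNIV k" "compact C" "\<And>x. x \<notin> C \<Longrightarrow> k x = 0" "\<And>x. \<bar>k x\<bar> \<le> B"
    "L2 lborel k" "(LINT x|lborel. (p x - k x)\<^sup>2) < e"
proof -
  have pm [measurable]: "p \<in> borel_measurable borel" using p by (auto simp: L2_def)
  have "\<exists>\<zeta>. \<zeta> \<in> test_functions UNIV \<and> (\<forall>x. 0 \<le> \<zeta> x) \<and> (\<forall>x. \<zeta> x \<le> 1) \<and> (\<forall>x\<in>cball (0::'a) (real m). \<zeta> x = 1)" for m :: nat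
    using smooth_urysohn[of "cball (0::'a) (real m)" UNIV] by (metis compact_cball open_UNIV subset_UNIV)
  then obtain \<zeta> :: "nat \<Rightarrow> 'a \<Rightarrow> real" where \<zeta>: "\<And>m. \<zeta> m \<in> test_functions UNIV" "\<And>m x. 0 \<le> \<zeta> m x" "\<And>m x. \<zeta> m x \<le> 1"
    "\<And>m x. x \<in> cball 0 (real m) \<Longrightarrow> \<zeta> m x = 1" by metis
  have [measurable]: "\<zeta> m \<in> borel_measurable borel" for m using \<zeta>(1) by (rule test_borel_measurable)
  have clm [measurable]: "(\<lambda>x. clamp_real m (f x)) \<in> borel_measurable M" if "f \<in> borel_measurable M" for m f and M :: "'a measure"
    using that unfolding clamp_real_def by measurable
  define P where "P m x = clamp_real (real m) (p x) * \<zeta> m x" for m x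
  have between: "\<bar>y - clamp_real (real m) y * z\<bar> \<le> \<bar>y\<bar>" if "0 \<le> z" "z \<le> 1" for y z m
  proof (cases "y \<ge> 0")
    case True
    then have c: "0 \<le> clamp_real (real m) y" "clamp_real (real m) y \<le> y" by (auto simp: clamp_real_def)
    then have "0 \<le> clamp_real (real m) y * z" "clamp_real (real m) y * z \<le> clamp_real (real m) y"
      using that by (auto intro: mult_left_le)
    with c have "0 \<le> clamp_real (real m) y * z" "clamp_real (real m) y * z \<le> y" by linarith+
    then show ?thesis using True by auto
  next
    case False
    then have c: "clamp_real (real m) y \<le> 0" "y \<le> clamp_real (real m) y" by (auto simp: clamp_real_def)
    then have "clamp_real (real m) y * z \<le> 0" using that by (simp add: mult_nonpos_nonneg)
    moreover have "(- clamp_real (real m) y) * z \<le> (- y) * 1" using that False c by (intro mult_mono) auto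
    ultimately show ?thesis using False by auto
  qed
  have "(\<lambda>m. LINT x|lborel. (p x - P m x)\<^sup>2) \<longlonglongrightarrow> (LINT x|(lborel::'a measure). (0::real))"
  proof (rule integral_dominated_convergence[where w="\<lambda>x. (p x)\<^sup>2"])
    show "integrable lborel (\<lambda>x. (p x)\<^sup>2)" using p by (rule L2_real_sq)
    show "AE x in lborel. norm ((p x - P m x)\<^sup>2) \<le> (p x)\<^sup>2" for m
      using between[OF \<zeta>(2,3)] by (intro AE_I2) (simp add: P_def abs_le_square_iff[symmetric])
    show "AE x in lborel. (\<lambda>m. (p x - P m x)\<^sup>2) \<longlonglongrightarrow> 0"
    proof (intro AE_I2 tendsto_eventually)
      fix x
      show "\<forall>\<^sub>F m in sequentially. (p x - P m x)\<^sup>2 = 0"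
        using eventually_ge_at_top[of "nat \<lceil>norm x + \<bar>p x\<bar>\<rceil>"]
      proof eventually_elim
        case (elim m)
        then have "norm x + \<bar>p x\<bar> \<le> real m" by linarith
        then have "norm x \<le> real m" "\<bar>p x\<bar> \<le> real m" using norm_ge_zero[of x] abs_ge_zero[of "p x"] by linarith+
        then show ?case by (simp add: P_def clamp_real_def \<zeta>(4) abs_le_iff)
      qed
    qed
  qed (simp_all add: P_def)
  then have "\<forall>\<^sub>F m in sequentially. (LINT x|lborel. (p x - P m x)\<^sup>2) < e / 4"
    using e by (intro order_tendstoD) auto
  then obtain m where m: "(LINT x|lborel. (p x - P m x)\<^sup>2) < e / 4"
    by (auto simp: eventually_sequentially)
  have "p measurable_on UNIV"
    using pm by (intro lebesgue_measurable_imp_measurable_on) (auto simp: lebesgue_on_UNIV_eq measurable_completion)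
  then obtain N g where N: "negligible N" and g: "\<And>n::nat. continuous_on UNIV (g n)"
    and lim: "\<And>x. x \<notin> N \<Longrightarrow> (\<lambda>n. g n x) \<longlonglongrightarrow> p x"
    unfolding measurable_on_def by auto
  have [measurable]: "g n \<in> borel_measurable borel" for n using g by (rule borel_measurable_continuous_onI)
  define k where "k n x = clamp_real (real m) (g n x) * \<zeta> m x" for n x
  have km [measurable]: "k n \<in> borel_measurable borel" for n unfolding k_def by measurable
  have Pm [measurable]: "P m \<in> borel_measurable borel" unfolding P_def by measurable
  have kb: "\<bar>k n x\<bar> \<le> real m * \<zeta> m x" and Pb: "\<bar>P m x\<bar> \<le> real m * \<zeta> m x" for n x
    using \<zeta>(2)[of m x] by (auto simp: k_def P_def abs_mult clamp_real_def intro!: mult_right_mono)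
  have L2z: "integrable lborel (\<lambda>x. (\<zeta> m x)\<^sup>2)"
    using L2_continuous_test(1)[OF \<zeta>(1), of UNIV m] test_borel_measurable[OF \<zeta>(1), of m]
    by (simp add: L2_def lebesgue_on_UNIV_eq integrable_completion)
  have L2k: "L2 lborel (k n)" for n
  proof -
    have "integrable lborel (\<lambda>x. (real m)\<^sup>2 * (\<zeta> m x)\<^sup>2)" using L2z by simp
    then have "integrable lborel (\<lambda>x. (k n x)\<^sup>2)"
    proof (rule integrable_bound_real)
      show "norm ((k n x)\<^sup>2) \<le> (real m)\<^sup>2 * (\<zeta> m x)\<^sup>2" for x
        using power_mono[OF kb[of n x] abs_ge_zero, of 2] by (simp add: power_mult_distrib)
    qed measurable
    then show ?thesis by (simp add: L2_def)
  qed
  have "(\<lambda>n. LINT x|lborel. (P m x - k n x)\<^sup>2) \<longlonglongrightarrow> (LINT x|(lborel::'a measure). (0::real))"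
  proof (rule integral_dominated_convergence[where w="\<lambda>x. (2 * real m)\<^sup>2 * (\<zeta> m x)\<^sup>2"])
    show "integrable lborel (\<lambda>x. (2 * real m)\<^sup>2 * (\<zeta> m x)\<^sup>2)" using L2z by simp
    show "AE x in lborel. norm ((P m x - k n x)\<^sup>2) \<le> (2 * real m)\<^sup>2 * (\<zeta> m x)\<^sup>2" for n
    proof (intro AE_I2)
      fix x
      have "\<bar>P m x - k n x\<bar> \<le> 2 * real m * \<zeta> m x" using kb[of n x] Pb[of x] by linarith
      from power_mono[OF this abs_ge_zero, of 2]
      show "norm ((P m x - k n x)\<^sup>2) \<le> (2 * real m)\<^sup>2 * (\<zeta> m x)\<^sup>2" by (simp add: power_mult_distrib)
    qed
    have "AE x in lebesgue. x \<notin> N" using N unfolding negligible_iff_null_sets by (rule AE_not_in)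
    then have "AE x in lborel. x \<notin> N" by (simp add: AE_completion_iff)
    then show "AE x in lborel. (\<lambda>n. (P m x - k n x)\<^sup>2) \<longlonglongrightarrow> 0"
    proof eventually_elim
      case (elim x)
      have "(\<lambda>n. (P m x - k n x)\<^sup>2) \<longlonglongrightarrow> (P m x - clamp_real (real m) (p x) * \<zeta> m x)\<^sup>2"
        unfolding k_def clamp_real_def by (intro tendsto_intros lim[OF elim])
      then show ?case by (simp add: P_def)
    qed
  qed (simp_all add: P_def k_def)
  then have "\<forall>\<^sub>F n in sequentially. (LINT x|lborel. (P m x - k n x)\<^sup>2) < e / 4"
    using e by (intro order_tendstoD) auto
  then obtain n where n: "(LINT x|lborel. (P m x - k n x)\<^sup>2) < e / 4"
    by (auto simp: eventually_sequentially)
  obtain C where C: "compact C" "\<And>x. x \<notin> C \<Longrightarrow> \<zeta> m x = 0" using test_functionE[OF \<zeta>(1)[of m]] by metis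
  have L2P: "L2 lborel (P m)"
  proof -
    have "integrable lborel (\<lambda>x. (real m)\<^sup>2 * (\<zeta> m x)\<^sup>2)" using L2z by simp
    then have "integrable lborel (\<lambda>x. (P m x)\<^sup>2)"
    proof (rule integrable_bound_real)
      show "norm ((P m x)\<^sup>2) \<le> (real m)\<^sup>2 * (\<zeta> m x)\<^sup>2" for x
        using power_mono[OF Pb[of x] abs_ge_zero, of 2] by (simp add: power_mult_distrib)
    qed measurable
    then show ?thesis by (simp add: L2_def)
  qed
  show thesis
  proof
    show "continuous_on UNIV (k n)"
      unfolding k_def clamp_real_def by (intro continuous_intros g smooth_continuous test_function_smooth[OF \<zeta>(1)])
    show "compact C" "L2 lborel (k n)" by (fact C L2k)+
    show "k n x = 0" if "x \<notin> C" for x using C(2)[OF that] by (simp add: k_def)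
    show "\<bar>k n x\<bar> \<le> real m" for x
      using order_trans[OF kb[of n x] mult_left_mono[OF \<zeta>(3)[of m x]]] by simp
    have "(LINT x|lborel. (p x - k n x)\<^sup>2) \<le> (LINT x|lborel. 2 * (p x - P m x)\<^sup>2 + 2 * (P m x - k n x)\<^sup>2)"
    proof (rule integral_mono)
      show "integrable lborel (\<lambda>x. (p x - k n x)\<^sup>2)"
        "integrable lborel (\<lambda>x. 2 * (p x - P m x)\<^sup>2 + 2 * (P m x - k n x)\<^sup>2)"
        using L2_real_sq[OF L2_diff[OF p L2k]] L2_real_sq[OF L2_diff[OF p L2P]] L2_real_sq[OF L2_diff[OF L2P L2k]]
        by simp_all
      show "(p x - k n x)\<^sup>2 \<le> 2 * (p x - P m x)\<^sup>2 + 2 * (P m x - k n x)\<^sup>2" for x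
        using sum_squares_bound[of "p x - P m x" "P m x - k n x"] power2_sum[of "p x - P m x" "P m x - k n x"] by simp
    qed
    also have "\<dots> = 2 * (LINT x|lborel. (p x - P m x)\<^sup>2) + 2 * (LINT x|lborel. (P m x - k n x)\<^sup>2)"
      using L2_real_sq[OF L2_diff[OF p L2P]] L2_real_sq[OF L2_diff[OF L2P L2k]] by simp
    also have "\<dots> < e" using m n e by simp
    finally show "(LINT x|lborel. (p x - k n x)\<^sup>2) < e" .
  qed
qed

text \<open>For continuous \<open>p\<close> with compact support this is dominated convergence after moving
  the translation to \<open>p\<close>; the general case follows by density.\<close>

lemma correlation_continuous:
  fixes p g :: "'a::euclidean_space \<Rightarrow> real"
  assumes p: "L2 lborel p" and g: "L2 lborel g"
  shows "((\<lambda>y. LINT x|lborel. p x * g (x + y)) \<longlongrightarrow> (LINT x|lborel. p x * g x)) (at 0)"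
proof (rule tendstoI)
  fix e :: real assume e: "e > 0"
  have [measurable]: "g \<in> borel_measurable borel" using g by (auto simp: L2_def)
  define Ng where "Ng = sqrt (LINT x|lborel. (g x)\<^sup>2)"
  define e1 where "e1 = (e / (3 * (Ng + 1)))\<^sup>2"
  have Ng: "Ng \<ge> 0" by (simp add: Ng_def)
  have se: "sqrt e1 = e / (3 * (Ng + 1))" using e Ng by (simp add: e1_def)
  have e1: "e1 > 0" using e Ng by (simp add: e1_def)
  have "e / (3 * (Ng + 1)) * Ng = (e / 3) * (Ng / (Ng + 1))" using Ng by (simp add: field_simps)
  also have "\<dots> \<le> (e / 3) * 1" using e Ng by (intro mult_left_mono) (simp_all add: divide_le_eq)
  finally have e2: "sqrt e1 * Ng \<le> e / 3" by (simp add: se)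
  obtain k C B where k: "continuous_on UNIV k" "compact C" "\<And>x. x \<notin> C \<Longrightarrow> k x = 0" "\<And>x. \<bar>k x\<bar> \<le> B"
    "L2 lborel k" "(LINT x|lborel. (p x - k x)\<^sup>2) < e1"
    by (rule L2_dense_continuous[OF p e1]) (rule that)
  have [measurable]: "k \<in> borel_measurable borel" using k(5) by (auto simp: L2_def)
  have diff: "\<bar>(LINT x|lborel. p x * g (x + y)) - (LINT x|lborel. k x * g (x + y))\<bar> \<le> e / 3" for y
  proof -
    have "(LINT x|lborel. p x * g (x + y)) - (LINT x|lborel. k x * g (x + y)) = (LINT x|lborel. (p x - k x) * g (x + y))"
      using L2_mult_integrable[OF p L2_translate(1)[OF g]] L2_mult_integrable[OF k(5) L2_translate(1)[OF g]]
      by (simp add: left_diff_distrib)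
    also have "\<bar>\<dots>\<bar> \<le> sqrt (LINT x|lborel. (p x - k x)\<^sup>2) * Ng"
      using L2_Cauchy_Schwarz_sqrt[OF L2_diff[OF p k(5)] L2_translate(1)[OF g], of y]
      by (simp add: L2_translate(2)[OF g] Ng_def)
    also have "\<dots> \<le> sqrt e1 * Ng" using k(6) Ng by (intro mult_right_mono) auto
    finally show ?thesis using e2 by simp
  qed
  have "((\<lambda>y. LINT x|lborel. k x * g (x + y)) \<longlongrightarrow> (LINT x|lborel. k x * g x)) (at 0)"
    unfolding tendsto_at_iff_sequentially
  proof (intro allI impI)
    fix Y :: "nat \<Rightarrow> 'a" assume "\<forall>i. Y i \<in> UNIV - {0}" and Y0: "Y \<longlonglongrightarrow> 0"
    have "bounded (range Y)" using Y0 convergent_imp_bounded convergent_def by metis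
    then have "bounded (\<Union>x\<in>C. \<Union>y\<in>range Y. {x + y})"
      using bounded_plus[OF compact_imp_bounded[OF k(2)]] by (auto simp: set_plus_def intro: bounded_subset)
    then obtain R where R: "\<And>x i. x \<in> C \<Longrightarrow> norm (x + Y i) \<le> R"
      unfolding bounded_iff by auto
    have eq: "(LINT x|lborel. k x * g (x + Y i)) = (LINT x|lborel. k (x - Y i) * g x)" for i
      using lborel_translation(1)[of "\<lambda>x. k (x - Y i) * g x" "Y i"] by simp
    have B0: "B \<ge> 0" using k(4)[of 0] by simp
    have [measurable]: "C \<in> sets borel" using k(2) by (simp add: compact_imp_closed borel_closed)
    have cz: "L2 lborel (\<lambda>x. B * (indicator (cball 0 (max R 0)) x + indicator C x))"
    proof -
      have "(\<lambda>x. B * (indicator (cball 0 (max R 0)) x + indicator C x)) \<in> borel_measurable (lborel :: 'a measure)"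
        using \<open>C \<in> sets borel\<close> by (intro borel_measurable_times borel_measurable_const
          borel_measurable_add borel_measurable_indicator) simp_all
      moreover have "integrable lborel (\<lambda>x. (B * (indicator (cball (0::'a) (max R 0)) x + indicator C x))\<^sup>2)"
      proof (rule integrable_bound_real)
        show "integrable lborel (\<lambda>x. (2 * B)\<^sup>2 * indicator (cball (0::'a) (max R 0) \<union> C) x)"
          using emeasure_compact_finite[OF compact_Un[OF compact_cball[of "0::'a" "max R 0"] k(2)]]
          by (intro integrable_mult_right integrable_real_indicator) simp_all
        show "norm ((B * (indicator (cball (0::'a) (max R 0)) x + indicator C x))\<^sup>2)
          \<le> (2 * B)\<^sup>2 * indicator (cball (0::'a) (max R 0) \<union> C) x" for x
          using B0 by (auto simp: indicator_def power2_eq_square intro!: mult_mono)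
      qed (use calculation in measurable)
      ultimately show ?thesis by (simp add: L2_def)
    qed
    have "(\<lambda>i. LINT x|lborel. k (x - Y i) * g x) \<longlonglongrightarrow> (LINT x|lborel. k x * g x)"
    proof (rule integral_dominated_convergence[where w="\<lambda>x. (B * (indicator (cball 0 (max R 0)) x + indicator C x)) * \<bar>g x\<bar>"])
      have "L2 lborel (\<lambda>x. \<bar>g x\<bar>)" using g by (simp add: L2_def)
      from L2_mult_integrable[OF cz this]
      show "integrable lborel (\<lambda>x. (B * (indicator (cball 0 (max R 0)) x + indicator C x)) * \<bar>g x\<bar>)" .
      show "AE x in lborel. (\<lambda>i. k (x - Y i) * g x) \<longlonglongrightarrow> k x * g x"
      proof (intro AE_I2 tendsto_mult tendsto_const)
        fix x
        have "(\<lambda>i. x - Y i) \<longlonglongrightarrow> x - 0" by (intro tendsto_intros Y0)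
        moreover have "isCont k x" using k(1) by (simp add: continuous_on_eq_continuous_at)
        ultimately show "(\<lambda>i. k (x - Y i)) \<longlonglongrightarrow> k x" using isCont_tendsto_compose by force
      qed
      show "AE x in lborel. norm (k (x - Y i) * g x) \<le> (B * (indicator (cball 0 (max R 0)) x + indicator C x)) * \<bar>g x\<bar>" for i
      proof (intro AE_I2)
        fix x
        have "\<bar>k (x - Y i)\<bar> \<le> B * (indicator (cball 0 (max R 0)) x + indicator C x)"
        proof (cases "x - Y i \<in> C")
          case True
          from R[OF this, of i] have "x \<in> cball 0 (max R 0)" by simp
          then have "B * 1 \<le> B * (indicator (cball 0 (max R 0)) x + indicator C x)"
            using B0 by (intro mult_left_mono) (auto simp: indicator_def)
          then show ?thesis using k(4)[of "x - Y i"] by simp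
        qed (use k(3) B0 in simp)
        then show "norm (k (x - Y i) * g x) \<le> (B * (indicator (cball 0 (max R 0)) x + indicator C x)) * \<bar>g x\<bar>"
          by (simp add: abs_mult mult_right_mono)
      qed
    qed measurable
    then show "((\<lambda>y. LINT x|lborel. k x * g (x + y)) \<circ> Y) \<longlonglongrightarrow> (LINT x|lborel. k x * g x)"
      by (simp add: o_def eq)
  qed
  then have "\<forall>\<^sub>F y in at 0. dist (LINT x|lborel. k x * g (x + y)) (LINT x|lborel. k x * g x) < e / 3"
    using e by (intro tendstoD) auto
  then show "\<forall>\<^sub>F y in at 0. dist (LINT x|lborel. p x * g (x + y)) (LINT x|lborel. p x * g x) < e"
  proof eventually_elim
    case (elim y)
    have tri: "\<bar>c - d\<bar> < e" if "\<bar>a - b\<bar> < e / 3" "\<bar>c - a\<bar> \<le> e / 3" "\<bar>d - b\<bar> \<le> e / 3" for a b c d :: real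
      using that by linarith
    show ?case using elim diff[of y] diff[of 0] unfolding dist_real_def by (intro tri) simp_all
  qed
qed

text \<open>The kernels may concentrate at \<open>0\<close> from one side only. By Fubini the pairing is an average of
  the correlation function, which is continuous at \<open>0\<close>. Weak convergence is all that is needed below, and it
  spares the continuity of translations in the norm.\<close>

lemma mollification_weak_limit:
  fixes p g :: "'a::euclidean_space \<Rightarrow> real"
  assumes p: "L2 lborel p" and g: "L2 lborel g"
    and \<rho>: "\<And>n::nat. \<rho> n \<in> test_functions (ball (y0 n) (r n))" "\<And>n x. 0 \<le> \<rho> n x" "\<And>n. (LINT x|lborel. \<rho> n x) = 1"
    and lim: "(\<lambda>n. norm (y0 n) + r n) \<longlonglongrightarrow> 0"
  shows "(\<lambda>n. LINT x|lborel. p x * conv (\<rho> n) g x) \<longlonglongrightarrow> (LINT x|lborel. p x * g x)"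
proof -
  have [measurable]: "g \<in> borel_measurable borel" "p \<in> borel_measurable borel" using p g by (auto simp: L2_def)
  have [measurable]: "\<rho> n \<in> borel_measurable borel" for n using \<rho>(1) by (rule test_borel_measurable)
  have \<rho>i: "integrable lborel (\<rho> n)" for n using \<rho>(3)[of n] not_integrable_integral_eq by fastforce
  define Cr where "Cr y = (LINT x|lborel. p x * g (x + y))" for y
  define K where "K = sqrt (LINT x|lborel. (p x)\<^sup>2) * sqrt (LINT x|lborel. (g x)\<^sup>2)"
  have pabs: "L2 lborel (\<lambda>x. \<bar>p x\<bar>)" and gabs: "L2 lborel (\<lambda>x. \<bar>g (x + y)\<bar>)" for y
    using p L2_translate(1)[OF g] by (auto simp: L2_def)
  have Kb: "(LINT x|lborel. \<bar>p x * g (x + y)\<bar>) \<le> K" for y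
    using L2_Cauchy_Schwarz_sqrt[OF pabs gabs, of y]
    by (simp add: abs_mult K_def L2_translate(2)[OF g] abs_of_nonneg)
  have Cm [measurable]: "Cr \<in> borel_measurable borel" unfolding Cr_def by measurable
  have swap: "(LINT x|lborel. p x * conv (\<rho> n) g x) = (LINT y|lborel. \<rho> n y * Cr y)" for n
  proof -
    let ?F = "\<lambda>(y, x). \<rho> n y * (p x * g (x + y))"
    have i: "integrable (lborel \<Otimes>\<^sub>M lborel) ?F"
    proof (rule lborel_pair.Fubini_integrable)
      show "?F \<in> borel_measurable (lborel \<Otimes>\<^sub>M lborel)" by measurable
      have "integrable lborel (\<lambda>y. K * \<rho> n y)" using \<rho>i by simp
      then show "integrable lborel (\<lambda>y. LINT x|lborel. norm (?F (y, x)))"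
      proof (rule integrable_bound_real)
        show "(\<lambda>y. LINT x|lborel. norm (?F (y, x))) \<in> borel_measurable lborel" by measurable
        show "norm (LINT x|lborel. norm (?F (y, x))) \<le> K * \<rho> n y" for y
          using mult_right_mono[OF Kb[of y] \<rho>(2)[of n y]] \<rho>(2)[of n y] by (simp add: abs_mult mult.commute)
      qed
      show "AE y in lborel. integrable lborel (\<lambda>x. ?F (y, x))"
        using L2_mult_integrable[OF p L2_translate(1)[OF g]] by simp
    qed
    have "(LINT y|lborel. LINT x|lborel. \<rho> n y * (p x * g (x + y))) = (LINT x|lborel. LINT y|lborel. \<rho> n y * (p x * g (x + y)))"
      using lborel_pair.Fubini_integral[of "\<lambda>y x. \<rho> n y * (p x * g (x + y))"] i by simp
    then show ?thesis
      by (simp add: Cr_def conv_translate mult.left_commute flip: integral_mult_right_zero)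
  qed
  have "Cr \<midarrow>0\<rightarrow> Cr 0" using correlation_continuous[OF p g] unfolding Cr_def by simp
  then have cont: "\<exists>d>0. \<forall>y. norm y < d \<longrightarrow> \<bar>Cr y - Cr 0\<bar> < e" if "e > 0" for e
    using that unfolding LIM_eq by (metis diff_zero diff_self abs_zero real_norm_def)
  show ?thesis
  proof (rule LIMSEQ_I)
    fix e :: real assume e: "e > 0"
    obtain d where d: "d > 0" "\<And>y. norm y < d \<Longrightarrow> \<bar>Cr y - Cr 0\<bar> < e / 2" using cont[of "e/2"] e by auto
    obtain n0 where n0: "\<And>n. n \<ge> n0 \<Longrightarrow> \<bar>norm (y0 n) + r n\<bar> < d"
      using LIMSEQ_D[OF lim d(1)] by auto
    have "norm ((LINT x|lborel. p x * conv (\<rho> n) g x) - (LINT x|lborel. p x * g x)) < e" if n: "n \<ge> n0" for n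
    proof -
      have near: "\<rho> n y * \<bar>Cr y - Cr 0\<bar> \<le> \<rho> n y * (e / 2)" for y
      proof (cases "y \<in> ball (y0 n) (r n)")
        case True
        then have "norm y < d" using n0[OF n] norm_triangle_ineq2[of y "y0 n"] by (simp add: dist_norm norm_minus_commute)
        then show ?thesis using d(2)[of y] \<rho>(2)[of n y] by (intro mult_left_mono) auto
      next
        case False
        then have "\<rho> n y = 0" using test_functionE[OF \<rho>(1)[of n]] by (metis subsetD)
        then show ?thesis by simp
      qed
      have iC: "integrable lborel (\<lambda>y. \<rho> n y * Cr y)"
      proof (rule integrable_bound_real)
        show "integrable lborel (\<lambda>y. K * \<rho> n y)" using \<rho>i by simp
        have "\<bar>Cr y\<bar> \<le> K" for y unfolding Cr_def using order_trans[OF integral_abs_bound Kb] .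
        then show "norm (\<rho> n y * Cr y) \<le> K * \<rho> n y" for y
          using \<rho>(2)[of n y] by (simp add: abs_mult mult.commute mult_right_mono)
      qed measurable
      have "(LINT x|lborel. p x * conv (\<rho> n) g x) - (LINT x|lborel. p x * g x) = (LINT y|lborel. \<rho> n y * Cr y) - Cr 0 * (LINT y|lborel. \<rho> n y)"
        by (simp add: swap \<rho>(3)) (simp add: Cr_def)
      also have "\<dots> = (LINT y|lborel. \<rho> n y * (Cr y - Cr 0))"
        using iC \<rho>i by (simp add: right_diff_distrib mult.commute)
      also have "norm \<dots> \<le> (LINT y|lborel. \<rho> n y * \<bar>Cr y - Cr 0\<bar>)"
        using \<rho>(2) integral_norm_bound[of lborel "\<lambda>y. \<rho> n y * (Cr y - Cr 0)"] by (simp add: abs_mult)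
      also have "\<dots> \<le> (LINT y|lborel. \<rho> n y * (e / 2))"
      proof (rule integral_mono)
        have "integrable lborel (\<lambda>y. norm (\<rho> n y * (Cr y - Cr 0)))"
          using iC \<rho>i by (intro integrable_norm) (simp add: right_diff_distrib mult.commute)
        then show "integrable lborel (\<lambda>y. \<rho> n y * \<bar>Cr y - Cr 0\<bar>)" using \<rho>(2) by (simp add: abs_mult)
      qed (use \<rho>i near in auto)
      also have "\<dots> = e / 2" using \<rho>(3)[of n] by simp
      finally show ?thesis using e by simp
    qed
    then show "\<exists>no. \<forall>n\<ge>no. norm ((LINT x|lborel. p x * conv (\<rho> n) g x) - (LINT x|lborel. p x * g x)) < e" by blast
  qed
qed

section \<open>Test functions are weakly dense in the form domain\<close>

text \<open>The pair \<open>(u, G)\<close> is annihilated by every functional on \<open>L\<^sup>2 \<times> L\<^sup>2\<close> that annihilates all pairs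
  \<open>(\<psi>, \<nabla>\<psi>)\<close> with \<open>\<psi> \<in> \<T>\<close>. By the bipolar theorem this means that \<open>u\<close> with gradient \<open>G\<close> lies in the
  closure of \<open>\<T>\<close> in \<open>H\<^sup>1\<close>. In this dual form, enlarging the space of test functions of a weak
  equation needs no approximating sequence, and the property passes to sums and products.\<close>

definition form_closure ::
    "'a::euclidean_space set \<Rightarrow> ('a \<Rightarrow> real) set \<Rightarrow> ('a \<Rightarrow> real) \<Rightarrow> ('a \<Rightarrow> 'a) \<Rightarrow> bool" where
  "form_closure \<Omega> \<T> u G \<longleftrightarrow> L2 (lebesgue_on \<Omega>) u \<and> L2 (lebesgue_on \<Omega>) G \<and>
     (\<forall>w W. L2 (lebesgue_on \<Omega>) w \<and> L2 (lebesgue_on \<Omega>) W \<and>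
        (\<forall>\<psi>\<in>\<T>. (LINT x|lebesgue_on \<Omega>. w x * \<psi> x + W x \<bullet> grad \<psi> x) = 0) \<longrightarrow>
        (LINT x|lebesgue_on \<Omega>. w x * u x + W x \<bullet> G x) = 0)"

text \<open>Near a boundary point the set lies above the graph of a Lipschitz function, so a cone of
  directions around \<open>e\<close> points into it, uniformly near \<open>x0\<close>. At interior points \<open>e = 0\<close> will do.\<close>

lemma C2_boundary_cone:
  fixes \<Omega> :: "'a::euclidean_space set"
  assumes "open \<Omega>" "C2_boundary \<Omega>" "x0 \<in> closure \<Omega>"
  obtains r e s d where "r > 0" "s > 0" "d > 0"
    "\<And>x \<epsilon> y. x \<in> \<Omega> \<Longrightarrow> x \<in> ball x0 r \<Longrightarrow> 0 < \<epsilon> \<Longrightarrow> \<epsilon> < d \<Longrightarrow> y \<in> ball (\<epsilon> *\<^sub>R e) (\<epsilon> * s) \<Longrightarrow> x + y \<in> \<Omega>"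
proof (cases "x0 \<in> \<Omega>")
  case True
  then obtain R where R: "R > 0" "ball x0 R \<subseteq> \<Omega>" using assms(1) open_contains_ball by blast
  show thesis
  proof (rule that[of "R / 2" 1 "R / 2" 0])
    fix x y :: 'a and \<epsilon> :: real
    assume "x \<in> ball x0 (R / 2)" "\<epsilon> < R / 2" "y \<in> ball (\<epsilon> *\<^sub>R 0) (\<epsilon> * 1)"
    then have "dist x0 x < R / 2" "norm y < R / 2" by auto
    then have "dist x0 (x + y) < R"
      using norm_triangle_ineq4[of "x0 - x" y] by (simp add: dist_norm algebra_simps)
    then show "x + y \<in> \<Omega>" using R(2) by auto
  qed (use R in auto)
next
  case False
  then have "x0 \<in> frontier \<Omega>" using assms(1,3) by (simp add: frontier_def interior_open)
  then obtain R e \<gamma> where R: "R > 0" "norm e = 1" "cont_diff 2 \<gamma>"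
    "\<Omega> \<inter> ball x0 R = {x \<in> ball x0 R. \<gamma> (x - (x \<bullet> e) *\<^sub>R e) < x \<bullet> e}"
    using assms(2)[unfolded C2_boundary_def, THEN bspec, of x0] by blast
  define prj where "prj x = x - (x \<bullet> e) *\<^sub>R e" for x :: 'a
  have prj_lin: "prj (x + y) = prj x + prj y" "prj (x - y) = prj x - prj y" "prj (c *\<^sub>R e) = 0" for x y c
    using R(2) by (simp_all add: prj_def algebra_simps dot_square_norm)
  have prj_norm: "norm (prj x) \<le> norm x" for x
  proof -
    have "(norm (prj x))\<^sup>2 = (norm x)\<^sup>2 - (x \<bullet> e)\<^sup>2"
      using R(2) unfolding prj_def power2_norm_eq_inner
      by (simp add: inner_diff_left inner_diff_right inner_commute power2_eq_square norm_eq_1)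
    then have "(norm (prj x))\<^sup>2 \<le> (norm x)\<^sup>2" by simp
    then show ?thesis by (simp add: power2_le_iff_abs_le)
  qed
  have two: "(2::nat) = Suc (Suc 0)" by simp
  have \<gamma>d: "\<gamma> differentiable (at x)" for x using R(3) unfolding two by simp
  have \<gamma>c: "continuous_on UNIV (dderiv b \<gamma>)" for b
  proof -
    have "\<And>x. dderiv b \<gamma> differentiable (at x)"
      using R(3) unfolding two by (simp add: dderiv_def[abs_def])
    then show ?thesis
      by (intro differentiable_imp_continuous_on) (simp add: differentiable_on_def)
  qed
  define D where "D = cball (prj x0) R"
  have "\<exists>B. \<forall>x\<in>D. \<bar>dderiv b \<gamma> x\<bar> \<le> B" for b
    using compact_imp_bounded[OF compact_continuous_image[OF continuous_on_subset[OF \<gamma>c] compact_cball], of _ _ b]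
    unfolding bounded_iff D_def by (auto simp: real_norm_def)
  then obtain Bd where Bd: "\<And>b x. x \<in> D \<Longrightarrow> \<bar>dderiv b \<gamma> x\<bar> \<le> Bd b" by metis
  define L where "L = (\<Sum>b\<in>Basis. \<bar>Bd b\<bar>)"
  have L0: "L \<ge> 0" by (simp add: L_def sum_nonneg)
  have Lip: "norm (\<gamma> x - \<gamma> y) \<le> L * norm (x - y)" if "x \<in> D" "y \<in> D" for x y
  proof (rule differentiable_bound[of D \<gamma> "\<lambda>x v. dderiv v \<gamma> x"])
    fix x assume x: "x \<in> D"
    have hd: "(\<gamma> has_derivative (\<lambda>v. dderiv v \<gamma> x)) (at x)"
      using \<gamma>d[of x] by (simp add: dderiv_def frechet_derivative_works)
    then show "(\<gamma> has_derivative (\<lambda>v. dderiv v \<gamma> x)) (at x within D)" by (rule has_derivative_at_withinI)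
    interpret l: linear "\<lambda>v. dderiv v \<gamma> x" by (rule has_derivative_linear[OF hd])
    show "onorm (\<lambda>v. dderiv v \<gamma> x) \<le> L"
    proof (rule onorm_bound[OF L0])
      fix v :: 'a
      have "dderiv v \<gamma> x = dderiv (\<Sum>b\<in>Basis. (v \<bullet> b) *\<^sub>R b) \<gamma> x" by (simp add: euclidean_representation)
      also have "\<dots> = (\<Sum>b\<in>Basis. (v \<bullet> b) * dderiv b \<gamma> x)" by (simp add: l.sum l.scale)
      also have "norm \<dots> \<le> (\<Sum>b\<in>Basis. norm v * \<bar>Bd b\<bar>)"
      proof (rule sum_norm_le)
        fix b :: 'a assume "b \<in> Basis"
        then have "\<bar>v \<bullet> b\<bar> \<le> norm v" by (rule Basis_le_norm)
        moreover have "\<bar>dderiv b \<gamma> x\<bar> \<le> \<bar>Bd b\<bar>" using Bd[OF x, of b] by simp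
        ultimately show "norm ((v \<bullet> b) * dderiv b \<gamma> x) \<le> norm v * \<bar>Bd b\<bar>"
          by (simp add: abs_mult mult_mono)
      qed
      finally show "norm (dderiv v \<gamma> x) \<le> L * norm v" by (simp add: L_def sum_distrib_left mult.commute)
    qed
  qed (use that in \<open>auto simp: D_def\<close>)
  \<comment> \<open>With this aperture, the rise of the boundary below the cone is at most the rise of the cone:
     \<open>L s = 1 - s\<close>.\<close>
  define s where "s = 1 / (L + 1)"
  have s: "s > 0" "s \<le> 1" "L * s + s = 1" using L0 by (auto simp: s_def field_simps)
  show thesis
  proof (rule that[of "R / 2" s "R / 4" e])
    fix x y :: 'a and \<epsilon> :: real
    assume x: "x \<in> \<Omega>" "x \<in> ball x0 (R / 2)" and \<epsilon>: "0 < \<epsilon>" "\<epsilon> < R / 4" and y: "y \<in> ball (\<epsilon> *\<^sub>R e) (\<epsilon> * s)"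
    define y2 where "y2 = y - \<epsilon> *\<^sub>R e"
    have y2: "norm y2 < \<epsilon> * s" using y by (simp add: y2_def dist_norm norm_minus_commute)
    have "\<epsilon> * s \<le> \<epsilon>" using \<epsilon> s by (simp add: mult_left_le)
    moreover have "norm y \<le> \<epsilon> + norm y2"
      using norm_triangle_ineq[of "\<epsilon> *\<^sub>R e" y2] \<epsilon> R(2) by (simp add: y2_def)
    ultimately have ny: "norm y < R / 2" using y2 \<epsilon>(2) by linarith
    have in1: "x \<in> ball x0 R" using x R(1) by auto
    have in2: "x + y \<in> ball x0 R"
      using x(2) ny norm_triangle_ineq4[of "x0 - x" y] by (simp add: dist_norm algebra_simps)
    have prjD: "prj z \<in> D" if "z \<in> ball x0 R" for z
    proof -
      have "norm (prj x0 - prj z) \<le> norm (x0 - z)" using prj_norm[of "x0 - z"] by (simp add: prj_lin)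
      then show ?thesis using that by (simp add: D_def dist_norm)
    qed
    have "prj (x + y) - prj x = prj y2"
      by (simp add: prj_lin y2_def)
    then have "norm (\<gamma> (prj (x + y)) - \<gamma> (prj x)) \<le> L * norm y2"
      using Lip[OF prjD[OF in2] prjD[OF in1]] prj_norm[of y2] L0 by (metis mult_left_mono order_trans)
    also have "\<dots> \<le> L * (\<epsilon> * s)" using y2 L0 by (intro mult_left_mono) auto
    finally have 1: "\<gamma> (prj (x + y)) \<le> \<gamma> (prj x) + L * (\<epsilon> * s)" by simp
    have 2: "\<gamma> (prj x) < x \<bullet> e" using x(1) in1 R(4) unfolding prj_def by blast
    have "\<bar>y2 \<bullet> e\<bar> \<le> \<epsilon> * s" using Cauchy_Schwarz_ineq2[of y2 e] R(2) y2 by simp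
    then have 3: "(x + y) \<bullet> e \<ge> x \<bullet> e + \<epsilon> - \<epsilon> * s"
      using R(2) by (simp add: y2_def inner_add_left inner_diff_left norm_eq_1)
    have "\<epsilon> - \<epsilon> * s = L * (\<epsilon> * s)" using arg_cong[OF s(3), of "\<lambda>c. \<epsilon> * c"] by (simp add: algebra_simps)
    with 1 2 3 have "\<gamma> (prj (x + y)) < (x + y) \<bullet> e" by linarith
    then show "x + y \<in> \<Omega>" using in2 R(4) unfolding prj_def by blast
  qed (use R s in auto)
qed

lemma bump_with_integral_1:
  assumes "r > 0"
  obtains \<rho> :: "'a::euclidean_space \<Rightarrow> real" where "\<rho> \<in> test_functions (ball y r)" "\<And>x. 0 \<le> \<rho> x" "(LINT x|lborel. \<rho> x) = 1"
proof -
  obtain \<zeta> where \<zeta>: "\<zeta> \<in> test_functions (ball y r)" "\<And>x. 0 \<le> \<zeta> x" "\<And>x. x \<in> cball y (r / 2) \<Longrightarrow> \<zeta> x = 1"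
    using smooth_urysohn[of "cball y (r / 2)" "ball y r"] assms
    by (metis ball_subset_cball cball_subset_ball_iff compact_cball dist_self add_0 field_sum_of_halves half_gt_zero less_add_same_cancel1 open_ball)
  obtain C where C: "compact C" "\<And>x. x \<notin> C \<Longrightarrow> \<zeta> x = 0" using test_functionE[OF \<zeta>(1)] by metis
  have "integrable lborel (\<lambda>x. indicator C x *\<^sub>R \<zeta> x)"
    using C(1) by (intro borel_integrable_compact smooth_continuous test_function_smooth[OF \<zeta>(1)])
  moreover have "(\<lambda>x. indicator C x *\<^sub>R \<zeta> x) = \<zeta>" using C(2) by (auto simp: indicator_def fun_eq_iff)
  ultimately have i: "integrable lborel \<zeta>" by simp
  have "0 < measure lborel (cball y (r / 2))"
    using content_cball_pos[of "r / 2" y] assms by simp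
  also have "\<dots> = (LINT x|lborel. indicator (cball y (r / 2)) x)" by simp
  also have "\<dots> \<le> (LINT x|lborel. \<zeta> x)"
    using i \<zeta>(2,3) emeasure_lborel_cball_finite by (intro integral_mono integrable_real_indicator) (auto simp: indicator_def)
  finally have pos: "(LINT x|lborel. \<zeta> x) > 0" .
  show thesis
  proof
    show "(\<lambda>x. inverse (LINT x|lborel. \<zeta> x) * \<zeta> x) \<in> test_functions (ball y r)"
      by (intro test_mult_smooth \<zeta> smooth_const)
    show "0 \<le> inverse (LINT x|lborel. \<zeta> x) * \<zeta> x" for x using pos \<zeta>(2)[of x] by simp
    show "(LINT x|lborel. inverse (LINT x|lborel. \<zeta> x) * \<zeta> x) = 1" using pos by simp
  qed
qed

lemma dderiv_locally_const: "open U \<Longrightarrow> x \<in> U \<Longrightarrow> (\<And>y. y \<in> U \<Longrightarrow> f y = c) \<Longrightarrow> dderiv v f x = 0"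
  by (rule dderivI[where D="\<lambda>v. 0"])
     (rule has_derivative_transform_within_open[where f="\<lambda>x. c" and s=U], auto)

lemma grad_locally_const: "open U \<Longrightarrow> x \<in> U \<Longrightarrow> (\<And>y. y \<in> U \<Longrightarrow> f y = c) \<Longrightarrow> grad f x = 0"
  by (simp add: grad_def dderiv_locally_const)

lemma L2_representative:
  fixes f :: "'a::euclidean_space \<Rightarrow> real"
  assumes "L2 (lebesgue_on S) f" "S \<in> sets borel"
  obtains g where "L2 lborel g" "AE x in lborel. indicator S x * f x = g x" "\<And>x. x \<notin> S \<Longrightarrow> g x = 0"
proof -
  have "f \<in> borel_measurable (lebesgue_on S)" using assms by (simp add: L2_def)
  then obtain g where g: "g \<in> borel_measurable borel" "AE x in lborel. indicator S x * f x = g x"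
    "\<And>x. x \<notin> S \<Longrightarrow> g x = 0" by (rule lebesgue_on_borel_representative[OF assms(2)]) (rule that)
  have "AE x in lborel. indicator S x * (f x)\<^sup>2 = (g x)\<^sup>2"
    using g(2) by eventually_elim (auto simp: indicator_def split: if_splits)
  then have "integrable lborel (\<lambda>x. (g x)\<^sup>2)"
    using integral_lebesgue_on_representative(2)[OF assms(2), of "\<lambda>x. (g x)\<^sup>2"] g(1) L2_real_sq[OF assms(1)] by simp
  then show thesis using g that by (simp add: L2_def)
qed

lemma L2_finite_imp_integrable:
  assumes "L2 M f" "A \<in> sets M" "emeasure M A < \<infinity>" "\<And>x. x \<in> space M - A \<Longrightarrow> f x = (0::real)"
  shows "integrable M f"
proof -
  have "L2 M (indicator A :: _ \<Rightarrow> real)"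
    using assms by (simp add: L2_def power2_eq_square flip: indicator_inter_arith)
  from L2_mult_integrable[OF assms(1) this]
  have "integrable M (\<lambda>x. f x * indicator A x)" .
  moreover have "f x * indicator A x = f x" if "x \<in> space M" for x
    using assms(4) that by (auto simp: indicator_def)
  ultimately show ?thesis by (metis (no_types, lifting) Bochner_Integration.integrable_cong)
qed

lemma L2_continuous:
  fixes f :: "'a::euclidean_space \<Rightarrow> 'b::euclidean_space"
  assumes "open \<Omega>" "bounded \<Omega>" "continuous_on UNIV f"
  shows "L2 (lebesgue_on \<Omega>) f"
proof -
  let ?M = "lebesgue_on \<Omega>"
  have m: "f \<in> borel_measurable ?M"
    using borel_measurable_continuous_onI[OF assms(3)] by (intro measurable_restrict_space1 measurable_completion) simp
  have "bounded (f ` closure \<Omega>)"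
    using assms by (intro compact_imp_bounded compact_continuous_image continuous_on_subset[OF assms(3)]) simp_all
  then obtain B where B: "\<And>x. x \<in> closure \<Omega> \<Longrightarrow> norm (f x) \<le> B" unfolding bounded_iff by auto
  interpret finite_measure "?M"
    using assms by (intro finite_measure_lebesgue_on lmeasurable_open)
  have "integrable ?M (\<lambda>x. (norm (f x))\<^sup>2)"
  proof (rule integrable_bound_real[of _ "\<lambda>x. B\<^sup>2"])
    fix x assume "x \<in> space ?M"
    then have "norm (f x) \<le> B" using B[of x] closure_subset[of \<Omega>] by auto
    then show "norm ((norm (f x))\<^sup>2) \<le> B\<^sup>2" by (simp add: power_mono)
  qed (use m in simp_all)
  with m show ?thesis by (simp add: L2_def)
qed

lemma continuous_measurable_lebesgue_on:
  fixes f :: "'a::euclidean_space \<Rightarrow> 'b::euclidean_space"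
  assumes "continuous_on UNIV f"
  shows "f \<in> borel_measurable (lebesgue_on S)"
  using borel_measurable_continuous_onI[OF assms] by (intro measurable_restrict_space1 measurable_completion) simp

lemma L2_test_mult:
  fixes \<zeta> :: "'a::euclidean_space \<Rightarrow> real"
  assumes "\<zeta> \<in> test_functions U"
  shows "L2 (lebesgue_on \<Omega>) f \<Longrightarrow> L2 (lebesgue_on \<Omega>) (\<lambda>x. \<zeta> x * f x :: real)"
    and "L2 (lebesgue_on \<Omega>) F \<Longrightarrow> L2 (lebesgue_on \<Omega>) (\<lambda>x. \<zeta> x *\<^sub>R F x :: 'a)"
    and "L2 (lebesgue_on \<Omega>) f \<Longrightarrow> L2 (lebesgue_on \<Omega>) (\<lambda>x. f x *\<^sub>R grad \<zeta> x)"
    and "L2 (lebesgue_on \<Omega>) F \<Longrightarrow> L2 (lebesgue_on \<Omega>) (\<lambda>x. F x \<bullet> grad \<zeta> x)"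
proof -
  let ?M = "lebesgue_on \<Omega>"
  have m: "L2 ?M f \<Longrightarrow> L2 ?M (\<lambda>x. \<zeta> x * f x :: real)" if h: "\<zeta> \<in> test_functions U" for \<zeta> f
  proof -
    obtain B where "\<And>x. \<bar>\<zeta> x\<bar> \<le> B" using test_grad_bounded[OF h] by metis
    then show "L2 ?M f \<Longrightarrow> L2 ?M (\<lambda>x. \<zeta> x * f x)"
      by (intro L2_bounded_mult continuous_measurable_lebesgue_on smooth_continuous test_function_smooth[OF h])
  qed
  show "L2 ?M f \<Longrightarrow> L2 ?M (\<lambda>x. \<zeta> x * f x)" by (rule m[OF assms])
  obtain B where "\<And>x. \<bar>\<zeta> x\<bar> \<le> B" using test_grad_bounded[OF assms] by metis
  then show "L2 ?M F \<Longrightarrow> L2 ?M (\<lambda>x. \<zeta> x *\<^sub>R F x)"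
    by (intro L2_bounded_scaleR continuous_measurable_lebesgue_on smooth_continuous test_function_smooth[OF assms])
  show "L2 ?M (\<lambda>x. f x *\<^sub>R grad \<zeta> x)" if "L2 ?M f"
  proof (rule L2_components)
    show "L2 ?M (\<lambda>x. f x *\<^sub>R grad \<zeta> x \<bullet> b)" if "b \<in> Basis" for b
      using m[OF test_dderiv[OF assms] \<open>L2 ?M f\<close>, of b] that by (simp add: grad_inner mult.commute)
  qed
  show "L2 ?M (\<lambda>x. F x \<bullet> grad \<zeta> x)" if "L2 ?M F"
  proof -
    have "(\<lambda>x. F x \<bullet> grad \<zeta> x) = (\<lambda>x. \<Sum>b\<in>Basis. dderiv b \<zeta> x * (F x \<bullet> b))"
      by (simp add: grad_def inner_sum_right fun_eq_iff)
    then show ?thesis using that by (simp add: L2_sum m[OF test_dderiv[OF assms]] L2_component)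
  qed
qed

text \<open>Localize with cut-off functions. Near a boundary point, mollify with kernels that look only
  into the interior cone: the mollified function is smooth on the whole space, and at the
  points of \<open>\<Omega>\<close> near that point its gradient is the mollified gradient, so no extension operator
  is needed. The functional is evaluated on cut-offs of these functions and converges weakly.\<close>

theorem Neumann_form_closure:
  fixes \<Omega> :: "'a::euclidean_space set"
  assumes \<Omega>: "open \<Omega>" "bounded \<Omega>" "C2_boundary \<Omega>" and wg: "weak_grad \<Omega> u G"
    and u: "L2 (lebesgue_on \<Omega>) u" and G: "L2 (lebesgue_on \<Omega>) G"
  shows "form_closure \<Omega> (test_functions UNIV) u G"
  unfolding form_closure_def
proof (intro conjI u G allI impI, elim conjE)
  let ?M = "lebesgue_on \<Omega>"
  fix w W assume w: "L2 ?M w" and W: "L2 ?M W"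
    and ann: "\<forall>\<psi>\<in>test_functions UNIV. (LINT x|?M. w x * \<psi> x + W x \<bullet> grad \<psi> x) = 0"
  have \<Omega>b: "\<Omega> \<in> sets borel" and \<Omega>l: "\<Omega> \<in> sets lebesgue" using \<Omega>(1) by auto
  have \<Omega>fin: "emeasure lborel \<Omega> < \<infinity>" using \<Omega>(2) by (rule emeasure_bounded_finite)
  define J where "J \<eta> = (LINT x|?M. w x * (\<eta> x * u x) + W x \<bullet> (\<eta> x *\<^sub>R G x + u x *\<^sub>R grad \<eta> x))" for \<eta> :: "'a \<Rightarrow> real"
  have Ji: "integrable ?M (\<lambda>x. w x * (\<eta> x * u x) + W x \<bullet> (\<eta> x *\<^sub>R G x + u x *\<^sub>R grad \<eta> x))"
    if "\<eta> \<in> test_functions UNIV" for \<eta>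
    using that w W u G by (intro Bochner_Integration.integrable_add L2_mult_integrable L2_inner_integrable L2_add
          L2_test_mult)
  have Jadd: "J (\<lambda>x. \<eta> x + \<zeta> x) = J \<eta> + J \<zeta>" if "\<eta> \<in> test_functions UNIV" "\<zeta> \<in> test_functions UNIV" for \<eta> \<zeta>
    unfolding J_def using that
    by (subst LINT_add[symmetric, OF Ji Ji])
       (auto simp: grad_add test_function_smooth algebra_simps inner_add_right intro!: LINT_cong)
  have local: "\<exists>r>0. \<forall>\<eta>\<in>test_functions (ball x0 r). J \<eta> = 0" if x0: "x0 \<in> closure \<Omega>" for x0
  proof -
    obtain r e s d where r: "r > 0" "s > 0" "d > 0" and
      cone: "\<And>x \<epsilon> y. x \<in> \<Omega> \<Longrightarrow> x \<in> ball x0 r \<Longrightarrow> 0 < \<epsilon> \<Longrightarrow> \<epsilon> < d \<Longrightarrow> y \<in> ball (\<epsilon> *\<^sub>R e) (\<epsilon> * s) \<Longrightarrow> x + y \<in> \<Omega>"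
      by (rule C2_boundary_cone[OF \<Omega>(1,3) x0]) (rule that)
    define \<epsilon> where "\<epsilon> n = d / (real n + 2)" for n :: nat
    have \<epsilon>: "0 < \<epsilon> n" "\<epsilon> n < d" for n
      using r(3) mult_strict_left_mono[of 1 "real n + 2" d] by (simp_all add: \<epsilon>_def divide_less_eq)
    have "\<exists>\<rho>. \<rho> \<in> test_functions (ball (\<epsilon> n *\<^sub>R e) (\<epsilon> n * s)) \<and> (\<forall>x. 0 \<le> \<rho> x) \<and> (LINT x|lborel. \<rho> x) = 1" for n
      using bump_with_integral_1[of "\<epsilon> n * s" "\<epsilon> n *\<^sub>R e"] \<epsilon>(1)[of n] r(2) by (metis mult_pos_pos)
    then obtain \<rho> where \<rho>: "\<And>n. \<rho> n \<in> test_functions (ball (\<epsilon> n *\<^sub>R e) (\<epsilon> n * s))" "\<And>n x. 0 \<le> \<rho> n x"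
      "\<And>n. (LINT x|lborel. \<rho> n x) = 1" by metis
    have "(\<lambda>n. (d * (norm e + s)) / (real n + 2)) \<longlonglongrightarrow> 0" by real_asymp
    moreover have "norm (\<epsilon> n *\<^sub>R e) + \<epsilon> n * s = (d * (norm e + s)) / (real n + 2)" for n
    proof -
      have "norm (\<epsilon> n *\<^sub>R e) = \<epsilon> n * norm e" using \<epsilon>(1)[of n] by simp
      then show ?thesis by (simp add: \<epsilon>_def distrib_left add_divide_distrib)
    qed
    ultimately have lim: "(\<lambda>n. norm (\<epsilon> n *\<^sub>R e) + \<epsilon> n * s) \<longlonglongrightarrow> 0" by simp
    obtain u' where u': "L2 lborel u'" "AE x in lborel. indicator \<Omega> x * u x = u' x" "\<And>x. x \<notin> \<Omega> \<Longrightarrow> u' x = 0"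
      by (rule L2_representative[OF u \<Omega>b]) (rule that)
    have "\<exists>g. L2 lborel g \<and> (AE x in lborel. indicator \<Omega> x * (G x \<bullet> b) = g x) \<and> (\<forall>x. x \<notin> \<Omega> \<longrightarrow> g x = 0)" for b
    proof -
      obtain g where "L2 lborel g" "AE x in lborel. indicator \<Omega> x * (G x \<bullet> b) = g x" "\<And>x. x \<notin> \<Omega> \<Longrightarrow> g x = 0"
        by (rule L2_representative[OF L2_component[OF G, of b] \<Omega>b]) (rule that)
      then show ?thesis by (intro exI[of _ g] conjI allI impI)
    qed
    then have "\<exists>G'. \<forall>b. L2 lborel (G' b) \<and> (AE x in lborel. indicator \<Omega> x * (G x \<bullet> b) = G' b x) \<and> (\<forall>x. x \<notin> \<Omega> \<longrightarrow> G' b x = 0)"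
      by (intro choice allI)
    then obtain G' where G': "\<And>b. L2 lborel (G' b)" "\<And>b. AE x in lborel. indicator \<Omega> x * (G x \<bullet> b) = G' b x"
      "\<And>b x. x \<notin> \<Omega> \<Longrightarrow> G' b x = 0" by (elim exE) (rule that, blast+)
    have ui: "integrable lborel u'"
      using u'(3) by (intro L2_finite_imp_integrable[OF u'(1), of \<Omega>]) (use \<Omega>b \<Omega>fin in auto)
    have Gi: "integrable lborel (G' b)" for b
      using G'(3) by (intro L2_finite_imp_integrable[OF G'(1), of \<Omega>]) (use \<Omega>b \<Omega>fin in auto)
    have dconv: "dderiv b (conv (\<rho> n) u') x = conv (\<rho> n) (G' b) x" if x: "x \<in> \<Omega>" "x \<in> ball x0 r" and b: "b \<in> Basis" for x b n
    proof -
      have T: "(\<lambda>z. \<rho> n (z - x)) \<in> test_functions \<Omega>" "dderiv b (\<lambda>z. \<rho> n (z - x)) = (\<lambda>z. dderiv b (\<rho> n) (z - x))"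
        using test_translate[OF \<rho>(1)[of n], of x \<Omega>] cone[OF x \<epsilon>] by auto
      have m: "(\<lambda>z. f (z - x)) \<in> borel_measurable borel" if "f \<in> test_functions V" for f :: "'a \<Rightarrow> real" and V
        using test_borel_measurable[OF that] by measurable
      have "(LINT z|?M. u z * dderiv b (\<rho> n) (z - x)) = - (LINT z|?M. (G z \<bullet> b) * \<rho> n (z - x))"
      proof -
        have "\<forall>\<psi>\<in>test_functions \<Omega>. (LINT z|?M. u z * dderiv b \<psi> z) = - (LINT z|?M. (G z \<bullet> b) * \<psi> z)"
          using wg b by (simp add: weak_grad_def weak_dderiv_def)
        from bspec[OF this T(1)] show ?thesis unfolding T(2) .
      qed
      moreover have "(LINT z|?M. u z * dderiv b (\<rho> n) (z - x)) = (LINT z|lborel. dderiv b (\<rho> n) (z - x) * u' z)"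
      proof (rule integral_lebesgue_on_representative(3)[OF \<Omega>b])
        show "(\<lambda>z. dderiv b (\<rho> n) (z - x) * u' z) \<in> borel_measurable borel"
          using m[OF test_dderiv[OF \<rho>(1)]] u'(1) by (auto simp: L2_def)
        show "AE z in lborel. indicator \<Omega> z * (u z * dderiv b (\<rho> n) (z - x)) = dderiv b (\<rho> n) (z - x) * u' z"
          using u'(2) by eventually_elim (auto simp: indicator_def split: if_splits)
      qed
      moreover have "(LINT z|?M. (G z \<bullet> b) * \<rho> n (z - x)) = (LINT z|lborel. \<rho> n (z - x) * G' b z)"
      proof (rule integral_lebesgue_on_representative(3)[OF \<Omega>b])
        show "(\<lambda>z. \<rho> n (z - x) * G' b z) \<in> borel_measurable borel"
          using m[OF \<rho>(1)] G'(1)[of b] by (auto simp: L2_def)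
        show "AE z in lborel. indicator \<Omega> z * ((G z \<bullet> b) * \<rho> n (z - x)) = \<rho> n (z - x) * G' b z"
          using G'(2)[of b] by eventually_elim (auto simp: indicator_def split: if_splits)
      qed
      ultimately show ?thesis using smooth_conv(2)[OF \<rho>(1) ui, of b n x] by (simp add: conv_def)
    qed
    show ?thesis
    proof (intro exI[of _ r] conjI r(1) ballI)
      fix \<eta> :: "'a \<Rightarrow> real" assume \<eta>: "\<eta> \<in> test_functions (ball x0 r)"
      have \<eta>U: "\<eta> \<in> test_functions UNIV" using \<eta> by (rule test_functions_mono) simp
      have \<eta>s: "smooth \<eta>" using \<eta> by (rule test_function_smooth)
      have \<eta>0: "\<eta> x = 0" "grad \<eta> x = 0" if "x \<notin> ball x0 r" for x
      proof -
        obtain C where C: "C \<subseteq> ball x0 r" "\<And>x. x \<notin> C \<Longrightarrow> \<eta> x = 0" "\<And>v x. x \<notin> C \<Longrightarrow> dderiv v \<eta> x = 0"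
          using test_functionE[OF \<eta>] by metis
        then have "x \<notin> C" using that by blast
        with C show "\<eta> x = 0" "grad \<eta> x = 0" by (simp_all add: grad_def)
      qed
      define p where "p x = w x * \<eta> x + W x \<bullet> grad \<eta> x" for x
      define pb where "pb b x = \<eta> x * (W x \<bullet> b)" for b x
      have pL: "L2 ?M p"
        unfolding p_def using L2_test_mult(1)[OF \<eta>U w] L2_test_mult(4)[OF \<eta>U W]
        by (intro L2_add) (simp_all add: mult.commute)
      have pbL: "L2 ?M (pb b)" for b
        unfolding pb_def by (intro L2_test_mult(1)[OF \<eta>U] L2_component W)
      obtain p' where p': "L2 lborel p'" "AE x in lborel. indicator \<Omega> x * p x = p' x" "\<And>x. x \<notin> \<Omega> \<Longrightarrow> p' x = 0"
        by (rule L2_representative[OF pL \<Omega>b]) (rule that)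
      have "\<exists>g. L2 lborel g \<and> (AE x in lborel. indicator \<Omega> x * pb b x = g x) \<and> (\<forall>x. x \<notin> \<Omega> \<longrightarrow> g x = 0)" for b
      proof -
        obtain g where "L2 lborel g" "AE x in lborel. indicator \<Omega> x * pb b x = g x" "\<And>x. x \<notin> \<Omega> \<Longrightarrow> g x = 0"
          by (rule L2_representative[OF pbL[of b] \<Omega>b]) (rule that)
        then show ?thesis by (intro exI[of _ g] conjI allI impI)
      qed
      then obtain pb' where pb': "\<And>b. L2 lborel (pb' b)" "\<And>b. AE x in lborel. indicator \<Omega> x * pb b x = pb' b x"
        "\<And>b x. x \<notin> \<Omega> \<Longrightarrow> pb' b x = 0" by metis
      have cs: "smooth (conv (\<rho> n) u')" for n by (rule smooth_conv(1)[OF \<rho>(1) ui])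
      have cm: "conv (\<rho> n) g \<in> borel_measurable borel" if "integrable lborel g" for n g
        using smooth_conv(1)[OF \<rho>(1) that] by (intro borel_measurable_continuous_onI smooth_continuous)
      have tr: "(LINT x|?M. f x * g x) = (LINT x|lborel. f' x * g x)"
        "integrable ?M (\<lambda>x. f x * g x) \<longleftrightarrow> integrable lborel (\<lambda>x. f' x * g x)"
        if "L2 lborel f'" "AE x in lborel. indicator \<Omega> x * f x = f' x" "g \<in> borel_measurable borel" for f f' g :: "'a \<Rightarrow> real"
      proof -
        have m: "(\<lambda>x. f' x * g x) \<in> borel_measurable borel" using that by (auto simp: L2_def)
        have a: "AE x in lborel. indicator \<Omega> x * (f x * g x) = f' x * g x"
          using that(2) by eventually_elim (metis mult.assoc)
        show "(LINT x|?M. f x * g x) = (LINT x|lborel. f' x * g x)"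
          "integrable ?M (\<lambda>x. f x * g x) \<longleftrightarrow> integrable lborel (\<lambda>x. f' x * g x)"
          using integral_lebesgue_on_representative(2,3)[OF \<Omega>b m a] by auto
      qed
      have eq0: "(LINT x|lborel. p' x * conv (\<rho> n) u' x) + (\<Sum>b\<in>Basis. LINT x|lborel. pb' b x * conv (\<rho> n) (G' b) x) = 0" for n
      proof -
        have T: "(\<lambda>x. conv (\<rho> n) u' x * \<eta> x) \<in> test_functions UNIV" by (rule test_mult_smooth[OF \<eta>U cs])
        have pt: "w x * (conv (\<rho> n) u' x * \<eta> x) + W x \<bullet> grad (\<lambda>x. conv (\<rho> n) u' x * \<eta> x) x
            = p x * conv (\<rho> n) u' x + (\<Sum>b\<in>Basis. pb b x * conv (\<rho> n) (G' b) x)" if x: "x \<in> \<Omega>" for x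
        proof (cases "x \<in> ball x0 r")
          case True
          have "W x \<bullet> grad (conv (\<rho> n) u') x = (\<Sum>b\<in>Basis. (W x \<bullet> b) * conv (\<rho> n) (G' b) x)"
            using dconv[OF x True] by (simp add: grad_def inner_sum_right mult.commute)
          then show ?thesis unfolding grad_mult[OF cs \<eta>s]
            by (simp add: p_def pb_def algebra_simps inner_add_right sum_distrib_left)
        next
          case False
          then show ?thesis using \<eta>0[OF False] unfolding grad_mult[OF cs \<eta>s] by (simp add: p_def pb_def)
        qed
        have i1: "integrable ?M (\<lambda>x. p x * conv (\<rho> n) u' x)"
          using cs by (intro L2_mult_integrable pL L2_continuous \<Omega> smooth_continuous)
        have i2: "integrable ?M (\<lambda>x. pb b x * conv (\<rho> n) (G' b) x)" for b
          by (intro L2_mult_integrable pbL L2_continuous \<Omega> smooth_continuous smooth_conv(1)[OF \<rho>(1) Gi])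
        have "0 = (LINT x|?M. w x * (conv (\<rho> n) u' x * \<eta> x) + W x \<bullet> grad (\<lambda>x. conv (\<rho> n) u' x * \<eta> x) x)"
          using ann T by simp
        also have "\<dots> = (LINT x|?M. p x * conv (\<rho> n) u' x + (\<Sum>b\<in>Basis. pb b x * conv (\<rho> n) (G' b) x))"
          using pt by (intro LINT_cong) auto
        also have "\<dots> = (LINT x|?M. p x * conv (\<rho> n) u' x) + (\<Sum>b\<in>Basis. LINT x|?M. pb b x * conv (\<rho> n) (G' b) x)"
          using i1 i2 by simp
        finally show ?thesis
          using tr(1)[OF p'(1,2) cm[OF ui]] tr(1)[OF pb'(1,2) cm[OF Gi]] by simp
      qed
      have "(\<lambda>n. (LINT x|lborel. p' x * conv (\<rho> n) u' x) + (\<Sum>b\<in>Basis. LINT x|lborel. pb' b x * conv (\<rho> n) (G' b) x))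
         \<longlonglongrightarrow> (LINT x|lborel. p' x * u' x) + (\<Sum>b\<in>Basis. LINT x|lborel. pb' b x * G' b x)"
        by (intro tendsto_add tendsto_sum mollification_weak_limit[OF _ _ \<rho> lim] p' u' pb' G')
      then have lim0: "(LINT x|lborel. p' x * u' x) + (\<Sum>b\<in>Basis. LINT x|lborel. pb' b x * G' b x) = 0"
        by (simp add: eq0 LIMSEQ_const_iff)
      have r1: "(LINT x|?M. p x * u x) = (LINT x|lborel. p' x * u' x)"
      proof (rule integral_lebesgue_on_representative(3)[OF \<Omega>b])
        show "(\<lambda>x. p' x * u' x) \<in> borel_measurable borel" using p'(1) u'(1) by (auto simp: L2_def)
        show "AE x in lborel. indicator \<Omega> x * (p x * u x) = p' x * u' x"
          using p'(2) u'(2) by eventually_elim (auto simp: indicator_def split: if_splits)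
      qed
      have r2: "(LINT x|?M. pb b x * (G x \<bullet> b)) = (LINT x|lborel. pb' b x * G' b x)" for b
      proof (rule integral_lebesgue_on_representative(3)[OF \<Omega>b])
        show "(\<lambda>x. pb' b x * G' b x) \<in> borel_measurable borel" using pb'(1)[of b] G'(1)[of b] by (auto simp: L2_def)
        show "AE x in lborel. indicator \<Omega> x * (pb b x * (G x \<bullet> b)) = pb' b x * G' b x"
          using pb'(2)[of b] G'(2)[of b] by eventually_elim (auto simp: indicator_def split: if_splits)
      qed
      have "J \<eta> = (LINT x|?M. p x * u x + (\<Sum>b\<in>Basis. pb b x * (G x \<bullet> b)))"
        unfolding J_def p_def pb_def
        by (intro LINT_cong refl)
           (simp add: algebra_simps inner_add_right sum_distrib_left euclidean_inner[of "W _" "G _"])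
      also have "\<dots> = (LINT x|?M. p x * u x) + (\<Sum>b\<in>Basis. LINT x|?M. pb b x * (G x \<bullet> b))"
        using L2_mult_integrable[OF pL u] L2_mult_integrable[OF pbL L2_component[OF G]] by simp
      finally show "J \<eta> = 0" using r1 r2 lim0 by simp
    qed
  qed
  then obtain r where r: "\<And>x. x \<in> closure \<Omega> \<Longrightarrow> r x > 0" "\<And>x \<eta>. x \<in> closure \<Omega> \<Longrightarrow> \<eta> \<in> test_functions (ball x (r x)) \<Longrightarrow> J \<eta> = 0"
    by metis
  have cpt: "compact (closure \<Omega>)" using \<Omega>(2) by simp
  obtain I where I: "I \<subseteq> closure \<Omega>" "finite I" "closure \<Omega> \<subseteq> (\<Union>x\<in>I. ball x (r x / 2))"
  proof (rule compactE_image[OF cpt, of "closure \<Omega>" "\<lambda>x. ball x (r x / 2)"])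
    show "closure \<Omega> \<subseteq> (\<Union>x\<in>closure \<Omega>. ball x (r x / 2))" using r(1) by force
  qed (use that in auto)
  have "\<exists>\<zeta>. \<zeta> \<in> test_functions (ball x (r x)) \<and> (\<forall>y\<in>cball x (r x / 2). \<zeta> y = 1)" if "x \<in> I" for x
  proof -
    have "r x > 0" using r(1) I(1) that by auto
    then have "cball x (r x / 2) \<subseteq> ball x (r x)" by auto
    then show ?thesis using smooth_urysohn[OF compact_cball open_ball] by metis
  qed
  then obtain \<zeta> where \<zeta>: "\<And>x. x \<in> I \<Longrightarrow> \<zeta> x \<in> test_functions (ball x (r x))" "\<And>x y. x \<in> I \<Longrightarrow> y \<in> cball x (r x / 2) \<Longrightarrow> \<zeta> x y = 1"
    by metis
  \<comment> \<open>Removing the local pieces one by one does not change the functional; the remaining factor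
     is \<open>0\<close> on \<open>\<Omega>\<close> because the plateaus of the cut-off functions cover it.\<close>
  have peel: "J \<eta> = J (\<lambda>y. (\<Prod>x\<in>F. 1 - \<zeta> x y) * \<eta> y) \<and> (\<lambda>y. (\<Prod>x\<in>F. 1 - \<zeta> x y) * \<eta> y) \<in> test_functions UNIV"
    if \<eta>: "\<eta> \<in> test_functions UNIV" and F: "finite F" "F \<subseteq> I" for \<eta> F
    using F
  proof (induction F rule: finite_induct)
    case empty
    then show ?case using \<eta> by simp
  next
    case (insert x F)
    define \<theta> where "\<theta> y = (\<Prod>x\<in>F. 1 - \<zeta> x y) * \<eta> y" for y
    have \<theta>: "\<theta> \<in> test_functions UNIV" "J \<eta> = J \<theta>" using insert by (simp_all add: \<theta>_def[abs_def])
    have x: "\<zeta> x \<in> test_functions (ball x (r x))" "x \<in> closure \<Omega>" using \<zeta> insert.prems I by auto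
    have t1: "(\<lambda>y. \<theta> y * \<zeta> x y) \<in> test_functions (ball x (r x))"
      by (intro test_mult_smooth x test_function_smooth[OF \<theta>(1)])
    have t2: "(\<lambda>y. (1 - \<zeta> x y) * \<theta> y) \<in> test_functions UNIV"
      by (intro test_mult_smooth \<theta> smooth_diff smooth_const test_function_smooth[OF x(1)])
    have "J \<theta> = J (\<lambda>y. \<theta> y * \<zeta> x y + (1 - \<zeta> x y) * \<theta> y)" by (simp add: algebra_simps)
    also have "\<dots> = J (\<lambda>y. \<theta> y * \<zeta> x y) + J (\<lambda>y. (1 - \<zeta> x y) * \<theta> y)"
      by (intro Jadd t2 test_functions_mono[OF t1]) simp
    also have "J (\<lambda>y. \<theta> y * \<zeta> x y) = 0" using r(2) x t1 by blast
    finally show ?case using insert.hyps t2 \<theta>(2) by (simp add: \<theta>_def[abs_def] mult.assoc)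
  qed
  obtain \<eta> where \<eta>: "\<eta> \<in> test_functions UNIV" "\<And>x. x \<in> closure \<Omega> \<Longrightarrow> \<eta> x = 1"
    using smooth_urysohn[OF cpt open_UNIV subset_UNIV] by metis
  have "(LINT x|?M. w x * u x + W x \<bullet> G x) = J \<eta>"
    unfolding J_def
  proof (intro LINT_cong refl)
    fix x assume "x \<in> space ?M"
    then have x: "x \<in> \<Omega>" by simp
    then have "\<eta> x = 1" "grad \<eta> x = 0"
      using \<eta>(2) closure_subset by (auto intro!: grad_locally_const[OF \<Omega>(1)] simp: subset_iff)
    then show "w x * u x + W x \<bullet> G x = w x * (\<eta> x * u x) + W x \<bullet> (\<eta> x *\<^sub>R G x + u x *\<^sub>R grad \<eta> x)" by simp
  qed
  also have "\<dots> = J (\<lambda>y. (\<Prod>x\<in>I. 1 - \<zeta> x y) * \<eta> y)" using peel[OF \<eta>(1) I(2)] by blast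
  also have "\<dots> = (LINT x|?M. 0)"
    unfolding J_def
  proof (intro LINT_cong refl)
    fix x assume "x \<in> space ?M"
    then have x: "x \<in> \<Omega>" by simp
    have z: "(\<Prod>x\<in>I. 1 - \<zeta> x y) * \<eta> y = 0" if "y \<in> \<Omega>" for y
    proof -
      have "y \<in> (\<Union>x\<in>I. ball x (r x / 2))" using that I(3) closure_subset by blast
      then obtain x where "x \<in> I" "y \<in> cball x (r x / 2)" by auto
      then have "1 - \<zeta> x y = 0" using \<zeta>(2) by simp
      then show ?thesis using \<open>x \<in> I\<close> I(2) by (auto simp: prod_zero_iff)
    qed
    show "w x * ((\<Prod>xa\<in>I. 1 - \<zeta> xa x) * \<eta> x * u x) + W x \<bullet> (((\<Prod>xa\<in>I. 1 - \<zeta> xa x) * \<eta> x) *\<^sub>R G x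
        + u x *\<^sub>R grad (\<lambda>y. (\<Prod>x\<in>I. 1 - \<zeta> x y) * \<eta> y) x) = 0"
    proof -
      have "grad (\<lambda>y. (\<Prod>x\<in>I. 1 - \<zeta> x y) * \<eta> y) x = 0"
        by (rule grad_locally_const[OF \<Omega>(1) x]) (rule z)
      then show ?thesis unfolding z[OF x] by simp
    qed
  qed
  finally show "(LINT x|?M. w x * u x + W x \<bullet> G x) = 0" by simp
qed

section \<open>Orthonormal bases\<close>

locale L2_basis =
  fixes M :: "'m measure" and \<phi> :: "nat \<Rightarrow> 'm \<Rightarrow> real"
  assumes L2_basis: "k \<ge> 1 \<Longrightarrow> L2 M (\<phi> k)"
    and orthonormal: "j \<ge> 1 \<Longrightarrow> k \<ge> 1 \<Longrightarrow> (LINT x|M. \<phi> j x * \<phi> k x) = (if j = k then 1 else 0)"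
    and complete: "L2 M f \<Longrightarrow>
      (\<lambda>n. LINT x|M. (f x - (\<Sum>k=1..n. (LINT y|M. f y * \<phi> k y) * \<phi> k x))\<^sup>2) \<longlonglongrightarrow> 0"
begin

definition coef :: "('m \<Rightarrow> real) \<Rightarrow> nat \<Rightarrow> real" where
  "coef f k = (LINT x|M. f x * \<phi> k x)"

lemma L2_comb: "(\<And>k. k \<in> J \<Longrightarrow> k \<ge> 1) \<Longrightarrow> L2 M (\<lambda>x. \<Sum>k\<in>J. b k * \<phi> k x)"
  by (intro L2_sum L2_rcmult L2_basis)

lemma integral_mult_comb:
  assumes "L2 M f" "\<And>k. k \<in> J \<Longrightarrow> k \<ge> 1"
  shows "(LINT x|M. f x * (\<Sum>k\<in>J. b k * \<phi> k x)) = (\<Sum>k\<in>J. b k * coef f k)"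
proof -
  have "(LINT x|M. f x * (\<Sum>k\<in>J. b k * \<phi> k x)) = (LINT x|M. (\<Sum>k\<in>J. b k * (f x * \<phi> k x)))"
    by (simp add: sum_distrib_left mult_ac)
  also have "\<dots> = (\<Sum>k\<in>J. LINT x|M. b k * (f x * \<phi> k x))"
    using assms by (intro LINT_sum integrable_mult_right L2_mult_integrable L2_basis)
  finally show ?thesis by (simp add: coef_def)
qed

lemma coef_comb:
  assumes "finite J" "\<And>k. k \<in> J \<Longrightarrow> k \<ge> 1" "m \<ge> 1"
  shows "coef (\<lambda>x. \<Sum>k\<in>J. b k * \<phi> k x) m = (if m \<in> J then b m else 0)"
proof -
  have "coef (\<lambda>x. \<Sum>k\<in>J. b k * \<phi> k x) m = (\<Sum>k\<in>J. b k * coef (\<phi> m) k)"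
    using integral_mult_comb[OF L2_basis[OF assms(3)], of J b] assms(2) by (simp add: coef_def mult.commute)
  also have "\<dots> = (\<Sum>k\<in>J. if m = k then b k else 0)"
    using assms(2,3) by (intro sum.cong refl) (simp add: coef_def orthonormal)
  also have "\<dots> = (if m \<in> J then b m else 0)" using assms(1) by simp
  finally show ?thesis .
qed

lemma integral_comb_sq:
  assumes "finite J" "\<And>k. k \<in> J \<Longrightarrow> k \<ge> 1"
  shows "(LINT x|M. (\<Sum>k\<in>J. b k * \<phi> k x)\<^sup>2) = (\<Sum>k\<in>J. (b k)\<^sup>2)"
proof -
  have "(LINT x|M. (\<Sum>k\<in>J. b k * \<phi> k x) * (\<Sum>k\<in>J. b k * \<phi> k x)) = (\<Sum>k\<in>J. b k * coef (\<lambda>x. \<Sum>k\<in>J. b k * \<phi> k x) k)"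
    using assms(2) by (intro integral_mult_comb L2_comb)
  also have "\<dots> = (\<Sum>k\<in>J. b k * b k)"
    using assms by (intro sum.cong refl) (simp add: coef_comb)
  finally show ?thesis by (simp add: power2_eq_square)
qed

lemma integral_minus_projection_sq:
  assumes "L2 M f" "finite J" "\<And>k. k \<in> J \<Longrightarrow> k \<ge> 1"
  shows "(LINT x|M. (f x - (\<Sum>k\<in>J. coef f k * \<phi> k x))\<^sup>2) = (LINT x|M. (f x)\<^sup>2) - (\<Sum>k\<in>J. (coef f k)\<^sup>2)"
proof -
  let ?p = "\<lambda>x. \<Sum>k\<in>J. coef f k * \<phi> k x"
  have p: "L2 M ?p" using assms(3) by (rule L2_comb)
  have "(LINT x|M. (f x - ?p x)\<^sup>2) = (LINT x|M. (f x)\<^sup>2 - 2 * (f x * ?p x) + (?p x)\<^sup>2)"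
    by (intro LINT_cong refl) (simp add: power2_diff algebra_simps)
  also have "\<dots> = (LINT x|M. (f x)\<^sup>2) - 2 * (LINT x|M. f x * ?p x) + (LINT x|M. (?p x)\<^sup>2)"
    using L2_real_sq[OF assms(1)] L2_real_sq[OF p] L2_mult_integrable[OF assms(1) p] by simp
  also have "(LINT x|M. f x * ?p x) = (\<Sum>k\<in>J. (coef f k)\<^sup>2)"
    using integral_mult_comb[OF assms(1,3)] by (simp add: power2_eq_square)
  also have "(LINT x|M. (?p x)\<^sup>2) = (\<Sum>k\<in>J. (coef f k)\<^sup>2)"
    using assms(2,3) by (rule integral_comb_sq)
  finally show ?thesis by simp
qed

lemma Bessel:
  assumes "L2 M f" "finite J" "\<And>k. k \<in> J \<Longrightarrow> k \<ge> 1"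
  shows "(\<Sum>k\<in>J. (coef f k)\<^sup>2) \<le> (LINT x|M. (f x)\<^sup>2)"
proof -
  have "0 \<le> (LINT x|M. (f x - (\<Sum>k\<in>J. coef f k * \<phi> k x))\<^sup>2)" by simp
  then show ?thesis using integral_minus_projection_sq[OF assms] by simp
qed

lemma Parseval:
  assumes "L2 M f"
  shows "(\<lambda>n. \<Sum>k=1..n. (coef f k)\<^sup>2) \<longlonglongrightarrow> (LINT x|M. (f x)\<^sup>2)"
proof -
  have "(\<lambda>n. (LINT x|M. (f x)\<^sup>2) - (LINT x|M. (f x - (\<Sum>k=1..n. coef f k * \<phi> k x))\<^sup>2)) \<longlonglongrightarrow> (LINT x|M. (f x)\<^sup>2) - 0"
    unfolding coef_def by (intro tendsto_diff tendsto_const complete assms)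
  moreover have "(LINT x|M. (f x)\<^sup>2) - (LINT x|M. (f x - (\<Sum>k=1..n. coef f k * \<phi> k x))\<^sup>2) = (\<Sum>k=1..n. (coef f k)\<^sup>2)" for n
    by (subst integral_minus_projection_sq[OF assms]) auto
  ultimately show ?thesis by (simp only: diff_zero)
qed

lemma partial_sums_pairing:
  assumes "L2 M f" "L2 M g"
  shows "(\<lambda>n. LINT x|M. (\<Sum>k=1..n. coef f k * \<phi> k x) * g x) \<longlonglongrightarrow> (LINT x|M. f x * g x)"
proof -
  have "(\<lambda>n. LINT x|M. (norm ((\<Sum>k=1..n. coef f k * \<phi> k x) - f x))\<^sup>2) \<longlonglongrightarrow> 0"
    using complete[OF assms(1)] by (simp add: coef_def power2_commute)
  moreover have "L2 M (\<lambda>x. \<Sum>k=1..n. coef f k * \<phi> k x)" for n by (rule L2_comb) simp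
  ultimately show ?thesis using L2_pairing_tendsto[OF _ assms, of "\<lambda>n x. \<Sum>k=1..n. coef f k * \<phi> k x"]
    by (simp del: One_nat_def)
qed

lemma coef_diff: "L2 M f \<Longrightarrow> L2 M g \<Longrightarrow> k \<ge> 1 \<Longrightarrow> coef (\<lambda>x. f x - g x) k = coef f k - coef g k"
  by (simp add: coef_def left_diff_distrib L2_mult_integrable L2_basis)

lemma coef_sq_le: "L2 M f \<Longrightarrow> k \<ge> 1 \<Longrightarrow> (coef f k)\<^sup>2 \<le> (LINT x|M. (f x)\<^sup>2)"
  using Bessel[of f "{k}"] by simp

end

section \<open>The localized energy of combinations of eigenfunctions\<close>

lemma norm_diff_square: "(norm (a - b))\<^sup>2 = (norm a)\<^sup>2 - 2 * (b \<bullet> a) + b \<bullet> b" for a b :: "'a::real_inner"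
  by (simp add: power2_norm_eq_inner inner_diff_left inner_diff_right inner_commute)

lemma form_closureD:
  assumes "form_closure \<Omega> \<T> u G" "L2 (lebesgue_on \<Omega>) w" "L2 (lebesgue_on \<Omega>) W"
    and "\<And>\<psi>. \<psi> \<in> \<T> \<Longrightarrow> (LINT x|lebesgue_on \<Omega>. w x * \<psi> x + W x \<bullet> grad \<psi> x) = 0"
  shows "(LINT x|lebesgue_on \<Omega>. w x * u x + W x \<bullet> G x) = 0"
  using assms unfolding form_closure_def by blast

lemma form_closure_L2: "form_closure \<Omega> \<T> u G \<Longrightarrow> L2 (lebesgue_on \<Omega>) u" "form_closure \<Omega> \<T> u G \<Longrightarrow> L2 (lebesgue_on \<Omega>) G"
  by (auto simp: form_closure_def)

lemma form_closure_sum: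
  assumes "\<And>i. i \<in> I \<Longrightarrow> form_closure \<Omega> \<T> (u i) (G i)"
  shows "form_closure \<Omega> \<T> (\<lambda>x. \<Sum>i\<in>I. b i * u i x) (\<lambda>x. \<Sum>i\<in>I. b i *\<^sub>R G i x)"
  unfolding form_closure_def
proof (intro conjI allI impI; (elim conjE)?)
  let ?M = "lebesgue_on \<Omega>"
  have L: "L2 ?M (u i)" "L2 ?M (G i)" if "i \<in> I" for i
    using form_closure_L2 assms that by blast+
  show "L2 ?M (\<lambda>x. \<Sum>i\<in>I. b i * u i x)" "L2 ?M (\<lambda>x. \<Sum>i\<in>I. b i *\<^sub>R G i x)"
    by (intro L2_sum L2_rcmult L2_cmult L; assumption)+
  fix w W assume w: "L2 ?M w" "L2 ?M W"
    "\<forall>\<psi>\<in>\<T>. (LINT x|?M. w x * \<psi> x + W x \<bullet> grad \<psi> x) = 0"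
  have "(LINT x|?M. w x * (\<Sum>i\<in>I. b i * u i x) + W x \<bullet> (\<Sum>i\<in>I. b i *\<^sub>R G i x))
      = (LINT x|?M. (\<Sum>i\<in>I. b i * (w x * u i x + W x \<bullet> G i x)))"
    by (simp add: sum_distrib_left inner_sum_right distrib_left sum.distrib mult_ac)
  also have "\<dots> = (\<Sum>i\<in>I. (LINT x|?M. b i * (w x * u i x + W x \<bullet> G i x)))"
    using w L by (intro LINT_sum integrable_mult_right Bochner_Integration.integrable_add
        L2_mult_integrable L2_inner_integrable)
  also have "\<dots> = 0"
    using form_closureD[OF assms w(1,2)] w(3) by (intro sum.neutral) simp
  finally show "(LINT x|?M. w x * (\<Sum>i\<in>I. b i * u i x) + W x \<bullet> (\<Sum>i\<in>I. b i *\<^sub>R G i x)) = 0" .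
qed

text \<open>Multiplication by \<open>\<zeta>\<close> is moved to the functional: \<open>(w, W)\<close> becomes
  \<open>(\<zeta> w + W \<bullet> \<nabla>\<zeta>, \<zeta> W)\<close>, which again annihilates \<open>\<T>\<close>.\<close>

lemma form_closure_test_mult:
  assumes "form_closure \<Omega> \<T> u G" "\<zeta> \<in> test_functions UNIV"
    and \<T>: "\<And>\<psi>. \<psi> \<in> \<T> \<Longrightarrow> \<psi> \<in> test_functions UNIV" "\<And>\<psi>. \<psi> \<in> \<T> \<Longrightarrow> (\<lambda>x. \<zeta> x * \<psi> x) \<in> \<T>"
  shows "form_closure \<Omega> \<T> (\<lambda>x. \<zeta> x * u x) (\<lambda>x. \<zeta> x *\<^sub>R G x + u x *\<^sub>R grad \<zeta> x)"
  unfolding form_closure_def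
proof (intro conjI allI impI; (elim conjE)?)
  let ?M = "lebesgue_on \<Omega>"
  note L = form_closure_L2[OF assms(1)]
  show "L2 ?M (\<lambda>x. \<zeta> x * u x)" "L2 ?M (\<lambda>x. \<zeta> x *\<^sub>R G x + u x *\<^sub>R grad \<zeta> x)"
    by (intro L2_add L2_test_mult[OF assms(2)] L)+
  fix w W assume w: "L2 ?M w" "L2 ?M W"
    "\<forall>\<psi>\<in>\<T>. (LINT x|?M. w x * \<psi> x + W x \<bullet> grad \<psi> x) = 0"
  have "(LINT x|?M. (\<zeta> x * w x + W x \<bullet> grad \<zeta> x) * u x + (\<zeta> x *\<^sub>R W x) \<bullet> G x) = 0"
  proof (rule form_closureD[OF assms(1)])
    show "L2 ?M (\<lambda>x. \<zeta> x * w x + W x \<bullet> grad \<zeta> x)" "L2 ?M (\<lambda>x. \<zeta> x *\<^sub>R W x)"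
      by (intro L2_add L2_test_mult[OF assms(2)] w)+
    fix \<psi> assume \<psi>: "\<psi> \<in> \<T>"
    have "(LINT x|?M. w x * (\<zeta> x * \<psi> x) + W x \<bullet> grad (\<lambda>x. \<zeta> x * \<psi> x) x) = 0"
      by (rule bspec[OF w(3) \<T>(2)[OF \<psi>]])
    moreover have "grad (\<lambda>x. \<zeta> x * \<psi> x) x = \<zeta> x *\<^sub>R grad \<psi> x + \<psi> x *\<^sub>R grad \<zeta> x" for x
      using assms(2) \<T>(1)[OF \<psi>] by (intro grad_mult test_function_smooth)
    ultimately show "(LINT x|?M. (\<zeta> x * w x + W x \<bullet> grad \<zeta> x) * \<psi> x + (\<zeta> x *\<^sub>R W x) \<bullet> grad \<psi> x) = 0"
      by (simp add: inner_add_right algebra_simps)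
  qed
  then show "(LINT x|?M. w x * (\<zeta> x * u x) + W x \<bullet> (\<zeta> x *\<^sub>R G x + u x *\<^sub>R grad \<zeta> x)) = 0"
    by (simp add: inner_add_right algebra_simps)
qed

text \<open>\<open>\<T>\<close> are the test functions of the weak formulation (compactly supported in \<open>\<Omega>\<close> for the
  Dirichlet condition, on the whole space for the Neumann condition), and \<open>\<Gamma> k\<close> is the weak gradient of \<open>\<phi> k\<close>.
  The estimates of the modes depend on the boundary condition only through \<open>\<T>\<close>.\<close>

locale eigenbasis = L2_basis "lebesgue_on \<Omega>" \<phi>
  for \<Omega> :: "'a::euclidean_space set" and \<phi> +
  fixes \<T> :: "('a \<Rightarrow> real) set" and \<Gamma> :: "nat \<Rightarrow> 'a \<Rightarrow> 'a" and \<Lambda> :: "nat \<Rightarrow> real"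
  assumes \<T>_test: "\<psi> \<in> \<T> \<Longrightarrow> \<psi> \<in> test_functions UNIV"
    and \<T>_mult: "\<psi> \<in> \<T> \<Longrightarrow> \<zeta> \<in> test_functions UNIV \<Longrightarrow> (\<lambda>x. \<zeta> x * \<psi> x) \<in> \<T>"
    and eigen_closure: "k \<ge> 1 \<Longrightarrow> form_closure \<Omega> \<T> (\<phi> k) (\<Gamma> k)"
    and eigen_eq: "k \<ge> 1 \<Longrightarrow> \<psi> \<in> \<T> \<Longrightarrow>
      (LINT x|lebesgue_on \<Omega>. (- \<Lambda> k * \<phi> k x) * \<psi> x + \<Gamma> k x \<bullet> grad \<psi> x) = 0"
    and \<Lambda>_nonneg: "0 \<le> \<Lambda> 1" and \<Lambda>_mono: "1 \<le> j \<Longrightarrow> j \<le> k \<Longrightarrow> \<Lambda> j \<le> \<Lambda> k"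
    and \<Lambda>_lim: "filterlim \<Lambda> at_top sequentially"
begin

lemma \<Lambda>_ge_0: "k \<ge> 1 \<Longrightarrow> 0 \<le> \<Lambda> k"
  using \<Lambda>_nonneg \<Lambda>_mono[of 1 k] by simp

lemma L2_\<Gamma>: "k \<ge> 1 \<Longrightarrow> L2 (lebesgue_on \<Omega>) (\<Gamma> k)"
  using form_closure_L2(2)[OF eigen_closure] .

lemma eigen_weak:
  assumes "k \<ge> 1" "form_closure \<Omega> \<T> u G"
  shows "(LINT x|lebesgue_on \<Omega>. \<Gamma> k x \<bullet> G x) = \<Lambda> k * coef u k"
proof -
  let ?M = "lebesgue_on \<Omega>"
  note L = form_closure_L2[OF assms(2)]
  have "(LINT x|?M. (- \<Lambda> k * \<phi> k x) * u x + \<Gamma> k x \<bullet> G x) = 0"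
    using eigen_eq[OF assms(1)] by (intro form_closureD[OF assms(2)] L2_rcmult L2_basis assms(1) L2_\<Gamma>)
  moreover have "(LINT x|?M. (- \<Lambda> k * \<phi> k x) * u x + \<Gamma> k x \<bullet> G x)
      = (LINT x|?M. - \<Lambda> k * (u x * \<phi> k x)) + (LINT x|?M. \<Gamma> k x \<bullet> G x)"
    using L L2_basis[OF assms(1)] L2_\<Gamma>[OF assms(1)]
    by (subst LINT_add[symmetric])
       (auto simp: mult_ac intro!: L2_mult_integrable L2_inner_integrable integrable_mult_right)
  ultimately show ?thesis by (simp add: coef_def)
qed

text \<open>Bessel's inequality for the Dirichlet form, in which the eigenfunctions are orthogonal: the
  distance of \<open>G\<close> to the combination of the \<open>\<Gamma> m\<close> with the coefficients of \<open>u\<close> is nonnegative.\<close>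

lemma energy_Bessel:
  assumes "form_closure \<Omega> \<T> u G"
  shows "(\<Sum>m=1..n. \<Lambda> m * (coef u m)\<^sup>2) \<le> (LINT x|lebesgue_on \<Omega>. (norm (G x))\<^sup>2)"
proof -
  let ?M = "lebesgue_on \<Omega>"
  let ?b = "coef u"
  let ?S = "\<lambda>x. \<Sum>m=1..n. ?b m *\<^sub>R \<Gamma> m x"
  note G = form_closure_L2(2)[OF assms]
  have S: "L2 ?M ?S" by (intro L2_sum L2_cmult L2_\<Gamma>) simp
  have SG: "(LINT x|?M. ?S x \<bullet> G x) = (\<Sum>m=1..n. \<Lambda> m * (?b m)\<^sup>2)"
  proof -
    have "(LINT x|?M. ?S x \<bullet> G x) = (LINT x|?M. (\<Sum>m=1..n. ?b m * (\<Gamma> m x \<bullet> G x)))"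
      by (simp add: inner_sum_left)
    also have "\<dots> = (\<Sum>m=1..n. (LINT x|?M. ?b m * (\<Gamma> m x \<bullet> G x)))"
      using G by (intro LINT_sum integrable_mult_right L2_inner_integrable L2_\<Gamma>) auto
    also have "\<dots> = (\<Sum>m=1..n. \<Lambda> m * (?b m)\<^sup>2)"
      using eigen_weak[OF _ assms] by (intro sum.cong refl) (simp add: power2_eq_square)
    finally show ?thesis .
  qed
  have SS: "(LINT x|?M. ?S x \<bullet> ?S x) = (\<Sum>m=1..n. \<Lambda> m * (?b m)\<^sup>2)"
  proof -
    have fc: "form_closure \<Omega> \<T> (\<lambda>x. \<Sum>m=1..n. ?b m * \<phi> m x) ?S"
      by (intro form_closure_sum eigen_closure) simp
    have "(LINT x|?M. ?S x \<bullet> ?S x) = (LINT x|?M. (\<Sum>m=1..n. ?b m * (\<Gamma> m x \<bullet> ?S x)))"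
      by (subst inner_sum_left) simp
    also have "\<dots> = (\<Sum>m=1..n. (LINT x|?M. ?b m * (\<Gamma> m x \<bullet> ?S x)))"
      using S by (intro LINT_sum integrable_mult_right L2_inner_integrable L2_\<Gamma>) auto
    also have "\<dots> = (\<Sum>m=1..n. ?b m * (\<Lambda> m * coef (\<lambda>x. \<Sum>m=1..n. ?b m * \<phi> m x) m))"
      using eigen_weak[OF _ fc] by (intro sum.cong refl) simp
    also have "\<dots> = (\<Sum>m=1..n. \<Lambda> m * (?b m)\<^sup>2)"
      using coef_comb[of "{1..n}" _ ?b] by (intro sum.cong refl) (auto simp: power2_eq_square)
    finally show ?thesis .
  qed
  have "0 \<le> (LINT x|?M. (norm (G x - ?S x))\<^sup>2)" by simp
  also have "\<dots> = (LINT x|?M. (norm (G x))\<^sup>2 - 2 * (?S x \<bullet> G x) + ?S x \<bullet> ?S x)"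
    by (intro LINT_cong refl norm_diff_square)
  also have "\<dots> = (LINT x|?M. (norm (G x))\<^sup>2) - 2 * (LINT x|?M. ?S x \<bullet> G x) + (LINT x|?M. ?S x \<bullet> ?S x)"
    using L2_integrable_sq[OF G] L2_inner_integrable[OF S G] L2_inner_integrable[OF S S] by simp
  finally show ?thesis unfolding SG SS by simp
qed

text \<open>The localization formula of Ismagilov, Morgan and Simon: for \<open>u\<close> with gradient \<open>G\<close>,
  \<open>|\<nabla>(\<zeta> u)|\<^sup>2 = G \<bullet> \<nabla>(\<zeta>\<^sup>2 u) + |\<nabla>\<zeta>|\<^sup>2 u\<^sup>2\<close>, and the first term is the weak form of \<open>\<zeta>\<^sup>2 u (- \<Delta> u)\<close>. The
  commutator has order zero, so it does not see the frequencies of \<open>u\<close>.\<close>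

lemma localized_energy:
  fixes c :: "nat \<Rightarrow> real" and n l :: nat
  assumes \<zeta>: "\<zeta> \<in> test_functions UNIV"
  defines "u \<equiv> \<lambda>x. \<Sum>k=1..n. c k * \<phi> k x"
  shows "(\<Sum>m=1..l. \<Lambda> m * (coef (\<lambda>x. \<zeta> x * u x) m)\<^sup>2) \<le>
     (LINT x|lebesgue_on \<Omega>. (\<zeta> x)\<^sup>2 * u x * (\<Sum>k=1..n. \<Lambda> k * c k * \<phi> k x)) +
     (LINT x|lebesgue_on \<Omega>. (norm (grad \<zeta> x))\<^sup>2 * (u x)\<^sup>2)"
proof -
  let ?M = "lebesgue_on \<Omega>"
  define G where "G x = (\<Sum>k=1..n. c k *\<^sub>R \<Gamma> k x)" for x
  have fc: "form_closure \<Omega> \<T> u G"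
    unfolding u_def G_def by (intro form_closure_sum eigen_closure) simp
  have fc1: "form_closure \<Omega> \<T> (\<lambda>x. \<zeta> x * u x) (\<lambda>x. \<zeta> x *\<^sub>R G x + u x *\<^sub>R grad \<zeta> x)"
    by (rule form_closure_test_mult[OF fc \<zeta> \<T>_test \<T>_mult[OF _ \<zeta>]])
  have fc2: "form_closure \<Omega> \<T> (\<lambda>x. \<zeta> x * (\<zeta> x * u x))
     (\<lambda>x. \<zeta> x *\<^sub>R (\<zeta> x *\<^sub>R G x + u x *\<^sub>R grad \<zeta> x) + (\<zeta> x * u x) *\<^sub>R grad \<zeta> x)" (is "form_closure _ _ ?u2 ?G2")
    by (rule form_closure_test_mult[OF fc1 \<zeta> \<T>_test \<T>_mult[OF _ \<zeta>]])
  note L2 = form_closure_L2[OF fc] form_closure_L2[OF fc1] form_closure_L2[OF fc2]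
  have "(LINT x|?M. G x \<bullet> ?G2 x) = (LINT x|?M. (\<Sum>k=1..n. c k * (\<Gamma> k x \<bullet> ?G2 x)))"
    unfolding G_def by (subst inner_sum_left) simp
  also have "\<dots> = (\<Sum>k=1..n. (LINT x|?M. c k * (\<Gamma> k x \<bullet> ?G2 x)))"
    using L2 by (intro LINT_sum integrable_mult_right L2_inner_integrable L2_\<Gamma>) auto
  also have "\<dots> = (\<Sum>k=1..n. (\<Lambda> k * c k) * coef ?u2 k)"
    using eigen_weak[OF _ fc2] by (intro sum.cong refl) simp
  also have "\<dots> = (LINT x|?M. ?u2 x * (\<Sum>k=1..n. \<Lambda> k * c k * \<phi> k x))"
    using L2 by (intro integral_mult_comb[symmetric]) auto
  finally have e1: "(LINT x|?M. G x \<bullet> ?G2 x) =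
      (LINT x|?M. (\<zeta> x)\<^sup>2 * u x * (\<Sum>k=1..n. \<Lambda> k * c k * \<phi> k x))"
    by (simp add: power2_eq_square mult.assoc)
  have "(\<Sum>m=1..l. \<Lambda> m * (coef (\<lambda>x. \<zeta> x * u x) m)\<^sup>2) \<le> (LINT x|?M. (norm (\<zeta> x *\<^sub>R G x + u x *\<^sub>R grad \<zeta> x))\<^sup>2)"
    using fc1 by (rule energy_Bessel)
  also have "\<dots> = (LINT x|?M. G x \<bullet> ?G2 x + (norm (u x *\<^sub>R grad \<zeta> x))\<^sup>2)"
    by (intro LINT_cong refl)
       (simp only: power2_norm_eq_inner inner_add_left inner_add_right, simp add: inner_commute algebra_simps)
  also have "\<dots> = (LINT x|?M. G x \<bullet> ?G2 x) + (LINT x|?M. (norm (u x *\<^sub>R grad \<zeta> x))\<^sup>2)"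
    using L2 L2_test_mult(3)[OF \<zeta>, of \<Omega> u] by (intro LINT_add L2_inner_integrable L2_integrable_sq) auto
  finally show ?thesis unfolding e1 by (simp add: power_mult_distrib mult.commute)
qed

end

section \<open>Modes of a solution\<close>

lemma bdd_meas_L2: "bdd_meas T g \<Longrightarrow> L2 (lebesgue_on {0..T}) g"
  using bdd_meas_LINT(1)[OF bdd_meas_power] by (simp add: L2_def bdd_meas_def)

lemma integral_sq_Cauchy_Schwarz:
  assumes "bdd_meas T f" "bdd_meas T g"
  shows "\<bar>integral {0..T} (\<lambda>t. f t * g t)\<bar> \<le> sqrt (integral {0..T} (\<lambda>t. (f t)\<^sup>2)) * sqrt (integral {0..T} (\<lambda>t. (g t)\<^sup>2))"
  using L2_Cauchy_Schwarz_sqrt[OF bdd_meas_L2[OF assms(1)] bdd_meas_L2[OF assms(2)]] assms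
  by (simp add: bdd_meas_LINT bdd_meas_mult bdd_meas_power)

lemma integral_mono_bdd_meas:
  assumes "bdd_meas T f" "bdd_meas T g" "\<And>t. t \<in> {0..T} \<Longrightarrow> f t \<le> g t"
  shows "integral {0..T} f \<le> integral {0..T} g"
  using assms by (intro integral_le bdd_meas_integrable_on) auto

lemma integral_bdd_meas_add:
  "bdd_meas T f \<Longrightarrow> bdd_meas T g \<Longrightarrow> integral {0..T} (\<lambda>t. f t + g t) = integral {0..T} f + integral {0..T} g"
  by (intro HK_add bdd_meas_integrable_on) auto

lemma integral_bdd_meas_sum:
  "finite I \<Longrightarrow> (\<And>i. i \<in> I \<Longrightarrow> bdd_meas T (f i)) \<Longrightarrow>
    integral {0..T} (\<lambda>t. \<Sum>i\<in>I. f i t) = (\<Sum>i\<in>I. integral {0..T} (f i))"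
  by (intro Henstock_Kurzweil_Integration.integral_sum bdd_meas_integrable_on) auto

lemma integral_nonneg_bdd: "(\<And>t. t \<in> {0..T} \<Longrightarrow> 0 \<le> f t) \<Longrightarrow> 0 \<le> integral {0..T} (f :: real \<Rightarrow> real)"
  by (cases "f integrable_on {0..T}") (auto intro: Henstock_Kurzweil_Integration.integral_nonneg simp: not_integrable_integral)

text \<open>The potential enters through its slices; only integrals over \<open>\<Omega>\<close> have to depend measurably on
  time.\<close>

locale heat_modes = eigenbasis \<Omega> \<phi> \<T> \<Gamma> \<Lambda>
  for \<Omega> :: "'a::euclidean_space set" and \<phi> \<T> \<Gamma> \<Lambda> +
  fixes T Q :: real and q :: "real \<Rightarrow> 'a \<Rightarrow> real"
  assumes T: "T > 0" and Q: "Q \<ge> 0"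
    and q_meas: "t \<in> {0..T} \<Longrightarrow> q t \<in> borel_measurable (lebesgue_on \<Omega>)"
    and q_bound: "\<bar>q t x\<bar> \<le> Q"
    and q_coef_meas: "j \<ge> 1 \<Longrightarrow> k \<ge> 1 \<Longrightarrow>
      (\<lambda>t. LINT x|lebesgue_on \<Omega>. q t x * \<phi> j x * \<phi> k x) \<in> borel_measurable (lebesgue_on {0..T})"
    and q_sq_meas: "k \<ge> 1 \<Longrightarrow>
      (\<lambda>t. LINT x|lebesgue_on \<Omega>. (q t x * \<phi> k x)\<^sup>2) \<in> borel_measurable (lebesgue_on {0..T})"
begin

abbreviation "nsq f \<equiv> LINT x|lebesgue_on \<Omega>. (f x :: real)\<^sup>2"

lemma L2_q: "L2 (lebesgue_on \<Omega>) f \<Longrightarrow> t \<in> {0..T} \<Longrightarrow> L2 (lebesgue_on \<Omega>) (\<lambda>x. q t x * f x)"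
  using q_bound by (intro L2_bounded_mult q_meas)

lemma nsq_q: "L2 (lebesgue_on \<Omega>) f \<Longrightarrow> t \<in> {0..T} \<Longrightarrow> nsq (\<lambda>x. q t x * f x) \<le> Q\<^sup>2 * nsq f"
proof -
  assume f: "L2 (lebesgue_on \<Omega>) f" "t \<in> {0..T}"
  have "nsq (\<lambda>x. q t x * f x) \<le> (LINT x|lebesgue_on \<Omega>. Q\<^sup>2 * (f x)\<^sup>2)"
  proof (rule integral_mono)
    show "(q t x * f x)\<^sup>2 \<le> Q\<^sup>2 * (f x)\<^sup>2" for x
      using power_mono[OF q_bound[of t x] abs_ge_zero, of 2] by (simp add: power_mult_distrib mult_right_mono)
  qed (use L2_real_sq[OF L2_q[OF f]] L2_real_sq[OF f(1)] in auto)
  then show ?thesis by simp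
qed

text \<open>By Pythagoras, \<open>R K k t\<close> is the squared distance of \<open>q(t) \<phi>\<^sub>k\<close> to the span of the modes below
  \<open>K\<close>. It measures the influence of the modes from \<open>K\<close> on upon the mode \<open>k\<close>, since \<open>q\<close> acts symmetrically.\<close>

definition R :: "nat \<Rightarrow> nat \<Rightarrow> real \<Rightarrow> real" where
  "R K k t = nsq (\<lambda>x. q t x * \<phi> k x) - (\<Sum>i\<in>{1..<K}. (coef (\<lambda>x. q t x * \<phi> k x) i)\<^sup>2)"

lemma R_nonneg: "k \<ge> 1 \<Longrightarrow> t \<in> {0..T} \<Longrightarrow> 0 \<le> R K k t"
  using Bessel[OF L2_q[OF L2_basis], of k t "{1..<K}"] by (auto simp: R_def)

lemma nsq_basis: "k \<ge> 1 \<Longrightarrow> nsq (\<phi> k) = 1"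
  using orthonormal[of k k] by (simp add: power2_eq_square)

lemma R_le: "k \<ge> 1 \<Longrightarrow> t \<in> {0..T} \<Longrightarrow> R K k t \<le> Q\<^sup>2"
  using nsq_q[OF L2_basis, of k t] nsq_basis[of k] sum_nonneg[of "{1..<K}" "\<lambda>i. (coef (\<lambda>x. q t x * \<phi> k x) i)\<^sup>2"]
  by (auto simp: R_def)

lemma R_bdd_meas:
  assumes k: "k \<ge> 1"
  shows "bdd_meas T (R K k)"
proof -
  have "(\<lambda>t. coef (\<lambda>x. q t x * \<phi> k x) i) \<in> borel_measurable (lebesgue_on {0..T})" if "i \<ge> 1" for i
    using q_coef_meas[OF k that] by (simp add: coef_def)
  then have "R K k \<in> borel_measurable (lebesgue_on {0..T})"
    unfolding R_def[abs_def] using q_sq_meas[OF k]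
    by (intro borel_measurable_diff borel_measurable_sum borel_measurable_power) auto
  moreover have "\<forall>t\<in>{0..T}. \<bar>R K k t\<bar> \<le> Q\<^sup>2" using R_nonneg[OF k] R_le[OF k] by (auto simp: abs_le_iff)
  ultimately show ?thesis unfolding bdd_meas_def by blast
qed

lemma R_integral_tendsto_0:
  assumes k: "k \<ge> 1"
  shows "(\<lambda>K. integral {0..T} (R K k)) \<longlonglongrightarrow> 0"
proof -
  have "(\<lambda>K. LINT t|lebesgue_on {0..T}. R K k t) \<longlonglongrightarrow> (LINT t|lebesgue_on {0..T}. 0)"
  proof (rule integral_dominated_convergence[where w="\<lambda>t. Q\<^sup>2"])
    show "integrable (lebesgue_on {0..T}) (\<lambda>t. Q\<^sup>2)" by (rule bdd_meas_LINT) simp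
    show "R K k \<in> borel_measurable (lebesgue_on {0..T})" for K using R_bdd_meas[OF k] by (simp add: bdd_meas_def)
    show "AE t in lebesgue_on {0..T}. norm (R K k t) \<le> Q\<^sup>2" for K
      using R_nonneg[OF k] R_le[OF k] by (intro AE_I2) (auto simp: abs_le_iff)
    show "AE t in lebesgue_on {0..T}. (\<lambda>K. R K k t) \<longlonglongrightarrow> 0"
    proof (intro AE_I2)
      fix t assume "t \<in> space (lebesgue_on {0..T})"
      then have t: "t \<in> {0..T}" by simp
      let ?f = "\<lambda>x. q t x * \<phi> k x"
      have "(\<lambda>n. nsq ?f - (\<Sum>i=1..n. (coef ?f i)\<^sup>2)) \<longlonglongrightarrow> nsq ?f - nsq ?f"
        by (intro tendsto_diff tendsto_const Parseval L2_q L2_basis k t)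
      then have "(\<lambda>n. R (Suc n) k t) \<longlonglongrightarrow> 0"
        by (simp add: R_def atLeastLessThanSuc_atLeastAtMost del: One_nat_def)
      then show "(\<lambda>K. R K k t) \<longlonglongrightarrow> 0" by (rule LIMSEQ_imp_Suc)
    qed
  qed simp
  then show ?thesis using R_bdd_meas[OF k] by (simp add: bdd_meas_LINT)
qed

text \<open>All that the estimates need to know about a solution: the equations of its modes, with initial
  values given by \<open>h\<close>, and enough regularity in time to integrate.\<close>

definition solution_modes :: "('a \<Rightarrow> real) \<Rightarrow> (real \<Rightarrow> 'a \<Rightarrow> real) \<Rightarrow> bool" where
  "solution_modes h V \<longleftrightarrow> L2 (lebesgue_on \<Omega>) h \<and> (\<forall>t\<in>{0..T}. L2 (lebesgue_on \<Omega>) (V t)) \<and>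
     continuous_on {0..T} (\<lambda>t. nsq (V t)) \<and> (\<forall>k\<ge>1. coef (V 0) k = coef h k) \<and>
     (\<forall>k\<ge>1. bdd_meas T (\<lambda>t. coef (\<lambda>x. q t x * V t x) k) \<and>
        prim T (\<lambda>t. coef (V t) k) (\<lambda>t. - \<Lambda> k * coef (V t) k + coef (\<lambda>x. q t x * V t x) k)) \<and>
     (\<forall>\<rho>. L2 (lebesgue_on \<Omega>) \<rho> \<longrightarrow> bdd_meas T (\<lambda>t. LINT x|lebesgue_on \<Omega>. V t x * \<rho> x)) \<and>
     (\<forall>\<zeta>\<in>test_functions UNIV. bdd_meas T (\<lambda>t. nsq (\<lambda>x. \<zeta> x * V t x)))"

context
  fixes h V assumes sol: "solution_modes h V"
begin

abbreviation "c k t \<equiv> coef (V t) k"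
abbreviation "f k t \<equiv> coef (\<lambda>x. q t x * V t x) k"
abbreviation "S \<equiv> integral {0..T} (\<lambda>t. nsq (V t))"

lemma
  shows L2_V: "t \<in> {0..T} \<Longrightarrow> L2 (lebesgue_on \<Omega>) (V t)"
    and L2_h: "L2 (lebesgue_on \<Omega>) h"
    and nsq_continuous: "continuous_on {0..T} (\<lambda>t. nsq (V t))"
    and c_0: "k \<ge> 1 \<Longrightarrow> c k 0 = coef h k"
    and f_bdd_meas: "k \<ge> 1 \<Longrightarrow> bdd_meas T (f k)"
    and c_prim: "k \<ge> 1 \<Longrightarrow> prim T (c k) (\<lambda>t. - \<Lambda> k * c k t + f k t)"
    and pairing_bdd_meas: "L2 (lebesgue_on \<Omega>) \<rho> \<Longrightarrow> bdd_meas T (\<lambda>t. LINT x|lebesgue_on \<Omega>. V t x * \<rho> x)"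
    and nsq_test_bdd_meas: "\<zeta> \<in> test_functions UNIV \<Longrightarrow> bdd_meas T (\<lambda>t. nsq (\<lambda>x. \<zeta> x * V t x))"
  using sol by (auto simp: solution_modes_def)

lemma nsq_bdd_meas: "bdd_meas T (\<lambda>t. nsq (V t))"
  by (rule bdd_meas_continuous[OF nsq_continuous])

lemma c_bdd_meas: "k \<ge> 1 \<Longrightarrow> bdd_meas T (c k)"
  using c_prim by (rule prim_bdd_meas)

lemma c_sq_prim: "k \<ge> 1 \<Longrightarrow> prim T (\<lambda>t. (c k t)\<^sup>2) (\<lambda>t. 2 * (c k t * (- \<Lambda> k * c k t + f k t)))"
  using prim_mult[OF c_prim c_prim, of k k] by (simp add: power2_eq_square algebra_simps)

lemma S_nonneg: "0 \<le> S" by (rule integral_nonneg_bdd) simp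

lemma sum_f_sq_le: "finite J \<Longrightarrow> (\<And>k. k \<in> J \<Longrightarrow> k \<ge> 1) \<Longrightarrow> t \<in> {0..T} \<Longrightarrow> (\<Sum>k\<in>J. (f k t)\<^sup>2) \<le> Q\<^sup>2 * nsq (V t)"
  using Bessel[OF L2_q[OF L2_V], of t t J] nsq_q[OF L2_V, of t t] by (meson order_trans)

text \<open>Integrate \<open>(c\<^sup>2)' = - 2 \<Lambda> c\<^sup>2 + 2 c f \<le> - \<Lambda> c\<^sup>2 + f\<^sup>2 / \<Lambda>\<close> from \<open>c(0) = 0\<close>.\<close>

lemma mode_estimate:
  assumes k: "k \<ge> 1" and z: "c k 0 = 0" and pos: "\<Lambda> k > 0"
  shows "(\<Lambda> k)\<^sup>2 * integral {0..T} (\<lambda>t. (c k t)\<^sup>2) \<le> integral {0..T} (\<lambda>t. (f k t)\<^sup>2)"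
proof -
  note b = c_bdd_meas[OF k] f_bdd_meas[OF k]
  have "0 \<le> integral {0..T} (\<lambda>t. 2 * (c k t * (- \<Lambda> k * c k t + f k t)))"
    using primD[OF c_sq_prim[OF k], of T] z T zero_le_power2[of "c k T"] by simp
  also have "\<dots> \<le> integral {0..T} (\<lambda>t. (- \<Lambda> k) * (c k t)\<^sup>2 + (1 / \<Lambda> k) * (f k t)\<^sup>2)"
  proof (rule integral_mono_bdd_meas)
    fix t
    have "2 * (c k t * f k t) \<le> \<Lambda> k * (c k t)\<^sup>2 + (1 / \<Lambda> k) * (f k t)\<^sup>2"
    proof -
      have "0 \<le> (\<Lambda> k * c k t - f k t)\<^sup>2 / \<Lambda> k" using pos by simp
      also have "\<dots> = \<Lambda> k * (c k t)\<^sup>2 + (1 / \<Lambda> k) * (f k t)\<^sup>2 - 2 * (c k t * f k t)"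
        using pos by (simp add: power2_diff field_simps power2_eq_square)
      finally show ?thesis by simp
    qed
    then show "2 * (c k t * (- \<Lambda> k * c k t + f k t)) \<le> (- \<Lambda> k) * (c k t)\<^sup>2 + (1 / \<Lambda> k) * (f k t)\<^sup>2"
      by (simp add: algebra_simps power2_eq_square)
  qed (intro bdd_meas_intros b)+
  also have "\<dots> = (- \<Lambda> k) * integral {0..T} (\<lambda>t. (c k t)\<^sup>2) + (1 / \<Lambda> k) * integral {0..T} (\<lambda>t. (f k t)\<^sup>2)"
    by (subst integral_bdd_meas_add) (intro bdd_meas_intros b | simp)+
  finally have "\<Lambda> k * integral {0..T} (\<lambda>t. (c k t)\<^sup>2) \<le> (1 / \<Lambda> k) * integral {0..T} (\<lambda>t. (f k t)\<^sup>2)" by simp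
  from mult_left_mono[OF this, of "\<Lambda> k"] pos show ?thesis by (simp add: power2_eq_square mult.assoc)
qed

lemma middle_modes:
  assumes mu: "0 < \<mu>" "\<mu> \<le> \<Lambda> (Suc n)" and z: "\<And>k. 1 \<le> k \<Longrightarrow> k < K \<Longrightarrow> c k 0 = 0"
  shows "integral {0..T} (\<lambda>t. \<Sum>k\<in>{Suc n..<K}. (c k t)\<^sup>2) \<le> (Q / \<mu>)\<^sup>2 * S"
proof -
  have "\<mu>\<^sup>2 * integral {0..T} (\<lambda>t. \<Sum>k\<in>{Suc n..<K}. (c k t)\<^sup>2) = (\<Sum>k\<in>{Suc n..<K}. \<mu>\<^sup>2 * integral {0..T} (\<lambda>t. (c k t)\<^sup>2))"
    by (subst integral_bdd_meas_sum) (auto simp: sum_distrib_left intro!: bdd_meas_power c_bdd_meas)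
  also have "\<dots> \<le> (\<Sum>k\<in>{Suc n..<K}. integral {0..T} (\<lambda>t. (f k t)\<^sup>2))"
  proof (rule sum_mono)
    fix k assume k: "k \<in> {Suc n..<K}"
    then have le: "\<mu> \<le> \<Lambda> k" using mu(2) \<Lambda>_mono[of "Suc n" k] by simp
    have "\<mu>\<^sup>2 * integral {0..T} (\<lambda>t. (c k t)\<^sup>2) \<le> (\<Lambda> k)\<^sup>2 * integral {0..T} (\<lambda>t. (c k t)\<^sup>2)"
      using le mu(1) by (intro mult_right_mono power_mono integral_nonneg_bdd) auto
    also have "\<dots> \<le> integral {0..T} (\<lambda>t. (f k t)\<^sup>2)"
      using k le mu(1) by (intro mode_estimate z) auto
    finally show "\<mu>\<^sup>2 * integral {0..T} (\<lambda>t. (c k t)\<^sup>2) \<le> integral {0..T} (\<lambda>t. (f k t)\<^sup>2)" .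
  qed
  also have "\<dots> = integral {0..T} (\<lambda>t. \<Sum>k\<in>{Suc n..<K}. (f k t)\<^sup>2)"
    by (subst integral_bdd_meas_sum) (auto intro!: bdd_meas_power f_bdd_meas)
  also have "\<dots> \<le> integral {0..T} (\<lambda>t. Q\<^sup>2 * nsq (V t))"
    by (intro integral_mono_bdd_meas bdd_meas_sum bdd_meas_power f_bdd_meas bdd_meas_cmult nsq_bdd_meas sum_f_sq_le) auto
  finally show ?thesis using mu(1) by (simp add: power_divide field_simps)
qed

text \<open>Split \<open>V\<close> into modes up to \<open>n\<close>, modes between \<open>n\<close> and \<open>K\<close>, and the rest \<open>r\<close>. Since \<open>r\<close> is orthogonal to
  the modes below \<open>K\<close>, its pairing with \<open>q \<phi>\<^sub>k\<close> sees only the tail of \<open>q \<phi>\<^sub>k\<close>.\<close>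

lemma low_mode_pairing:
  assumes t: "t \<in> {0..T}" and nK: "n < K"
  shows "(\<Sum>k=1..n. c k t * f k t) \<le> Q * (\<Sum>k=1..n. (c k t)\<^sup>2)
    + sqrt (\<Sum>k=1..n. (c k t)\<^sup>2) * (Q * sqrt (\<Sum>k\<in>{Suc n..<K}. (c k t)\<^sup>2) + sqrt (nsq (V t)) * (\<Sum>k=1..n. sqrt (R K k t)))"
proof -
  let ?M = "lebesgue_on \<Omega>"
  define p where "p x = (\<Sum>k=1..n. c k t * \<phi> k x)" for x
  define m where "m x = (\<Sum>k\<in>{Suc n..<K}. c k t * \<phi> k x)" for x
  define r where "r x = V t x - (\<Sum>k\<in>{1..<K}. c k t * \<phi> k x)" for x
  define Y where "Y = sqrt (\<Sum>k=1..n. (c k t)\<^sup>2)"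
  have L: "L2 ?M p" "L2 ?M m" "L2 ?M r" "L2 ?M (V t)"
    unfolding p_def m_def r_def using L2_V[OF t] by (auto intro!: L2_comb L2_diff)
  have split: "V t x = p x + m x + r x" for x
  proof -
    have "{1..<K} = {1..n} \<union> {Suc n..<K}" using nK by auto
    then have "(\<Sum>k\<in>{1..<K}. c k t * \<phi> k x) = p x + m x"
      unfolding p_def m_def by (simp only:) (subst sum.union_disjoint, auto)
    then show ?thesis by (simp add: r_def)
  qed
  have np: "nsq p = (\<Sum>k=1..n. (c k t)\<^sup>2)" and nm: "nsq m = (\<Sum>k\<in>{Suc n..<K}. (c k t)\<^sup>2)"
    unfolding p_def m_def by (rule integral_comb_sq; auto)+
  have nr: "nsq r \<le> nsq (V t)"
    unfolding r_def using integral_minus_projection_sq[OF L(4), of "{1..<K}"] by (auto intro: sum_nonneg)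
  have "(\<Sum>k=1..n. c k t * f k t) = (LINT x|?M. (q t x * V t x) * p x)"
    unfolding p_def by (subst integral_mult_comb[OF L2_q[OF L(4) t]]) auto
  also have "\<dots> = (LINT x|?M. (q t x * p x) * p x + (q t x * m x) * p x + r x * (q t x * p x))"
    by (simp add: split algebra_simps)
  also have "\<dots> = (LINT x|?M. (q t x * p x) * p x) + (LINT x|?M. (q t x * m x) * p x) + (LINT x|?M. r x * (q t x * p x))"
    using L2_mult_integrable[OF L2_q[OF L(1) t] L(1)] L2_mult_integrable[OF L2_q[OF L(2) t] L(1)]
      L2_mult_integrable[OF L(3) L2_q[OF L(1) t]] by simp
  finally have eq: "(\<Sum>k=1..n. c k t * f k t) = \<dots>" .
  have sq: "sqrt (nsq (\<lambda>x. q t x * g x)) \<le> Q * sqrt (nsq g)" if "L2 ?M g" for g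
    using real_sqrt_le_mono[OF nsq_q[OF that t]] Q by (simp add: real_sqrt_mult)
  have 1: "(LINT x|?M. (q t x * p x) * p x) \<le> Q * (\<Sum>k=1..n. (c k t)\<^sup>2)"
  proof -
    have "(LINT x|?M. (q t x * p x) * p x) \<le> sqrt (nsq (\<lambda>x. q t x * p x)) * sqrt (nsq p)"
      using L2_Cauchy_Schwarz_sqrt[OF L2_q[OF L(1) t] L(1)] by linarith
    also have "\<dots> \<le> (Q * sqrt (nsq p)) * sqrt (nsq p)" by (intro mult_right_mono sq L) simp
    finally show ?thesis by (simp add: np mult.assoc sum_nonneg)
  qed
  have 2: "(LINT x|?M. (q t x * m x) * p x) \<le> Y * (Q * sqrt (\<Sum>k\<in>{Suc n..<K}. (c k t)\<^sup>2))"
  proof -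
    have "(LINT x|?M. (q t x * m x) * p x) \<le> sqrt (nsq (\<lambda>x. q t x * m x)) * sqrt (nsq p)"
      using L2_Cauchy_Schwarz_sqrt[OF L2_q[OF L(2) t] L(1)] by linarith
    also have "\<dots> \<le> (Q * sqrt (nsq m)) * sqrt (nsq p)" by (intro mult_right_mono sq L) simp
    finally show ?thesis by (simp add: np nm Y_def mult.commute)
  qed
  have rk: "\<bar>LINT x|?M. r x * (q t x * \<phi> k x)\<bar> \<le> sqrt (nsq (V t)) * sqrt (R K k t)" if k: "k \<ge> 1" for k
  proof -
    let ?g = "\<lambda>x. q t x * \<phi> k x"
    let ?P = "\<lambda>x. \<Sum>i\<in>{1..<K}. coef ?g i * \<phi> i x"
    have g: "L2 ?M ?g" by (intro L2_q L2_basis k t)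
    have P: "L2 ?M ?P" by (rule L2_comb) auto
    have "(LINT x|?M. r x * ?P x) = (\<Sum>i\<in>{1..<K}. coef ?g i * coef r i)"
      by (rule integral_mult_comb[OF L(3)]) auto
    also have "\<dots> = 0"
    proof (rule sum.neutral, rule ballI)
      fix i assume i: "i \<in> {1..<K}"
      have "coef r i = c i t - coef (\<lambda>x. \<Sum>k\<in>{1..<K}. c k t * \<phi> k x) i"
        unfolding r_def using i L(4) by (intro coef_diff L2_comb) auto
      also have "\<dots> = 0" using i by (subst coef_comb) auto
      finally show "coef ?g i * coef r i = 0" by simp
    qed
    finally have "(LINT x|?M. r x * ?g x) = (LINT x|?M. r x * (?g x - ?P x))"
      using L2_mult_integrable[OF L(3) g] L2_mult_integrable[OF L(3) P] by (simp add: right_diff_distrib)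
    moreover have "\<bar>LINT x|?M. r x * (?g x - ?P x)\<bar> \<le> sqrt (nsq r) * sqrt (nsq (\<lambda>x. ?g x - ?P x))"
      by (intro L2_Cauchy_Schwarz_sqrt L L2_diff g P)
    moreover have "nsq (\<lambda>x. ?g x - ?P x) = R K k t"
      unfolding R_def by (intro integral_minus_projection_sq g) auto
    ultimately have "\<bar>LINT x|?M. r x * ?g x\<bar> \<le> sqrt (nsq r) * sqrt (R K k t)" by simp
    also have "\<dots> \<le> sqrt (nsq (V t)) * sqrt (R K k t)"
      using nr R_nonneg[OF k t] by (intro mult_right_mono real_sqrt_le_mono) auto
    finally show ?thesis .
  qed
  have cY: "\<bar>c k t\<bar> \<le> Y" if "k \<in> {1..n}" for k
    unfolding Y_def using member_le_sum[OF that, of "\<lambda>k. (c k t)\<^sup>2"] by (intro real_le_rsqrt) simp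
  have 3: "(LINT x|?M. r x * (q t x * p x)) \<le> Y * (sqrt (nsq (V t)) * (\<Sum>k=1..n. sqrt (R K k t)))"
  proof -
    have "(LINT x|?M. r x * (q t x * p x)) = (LINT x|?M. (\<Sum>k=1..n. c k t * (r x * (q t x * \<phi> k x))))"
      unfolding p_def by (simp add: sum_distrib_left mult_ac)
    also have "\<dots> = (\<Sum>k=1..n. (LINT x|?M. c k t * (r x * (q t x * \<phi> k x))))"
      using L t by (intro LINT_sum integrable_mult_right L2_mult_integrable L2_q L2_basis) auto
    also have "\<dots> \<le> (\<Sum>k=1..n. Y * (sqrt (nsq (V t)) * sqrt (R K k t)))"
    proof (rule sum_mono)
      fix k assume k: "k \<in> {1..n}"
      then have "\<bar>c k t * (LINT x|?M. r x * (q t x * \<phi> k x))\<bar> \<le> Y * (sqrt (nsq (V t)) * sqrt (R K k t))"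
        unfolding abs_mult using cY[OF k] rk[of k] by (intro mult_mono) auto
      then show "(LINT x|?M. c k t * (r x * (q t x * \<phi> k x))) \<le> Y * (sqrt (nsq (V t)) * sqrt (R K k t))"
        by simp
    qed
    finally show ?thesis by (simp add: sum_distrib_left)
  qed
  show ?thesis using 1 2 3 unfolding eq Y_def[symmetric] by (simp add: distrib_left)
qed

text \<open>Let \<open>Y\<close> be the maximum over time of the norm of the low modes. Their square satisfies a Gronwall
  inequality with source at most \<open>2 Y g\<close>, where \<open>g\<close> collects the middle and the high modes; a factor \<open>Y\<close> cancels.\<close>

lemma low_modes_estimate:
  assumes mu: "0 < \<mu>" "\<mu> \<le> \<Lambda> (Suc n)" and nK: "n < K" and z: "\<And>k. 1 \<le> k \<Longrightarrow> k < K \<Longrightarrow> c k 0 = 0"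
    and j: "j \<in> {1..n}"
  shows "integral {0..T} (\<lambda>t. (c j t)\<^sup>2) \<le>
    T * (2 * exp (2 * Q * T) * (Q\<^sup>2 * sqrt T / \<mu> + (\<Sum>k=1..n. sqrt (integral {0..T} (R K k)))))\<^sup>2 * S"
proof -
  define y where "y t = (\<Sum>k=1..n. (c k t)\<^sup>2)" for t
  define md where "md t = sqrt (\<Sum>k\<in>{Suc n..<K}. (c k t)\<^sup>2)" for t
  \<comment> \<open>The source of the Gronwall inequality: middle modes and tails.\<close>
  define g where "g t = Q * md t + sqrt (nsq (V t)) * (\<Sum>k=1..n. sqrt (R K k t))" for t
  define \<Gamma>g where "\<Gamma>g = integral {0..T} g"
  have y_prim: "prim T y (\<lambda>t. \<Sum>k=1..n. 2 * (c k t * (- \<Lambda> k * c k t + f k t)))"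
    unfolding y_def by (intro prim_sum c_sq_prim) simp
  have yc: "continuous_on {0..T} y" by (rule prim_continuous_on[OF y_prim])
  have y0: "y 0 = 0" unfolding y_def using nK by (intro sum.neutral) (auto simp: z)
  have yn: "0 \<le> y t" for t by (simp add: y_def sum_nonneg)
  have bmd: "bdd_meas T md"
    unfolding md_def by (intro bdd_meas_sqrt bdd_meas_sum bdd_meas_power c_bdd_meas) simp
  have bR: "bdd_meas T (\<lambda>t. sqrt (R K k t))" if "k \<ge> 1" for k by (intro bdd_meas_sqrt R_bdd_meas that)
  have bg: "bdd_meas T g"
    unfolding g_def by (intro bdd_meas_add bdd_meas_mult bdd_meas_const bmd bdd_meas_sqrt nsq_bdd_meas bdd_meas_sum bR) simp
  have gn: "0 \<le> g t" if "t \<in> {0..T}" for t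
    using Q R_nonneg[OF _ that] by (auto simp: g_def md_def intro!: add_nonneg_nonneg mult_nonneg_nonneg sum_nonneg)
  obtain s where s: "s \<in> {0..T}" "\<And>t. t \<in> {0..T} \<Longrightarrow> y t \<le> y s"
    using continuous_attains_sup[OF compact_Icc _ yc] T by fastforce
  define Y where "Y = sqrt (y s)"
  have Y: "Y \<ge> 0" "Y\<^sup>2 = y s" by (simp_all add: Y_def yn)
  have yle: "y t \<le> 2 * Y * \<Gamma>g + (2 * Q) * integral {0..t} y" if t: "t \<in> {0..T}" for t
  proof -
    have "y t = integral {0..t} (\<lambda>t. \<Sum>k=1..n. 2 * (c k t * (- \<Lambda> k * c k t + f k t)))"
      using primD[OF y_prim t] y0 by simp
    also have "\<dots> \<le> integral {0..t} (\<lambda>t. 2 * Q * y t + 2 * Y * g t)"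
    proof (rule integral_le)
      show "(\<lambda>t. \<Sum>k=1..n. 2 * (c k t * (- \<Lambda> k * c k t + f k t))) integrable_on {0..t}"
        using y_prim t by (intro bdd_meas_integrable_on[of T]) (auto simp: prim_def)
      show "(\<lambda>t. 2 * Q * y t + 2 * Y * g t) integrable_on {0..t}"
        using t by (intro bdd_meas_integrable_on[of T] bdd_meas_add bdd_meas_cmult bg prim_bdd_meas[OF y_prim]) auto
      fix r assume "r \<in> {0..t}"
      then have r: "r \<in> {0..T}" using t by auto
      have "(\<Sum>k=1..n. 2 * (c k r * (- \<Lambda> k * c k r + f k r))) \<le> (\<Sum>k=1..n. 2 * (c k r * f k r))"
      proof (rule sum_mono)
        fix k assume "k \<in> {1..n}"
        then have "0 \<le> \<Lambda> k * (c k r)\<^sup>2" using \<Lambda>_ge_0[of k] by simp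
        then show "2 * (c k r * (- \<Lambda> k * c k r + f k r)) \<le> 2 * (c k r * f k r)"
          by (simp add: algebra_simps power2_eq_square)
      qed
      also have "\<dots> = 2 * (\<Sum>k=1..n. c k r * f k r)" by (simp add: sum_distrib_left)
      also have "\<dots> \<le> 2 * (Q * y r + sqrt (y r) * g r)"
        using low_mode_pairing[OF r nK] unfolding y_def g_def md_def by (intro mult_left_mono) simp_all
      also have "\<dots> \<le> 2 * (Q * y r + Y * g r)"
        using s(2)[OF r] gn[OF r] by (simp add: Y_def mult_right_mono)
      finally show "(\<Sum>k=1..n. 2 * (c k r * (- \<Lambda> k * c k r + f k r))) \<le> 2 * Q * y r + 2 * Y * g r" by simp
    qed
    also have "\<dots> = 2 * Q * integral {0..t} y + 2 * Y * integral {0..t} g"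
      using t prim_bdd_meas[OF y_prim] bg
      by (subst HK_add) (auto intro!: bdd_meas_integrable_on[of T] bdd_meas_cmult)
    also have "integral {0..t} g \<le> \<Gamma>g"
      unfolding \<Gamma>g_def using t gn by (intro integral_subset_le bdd_meas_integrable_on[OF bg]) auto
    then have "2 * Y * integral {0..t} g \<le> 2 * Y * \<Gamma>g" using Y(1) by (intro mult_left_mono) auto
    finally show ?thesis by simp
  qed
  have \<Gamma>n: "0 \<le> \<Gamma>g" unfolding \<Gamma>g_def by (rule integral_nonneg_bdd) (rule gn)
  have "y s \<le> (2 * Y * \<Gamma>g) * exp ((2 * Q) * s)"
    using integral_Gronwall[OF yc _ yle s(1)] Q by simp
  also have "\<dots> \<le> (2 * Y * \<Gamma>g) * exp (2 * Q * T)"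
  proof (rule mult_left_mono)
    show "exp (2 * Q * s) \<le> exp (2 * Q * T)" using s(1) Q by (simp add: mult_left_mono)
    show "0 \<le> 2 * Y * \<Gamma>g" using Y(1) \<Gamma>n by simp
  qed
  finally have ysT: "y s \<le> (2 * Y * \<Gamma>g) * exp (2 * Q * T)" .
  have Yle: "Y \<le> 2 * exp (2 * Q * T) * \<Gamma>g"
  proof (cases "Y = 0")
    case True
    then show ?thesis using \<Gamma>n by simp
  next
    case False
    have "Y * Y \<le> Y * (2 * exp (2 * Q * T) * \<Gamma>g)" using ysT Y(2) by (simp add: power2_eq_square mult_ac)
    then show ?thesis using False Y(1) by (simp add: mult_le_cancel_left)
  qed
  have "\<Gamma>g \<le> (Q\<^sup>2 * sqrt T / \<mu> + (\<Sum>k=1..n. sqrt (integral {0..T} (R K k)))) * sqrt S"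
  proof -
    have "\<Gamma>g = Q * integral {0..T} md + (\<Sum>k=1..n. integral {0..T} (\<lambda>t. sqrt (nsq (V t)) * sqrt (R K k t)))"
    proof -
      have "\<Gamma>g = integral {0..T} (\<lambda>t. Q * md t + (\<Sum>k=1..n. sqrt (nsq (V t)) * sqrt (R K k t)))"
        by (simp add: \<Gamma>g_def g_def[abs_def] sum_distrib_left)
      also have "\<dots> = integral {0..T} (\<lambda>t. Q * md t) + integral {0..T} (\<lambda>t. \<Sum>k=1..n. sqrt (nsq (V t)) * sqrt (R K k t))"
        by (intro integral_bdd_meas_add bdd_meas_cmult bmd bdd_meas_sum bdd_meas_mult bdd_meas_sqrt nsq_bdd_meas R_bdd_meas) simp
      also have "integral {0..T} (\<lambda>t. \<Sum>k=1..n. sqrt (nsq (V t)) * sqrt (R K k t)) = (\<Sum>k=1..n. integral {0..T} (\<lambda>t. sqrt (nsq (V t)) * sqrt (R K k t)))"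
        by (intro integral_bdd_meas_sum bdd_meas_mult bdd_meas_sqrt nsq_bdd_meas R_bdd_meas) auto
      finally show ?thesis by simp
    qed
    moreover have "Q * integral {0..T} md \<le> (Q\<^sup>2 * sqrt T / \<mu>) * sqrt S"
    proof -
      have "integral {0..T} md \<le> sqrt (integral {0..T} (\<lambda>t. (md t)\<^sup>2)) * sqrt (integral {0..T} (\<lambda>t. 1\<^sup>2))"
        using integral_sq_Cauchy_Schwarz[OF bmd bdd_meas_const, of 1] by simp
      also have "(\<lambda>t. (md t)\<^sup>2) = (\<lambda>t. \<Sum>k\<in>{Suc n..<K}. (c k t)\<^sup>2)"
        by (simp add: md_def sum_nonneg)
      also have "sqrt (integral {0..T} (\<lambda>t. \<Sum>k\<in>{Suc n..<K}. (c k t)\<^sup>2)) * sqrt (integral {0..T} (\<lambda>t. 1\<^sup>2)) \<le> sqrt ((Q / \<mu>)\<^sup>2 * S) * sqrt T"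
        using middle_modes[where K=K, OF mu z] T S_nonneg by (intro mult_mono real_sqrt_le_mono) auto
      also have "\<dots> = (Q / \<mu> * sqrt S) * sqrt T" using Q mu(1) by (simp add: real_sqrt_mult)
      finally have "Q * integral {0..T} md \<le> Q * ((Q / \<mu> * sqrt S) * sqrt T)" using Q by (rule mult_left_mono)
      then show ?thesis by (simp add: power2_eq_square mult_ac)
    qed
    moreover have "integral {0..T} (\<lambda>t. sqrt (nsq (V t)) * sqrt (R K k t)) \<le> sqrt (integral {0..T} (R K k)) * sqrt S" if k: "k \<in> {1..n}" for k
    proof -
      have "integral {0..T} (\<lambda>t. sqrt (nsq (V t)) * sqrt (R K k t)) \<le>
          sqrt (integral {0..T} (\<lambda>t. (sqrt (nsq (V t)))\<^sup>2)) * sqrt (integral {0..T} (\<lambda>t. (sqrt (R K k t))\<^sup>2))"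
        using integral_sq_Cauchy_Schwarz[OF bdd_meas_sqrt[OF nsq_bdd_meas] bR[of k]] k by auto
      also have "integral {0..T} (\<lambda>t. (sqrt (R K k t))\<^sup>2) = integral {0..T} (R K k)"
        using R_nonneg k by (intro HK_cong) auto
      finally show ?thesis by (simp add: mult.commute)
    qed
    then have "(\<Sum>k=1..n. integral {0..T} (\<lambda>t. sqrt (nsq (V t)) * sqrt (R K k t))) \<le> (\<Sum>k=1..n. sqrt (integral {0..T} (R K k)) * sqrt S)"
      by (rule sum_mono)
    ultimately show ?thesis by (simp add: distrib_right sum_distrib_right)
  qed
  then have "2 * exp (2 * Q * T) * \<Gamma>g \<le> 2 * exp (2 * Q * T) * (Q\<^sup>2 * sqrt T / \<mu> + (\<Sum>k=1..n. sqrt (integral {0..T} (R K k)))) * sqrt S" (is "_ \<le> ?B * sqrt S")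
    by (simp add: mult.assoc)
  with Yle have "Y \<le> ?B * sqrt S" by linarith
  then have "Y\<^sup>2 \<le> (?B * sqrt S)\<^sup>2" using Y(1) by (intro power_mono)
  then have ys: "y s \<le> ?B\<^sup>2 * S" using Y(2) S_nonneg by (simp add: power_mult_distrib)
  have "integral {0..T} (\<lambda>t. (c j t)\<^sup>2) \<le> integral {0..T} (\<lambda>t. ?B\<^sup>2 * S)"
  proof (intro integral_mono_bdd_meas bdd_meas_power c_bdd_meas bdd_meas_const)
    show "(c j t)\<^sup>2 \<le> ?B\<^sup>2 * S" if "t \<in> {0..T}" for t
      using member_le_sum[OF j, of "\<lambda>k. (c k t)\<^sup>2"] s(2)[OF that] ys by (simp add: y_def)
  qed (use j in auto)
  then show ?thesis using T by (simp add: mult_ac)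
qed


lemma bilinear_comb:
  assumes "\<zeta> \<in> test_functions UNIV"
  shows "(\<Sum>j=1..n. \<Sum>k=1..n. (LINT x|lebesgue_on \<Omega>. (\<zeta> x * \<phi> j x) * (\<zeta> x * \<phi> k x)) * (a j * b k)) =
    (LINT x|lebesgue_on \<Omega>. (\<zeta> x)\<^sup>2 * (\<Sum>j=1..n. a j * \<phi> j x) * (\<Sum>k=1..n. b k * \<phi> k x))"
proof -
  let ?M = "lebesgue_on \<Omega>"
  have i: "integrable ?M (\<lambda>x. (\<zeta> x * \<phi> j x) * (\<zeta> x * \<phi> k x) * (a j * b k))" if "j \<in> {1..n}" "k \<in> {1..n}" for j k
    using that by (intro integrable_mult_left L2_mult_integrable L2_test_mult[OF assms] L2_basis) auto
  have "(LINT x|?M. (\<zeta> x)\<^sup>2 * (\<Sum>j=1..n. a j * \<phi> j x) * (\<Sum>k=1..n. b k * \<phi> k x))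
      = (LINT x|?M. (\<Sum>j=1..n. \<Sum>k=1..n. (\<zeta> x * \<phi> j x) * (\<zeta> x * \<phi> k x) * (a j * b k)))"
  proof (intro LINT_cong refl)
    fix x
    have "(\<zeta> x)\<^sup>2 * (\<Sum>j=1..n. a j * \<phi> j x) * (\<Sum>k=1..n. b k * \<phi> k x)
        = (\<zeta> x)\<^sup>2 * (\<Sum>j=1..n. \<Sum>k=1..n. (a j * \<phi> j x) * (b k * \<phi> k x))"
      by (simp only: sum_product mult.assoc)
    also have "\<dots> = (\<Sum>j=1..n. \<Sum>k=1..n. (\<zeta> x * \<phi> j x) * (\<zeta> x * \<phi> k x) * (a j * b k))"
      by (simp add: sum_distrib_left power2_eq_square mult_ac)
    finally show "(\<zeta> x)\<^sup>2 * (\<Sum>j=1..n. a j * \<phi> j x) * (\<Sum>k=1..n. b k * \<phi> k x)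
        = (\<Sum>j=1..n. \<Sum>k=1..n. (\<zeta> x * \<phi> j x) * (\<zeta> x * \<phi> k x) * (a j * b k))" .
  qed
  also have "\<dots> = (\<Sum>j=1..n. \<Sum>k=1..n. (LINT x|?M. (\<zeta> x * \<phi> j x) * (\<zeta> x * \<phi> k x) * (a j * b k)))"
    using i by (subst LINT_sum, intro Bochner_Integration.integrable_sum, assumption)
       (intro sum.cong refl LINT_sum, assumption)
  finally show ?thesis by simp
qed

text \<open>For a finite combination \<open>u\<close> of the modes, \<open>E(t) = \<theta>\<^sup>2 \<integral> (\<zeta> u)\<^sup>2\<close> is a quadratic form in the
  functions \<open>\<theta> c\<^sub>k\<close> and may be differentiated by the product rule. Its derivative contains
  \<open>- 2 \<theta>\<^sup>2 \<integral> \<zeta>\<^sup>2 u (- \<Delta> u)\<close>, to which the localized energy estimate applies; all other terms are bounded by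
  the mass of the solution.\<close>

lemma weighted_energy_partial:
  assumes \<zeta>: "\<zeta> \<in> test_functions UNIV" and Z: "\<And>x. \<bar>\<zeta> x\<bar> \<le> Z" "\<And>x. norm (grad \<zeta> x) \<le> Z"
    and \<theta>: "prim T \<theta> \<theta>'" and A: "\<And>t. t \<in> {0..T} \<Longrightarrow> \<bar>\<theta> t\<bar> \<le> A" "\<And>t. t \<in> {0..T} \<Longrightarrow> \<bar>\<theta>' t\<bar> \<le> A"
  shows "(\<Sum>m=1..l. \<Lambda> m * integral {0..T} (\<lambda>t. (\<theta> t)\<^sup>2 * (coef (\<lambda>x. \<zeta> x * (\<Sum>k=1..n. c k t * \<phi> k x)) m)\<^sup>2)) \<le>
    (\<theta> 0)\<^sup>2 * nsq (\<lambda>x. \<zeta> x * (\<Sum>k=1..n. coef h k * \<phi> k x)) + A\<^sup>2 * Z\<^sup>2 * (2 + Q) * S"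
proof -
  let ?M = "lebesgue_on \<Omega>"
  define u where "u t x = (\<Sum>k=1..n. c k t * \<phi> k x)" for t x
  define F where "F t x = (\<Sum>k=1..n. f k t * \<phi> k x)" for t x
  define g where "g k t = - \<Lambda> k * c k t + f k t" for k t
  define B where "B j k = (LINT x|?M. (\<zeta> x * \<phi> j x) * (\<zeta> x * \<phi> k x))" for j k
  define E where "E t = (\<Sum>j=1..n. \<Sum>k=1..n. B j k * ((\<theta> t * c j t) * (\<theta> t * c k t)))" for t
  define e where "e t = (\<Sum>j=1..n. \<Sum>k=1..n. B j k * ((\<theta> t * c j t) * (\<theta> t * g k t + \<theta>' t * c k t) + (\<theta> t * g j t + \<theta>' t * c j t) * (\<theta> t * c k t)))" for t
  define D where "D t = (\<Sum>m=1..l. \<Lambda> m * ((\<theta> t)\<^sup>2 * (coef (\<lambda>x. \<zeta> x * u t x) m)\<^sup>2))" for t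
  have Z0: "Z \<ge> 0" using Z(1)[of 0] by simp
  have Lu: "L2 ?M (u t)" "L2 ?M (F t)" for t unfolding u_def F_def by (rule L2_comb; simp)+
  have Eprim: "prim T E e"
    unfolding E_def e_def g_def by (intro prim_sum prim_cmult prim_mult \<theta> c_prim) auto
  have Eeq: "E t = (\<theta> t)\<^sup>2 * nsq (\<lambda>x. \<zeta> x * u t x)" for t
  proof -
    have "E t = (\<theta> t)\<^sup>2 * (\<Sum>j=1..n. \<Sum>k=1..n. B j k * (c j t * c k t))"
      by (simp add: E_def sum_distrib_left power2_eq_square mult_ac)
    then show ?thesis unfolding B_def bilinear_comb[OF \<zeta>] by (simp add: u_def power_mult_distrib power2_eq_square mult_ac)
  qed
  have sym: "B j k = B k j" for j k by (simp add: B_def mult.commute)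
  have nu: "nsq (u t) \<le> nsq (V t)" if t: "t \<in> {0..T}" for t
    unfolding u_def by (subst integral_comb_sq) (auto intro!: Bessel L2_V[OF t])
  have nF: "nsq (F t) \<le> Q\<^sup>2 * nsq (V t)" if t: "t \<in> {0..T}" for t
    unfolding F_def by (subst integral_comb_sq) (auto intro!: sum_f_sq_le t)
  have nz: "nsq (\<lambda>x. \<zeta> x * w x) \<le> Z\<^sup>2 * nsq w" if w: "L2 ?M w" for w
  proof -
    have "nsq (\<lambda>x. \<zeta> x * w x) \<le> (LINT x|?M. Z\<^sup>2 * (w x)\<^sup>2)"
    proof (rule integral_mono)
      show "(\<zeta> x * w x)\<^sup>2 \<le> Z\<^sup>2 * (w x)\<^sup>2" for x
        using power_mono[OF Z(1)[of x] abs_ge_zero, of 2] by (simp add: power_mult_distrib mult_right_mono)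
    qed (use L2_real_sq[OF L2_test_mult(1)[OF \<zeta> w]] L2_real_sq[OF w] in auto)
    then show ?thesis by simp
  qed
  have ele: "e t \<le> 2 * (A\<^sup>2 * Z\<^sup>2 * (2 + Q) * nsq (V t)) - 2 * D t" if t: "t \<in> {0..T}" for t
  proof -
    have N0: "0 \<le> nsq (V t)" by simp
    have A2: "(\<theta> t)\<^sup>2 \<le> A\<^sup>2" using power_mono[OF A(1)[OF t] abs_ge_zero, of 2] by simp
    have "\<theta> t * \<theta>' t \<le> \<bar>\<theta> t\<bar> * \<bar>\<theta>' t\<bar>" by (simp flip: abs_mult)
    also have "\<dots> \<le> A * A" using A[OF t] by (intro mult_mono) auto
    finally have A3: "\<theta> t * \<theta>' t \<le> A\<^sup>2" by (simp add: power2_eq_square)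
    have "e t = 2 * (\<Sum>j=1..n. \<Sum>k=1..n. B j k * ((\<theta> t * c j t) * (\<theta> t * g k t + \<theta>' t * c k t)))"
    proof -
      have "(\<Sum>j=1..n. \<Sum>k=1..n. B j k * ((\<theta> t * g j t + \<theta>' t * c j t) * (\<theta> t * c k t)))
        = (\<Sum>j=1..n. \<Sum>k=1..n. B j k * ((\<theta> t * c j t) * (\<theta> t * g k t + \<theta>' t * c k t)))"
        by (subst sum.swap) (intro sum.cong refl, simp add: sym mult.commute)
      then show ?thesis by (simp add: e_def distrib_left[of "B _ _"] sum.distrib)
    qed
    also have "(\<Sum>j=1..n. \<Sum>k=1..n. B j k * ((\<theta> t * c j t) * (\<theta> t * g k t + \<theta>' t * c k t)))
      = \<theta> t * \<theta>' t * (\<Sum>j=1..n. \<Sum>k=1..n. B j k * (c j t * c k t)) + (\<theta> t)\<^sup>2 * (\<Sum>j=1..n. \<Sum>k=1..n. B j k * (c j t * g k t))"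
      by (simp add: sum_distrib_left sum.distrib[symmetric] power2_eq_square algebra_simps)
    also have "(\<Sum>j=1..n. \<Sum>k=1..n. B j k * (c j t * c k t)) = nsq (\<lambda>x. \<zeta> x * u t x)"
      unfolding B_def bilinear_comb[OF \<zeta>] by (simp add: u_def power2_eq_square mult_ac)
    also have "(\<Sum>j=1..n. \<Sum>k=1..n. B j k * (c j t * g k t)) =
       (LINT x|?M. (\<zeta> x * u t x) * (\<zeta> x * F t x)) - (LINT x|?M. (\<zeta> x)\<^sup>2 * u t x * (\<Sum>k=1..n. \<Lambda> k * c k t * \<phi> k x))"
    proof -
      have L: "L2 ?M (\<lambda>x. \<Sum>k=1..n. \<Lambda> k * c k t * \<phi> k x)" by (rule L2_comb) simp
      have "(\<Sum>j=1..n. \<Sum>k=1..n. B j k * (c j t * g k t)) = (LINT x|?M. (\<zeta> x)\<^sup>2 * u t x * (\<Sum>k=1..n. g k t * \<phi> k x))"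
        unfolding B_def bilinear_comb[OF \<zeta>] by (simp add: u_def)
      also have "\<dots> = (LINT x|?M. (\<zeta> x * u t x) * (\<zeta> x * F t x) - (\<zeta> x * u t x) * (\<zeta> x * (\<Sum>k=1..n. \<Lambda> k * c k t * \<phi> k x)))"
      proof (intro LINT_cong refl)
        fix x
        have "(\<Sum>k=1..n. g k t * \<phi> k x) = F t x - (\<Sum>k=1..n. \<Lambda> k * c k t * \<phi> k x)"
          by (simp add: g_def F_def sum_subtractf[symmetric] algebra_simps)
        moreover have "z\<^sup>2 * y * (a - b) = (z * y) * (z * a) - (z * y) * (z * b)" for z y a b :: real
          by (simp add: power2_eq_square algebra_simps)
        ultimately show "(\<zeta> x)\<^sup>2 * u t x * (\<Sum>k=1..n. g k t * \<phi> k x) = (\<zeta> x * u t x) * (\<zeta> x * F t x) - (\<zeta> x * u t x) * (\<zeta> x * (\<Sum>k=1..n. \<Lambda> k * c k t * \<phi> k x))"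
          by (simp only:)
      qed
      also have "\<dots> = (LINT x|?M. (\<zeta> x * u t x) * (\<zeta> x * F t x)) - (LINT x|?M. (\<zeta> x * u t x) * (\<zeta> x * (\<Sum>k=1..n. \<Lambda> k * c k t * \<phi> k x)))"
        by (intro LINT_diff L2_mult_integrable L2_test_mult[OF \<zeta>] Lu L)
      finally show ?thesis by (simp add: power2_eq_square mult_ac)
    qed
    finally have e_eq: "e t = 2 * (\<theta> t * \<theta>' t * nsq (\<lambda>x. \<zeta> x * u t x) + (\<theta> t)\<^sup>2 *
       ((LINT x|?M. (\<zeta> x * u t x) * (\<zeta> x * F t x)) - (LINT x|?M. (\<zeta> x)\<^sup>2 * u t x * (\<Sum>k=1..n. \<Lambda> k * c k t * \<phi> k x))))" .
    have t1: "\<theta> t * \<theta>' t * nsq (\<lambda>x. \<zeta> x * u t x) \<le> A\<^sup>2 * (Z\<^sup>2 * nsq (V t))"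
    proof -
      have "nsq (\<lambda>x. \<zeta> x * u t x) \<le> Z\<^sup>2 * nsq (V t)"
        using nz[OF Lu(1), of t] mult_left_mono[OF nu[OF t], of "Z\<^sup>2"] by simp
      then show ?thesis using A3 by (intro mult_mono) auto
    qed
    have gradle: "(LINT x|?M. (norm (grad \<zeta> x))\<^sup>2 * (u t x)\<^sup>2) \<le> Z\<^sup>2 * nsq (V t)"
    proof -
      have "(LINT x|?M. (norm (grad \<zeta> x))\<^sup>2 * (u t x)\<^sup>2) \<le> (LINT x|?M. Z\<^sup>2 * (u t x)\<^sup>2)"
      proof (rule integral_mono)
        show "integrable ?M (\<lambda>x. (norm (grad \<zeta> x))\<^sup>2 * (u t x)\<^sup>2)"
          using L2_integrable_sq[OF L2_test_mult(3)[OF \<zeta> Lu(1), of t]] by (simp add: power_mult_distrib mult.commute)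
        show "integrable ?M (\<lambda>x. Z\<^sup>2 * (u t x)\<^sup>2)" using L2_real_sq[OF Lu(1)] by simp
        show "(norm (grad \<zeta> x))\<^sup>2 * (u t x)\<^sup>2 \<le> Z\<^sup>2 * (u t x)\<^sup>2" for x
          using Z(2)[of x] by (intro mult_right_mono power_mono) auto
      qed
      also have "\<dots> \<le> Z\<^sup>2 * nsq (V t)" using nu[OF t] by (simp add: mult_left_mono)
      finally show ?thesis .
    qed
    have Fle: "(LINT x|?M. (\<zeta> x * u t x) * (\<zeta> x * F t x)) \<le> Z\<^sup>2 * Q * nsq (V t)"
    proof -
      have "(LINT x|?M. (\<zeta> x * u t x) * (\<zeta> x * F t x)) \<le> sqrt (nsq (\<lambda>x. \<zeta> x * u t x)) * sqrt (nsq (\<lambda>x. \<zeta> x * F t x))"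
        using L2_Cauchy_Schwarz_sqrt[OF L2_test_mult(1)[OF \<zeta> Lu(1)] L2_test_mult(1)[OF \<zeta> Lu(2)], of t t] by linarith
      also have "\<dots> \<le> sqrt (Z\<^sup>2 * nsq (V t)) * sqrt (Z\<^sup>2 * (Q\<^sup>2 * nsq (V t)))"
      proof (intro mult_mono real_sqrt_le_mono)
        show "nsq (\<lambda>x. \<zeta> x * u t x) \<le> Z\<^sup>2 * nsq (V t)"
          using nz[OF Lu(1), of t] mult_left_mono[OF nu[OF t], of "Z\<^sup>2"] by simp
        show "nsq (\<lambda>x. \<zeta> x * F t x) \<le> Z\<^sup>2 * (Q\<^sup>2 * nsq (V t))"
          using nz[OF Lu(2), of t] mult_left_mono[OF nF[OF t], of "Z\<^sup>2"] by simp
      qed auto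
      also have "\<dots> = Z\<^sup>2 * Q * nsq (V t)"
        using Z0 Q by (simp add: real_sqrt_mult power2_eq_square)
      finally show ?thesis .
    qed
    have DD: "D t = (\<theta> t)\<^sup>2 * (\<Sum>m=1..l. \<Lambda> m * (coef (\<lambda>x. \<zeta> x * u t x) m)\<^sup>2)"
      by (simp add: D_def sum_distrib_left mult_ac)
    have "(LINT x|?M. (\<zeta> x * u t x) * (\<zeta> x * F t x)) - (LINT x|?M. (\<zeta> x)\<^sup>2 * u t x * (\<Sum>k=1..n. \<Lambda> k * c k t * \<phi> k x))
       \<le> Z\<^sup>2 * (1 + Q) * nsq (V t) - (\<Sum>m=1..l. \<Lambda> m * (coef (\<lambda>x. \<zeta> x * u t x) m)\<^sup>2)"
    proof -
      have "Z\<^sup>2 * (1 + Q) * nsq (V t) = Z\<^sup>2 * nsq (V t) + Z\<^sup>2 * Q * nsq (V t)" by (simp add: algebra_simps)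
      with localized_energy[OF \<zeta>, where l=l and n=n and c="\<lambda>k. c k t", folded u_def] gradle Fle
      show ?thesis by linarith
    qed
    then have "(\<theta> t)\<^sup>2 * ((LINT x|?M. (\<zeta> x * u t x) * (\<zeta> x * F t x)) - (LINT x|?M. (\<zeta> x)\<^sup>2 * u t x * (\<Sum>k=1..n. \<Lambda> k * c k t * \<phi> k x)))
       \<le> (\<theta> t)\<^sup>2 * (Z\<^sup>2 * (1 + Q) * nsq (V t) - (\<Sum>m=1..l. \<Lambda> m * (coef (\<lambda>x. \<zeta> x * u t x) m)\<^sup>2))"
      by (rule mult_left_mono) simp
    also have "\<dots> = (\<theta> t)\<^sup>2 * (Z\<^sup>2 * (1 + Q) * nsq (V t)) - D t" by (simp add: DD right_diff_distrib)
    also have "\<dots> \<le> A\<^sup>2 * (Z\<^sup>2 * (1 + Q) * nsq (V t)) - D t"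
      using A2 Q N0 by (intro diff_right_mono mult_right_mono mult_nonneg_nonneg) auto
    finally show ?thesis using t1 unfolding e_eq by (simp add: algebra_simps)
  qed
  have cz: "coef (\<lambda>x. \<zeta> x * u t x) m = (\<Sum>k=1..n. c k t * coef (\<lambda>x. \<zeta> x * \<phi> m x) k)" if "m \<ge> 1" for t m
  proof -
    have "coef (\<lambda>x. \<zeta> x * u t x) m = (LINT x|?M. (\<zeta> x * \<phi> m x) * (\<Sum>k=1..n. c k t * \<phi> k x))"
      by (simp add: coef_def u_def mult_ac)
    also have "\<dots> = (\<Sum>k=1..n. c k t * coef (\<lambda>x. \<zeta> x * \<phi> m x) k)"
      using that by (intro integral_mult_comb L2_test_mult[OF \<zeta>] L2_basis) auto
    finally show ?thesis .
  qed
  have bcz: "bdd_meas T (\<lambda>t. (\<theta> t)\<^sup>2 * (coef (\<lambda>x. \<zeta> x * u t x) m)\<^sup>2)" if "m \<ge> 1" for m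
    unfolding cz[OF that]
    by (intro bdd_meas_mult bdd_meas_power prim_bdd_meas[OF \<theta>] bdd_meas_sum c_bdd_meas bdd_meas_const) simp
  have bD: "bdd_meas T D" unfolding D_def by (intro bdd_meas_sum bdd_meas_cmult bcz) simp
  have ID: "integral {0..T} D = (\<Sum>m=1..l. \<Lambda> m * integral {0..T} (\<lambda>t. (\<theta> t)\<^sup>2 * (coef (\<lambda>x. \<zeta> x * u t x) m)\<^sup>2))"
    unfolding D_def by (subst integral_bdd_meas_sum) (auto intro!: bdd_meas_cmult bcz)
  have "0 \<le> E T" unfolding Eeq by simp
  also have "E T = E 0 + integral {0..T} e" using primD[OF Eprim, of T] T by simp
  also have "integral {0..T} e \<le> integral {0..T} (\<lambda>t. 2 * (A\<^sup>2 * Z\<^sup>2 * (2 + Q)) * nsq (V t) + (- 2) * D t)"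
    using Eprim ele by (intro integral_mono_bdd_meas bdd_meas_add bdd_meas_cmult nsq_bdd_meas bD) (auto simp: prim_def mult.assoc)
  also have "\<dots> = 2 * (A\<^sup>2 * Z\<^sup>2 * (2 + Q)) * S + (- 2) * integral {0..T} D"
    by (subst integral_bdd_meas_add) (auto intro!: bdd_meas_cmult bdd_meas_minus nsq_bdd_meas bD)
  finally have "2 * integral {0..T} D \<le> E 0 + 2 * (A\<^sup>2 * Z\<^sup>2 * (2 + Q)) * S" by simp
  moreover have E0: "E 0 = (\<theta> 0)\<^sup>2 * nsq (\<lambda>x. \<zeta> x * (\<Sum>k=1..n. coef h k * \<phi> k x))"
    unfolding Eeq u_def using c_0 by simp
  moreover have "E 0 \<ge> 0" unfolding Eeq by simp
  ultimately have "integral {0..T} D \<le> (\<theta> 0)\<^sup>2 * nsq (\<lambda>x. \<zeta> x * (\<Sum>k=1..n. coef h k * \<phi> k x)) + A\<^sup>2 * Z\<^sup>2 * (2 + Q) * S"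
    by linarith
  then show ?thesis unfolding ID u_def .
qed

text \<open>Let the number of modes tend to infinity. The initial term disappears because
  \<open>\<zeta> h = 0\<close>, or because \<open>\<theta> 0 = 0\<close>. Each side is stable under this limit for fixed \<open>l\<close>.\<close>

lemma weighted_energy:
  assumes \<zeta>: "\<zeta> \<in> test_functions UNIV" and Z: "\<And>x. \<bar>\<zeta> x\<bar> \<le> Z" "\<And>x. norm (grad \<zeta> x) \<le> Z"
    and \<theta>: "prim T \<theta> \<theta>'" and A: "\<And>t. t \<in> {0..T} \<Longrightarrow> \<bar>\<theta> t\<bar> \<le> A" "\<And>t. t \<in> {0..T} \<Longrightarrow> \<bar>\<theta>' t\<bar> \<le> A"
    and zero: "\<theta> 0 = 0 \<or> (AE x in lebesgue_on \<Omega>. \<zeta> x * h x = 0)"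
  shows "(\<Sum>m=1..l. \<Lambda> m * integral {0..T} (\<lambda>t. (\<theta> t)\<^sup>2 * (coef (\<lambda>x. \<zeta> x * V t x) m)\<^sup>2)) \<le> A\<^sup>2 * Z\<^sup>2 * (2 + Q) * S"
proof -
  let ?M = "lebesgue_on \<Omega>"
  define u where "u n t x = (\<Sum>k=1..n. c k t * \<phi> k x)" for n t x
  define H where "H n x = (\<Sum>k=1..n. coef h k * \<phi> k x)" for n x
  have Lu: "L2 ?M (u n t)" and LH: "L2 ?M (H n)" for n t unfolding u_def H_def by (rule L2_comb; simp)+
  have init: "(\<lambda>n. (\<theta> 0)\<^sup>2 * nsq (\<lambda>x. \<zeta> x * H n x)) \<longlonglongrightarrow> 0"
  proof (cases "\<theta> 0 = 0")
    case False
    then have ae: "AE x in ?M. \<zeta> x * h x = 0" using zero by simp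
    have Z0: "Z \<ge> 0" using Z(1)[of 0] by simp
    have "nsq (\<lambda>x. \<zeta> x * H n x) \<le> Z\<^sup>2 * nsq (\<lambda>x. h x - H n x)" for n
    proof -
      have "nsq (\<lambda>x. \<zeta> x * H n x) \<le> (LINT x|?M. Z\<^sup>2 * (h x - H n x)\<^sup>2)"
      proof (rule integral_mono_AE)
        show "AE x in ?M. (\<zeta> x * H n x)\<^sup>2 \<le> Z\<^sup>2 * (h x - H n x)\<^sup>2"
          using ae
        proof eventually_elim
          case (elim x)
          have "\<zeta> x * (h x - H n x) = - (\<zeta> x * H n x)" using elim by (simp only: right_diff_distrib)
          then have "(\<zeta> x * H n x)\<^sup>2 = (\<zeta> x * (h x - H n x))\<^sup>2" by simp
          also have "\<dots> \<le> Z\<^sup>2 * (h x - H n x)\<^sup>2"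
            using power_mono[OF Z(1)[of x] abs_ge_zero, of 2] by (simp add: power_mult_distrib mult_right_mono)
          finally show ?case .
        qed
      qed (use L2_real_sq[OF L2_test_mult(1)[OF \<zeta> LH]] L2_real_sq[OF L2_diff[OF L2_h LH]] in auto)
      then show ?thesis by simp
    qed
    then have le: "norm ((\<theta> 0)\<^sup>2 * nsq (\<lambda>x. \<zeta> x * H n x)) \<le> (\<theta> 0)\<^sup>2 * (Z\<^sup>2 * nsq (\<lambda>x. h x - H n x))" for n
      by (simp add: mult_left_mono)
    have "(\<lambda>n. nsq (\<lambda>x. h x - H n x)) \<longlonglongrightarrow> 0"
      using complete[OF L2_h] unfolding H_def coef_def .
    then have "(\<lambda>n. (\<theta> 0)\<^sup>2 * (Z\<^sup>2 * nsq (\<lambda>x. h x - H n x))) \<longlonglongrightarrow> (\<theta> 0)\<^sup>2 * (Z\<^sup>2 * 0)" by (intro tendsto_intros)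
    then have "(\<lambda>n. (\<theta> 0)\<^sup>2 * (Z\<^sup>2 * nsq (\<lambda>x. h x - H n x))) \<longlonglongrightarrow> 0" by simp
    then show ?thesis by (rule Lim_null_comparison[OF always_eventually[OF allI[OF le]]])
  qed simp
  have lim: "(\<lambda>n. integral {0..T} (\<lambda>t. (\<theta> t)\<^sup>2 * (coef (\<lambda>x. \<zeta> x * u n t x) m)\<^sup>2)) \<longlonglongrightarrow>
      integral {0..T} (\<lambda>t. (\<theta> t)\<^sup>2 * (coef (\<lambda>x. \<zeta> x * V t x) m)\<^sup>2)" if m: "m \<ge> 1" for m
  proof -
    let ?g = "\<lambda>x. \<zeta> x * \<phi> m x"
    have g: "L2 ?M ?g" by (intro L2_test_mult[OF \<zeta>] L2_basis m)
    have ceq: "coef (\<lambda>x. \<zeta> x * w x) m = (LINT x|?M. w x * ?g x)" for w by (simp add: coef_def mult_ac)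
    obtain Nm where Nm: "\<And>t. t \<in> {0..T} \<Longrightarrow> \<bar>nsq (V t)\<bar> \<le> Nm" by (rule bdd_meas_bound[OF nsq_bdd_meas]) (rule that)
    have b1: "bdd_meas T (\<lambda>t. (\<theta> t)\<^sup>2 * (LINT x|?M. u n t x * ?g x)\<^sup>2)" for n
    proof -
      have "(LINT x|?M. u n t x * ?g x) = (\<Sum>k=1..n. c k t * coef ?g k)" for t
        using integral_mult_comb[OF g, of "{1..n}" "\<lambda>k. c k t"] by (simp add: u_def mult.commute)
      then show ?thesis
        by (simp only:) (intro bdd_meas_mult bdd_meas_power prim_bdd_meas[OF \<theta>] bdd_meas_sum c_bdd_meas bdd_meas_const, simp)
    qed
    have b2: "bdd_meas T (\<lambda>t. (\<theta> t)\<^sup>2 * (LINT x|?M. V t x * ?g x)\<^sup>2)"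
      by (intro bdd_meas_mult bdd_meas_power prim_bdd_meas[OF \<theta>] pairing_bdd_meas g)
    have "(\<lambda>n. LINT t|lebesgue_on {0..T}. (\<theta> t)\<^sup>2 * (LINT x|?M. u n t x * ?g x)\<^sup>2) \<longlonglongrightarrow>
       (LINT t|lebesgue_on {0..T}. (\<theta> t)\<^sup>2 * (LINT x|?M. V t x * ?g x)\<^sup>2)"
    proof (rule integral_dominated_convergence[where w="\<lambda>t. A\<^sup>2 * (Nm * nsq ?g)"])
      show "integrable (lebesgue_on {0..T}) (\<lambda>t. A\<^sup>2 * (Nm * nsq ?g))" by (rule bdd_meas_LINT) simp
      show "AE t in lebesgue_on {0..T}. (\<lambda>n. (\<theta> t)\<^sup>2 * (LINT x|?M. u n t x * ?g x)\<^sup>2) \<longlonglongrightarrow> (\<theta> t)\<^sup>2 * (LINT x|?M. V t x * ?g x)\<^sup>2"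
      proof (intro AE_I2 tendsto_mult tendsto_const tendsto_power)
        fix t assume "t \<in> space (lebesgue_on {0..T})"
        then have "t \<in> {0..T}" by simp
        from partial_sums_pairing[OF L2_V[OF this] g]
        show "(\<lambda>n. LINT x|?M. u n t x * ?g x) \<longlonglongrightarrow> (LINT x|?M. V t x * ?g x)" by (simp only: u_def)
      qed
      show "AE t in lebesgue_on {0..T}. norm ((\<theta> t)\<^sup>2 * (LINT x|?M. u n t x * ?g x)\<^sup>2) \<le> A\<^sup>2 * (Nm * nsq ?g)" for n
      proof (intro AE_I2)
        fix t assume "t \<in> space (lebesgue_on {0..T})"
        then have t: "t \<in> {0..T}" by simp
        have "(LINT x|?M. u n t x * ?g x)\<^sup>2 \<le> nsq (u n t) * nsq ?g" by (intro L2_Cauchy_Schwarz_real Lu g)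
        also have "\<dots> \<le> Nm * nsq ?g"
        proof (rule mult_right_mono)
          have "nsq (u n t) \<le> nsq (V t)" unfolding u_def by (subst integral_comb_sq) (auto intro!: Bessel L2_V[OF t])
          then show "nsq (u n t) \<le> Nm" using Nm[OF t] by linarith
        qed simp
        finally have "(\<theta> t)\<^sup>2 * (LINT x|?M. u n t x * ?g x)\<^sup>2 \<le> A\<^sup>2 * (Nm * nsq ?g)"
          using power_mono[OF A(1)[OF t] abs_ge_zero, of 2] by (intro mult_mono) auto
        then show "norm ((\<theta> t)\<^sup>2 * (LINT x|?M. u n t x * ?g x)\<^sup>2) \<le> A\<^sup>2 * (Nm * nsq ?g)" by simp
      qed
    qed (use b1 b2 in \<open>auto simp: bdd_meas_def\<close>)
    then show ?thesis unfolding ceq by (simp add: bdd_meas_LINT b1 b2)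
  qed
  have "(\<Sum>m=1..l. \<Lambda> m * integral {0..T} (\<lambda>t. (\<theta> t)\<^sup>2 * (coef (\<lambda>x. \<zeta> x * V t x) m)\<^sup>2)) \<le> 0 + A\<^sup>2 * Z\<^sup>2 * (2 + Q) * S"
  proof (rule LIMSEQ_le)
    show "(\<lambda>n. \<Sum>m=1..l. \<Lambda> m * integral {0..T} (\<lambda>t. (\<theta> t)\<^sup>2 * (coef (\<lambda>x. \<zeta> x * u n t x) m)\<^sup>2)) \<longlonglongrightarrow>
      (\<Sum>m=1..l. \<Lambda> m * integral {0..T} (\<lambda>t. (\<theta> t)\<^sup>2 * (coef (\<lambda>x. \<zeta> x * V t x) m)\<^sup>2))"
      by (intro tendsto_sum tendsto_mult tendsto_const lim) simp
    show "(\<lambda>n. (\<theta> 0)\<^sup>2 * nsq (\<lambda>x. \<zeta> x * H n x) + A\<^sup>2 * Z\<^sup>2 * (2 + Q) * S) \<longlonglongrightarrow> 0 + A\<^sup>2 * Z\<^sup>2 * (2 + Q) * S"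
      by (intro tendsto_add init tendsto_const)
    show "\<exists>N. \<forall>n\<ge>N. (\<Sum>m=1..l. \<Lambda> m * integral {0..T} (\<lambda>t. (\<theta> t)\<^sup>2 * (coef (\<lambda>x. \<zeta> x * u n t x) m)\<^sup>2))
       \<le> (\<theta> 0)\<^sup>2 * nsq (\<lambda>x. \<zeta> x * H n x) + A\<^sup>2 * Z\<^sup>2 * (2 + Q) * S"
      using weighted_energy_partial[OF \<zeta> Z \<theta> A] unfolding u_def H_def by blast
  qed
  then show ?thesis by simp
qed

end

end

section \<open>High initial frequencies make the solution concentrate\<close>

context heat_modes
begin

definition total :: "(real \<Rightarrow> 'a \<Rightarrow> real) \<Rightarrow> real" where
  "total V = integral {0..T} (\<lambda>t. nsq (V t))"

lemma total_nonneg: "0 \<le> total V"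
  unfolding total_def by (rule integral_nonneg_bdd) simp

text \<open>Every smallness statement is uniform over all solutions whose initial values have no modes below
  \<open>K\<close>, since solution and initial value change with \<open>K\<close>.\<close>

definition high_solution :: "nat \<Rightarrow> ('a \<Rightarrow> real) \<Rightarrow> (real \<Rightarrow> 'a \<Rightarrow> real) \<Rightarrow> bool" where
  "high_solution K h V \<longleftrightarrow> solution_modes h V \<and> (\<forall>k. 1 \<le> k \<longrightarrow> k < K \<longrightarrow> coef h k = 0)"

text \<open>Choose \<open>n\<close> to make the contribution of the middle modes small; then \<open>K\<close>, for this \<open>n\<close>, to make that of
  the tails small.\<close>

lemma low_modes_small:
  assumes j: "j \<ge> 1" and \<epsilon>: "\<epsilon> > 0"
  shows "\<forall>\<^sub>F K in sequentially. \<forall>h V. high_solution K h V \<longrightarrow> integral {0..T} (\<lambda>t. (coef (V t) j)\<^sup>2) \<le> \<epsilon> * total V"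
proof -
  define E where "E = 2 * exp (2 * Q * T)"
  define \<delta> where "\<delta> = sqrt (\<epsilon> / T) / (2 * E)"
  have E: "E > 0" by (simp add: E_def)
  have \<delta>: "\<delta> > 0" using \<epsilon> T E by (simp add: \<delta>_def)
  \<comment> \<open>If \<open>\<Lambda> (Suc n) \<ge> \<mu>\<close>, then the middle modes contribute at most \<open>\<delta>\<close> in the estimate of the low modes.\<close>
  define \<mu> where "\<mu> = Q\<^sup>2 * sqrt T / \<delta> + 1"
  have \<mu>: "\<mu> > 0" using \<delta> T by (auto simp: \<mu>_def intro!: add_nonneg_pos)
  have \<mu>le: "Q\<^sup>2 * sqrt T / \<mu> \<le> \<delta>"
    using \<delta> \<mu> by (simp add: \<mu>_def field_simps)
  have "\<forall>\<^sub>F n in sequentially. \<mu> \<le> \<Lambda> n" using \<Lambda>_lim by (simp add: filterlim_at_top)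
  then obtain n where n: "\<mu> \<le> \<Lambda> (Suc n)" "j \<le> n"
    unfolding eventually_sequentially by (metis le_Suc_eq nat_le_linear)
  have "(\<lambda>K. \<Sum>k=1..n. sqrt (integral {0..T} (R K k))) \<longlonglongrightarrow> (\<Sum>k=1..n. sqrt 0)"
    by (intro tendsto_sum tendsto_real_sqrt R_integral_tendsto_0) simp
  then have "\<forall>\<^sub>F K in sequentially. (\<Sum>k=1..n. sqrt (integral {0..T} (R K k))) < \<delta>"
    using \<delta> by (intro order_tendstoD(2)) auto
  then show ?thesis
    using eventually_gt_at_top[of n]
  proof eventually_elim
    case (elim K)
    show ?case
    proof (intro allI impI)
      fix h V assume hs: "high_solution K h V"
      then have sol: "solution_modes h V" by (simp add: high_solution_def)
      let ?B = "Q\<^sup>2 * sqrt T / \<mu> + (\<Sum>k=1..n. sqrt (integral {0..T} (R K k)))"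
      have "integral {0..T} (\<lambda>t. (coef (V t) j)\<^sup>2) \<le> T * (E * ?B)\<^sup>2 * total V"
        unfolding E_def total_def
        using hs c_0[OF sol] n j by (intro low_modes_estimate[OF sol \<mu> n(1) elim(2)]) (auto simp: high_solution_def)
      also have "\<dots> \<le> T * (E * (2 * \<delta>))\<^sup>2 * total V"
      proof (intro mult_right_mono mult_left_mono power_mono)
        show "?B \<le> 2 * \<delta>" using \<mu>le elim(1) by simp
        have "0 \<le> (\<Sum>k=1..n. sqrt (integral {0..T} (R K k)))"
          using R_nonneg by (intro sum_nonneg) (auto intro!: integral_nonneg_bdd)
        then show "0 \<le> E * ?B" using E \<mu> T by (intro mult_nonneg_nonneg add_nonneg_nonneg) auto
      qed (use E T total_nonneg in auto)
      also have "T * (E * (2 * \<delta>))\<^sup>2 = \<epsilon>" using E T \<epsilon> by (simp add: \<delta>_def)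
      finally show "integral {0..T} (\<lambda>t. (coef (V t) j)\<^sup>2) \<le> \<epsilon> * total V" .
    qed
  qed
qed

text \<open>A square integrable function is a finite combination of the eigenfunctions up to a small error.\<close>

lemma pairing_small:
  assumes \<rho>: "L2 (lebesgue_on \<Omega>) \<rho>" and \<epsilon>: "\<epsilon> > 0"
  shows "\<forall>\<^sub>F K in sequentially. \<forall>h V. high_solution K h V \<longrightarrow>
    integral {0..T} (\<lambda>t. (LINT x|lebesgue_on \<Omega>. V t x * \<rho> x)\<^sup>2) \<le> \<epsilon> * total V"
proof -
  let ?M = "lebesgue_on \<Omega>"
  define P where "P n x = (\<Sum>k=1..n. coef \<rho> k * \<phi> k x)" for n x
  have LP: "L2 ?M (P n)" for n unfolding P_def by (rule L2_comb) simp
  have "(\<lambda>n. nsq (\<lambda>x. \<rho> x - P n x)) \<longlonglongrightarrow> 0" using complete[OF \<rho>] unfolding P_def coef_def .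
  then have "\<forall>\<^sub>F n in sequentially. nsq (\<lambda>x. \<rho> x - P n x) < \<epsilon> / 4"
    using \<epsilon> by (intro order_tendstoD(2)) auto
  then obtain n where n: "nsq (\<lambda>x. \<rho> x - P n x) < \<epsilon> / 4" by (auto simp: eventually_sequentially)
  define N where "N = nsq \<rho>"
  have N: "N \<ge> 0" by (simp add: N_def)
  define \<epsilon>' where "\<epsilon>' = \<epsilon> / (4 * (N + 1) * (real n + 1))"
  have \<epsilon>': "\<epsilon>' > 0" using \<epsilon> N by (simp add: \<epsilon>'_def)
  have "\<forall>\<^sub>F K in sequentially. \<forall>j\<in>{1..n}. \<forall>h V. high_solution K h V \<longrightarrow> integral {0..T} (\<lambda>t. (coef (V t) j)\<^sup>2) \<le> \<epsilon>' * total V"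
    using low_modes_small[OF _ \<epsilon>'] by (intro eventually_ball_finite) auto
  then show ?thesis
  proof eventually_elim
    case (elim K)
    show ?case
    proof (intro allI impI)
      fix h V assume hs: "high_solution K h V"
      then have sol: "solution_modes h V" by (simp add: high_solution_def)
      note cb = c_bdd_meas[OF sol]
      have pt: "(LINT x|?M. V t x * \<rho> x)\<^sup>2 \<le> (2 * N) * (\<Sum>j=1..n. (coef (V t) j)\<^sup>2) + (\<epsilon> / 2) * nsq (V t)" if t: "t \<in> {0..T}" for t
      proof -
        note V = L2_V[OF sol t]
        define a where "a = (LINT x|?M. V t x * P n x)"
        define b where "b = (LINT x|?M. V t x * (\<rho> x - P n x))"
        have "(LINT x|?M. V t x * \<rho> x) = a + b"
          using L2_mult_integrable[OF V LP, of n] L2_mult_integrable[OF V L2_diff[OF \<rho> LP], of n]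
          by (simp add: a_def b_def flip: LINT_add) (simp add: algebra_simps)
        moreover have "(a + b)\<^sup>2 \<le> 2 * a\<^sup>2 + 2 * b\<^sup>2"
          using sum_squares_bound[of a b] by (simp add: power2_sum)
        moreover have "b\<^sup>2 \<le> nsq (V t) * (\<epsilon> / 4)"
        proof -
          have "b\<^sup>2 \<le> nsq (V t) * nsq (\<lambda>x. \<rho> x - P n x)"
            unfolding b_def by (rule L2_Cauchy_Schwarz_real[OF V L2_diff[OF \<rho> LP]])
          also have "\<dots> \<le> nsq (V t) * (\<epsilon> / 4)" using n by (intro mult_left_mono) auto
          finally show ?thesis .
        qed
        moreover have "a\<^sup>2 \<le> N * (\<Sum>j=1..n. (coef (V t) j)\<^sup>2)"
        proof -
          have "a = (\<Sum>j=1..n. coef \<rho> j * coef (V t) j)"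
            unfolding a_def P_def by (rule integral_mult_comb[OF V]) simp
          then have "a\<^sup>2 \<le> (\<Sum>j=1..n. (coef \<rho> j)\<^sup>2) * (\<Sum>j=1..n. (coef (V t) j)\<^sup>2)"
            using Cauchy_Schwarz_ineq_sum[of "coef \<rho>" "coef (V t)" "{1..n}"] by simp
          also have "\<dots> \<le> N * (\<Sum>j=1..n. (coef (V t) j)\<^sup>2)"
            unfolding N_def by (intro mult_right_mono Bessel \<rho> sum_nonneg) auto
          finally show ?thesis .
        qed
        ultimately show ?thesis by (simp add: mult_ac)
      qed
      have "integral {0..T} (\<lambda>t. (LINT x|?M. V t x * \<rho> x)\<^sup>2) \<le>
          integral {0..T} (\<lambda>t. (2 * N) * (\<Sum>j=1..n. (coef (V t) j)\<^sup>2) + (\<epsilon> / 2) * nsq (V t))"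
        using pt by (intro integral_mono_bdd_meas bdd_meas_add bdd_meas_cmult bdd_meas_sum bdd_meas_power cb
            pairing_bdd_meas[OF sol] nsq_bdd_meas[OF sol] \<rho>) auto
      also have "\<dots> = (2 * N) * (\<Sum>j=1..n. integral {0..T} (\<lambda>t. (coef (V t) j)\<^sup>2)) + (\<epsilon> / 2) * total V"
      proof -
        have "integral {0..T} (\<lambda>t. \<Sum>j=1..n. (coef (V t) j)\<^sup>2) = (\<Sum>j=1..n. integral {0..T} (\<lambda>t. (coef (V t) j)\<^sup>2))"
          by (intro integral_bdd_meas_sum bdd_meas_power cb) auto
        moreover have "integral {0..T} (\<lambda>t. (2 * N) * (\<Sum>j=1..n. (coef (V t) j)\<^sup>2) + (\<epsilon> / 2) * nsq (V t))
          = integral {0..T} (\<lambda>t. (2 * N) * (\<Sum>j=1..n. (coef (V t) j)\<^sup>2)) + integral {0..T} (\<lambda>t. (\<epsilon> / 2) * nsq (V t))"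
          by (intro integral_bdd_meas_add bdd_meas_cmult bdd_meas_sum bdd_meas_power cb nsq_bdd_meas[OF sol]) auto
        ultimately show ?thesis by (simp only: total_def integral_mult_right)
      qed
      also have "\<dots> \<le> (2 * N) * (\<Sum>j=1..n. \<epsilon>' * total V) + (\<epsilon> / 2) * total V"
        using elim hs N by (intro add_right_mono mult_left_mono sum_mono) auto
      also have "\<dots> = (2 * N * real n * \<epsilon>' + \<epsilon> / 2) * total V" by (simp add: algebra_simps)
      also have "\<dots> \<le> \<epsilon> * total V"
      proof (rule mult_right_mono[OF _ total_nonneg])
        have "N * real n \<le> (N + 1) * (real n + 1)" using N by (intro mult_mono) auto
        then have "2 * (N * real n) * \<epsilon>' \<le> 2 * ((N + 1) * (real n + 1)) * \<epsilon>'" using \<epsilon>' by (intro mult_right_mono) auto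
        also have "\<dots> = \<epsilon> / 2"
        proof -
          have "(N + 1) * (real n + 1) \<noteq> 0" using N by simp
          then show ?thesis unfolding \<epsilon>'_def by (simp add: field_simps)
        qed
        finally show "2 * N * real n * \<epsilon>' + \<epsilon> / 2 \<le> \<epsilon>" by (simp add: mult_ac)
      qed
      finally show "integral {0..T} (\<lambda>t. (LINT x|?M. V t x * \<rho> x)\<^sup>2) \<le> \<epsilon> * total V" .
    qed
  qed
qed

text \<open>Split the modes of \<open>\<theta> \<zeta> V\<close> at an index \<open>n\<close>, independent of \<open>K\<close>, beyond which \<open>\<Lambda>\<close> exceeds twice the constant of
  the weighted energy estimate divided by \<open>\<epsilon>\<close>. The finitely many low modes are pairings of \<open>V\<close> with the fixed
  functions \<open>\<zeta> \<phi>\<^sub>m\<close>.\<close>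

theorem weighted_mass_small:
  assumes \<zeta>: "\<zeta> \<in> test_functions UNIV" and \<theta>: "prim T \<theta> \<theta>'" and \<epsilon>: "\<epsilon> > 0"
  shows "\<forall>\<^sub>F K in sequentially. \<forall>h V. high_solution K h V \<longrightarrow> \<theta> 0 = 0 \<or> (AE x in lebesgue_on \<Omega>. \<zeta> x * h x = 0) \<longrightarrow>
    integral {0..T} (\<lambda>t. (\<theta> t)\<^sup>2 * nsq (\<lambda>x. \<zeta> x * V t x)) \<le> \<epsilon> * total V"
proof -
  let ?M = "lebesgue_on \<Omega>"
  obtain Z where Z: "\<And>x. \<bar>\<zeta> x\<bar> \<le> Z" "\<And>x. norm (grad \<zeta> x) \<le> Z" "Z \<ge> 0"
    by (rule test_grad_bounded[OF \<zeta>]) (rule that)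
  obtain A where A: "A \<ge> 0" "\<And>t. t \<in> {0..T} \<Longrightarrow> \<bar>\<theta> t\<bar> \<le> A" "\<And>t. t \<in> {0..T} \<Longrightarrow> \<bar>\<theta>' t\<bar> \<le> A"
  proof -
    obtain A1 where 1: "A1 \<ge> 0" "\<And>t. t \<in> {0..T} \<Longrightarrow> \<bar>\<theta> t\<bar> \<le> A1" by (rule bdd_meas_bound[OF prim_bdd_meas[OF \<theta>]]) (rule that)
    have "bdd_meas T \<theta>'" using \<theta> by (simp add: prim_def)
    then obtain A2 where 2: "A2 \<ge> 0" "\<And>t. t \<in> {0..T} \<Longrightarrow> \<bar>\<theta>' t\<bar> \<le> A2" by (rule bdd_meas_bound) (rule that)
    show thesis using 1 2 by (intro that[of "A1 + A2"]) force+
  qed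
  define C where "C = A\<^sup>2 * Z\<^sup>2 * (2 + Q)"
  have C: "C \<ge> 0" using Q by (simp add: C_def)
  \<comment> \<open>Modes with \<open>\<Lambda>\<^sub>m \<ge> \<mu>\<close> carry at most the fraction \<open>C / \<mu> \<le> \<epsilon> / 2\<close> of the mass.\<close>
  define \<mu> where "\<mu> = 2 * C / \<epsilon> + 1"
  have \<mu>: "\<mu> > 0" using C \<epsilon> by (auto simp: \<mu>_def intro!: add_nonneg_pos)
  have C\<mu>: "C \<le> (\<epsilon> / 2) * \<mu>" using C \<epsilon> by (simp add: \<mu>_def field_simps)
  have "\<forall>\<^sub>F n in sequentially. \<mu> \<le> \<Lambda> n" using \<Lambda>_lim by (simp add: filterlim_at_top)
  then obtain n where n: "\<And>m. m > n \<Longrightarrow> \<mu> \<le> \<Lambda> m"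
    unfolding eventually_sequentially by (metis less_imp_le)
  define \<epsilon>' where "\<epsilon>' = \<epsilon> / (2 * (A\<^sup>2 + 1) * (real n + 1))"
  have A1: "A\<^sup>2 + 1 > 0" by (simp add: add_nonneg_pos)
  have \<epsilon>': "\<epsilon>' > 0" using \<epsilon> A1 by (simp add: \<epsilon>'_def)
  have "\<forall>\<^sub>F K in sequentially. \<forall>j\<in>{1..n}. \<forall>h V. high_solution K h V \<longrightarrow>
     integral {0..T} (\<lambda>t. (LINT x|?M. V t x * (\<zeta> x * \<phi> j x))\<^sup>2) \<le> \<epsilon>' * total V"
    using pairing_small[OF L2_test_mult(1)[OF \<zeta> L2_basis] \<epsilon>'] by (intro eventually_ball_finite) auto
  then show ?thesis
  proof eventually_elim
    case (elim K)
    show ?case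
    proof (intro allI impI)
      fix h V assume hs: "high_solution K h V" and z: "\<theta> 0 = 0 \<or> (AE x in ?M. \<zeta> x * h x = 0)"
      then have sol: "solution_modes h V" by (simp add: high_solution_def)
      define d where "d m t = coef (\<lambda>x. \<zeta> x * V t x) m" for m t
      define I where "I m = integral {0..T} (\<lambda>t. (\<theta> t)\<^sup>2 * (d m t)\<^sup>2)" for m
      have deq: "d m t = (LINT x|?M. V t x * (\<zeta> x * \<phi> m x))" for m t by (simp add: d_def coef_def mult_ac)
      have bd: "bdd_meas T (d m)" if "m \<ge> 1" for m
        using pairing_bdd_meas[OF sol L2_test_mult(1)[OF \<zeta> L2_basis[OF that]]] by (simp add: deq[abs_def])
      have b\<theta>: "bdd_meas T \<theta>" using \<theta> by (rule prim_bdd_meas)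
      have bI: "bdd_meas T (\<lambda>t. (\<theta> t)\<^sup>2 * (d m t)\<^sup>2)" if "m \<ge> 1" for m
        by (intro bdd_meas_mult bdd_meas_power b\<theta> bd that)
      have I0: "0 \<le> I m" for m unfolding I_def by (rule integral_nonneg_bdd) simp
      have energy: "(\<Sum>m=1..l. \<Lambda> m * I m) \<le> C * total V" for l
        unfolding I_def d_def C_def total_def by (rule weighted_energy[OF sol \<zeta> Z(1,2) \<theta> A(2,3) z])
      have lowI: "I m \<le> A\<^sup>2 * (\<epsilon>' * total V)" if m: "m \<in> {1..n}" for m
      proof -
        have "I m \<le> integral {0..T} (\<lambda>t. A\<^sup>2 * (d m t)\<^sup>2)"
          unfolding I_def
        proof (intro integral_mono_bdd_meas bI bdd_meas_cmult bdd_meas_power bd)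
          show "(\<theta> t)\<^sup>2 * (d m t)\<^sup>2 \<le> A\<^sup>2 * (d m t)\<^sup>2" if "t \<in> {0..T}" for t
            using power_mono[OF A(2)[OF that] abs_ge_zero, of 2] by (intro mult_right_mono) auto
        qed (use m in auto)
        also have "\<dots> \<le> A\<^sup>2 * (\<epsilon>' * total V)"
          using elim m hs unfolding deq by (simp add: mult_left_mono)
        finally show ?thesis .
      qed
      have bound: "(\<Sum>m=1..l. I m) \<le> \<epsilon> * total V" for l
      proof -
        have "(\<Sum>m=1..l. I m) \<le> (\<Sum>m=1..n. I m) + (\<Sum>m\<in>{Suc n..l}. I m)"
        proof -
          have "(\<Sum>m=1..l. I m) \<le> (\<Sum>m\<in>{1..n} \<union> {Suc n..l}. I m)" using I0 by (intro sum_mono2) auto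
          also have "\<dots> = (\<Sum>m=1..n. I m) + (\<Sum>m\<in>{Suc n..l}. I m)" by (intro sum.union_disjoint) auto
          finally show ?thesis .
        qed
        also have "(\<Sum>m=1..n. I m) \<le> (\<epsilon> / 2) * total V"
        proof -
          have "(\<Sum>m=1..n. I m) \<le> (\<Sum>m=1..n. A\<^sup>2 * (\<epsilon>' * total V))" by (intro sum_mono lowI)
          also have "\<dots> = (A\<^sup>2 * real n * \<epsilon>') * total V" by simp
          also have "\<dots> \<le> (\<epsilon> / 2) * total V"
          proof (rule mult_right_mono[OF _ total_nonneg])
            have "A\<^sup>2 * real n \<le> (A\<^sup>2 + 1) * (real n + 1)" by (intro mult_mono) auto
            then have "A\<^sup>2 * real n * \<epsilon>' \<le> (A\<^sup>2 + 1) * (real n + 1) * \<epsilon>'" using \<epsilon>' by (intro mult_right_mono) auto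
            also have "\<dots> = \<epsilon> / 2"
            proof -
              have "(A\<^sup>2 + 1) * (real n + 1) \<noteq> 0" using A1 by simp
              then show ?thesis unfolding \<epsilon>'_def by (simp add: field_simps)
            qed
            finally show "A\<^sup>2 * real n * \<epsilon>' \<le> \<epsilon> / 2" .
          qed
          finally show ?thesis .
        qed
        also have "(\<Sum>m\<in>{Suc n..l}. I m) \<le> (\<epsilon> / 2) * total V"
        proof -
          have "\<mu> * (\<Sum>m\<in>{Suc n..l}. I m) \<le> (\<Sum>m\<in>{Suc n..l}. \<Lambda> m * I m)"
            unfolding sum_distrib_left using n I0 by (intro sum_mono mult_right_mono) auto
          also have "\<dots> \<le> (\<Sum>m=1..l. \<Lambda> m * I m)"
            using I0 \<Lambda>_ge_0 by (intro sum_mono2) auto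
          also have "\<dots> \<le> C * total V" by (rule energy)
          also have "\<dots> \<le> \<mu> * ((\<epsilon> / 2) * total V)"
            using mult_right_mono[OF C\<mu> total_nonneg[of V]] by (simp add: mult_ac)
          finally show ?thesis using \<mu> by (simp add: mult_le_cancel_left)
        qed
        finally show ?thesis by (simp add: algebra_simps)
      qed
      have bz: "bdd_meas T (\<lambda>t. (\<theta> t)\<^sup>2 * nsq (\<lambda>x. \<zeta> x * V t x))"
        by (intro bdd_meas_mult bdd_meas_power b\<theta> nsq_test_bdd_meas[OF sol \<zeta>])
      obtain Nm where Nm: "\<And>t. t \<in> {0..T} \<Longrightarrow> \<bar>(\<theta> t)\<^sup>2 * nsq (\<lambda>x. \<zeta> x * V t x)\<bar> \<le> Nm"
        by (rule bdd_meas_bound[OF bz]) (rule that)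
      have bs: "bdd_meas T (\<lambda>t. \<Sum>m=1..l. (\<theta> t)\<^sup>2 * (d m t)\<^sup>2)" for l by (intro bdd_meas_sum bI) simp
      have Lz: "L2 ?M (\<lambda>x. \<zeta> x * V t x)" if "t \<in> {0..T}" for t by (intro L2_test_mult[OF \<zeta>] L2_V[OF sol that])
      have "(\<lambda>l. LINT t|lebesgue_on {0..T}. (\<Sum>m=1..l. (\<theta> t)\<^sup>2 * (d m t)\<^sup>2)) \<longlonglongrightarrow>
          (LINT t|lebesgue_on {0..T}. (\<theta> t)\<^sup>2 * nsq (\<lambda>x. \<zeta> x * V t x))"
      proof (rule integral_dominated_convergence[where w="\<lambda>t. Nm"])
        show "integrable (lebesgue_on {0..T}) (\<lambda>t. Nm)" by (rule bdd_meas_LINT) simp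
        show "AE t in lebesgue_on {0..T}. (\<lambda>l. \<Sum>m=1..l. (\<theta> t)\<^sup>2 * (d m t)\<^sup>2) \<longlonglongrightarrow> (\<theta> t)\<^sup>2 * nsq (\<lambda>x. \<zeta> x * V t x)"
        proof (intro AE_I2)
          fix t assume "t \<in> space (lebesgue_on {0..T})"
          then have "t \<in> {0..T}" by simp
          from tendsto_mult[OF tendsto_const Parseval[OF Lz[OF this]], of "(\<theta> t)\<^sup>2"]
          show "(\<lambda>l. \<Sum>m=1..l. (\<theta> t)\<^sup>2 * (d m t)\<^sup>2) \<longlonglongrightarrow> (\<theta> t)\<^sup>2 * nsq (\<lambda>x. \<zeta> x * V t x)"
            by (simp only: d_def sum_distrib_left)
        qed
        show "AE t in lebesgue_on {0..T}. norm (\<Sum>m=1..l. (\<theta> t)\<^sup>2 * (d m t)\<^sup>2) \<le> Nm" for l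
        proof (intro AE_I2)
          fix t assume "t \<in> space (lebesgue_on {0..T})"
          then have t: "t \<in> {0..T}" by simp
          have "(\<Sum>m=1..l. (\<theta> t)\<^sup>2 * (d m t)\<^sup>2) \<le> (\<theta> t)\<^sup>2 * nsq (\<lambda>x. \<zeta> x * V t x)"
            unfolding sum_distrib_left[symmetric] d_def by (intro mult_left_mono Bessel Lz t) auto
          moreover have "0 \<le> (\<Sum>m=1..l. (\<theta> t)\<^sup>2 * (d m t)\<^sup>2)" by (intro sum_nonneg) simp
          ultimately show "norm (\<Sum>m=1..l. (\<theta> t)\<^sup>2 * (d m t)\<^sup>2) \<le> Nm" using Nm[OF t] by simp
        qed
      qed (use bs bz in \<open>auto simp: bdd_meas_def\<close>)
      then have "(\<lambda>l. integral {0..T} (\<lambda>t. \<Sum>m=1..l. (\<theta> t)\<^sup>2 * (d m t)\<^sup>2)) \<longlonglongrightarrow>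
          integral {0..T} (\<lambda>t. (\<theta> t)\<^sup>2 * nsq (\<lambda>x. \<zeta> x * V t x))"
        by (simp only: bdd_meas_LINT(2)[OF bs] bdd_meas_LINT(2)[OF bz])
      moreover have "integral {0..T} (\<lambda>t. \<Sum>m=1..l. (\<theta> t)\<^sup>2 * (d m t)\<^sup>2) \<le> \<epsilon> * total V" for l
        using bound[of l] unfolding I_def by (subst integral_bdd_meas_sum) (auto intro!: bI)
      ultimately show "integral {0..T} (\<lambda>t. (\<theta> t)\<^sup>2 * nsq (\<lambda>x. \<zeta> x * V t x)) \<le> \<epsilon> * total V"
        by (intro LIMSEQ_le_const2) auto
    qed
  qed
qed

text \<open>The squared norm is continuous in time and positive at time \<open>0\<close>.\<close>

lemma total_pos:
  assumes sol: "solution_modes h V" and k: "k \<ge> 1" "coef h k \<noteq> 0"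
  shows "total V > 0"
proof -
  have "0 < (coef (V 0) k)\<^sup>2" using c_0[OF sol k(1)] k(2) by simp
  also have "\<dots> \<le> nsq (V 0)" using T by (intro coef_sq_le L2_V[OF sol] k) auto
  finally have pos: "nsq (V 0) > 0" .
  have "total V \<noteq> 0"
  proof
    assume "total V = 0"
    then have "\<forall>t\<in>{0..T}. nsq (V t) = 0"
      using nsq_continuous[OF sol] T unfolding total_def by (subst (asm) integral_eq_0_iff) auto
    then show False using pos T by auto
  qed
  then show ?thesis using total_nonneg[of V] by simp
qed

end

section \<open>From weak solutions to modes\<close>

lemma weak_grad_laplacian:
  assumes "weak_grad \<Omega> u G" "L2 (lebesgue_on \<Omega>) u" "L2 (lebesgue_on \<Omega>) G" "\<psi> \<in> test_functions \<Omega>" "\<Omega> \<in> sets lebesgue"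
  shows "(LINT x|lebesgue_on \<Omega>. u x * laplacian \<psi> x) = - (LINT x|lebesgue_on \<Omega>. G x \<bullet> grad \<psi> x)"
proof -
  let ?M = "lebesgue_on \<Omega>"
  have d: "dderiv b \<psi> \<in> test_functions \<Omega>" "L2 ?M (dderiv b \<psi>)" "L2 ?M (dderiv b (dderiv b \<psi>))" for b
    using assms by (auto intro!: test_dderiv L2_continuous_test)
  have "(LINT x|?M. u x * laplacian \<psi> x) = (LINT x|?M. (\<Sum>b\<in>Basis. u x * dderiv b (dderiv b \<psi>) x))"
    by (simp add: laplacian_def sum_distrib_left)
  also have "\<dots> = (\<Sum>b\<in>Basis. (LINT x|?M. u x * dderiv b (dderiv b \<psi>) x))"
    by (intro LINT_sum L2_mult_integrable assms d)
  also have "\<dots> = (\<Sum>b\<in>Basis. - (LINT x|?M. (G x \<bullet> b) * dderiv b \<psi> x))"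
    using assms(1) d(1) unfolding weak_grad_def weak_dderiv_def by (intro sum.cong refl) blast
  also have "\<dots> = - (LINT x|?M. (\<Sum>b\<in>Basis. (G x \<bullet> b) * dderiv b \<psi> x))"
    by (subst LINT_sum) (auto simp: sum_negf intro!: L2_mult_integrable L2_component assms d)
  also have "(\<lambda>x. \<Sum>b\<in>Basis. (G x \<bullet> b) * dderiv b \<psi> x) = (\<lambda>x. G x \<bullet> grad \<psi> x)"
    by (simp add: grad_def inner_sum_right mult.commute)
  finally show ?thesis .
qed

lemma H10_form_closure:
  assumes "\<Omega> \<in> sets lebesgue" "Lp 2 \<Omega> f" "Lp 2 \<Omega> G" "\<And>n::nat. \<psi> n \<in> test_functions \<Omega>"
    and lim: "(\<lambda>n. LINT x|lebesgue_on \<Omega>. (f x - \<psi> n x)\<^sup>2 + (norm (G x - grad (\<psi> n) x))\<^sup>2) \<longlonglongrightarrow> 0"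
  shows "form_closure \<Omega> (test_functions \<Omega>) f G"
    and "(\<lambda>n. LINT x|lebesgue_on \<Omega>. (norm (grad (\<psi> n) x - G x))\<^sup>2) \<longlonglongrightarrow> 0"
proof -
  let ?M = "lebesgue_on \<Omega>"
  have L: "L2 ?M f" "L2 ?M G" using assms by (auto simp: Lp2_iff_L2)
  have L\<psi>: "L2 ?M (\<psi> n)" "L2 ?M (grad (\<psi> n))" for n using assms by (auto intro!: L2_continuous_test)
  have i: "integrable ?M (\<lambda>x. (f x - \<psi> n x)\<^sup>2)" "integrable ?M (\<lambda>x. (norm (G x - grad (\<psi> n) x))\<^sup>2)" for n
    by (intro L2_real_sq L2_integrable_sq L2_diff L L\<psi>)+
  have sum: "(LINT x|?M. (f x - \<psi> n x)\<^sup>2 + (norm (G x - grad (\<psi> n) x))\<^sup>2) =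
      (LINT x|?M. (norm (\<psi> n x - f x))\<^sup>2) + (LINT x|?M. (norm (grad (\<psi> n) x - G x))\<^sup>2)" for n
    using i[of n] by (simp add: power2_commute[of "f _"] norm_minus_commute)
  have 1: "(\<lambda>n. LINT x|?M. (norm (\<psi> n x - f x))\<^sup>2) \<longlonglongrightarrow> 0"
    by (rule Lim_null_comparison[OF always_eventually lim]) (simp add: sum)
  show 2: "(\<lambda>n. LINT x|?M. (norm (grad (\<psi> n) x - G x))\<^sup>2) \<longlonglongrightarrow> 0"
    by (rule Lim_null_comparison[OF always_eventually lim]) (simp add: sum)
  show "form_closure \<Omega> (test_functions \<Omega>) f G"
    unfolding form_closure_def
  proof (intro conjI L allI impI; (elim conjE)?)
    fix w W assume w: "L2 ?M w" "L2 ?M W" "\<forall>\<psi>\<in>test_functions \<Omega>. (LINT x|?M. w x * \<psi> x + W x \<bullet> grad \<psi> x) = 0"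
    have "(\<lambda>n. (LINT x|?M. \<psi> n x \<bullet> w x) + (LINT x|?M. grad (\<psi> n) x \<bullet> W x)) \<longlonglongrightarrow> (LINT x|?M. f x \<bullet> w x) + (LINT x|?M. G x \<bullet> W x)"
      by (intro tendsto_add L2_pairing_tendsto L L\<psi> w 1 2)
    moreover have "(LINT x|?M. \<psi> n x \<bullet> w x) + (LINT x|?M. grad (\<psi> n) x \<bullet> W x) = 0" for n
    proof -
      have "(LINT x|?M. w x * \<psi> n x + W x \<bullet> grad (\<psi> n) x) = 0" using w(3) assms(4) by blast
      moreover have "(LINT x|?M. w x * \<psi> n x + W x \<bullet> grad (\<psi> n) x) = (LINT x|?M. w x * \<psi> n x) + (LINT x|?M. W x \<bullet> grad (\<psi> n) x)"
        by (intro LINT_add L2_mult_integrable L2_inner_integrable w L\<psi>)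
      ultimately show ?thesis by (simp add: inner_commute mult.commute)
    qed
    ultimately have "(LINT x|?M. f x \<bullet> w x) + (LINT x|?M. G x \<bullet> W x) = 0" by (simp add: LIMSEQ_const_iff)
    moreover have "(LINT x|?M. w x * f x + W x \<bullet> G x) = (LINT x|?M. w x * f x) + (LINT x|?M. W x \<bullet> G x)"
      by (intro LINT_add L2_mult_integrable L2_inner_integrable w L)
    ultimately show "(LINT x|?M. w x * f x + W x \<bullet> G x) = 0" by (simp add: inner_commute mult.commute)
  qed
qed

lemma L2_finite_measure_integrable:
  assumes "L2 M f" "finite_measure M"
  shows "integrable M (f :: _ \<Rightarrow> real)"
proof -
  interpret finite_measure M by fact
  have "L2 M (\<lambda>x. 1::real)" by (simp add: L2_def)
  from L2_mult_integrable[OF assms(1) this] show ?thesis by simp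
qed

lemma L2_imp_L1_loc:
  assumes "L2 (lebesgue_on U) f" "U \<in> lmeasurable"
  shows "L1_loc U f"
  unfolding L1_loc_def
proof (intro allI impI)
  fix K assume K: "compact K \<and> K \<subseteq> U"
  have "integrable (lebesgue_on U) f"
    using assms by (intro L2_finite_measure_integrable finite_measure_lebesgue_on)
  then show "integrable (lebesgue_on K) f"
    by (rule integrable_lebesgue_on_subset) (use K assms in \<open>auto simp: lmeasurable_compact fmeasurableD\<close>)
qed

definition form_test :: "boundary_operator \<Rightarrow> 'a::euclidean_space set \<Rightarrow> ('a \<Rightarrow> real) set" where
  "form_test B \<Omega> = (case B of Dirichlet \<Rightarrow> test_functions \<Omega> | Neumann \<Rightarrow> test_functions UNIV)"

text \<open>In the Neumann case the function \<open>g\<close> in the definition of the normal derivative must be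
  identified with \<open>- l f\<close>. In the Dirichlet case the approximating test functions are recorded,
  because their gradients converge strongly.\<close>

lemma eigenfunction_form:
  assumes \<Omega>: "open \<Omega>" "bounded \<Omega>" "C2_boundary \<Omega>" and ef: "laplace_eigenfunction B \<Omega> l f"
  shows "\<exists>G. form_closure \<Omega> (form_test B \<Omega>) f G \<and>
    (\<forall>\<psi>\<in>form_test B \<Omega>. (LINT x|lebesgue_on \<Omega>. (- l * f x) * \<psi> x + G x \<bullet> grad \<psi> x) = 0) \<and>
    (B = Dirichlet \<longrightarrow> (\<exists>\<zeta>. (\<forall>n::nat. \<zeta> n \<in> test_functions \<Omega>) \<and>
        (\<lambda>n. LINT x|lebesgue_on \<Omega>. (norm (grad (\<zeta> n) x - G x))\<^sup>2) \<longlonglongrightarrow> 0))"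
proof -
  let ?M = "lebesgue_on \<Omega>"
  have \<Omega>l: "\<Omega> \<in> sets lebesgue" using \<Omega> by auto
  have fL: "L2 ?M f" using ef by (simp add: laplace_eigenfunction_def H1_def Lp2_iff_L2)
  have wl: "weak_laplacian \<Omega> f (\<lambda>x. - l * f x)" using ef by (simp add: laplace_eigenfunction_def)
  show ?thesis
  proof (cases B)
    case Dirichlet
    then have "H10 \<Omega> f" using ef by (simp add: laplace_eigenfunction_def)
    then obtain G \<psi> where G: "weak_grad \<Omega> f G" "Lp 2 \<Omega> G" "\<And>n. \<psi> n \<in> test_functions \<Omega>"
      "(\<lambda>n. LINT x|?M. (f x - \<psi> n x)\<^sup>2 + (norm (G x - grad (\<psi> n) x))\<^sup>2) \<longlonglongrightarrow> 0" "Lp 2 \<Omega> f"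
      unfolding H10_def by blast
    note fc = H10_form_closure[OF \<Omega>l G(5,2,3,4)]
    have GL: "L2 ?M G" using G by (simp add: Lp2_iff_L2)
    have "(LINT x|?M. (- l * f x) * \<psi> x + G x \<bullet> grad \<psi> x) = 0" if \<psi>: "\<psi> \<in> test_functions \<Omega>" for \<psi>
    proof -
      note L\<psi> = L2_continuous_test[OF \<psi> \<Omega>l]
      have "(LINT x|?M. f x * laplacian \<psi> x) = (LINT x|?M. (- l * f x) * \<psi> x)"
        using wl \<psi> unfolding weak_laplacian_def by blast
      then have "(LINT x|?M. (- l * f x) * \<psi> x) + (LINT x|?M. G x \<bullet> grad \<psi> x) = 0"
        using weak_grad_laplacian[OF G(1) fL GL \<psi> \<Omega>l] by simp
      then show ?thesis
        by (subst LINT_add) (auto intro!: L2_mult_integrable L2_inner_integrable L2_rcmult fL GL L\<psi> simp del: mult_minus_left)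
    qed
    then show ?thesis using fc G(3) Dirichlet by (auto simp: form_test_def)
  next
    case Neumann
    then obtain G g where G: "weak_grad \<Omega> f G" "Lp 2 \<Omega> G" "weak_laplacian \<Omega> f g" "Lp 2 \<Omega> g"
      and eq: "\<And>\<psi>. \<psi> \<in> test_functions UNIV \<Longrightarrow> (LINT x|?M. G x \<bullet> grad \<psi> x + g x * \<psi> x) = 0"
      using ef by (auto simp: laplace_eigenfunction_def normal_deriv_zero_def)
    have GL: "L2 ?M G" "L2 ?M g" using G by (simp_all add: Lp2_iff_L2)
    have hL: "L2 ?M (\<lambda>x. g x + l * f x)" by (intro L2_add GL L2_rcmult fL)
    have "AE x in ?M. g x + l * f x = 0"
    proof (rule fundamental_lemma[OF \<Omega>(1)])
      show "L1_loc \<Omega> (\<lambda>x. g x + l * f x)" using hL lmeasurable_open[OF \<Omega>(2,1)] by (rule L2_imp_L1_loc)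
      fix \<psi> assume \<psi>: "\<psi> \<in> test_functions \<Omega>"
      note L\<psi> = L2_continuous_test[OF \<psi> \<Omega>l]
      have "(LINT x|?M. g x * \<psi> x) = (LINT x|?M. (- l * f x) * \<psi> x)"
        using wl G(3) \<psi> unfolding weak_laplacian_def by (metis (no_types, lifting))
      moreover have "(LINT x|?M. (g x + l * f x) * \<psi> x) = (LINT x|?M. g x * \<psi> x - (- l * f x) * \<psi> x)"
        by (simp add: algebra_simps)
      moreover have "\<dots> = (LINT x|?M. g x * \<psi> x) - (LINT x|?M. (- l * f x) * \<psi> x)"
        by (intro LINT_diff L2_mult_integrable L2_rcmult GL fL L\<psi>)
      ultimately show "(LINT x|?M. (g x + l * f x) * \<psi> x) = 0" by simp
    qed
    then have ae: "AE x in ?M. g x = - l * f x" by eventually_elim simp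
    have "(LINT x|?M. (- l * f x) * \<psi> x + G x \<bullet> grad \<psi> x) = 0" if \<psi>: "\<psi> \<in> test_functions UNIV" for \<psi>
    proof -
      note L\<psi> = L2_continuous_test[OF \<psi> \<Omega>l]
      have "(LINT x|?M. (- l * f x) * \<psi> x + G x \<bullet> grad \<psi> x) = (LINT x|?M. G x \<bullet> grad \<psi> x + g x * \<psi> x)"
      proof (rule integral_cong_AE)
        show "(\<lambda>x. (- l * f x) * \<psi> x + G x \<bullet> grad \<psi> x) \<in> borel_measurable ?M"
          "(\<lambda>x. G x \<bullet> grad \<psi> x + g x * \<psi> x) \<in> borel_measurable ?M"
          using fL GL L\<psi> by (auto simp: L2_def)
      qed (use ae in eventually_elim, simp)
      then show ?thesis using eq[OF \<psi>] by simp
    qed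
    moreover have "form_closure \<Omega> (test_functions UNIV) f G" by (rule Neumann_form_closure[OF \<Omega> G(1) fL GL(1)])
    ultimately show ?thesis using Neumann by (auto simp: form_test_def)
  qed
qed

lemma eigenbasis_exists:
  assumes \<Omega>: "open \<Omega>" "bounded \<Omega>" "C2_boundary \<Omega>" and eb: "laplace_eigenbasis B \<Omega> \<Lambda> \<phi>"
  obtains \<Gamma> where "eigenbasis \<Omega> \<phi> (form_test B \<Omega>) \<Gamma> \<Lambda>"
    "\<And>k. B = Dirichlet \<Longrightarrow> k \<ge> 1 \<Longrightarrow> \<exists>\<zeta>. (\<forall>n::nat. \<zeta> n \<in> test_functions \<Omega>) \<and>
        (\<lambda>n. LINT x|lebesgue_on \<Omega>. (norm (grad (\<zeta> n) x - \<Gamma> k x))\<^sup>2) \<longlonglongrightarrow> 0"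
proof -
  let ?M = "lebesgue_on \<Omega>"
  have "\<forall>k\<in>{1..}. \<exists>G. form_closure \<Omega> (form_test B \<Omega>) (\<phi> k) G \<and>
    (\<forall>\<psi>\<in>form_test B \<Omega>. (LINT x|?M. (- \<Lambda> k * \<phi> k x) * \<psi> x + G x \<bullet> grad \<psi> x) = 0) \<and>
    (B = Dirichlet \<longrightarrow> (\<exists>\<zeta>. (\<forall>n::nat. \<zeta> n \<in> test_functions \<Omega>) \<and>
        (\<lambda>n. LINT x|?M. (norm (grad (\<zeta> n) x - G x))\<^sup>2) \<longlonglongrightarrow> 0))"
    using eb by (intro ballI eigenfunction_form \<Omega>) (simp add: laplace_eigenbasis_def)
  from bchoice[OF this] obtain \<Gamma> where \<Gamma>: "\<forall>k\<in>{1..}. form_closure \<Omega> (form_test B \<Omega>) (\<phi> k) (\<Gamma> k) \<and>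
    (\<forall>\<psi>\<in>form_test B \<Omega>. (LINT x|?M. (- \<Lambda> k * \<phi> k x) * \<psi> x + \<Gamma> k x \<bullet> grad \<psi> x) = 0) \<and>
    (B = Dirichlet \<longrightarrow> (\<exists>\<zeta>. (\<forall>n::nat. \<zeta> n \<in> test_functions \<Omega>) \<and>
        (\<lambda>n. LINT x|?M. (norm (grad (\<zeta> n) x - \<Gamma> k x))\<^sup>2) \<longlonglongrightarrow> 0))" by (elim exE)
  have onb: "orthonormal_basis_L2 \<Omega> \<phi>" using eb by (simp add: laplace_eigenbasis_def)
  have "eigenbasis \<Omega> \<phi> (form_test B \<Omega>) \<Gamma> \<Lambda>"
  proof
    show "L2 ?M (\<phi> k)" if "1 \<le> k" for k
      using onb that by (simp add: orthonormal_basis_L2_def Lp2_iff_L2)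
    show "(LINT x|?M. \<phi> j x * \<phi> k x) = (if j = k then 1 else 0)" if "1 \<le> j" "1 \<le> k" for j k
      using onb that unfolding orthonormal_basis_L2_def by blast
    show "(\<lambda>n. LINT x|?M. (f x - (\<Sum>k=1..n. (LINT y|?M. f y * \<phi> k y) * \<phi> k x))\<^sup>2) \<longlonglongrightarrow> 0"
      if "L2 ?M f" for f
      using onb that unfolding orthonormal_basis_L2_def Lp2_iff_L2 by blast
    show "\<psi> \<in> test_functions UNIV" if "\<psi> \<in> form_test B \<Omega>" for \<psi>
      using that by (cases B) (auto simp: form_test_def intro: test_functions_mono)
    show "(\<lambda>x. \<zeta> x * \<psi> x) \<in> form_test B \<Omega>" if "\<psi> \<in> form_test B \<Omega>" "\<zeta> \<in> test_functions UNIV" for \<psi> \<zeta>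
      using that by (cases B) (auto simp: form_test_def intro: test_mult_smooth test_function_smooth)
    show "form_closure \<Omega> (form_test B \<Omega>) (\<phi> k) (\<Gamma> k)" if "1 \<le> k" for k using \<Gamma> that by simp
    show "(LINT x|?M. (- \<Lambda> k * \<phi> k x) * \<psi> x + \<Gamma> k x \<bullet> grad \<psi> x) = 0" if "1 \<le> k" "\<psi> \<in> form_test B \<Omega>" for k \<psi>
      using \<Gamma> that by (meson atLeast_iff)
  qed (use eb in \<open>auto simp: laplace_eigenbasis_def\<close>)
  then show thesis using \<Gamma> that by (meson atLeast_iff)
qed

locale bounded_cylinder =
  fixes \<Omega> :: "'a::euclidean_space set" and T :: real
  assumes open_\<Omega>: "open \<Omega>" and bounded_\<Omega>: "bounded \<Omega>" and T_pos: "T > 0"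
begin

abbreviation "I \<equiv> {0<..<T}"
abbreviation "MI \<equiv> lebesgue_on I"
abbreviation "M\<Omega> \<equiv> lebesgue_on \<Omega>"
abbreviation "MQ \<equiv> lebesgue_on (I \<times> \<Omega>)"

lemma borel: "I \<in> sets borel" "\<Omega> \<in> sets borel" and lebesgue: "\<Omega> \<in> sets lebesgue"
  using open_\<Omega> by auto

lemma open_Q: "open (I \<times> \<Omega>)" and bounded_Q: "bounded (I \<times> \<Omega>)"
  using open_\<Omega> bounded_\<Omega> by (auto intro: open_Times bounded_Times)

lemma finite_measures: "finite_measure MI" "finite_measure M\<Omega>" "finite_measure MQ"
  using open_\<Omega> bounded_\<Omega> open_Q bounded_Q
  by (auto intro!: finite_measure_lebesgue_on lmeasurable_open bounded_box)

lemma L2_tensor: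
  assumes "L2 MI \<psi>" "L2 M\<Omega> \<rho>"
  shows "L2 MQ (\<lambda>z. \<psi> (fst z) * \<rho> (snd z) :: real)"
proof -
  have "integrable MQ (\<lambda>z. \<psi> (fst z) * \<rho> (snd z))"
    using assms finite_measures by (intro integrable_tensor borel L2_finite_measure_integrable)
  moreover have "integrable MQ (\<lambda>z. (\<psi> (fst z))\<^sup>2 * (\<rho> (snd z))\<^sup>2)"
    by (rule integrable_tensor[OF borel L2_real_sq[OF assms(1)] L2_real_sq[OF assms(2)]])
  ultimately show ?thesis by (auto simp: L2_def power_mult_distrib)
qed

lemma tensor_pairing:
  fixes V :: "real \<times> 'a \<Rightarrow> real" and \<psi> :: "real \<Rightarrow> real" and \<rho> :: "'a \<Rightarrow> real"
  assumes V: "L2 MQ V" and \<psi>: "L2 MI \<psi>" and \<rho>: "L2 M\<Omega> \<rho>"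
  shows "integrable MQ (\<lambda>z. V z * (\<psi> (fst z) * \<rho> (snd z)))"
    and "(LINT z|MQ. V z * (\<psi> (fst z) * \<rho> (snd z))) = (LINT x|M\<Omega>. (LINT t|MI. \<psi> t * V (t, x)) * \<rho> x)"
    and "(LINT z|MQ. V z * (\<psi> (fst z) * \<rho> (snd z))) = (LINT t|MI. \<psi> t * (LINT x|M\<Omega>. V (t, x) * \<rho> x))"
    and "integrable MI (\<lambda>t. \<psi> t * (LINT x|M\<Omega>. V (t, x) * \<rho> x))"
proof -
  show i: "integrable MQ (\<lambda>z. V z * (\<psi> (fst z) * \<rho> (snd z)))"
    by (rule L2_mult_integrable[OF V L2_tensor[OF \<psi> \<rho>]])
  note F = Fubini_cylinder[OF borel i]
  have e1: "(LINT t|MI. V (t, x) * (\<psi> t * \<rho> x)) = (LINT t|MI. \<psi> t * V (t, x)) * \<rho> x" for x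
    by (subst integral_mult_left_zero[symmetric]) (simp add: mult_ac)
  have e2: "(LINT x|M\<Omega>. V (t, x) * (\<psi> t * \<rho> x)) = \<psi> t * (LINT x|M\<Omega>. V (t, x) * \<rho> x)" for t
    by (subst integral_mult_right_zero[symmetric]) (simp add: mult_ac)
  show "(LINT z|MQ. V z * (\<psi> (fst z) * \<rho> (snd z))) = (LINT x|M\<Omega>. (LINT t|MI. \<psi> t * V (t, x)) * \<rho> x)"
    using F(6) by (simp add: e1)
  show "(LINT z|MQ. V z * (\<psi> (fst z) * \<rho> (snd z))) = (LINT t|MI. \<psi> t * (LINT x|M\<Omega>. V (t, x) * \<rho> x))"
    using F(3) by (simp add: e2)
  show "integrable MI (\<lambda>t. \<psi> t * (LINT x|M\<Omega>. V (t, x) * \<rho> x))"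
    using F(2) by (simp add: e2)
qed

lemma L2_one: "L2 MI (\<lambda>t. 1 :: real)" "L2 M\<Omega> (\<lambda>x. 1 :: real)"
proof -
  interpret a: finite_measure MI by (rule finite_measures)
  interpret b: finite_measure M\<Omega> by (rule finite_measures)
  show "L2 MI (\<lambda>t. 1 :: real)" "L2 M\<Omega> (\<lambda>x. 1 :: real)" by (simp_all add: L2_def)
qed

lemma L2_time_average:
  assumes V: "L2 MQ (V :: real \<times> 'a \<Rightarrow> real)" and \<psi>: "L2 MI \<psi>"
  shows "L2 M\<Omega> (\<lambda>x. LINT t|MI. \<psi> t * V (t, x))"
proof -
  have i1: "integrable MQ V" by (rule L2_finite_measure_integrable[OF V finite_measures(3)])
  have i2: "integrable MQ (\<lambda>z. (V z)\<^sup>2)" by (rule L2_real_sq[OF V])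
  have "integrable MQ (\<lambda>z. V z * (\<psi> (fst z) * 1))" by (rule tensor_pairing(1)[OF V \<psi> L2_one(2)])
  from Fubini_cylinder(5)[OF borel this]
  have m: "(\<lambda>x. LINT t|MI. \<psi> t * V (t, x)) \<in> borel_measurable M\<Omega>" by (simp add: mult.commute)
  have "AE x in M\<Omega>. norm ((LINT t|MI. \<psi> t * V (t, x))\<^sup>2) \<le> norm ((LINT t|MI. (\<psi> t)\<^sup>2) * (LINT t|MI. (V (t, x))\<^sup>2))"
    using Fubini_cylinder(4)[OF borel i1] Fubini_cylinder(4)[OF borel i2]
  proof eventually_elim
    case (elim x)
    then have "L2 MI (\<lambda>t. V (t, x))" by (auto simp: L2_def)
    from L2_Cauchy_Schwarz_real[OF \<psi> this] show ?case by simp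
  qed
  then have "integrable M\<Omega> (\<lambda>x. (LINT t|MI. \<psi> t * V (t, x))\<^sup>2)"
    by (rule Bochner_Integration.integrable_bound[OF integrable_mult_right[OF Fubini_cylinder(5)[OF borel i2]] borel_measurable_power[OF m]])
  with m show ?thesis by (simp add: L2_def)
qed

lemma L2_slices:
  assumes "L2 MQ (V :: real \<times> 'a \<Rightarrow> 'b::euclidean_space)"
  shows "AE t in MI. L2 M\<Omega> (\<lambda>x. V (t, x))"
proof -
  have "AE t in MI. \<forall>b\<in>Basis. L2 M\<Omega> (\<lambda>x. V (t, x) \<bullet> b)"
  proof (rule AE_finite_allI)
    fix b :: 'b
    have L: "L2 MQ (\<lambda>z. V z \<bullet> b)" by (rule L2_component[OF assms])
    show "AE t in MI. L2 M\<Omega> (\<lambda>x. V (t, x) \<bullet> b)"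
      using Fubini_cylinder(1)[OF borel L2_finite_measure_integrable[OF L finite_measures(3)]]
        Fubini_cylinder(1)[OF borel L2_real_sq[OF L]]
      by eventually_elim (auto simp: L2_def)
  qed simp
  then show ?thesis by eventually_elim (rule L2_components, blast)
qed

text \<open>A vector-valued integral, defined by components so that the scalar Fubini theorem applies to
  each of them.\<close>

definition time_average :: "(real \<Rightarrow> real) \<Rightarrow> (real \<times> 'a \<Rightarrow> 'a) \<Rightarrow> 'a \<Rightarrow> 'a" where
  "time_average \<psi> G x = (\<Sum>b\<in>Basis. (LINT t|MI. \<psi> t * (G (t, x) \<bullet> b)) *\<^sub>R b)"

lemma time_average_inner: "b \<in> Basis \<Longrightarrow> time_average \<psi> G x \<bullet> b = (LINT t|MI. \<psi> t * (G (t, x) \<bullet> b))"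
  by (simp add: time_average_def inner_sum_left inner_Basis if_distrib cong: if_cong)

lemma L2_vector_time_average:
  assumes "L2 MQ G" "L2 MI \<psi>"
  shows "L2 M\<Omega> (time_average \<psi> G)"
  by (rule L2_components) (simp only: time_average_inner L2_time_average[OF L2_component[OF assms(1)] assms(2)])

lemma vector_tensor_pairing:
  assumes G: "L2 MQ G" and \<psi>: "L2 MI \<psi>" and H: "L2 M\<Omega> (H :: 'a \<Rightarrow> 'a)"
  shows "integrable MQ (\<lambda>z. \<psi> (fst z) * (G z \<bullet> H (snd z)))"
    and "(LINT z|MQ. \<psi> (fst z) * (G z \<bullet> H (snd z))) = (LINT x|M\<Omega>. time_average \<psi> G x \<bullet> H x)"
    and "(LINT z|MQ. \<psi> (fst z) * (G z \<bullet> H (snd z))) = (LINT t|MI. \<psi> t * (LINT x|M\<Omega>. G (t, x) \<bullet> H x))"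
    and "integrable MI (\<lambda>t. \<psi> t * (LINT x|M\<Omega>. G (t, x) \<bullet> H x))"
proof -
  note t = tensor_pairing[OF L2_component[OF G] \<psi> L2_component[OF H]]
  have e: "\<psi> (fst z) * (G z \<bullet> H (snd z)) = (\<Sum>b\<in>Basis. (G z \<bullet> b) * (\<psi> (fst z) * (H (snd z) \<bullet> b)))" for z
    by (subst euclidean_inner) (simp add: sum_distrib_left mult_ac)
  show i: "integrable MQ (\<lambda>z. \<psi> (fst z) * (G z \<bullet> H (snd z)))"
    unfolding e using t(1) by (intro Bochner_Integration.integrable_sum)
  have s: "(LINT z|MQ. \<psi> (fst z) * (G z \<bullet> H (snd z))) = (\<Sum>b\<in>Basis. (LINT z|MQ. (G z \<bullet> b) * (\<psi> (fst z) * (H (snd z) \<bullet> b))))"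
    unfolding e using t(1) by (intro LINT_sum)
  have "(LINT x|M\<Omega>. time_average \<psi> G x \<bullet> H x) = (LINT x|M\<Omega>. (\<Sum>b\<in>Basis. (time_average \<psi> G x \<bullet> b) * (H x \<bullet> b)))"
    by (subst euclidean_inner) simp
  also have "\<dots> = (\<Sum>b\<in>Basis. (LINT x|M\<Omega>. (time_average \<psi> G x \<bullet> b) * (H x \<bullet> b)))"
    by (intro LINT_sum L2_mult_integrable L2_component L2_vector_time_average G \<psi> H)
  also have "\<dots> = (LINT z|MQ. \<psi> (fst z) * (G z \<bullet> H (snd z)))"
    unfolding s by (intro sum.cong refl) (simp add: time_average_inner t(2))
  finally show "(LINT z|MQ. \<psi> (fst z) * (G z \<bullet> H (snd z))) = (LINT x|M\<Omega>. time_average \<psi> G x \<bullet> H x)" by simp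
  note F = Fubini_cylinder[OF borel i]
  show "(LINT z|MQ. \<psi> (fst z) * (G z \<bullet> H (snd z))) = (LINT t|MI. \<psi> t * (LINT x|M\<Omega>. G (t, x) \<bullet> H x))"
    using F(3) by simp
  show "integrable MI (\<lambda>t. \<psi> t * (LINT x|M\<Omega>. G (t, x) \<bullet> H x))"
    using F(2) by simp
qed

end

section \<open>The ordinary differential equations of the modes\<close>

text \<open>Weak continuity is Cauchy-Schwarz; for the norm, \<open>|V\<^sub>t|\<^sup>2 = |V\<^sub>t - V\<^sub>s|\<^sup>2 + 2 (V\<^sub>t, V\<^sub>s) - |V\<^sub>s|\<^sup>2\<close>.\<close>

lemma L2_path_continuous:
  fixes V :: "real \<Rightarrow> 'm \<Rightarrow> real"
  assumes V: "\<And>t. t \<in> S \<Longrightarrow> L2 M (V t)"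
    and path: "\<And>s. s \<in> S \<Longrightarrow> ((\<lambda>t. LINT x|M. (V t x - V s x)\<^sup>2) \<longlongrightarrow> 0) (at s within S)"
  shows "L2 M \<rho> \<Longrightarrow> continuous_on S (\<lambda>t. LINT x|M. V t x * \<rho> x)"
    and "continuous_on S (\<lambda>t. LINT x|M. (V t x)\<^sup>2)"
proof -
  have lim: "((\<lambda>t. LINT x|M. V t x * \<rho> x) \<longlongrightarrow> (LINT x|M. V s x * \<rho> x)) (at s within S)"
    if s: "s \<in> S" and \<rho>: "L2 M \<rho>" for s \<rho>
  proof -
    have "((\<lambda>t. sqrt (LINT x|M. (V t x - V s x)\<^sup>2) * sqrt (LINT x|M. (\<rho> x)\<^sup>2)) \<longlongrightarrow> sqrt 0 * sqrt (LINT x|M. (\<rho> x)\<^sup>2)) (at s within S)"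
      by (intro tendsto_intros path s)
    then have z: "((\<lambda>t. sqrt (LINT x|M. (V t x - V s x)\<^sup>2) * sqrt (LINT x|M. (\<rho> x)\<^sup>2)) \<longlongrightarrow> 0) (at s within S)" by simp
    have le: "norm ((LINT x|M. V t x * \<rho> x) - (LINT x|M. V s x * \<rho> x))
        \<le> sqrt (LINT x|M. (V t x - V s x)\<^sup>2) * sqrt (LINT x|M. (\<rho> x)\<^sup>2)" if t: "t \<in> S" for t
    proof -
      have "(LINT x|M. V t x * \<rho> x) - (LINT x|M. V s x * \<rho> x) = (LINT x|M. (V t x - V s x) * \<rho> x)"
        unfolding left_diff_distrib
        by (intro LINT_diff[symmetric] L2_mult_integrable V s t \<rho>)
      then show ?thesis using L2_Cauchy_Schwarz_sqrt[OF L2_diff[OF V[OF t] V[OF s]] \<rho>] by simp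
    qed
    have "((\<lambda>t. (LINT x|M. V t x * \<rho> x) - (LINT x|M. V s x * \<rho> x)) \<longlongrightarrow> 0) (at s within S)"
      by (rule Lim_null_comparison[OF _ z]) (use le in \<open>auto simp: eventually_at_filter\<close>)
    then show ?thesis by (rule LIM_zero_cancel)
  qed
  show "L2 M \<rho> \<Longrightarrow> continuous_on S (\<lambda>t. LINT x|M. V t x * \<rho> x)"
    using lim by (auto simp: continuous_on_def)
  show "continuous_on S (\<lambda>t. LINT x|M. (V t x)\<^sup>2)"
    unfolding continuous_on_def
  proof
    fix s assume s: "s \<in> S"
    have e: "(LINT x|M. (V t x)\<^sup>2) = (LINT x|M. (V t x - V s x)\<^sup>2) + (2 * (LINT x|M. V t x * V s x) - (LINT x|M. (V s x)\<^sup>2))"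
      if t: "t \<in> S" for t
    proof -
      note i = L2_real_sq[OF V[OF t]] L2_real_sq[OF V[OF s]] L2_mult_integrable[OF V[OF t] V[OF s]]
      have "(LINT x|M. (V t x - V s x)\<^sup>2) = (LINT x|M. ((V t x)\<^sup>2 + (V s x)\<^sup>2) - 2 * (V t x * V s x))"
        by (simp add: power2_diff mult.assoc)
      also have "\<dots> = (LINT x|M. (V t x)\<^sup>2) + (LINT x|M. (V s x)\<^sup>2) - 2 * (LINT x|M. V t x * V s x)"
        using i by simp
      finally show ?thesis by simp
    qed
    have "((\<lambda>t. (LINT x|M. (V t x - V s x)\<^sup>2) + (2 * (LINT x|M. V t x * V s x) - (LINT x|M. (V s x)\<^sup>2)))
        \<longlongrightarrow> 0 + (2 * (LINT x|M. V s x * V s x) - (LINT x|M. (V s x)\<^sup>2))) (at s within S)"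
      by (intro tendsto_intros path lim s V)
    then have "((\<lambda>t. (LINT x|M. (V t x - V s x)\<^sup>2) + (2 * (LINT x|M. V t x * V s x) - (LINT x|M. (V s x)\<^sup>2)))
        \<longlongrightarrow> (LINT x|M. (V s x)\<^sup>2)) (at s within S)"
      by (simp add: power2_eq_square)
    then show "((\<lambda>t. LINT x|M. (V t x)\<^sup>2) \<longlongrightarrow> (LINT x|M. (V s x)\<^sup>2)) (at s within S)"
      by (rule Lim_transform_eventually) (auto simp: eventually_at_filter e)
  qed
qed

lemma L1_loc_test_integrable:
  assumes "L1_loc U f" "\<psi> \<in> test_functions U" "U \<in> sets lebesgue"
  shows "integrable (lebesgue_on U) (\<lambda>x. f x * \<psi> x)"
proof -
  obtain C where C: "compact C" "C \<subseteq> U" "\<And>x. x \<notin> C \<Longrightarrow> \<psi> x = 0" using assms(2) test_functionE by metis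
  obtain B where B: "\<And>x. \<bar>\<psi> x\<bar> \<le> B" using test_grad_bounded[OF assms(2)] by metis
  have i: "integrable (lebesgue_on C) f" using assms(1) C by (simp add: L1_loc_def)
  have m: "\<psi> \<in> borel_measurable (lebesgue_on C)"
    by (intro continuous_measurable_lebesgue_on smooth_continuous test_function_smooth[OF assms(2)])
  have "integrable (lebesgue_on C) (\<lambda>x. f x * \<psi> x)"
  proof (rule integrable_bound_real[of _ "\<lambda>x. \<bar>f x\<bar> * B"])
    show "integrable (lebesgue_on C) (\<lambda>x. \<bar>f x\<bar> * B)" using i by simp
    show "(\<lambda>x. f x * \<psi> x) \<in> borel_measurable (lebesgue_on C)" using i m by auto
    show "norm (f x * \<psi> x) \<le> \<bar>f x\<bar> * B" for x using B[of x] by (simp add: abs_mult mult_left_mono)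
  qed
  then show ?thesis
    using integral_lebesgue_on_superset(2)[of C U "\<lambda>x. f x * \<psi> x"] assms C
    by (auto simp: lmeasurable_compact fmeasurableD)
qed

lemma fundamental_lemma_eq:
  assumes U: "open U" and L: "L1_loc U f" "L1_loc U g"
    and eq: "\<And>\<psi>. \<psi> \<in> test_functions U \<Longrightarrow> (LINT x|lebesgue_on U. f x * \<psi> x) = (LINT x|lebesgue_on U. g x * \<psi> x)"
  shows "AE x in lebesgue_on U. f x = g x"
proof -
  have "AE x in lebesgue_on U. f x - g x = 0"
  proof (rule fundamental_lemma[OF U])
    show "L1_loc U (\<lambda>x. f x - g x)" using L by (simp add: L1_loc_def)
    fix \<psi> assume \<psi>: "\<psi> \<in> test_functions U"
    show "(LINT x|lebesgue_on U. (f x - g x) * \<psi> x) = 0"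
      using eq[OF \<psi>] U unfolding left_diff_distrib
      by (subst LINT_diff) (auto intro!: L1_loc_test_integrable L \<psi>)
  qed
  then show ?thesis by eventually_elim simp
qed

context bounded_cylinder
begin

lemma bdd_meas_of_open:
  assumes "g \<in> borel_measurable MI" "\<And>t. t \<in> {0..T} \<Longrightarrow> \<bar>g t\<bar> \<le> C"
  shows "bdd_meas T g"
proof -
  have "(\<lambda>t. if t \<in> I then g t else 0) \<in> borel_measurable lebesgue"
    by (rule borel_measurable_if_I) (use assms in auto)
  then have "(\<lambda>t. if t = 0 then g 0 else if t = T then g T else if t \<in> I then g t else 0) \<in> borel_measurable lebesgue"
    by (intro measurable_If[OF borel_measurable_const]) auto
  then have "(\<lambda>t. if t = 0 then g 0 else if t = T then g T else if t \<in> I then g t else 0) \<in> borel_measurable (lebesgue_on {0..T})"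
    by (rule measurable_restrict_space1)
  then have "g \<in> borel_measurable (lebesgue_on {0..T})"
    by (rule measurable_cong[THEN iffD1, rotated]) auto
  then show ?thesis unfolding bdd_meas_def using assms(2) by blast
qed

lemma test_I:
  assumes "\<psi> \<in> test_functions I"
  shows "L2 MI \<psi>" "L2 MI (dderiv 1 \<psi>)" "bdd_meas T \<psi>" "bdd_meas T (dderiv 1 \<psi>)"
  using assms
  by (auto intro!: L2_continuous_test test_dderiv bdd_meas_continuous smooth_continuous smooth_dderiv intro: test_function_smooth)

text \<open>A potential that is Borel and bounded everywhere has measurable and bounded slices at every
  time, not only at almost every time.\<close>

lemma bounded_borel_representative:
  assumes "Linfty (I \<times> \<Omega>) q"
  obtains g C where "g \<in> borel_measurable borel" "\<And>z. \<bar>g z\<bar> \<le> C" "AE z in MQ. q z = g z"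
proof -
  obtain C where m: "q \<in> borel_measurable MQ" and C: "AE z in MQ. \<bar>q z\<bar> \<le> C" using assms by (auto simp: Linfty_def)
  have b: "I \<times> \<Omega> \<in> sets borel" using open_Q by simp
  obtain g where g: "g \<in> borel_measurable borel" "AE z in lborel. indicator (I \<times> \<Omega>) z * q z = g z"
    by (rule lebesgue_on_borel_representative[OF b m]) (rule that)
  have "AE z in MQ. q z = g z"
    unfolding AE_lebesgue_on_iff[OF b] using g(2) by eventually_elim (auto simp: indicator_def)
  with C have "AE z in MQ. q z = max (- \<bar>C\<bar>) (min \<bar>C\<bar> (g z))"
    by eventually_elim (auto simp: max_def min_def)
  then show thesis using g(1) by (intro that[of "\<lambda>z. max (- \<bar>C\<bar>) (min \<bar>C\<bar> (g z))" "\<bar>C\<bar>"]) auto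
qed

lemma space_grad_tensor_pairing:
  assumes wg: "weak_space_grad (I \<times> \<Omega>) v G" and v: "L2 MQ v" and G: "L2 MQ G"
    and \<psi>: "\<psi> \<in> test_functions I" and \<chi>: "\<zeta> \<in> test_functions \<Omega>"
  shows "b \<in> Basis \<Longrightarrow> (LINT z|MQ. v z * (\<psi> (fst z) * dderiv b \<zeta> (snd z))) = - (LINT z|MQ. (G z \<bullet> b) * (\<psi> (fst z) * \<zeta> (snd z)))"
    and "(LINT z|MQ. v z * (\<psi> (fst z) * laplacian \<zeta> (snd z))) = - (LINT z|MQ. \<psi> (fst z) * (G z \<bullet> grad \<zeta> (snd z)))"
proof -
  have e: "(LINT z|MQ. v z * (\<psi> (fst z) * dderiv b \<zeta> (snd z))) = - (LINT z|MQ. (G z \<bullet> b) * (\<psi> (fst z) * \<zeta> (snd z)))"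
    if b: "b \<in> Basis" and z: "\<zeta> \<in> test_functions \<Omega>" for b \<zeta>
  proof -
    have "weak_dderiv (I \<times> \<Omega>) (0, b) v (\<lambda>z. G z \<bullet> b)" using wg b by (simp add: weak_space_grad_def)
    moreover have "(\<lambda>z. \<psi> (fst z) * \<zeta> (snd z)) \<in> test_functions (I \<times> \<Omega>)"
      using test_tensor[OF \<psi> z] by (simp add: cylinder_def)
    ultimately have "(LINT z|MQ. v z * dderiv (0, b) (\<lambda>z. \<psi> (fst z) * \<zeta> (snd z)) z) = - (LINT z|MQ. (G z \<bullet> b) * (\<psi> (fst z) * \<zeta> (snd z)))"
      unfolding weak_dderiv_def by blast
    then show ?thesis by (simp only: dderiv_tensor[OF test_function_smooth[OF \<psi>] test_function_smooth[OF z]])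
  qed
  then show "b \<in> Basis \<Longrightarrow> (LINT z|MQ. v z * (\<psi> (fst z) * dderiv b \<zeta> (snd z))) = - (LINT z|MQ. (G z \<bullet> b) * (\<psi> (fst z) * \<zeta> (snd z)))"
    using \<chi> by blast
  have d: "dderiv b \<zeta> \<in> test_functions \<Omega>" "L2 M\<Omega> (dderiv b \<zeta>)" "L2 M\<Omega> (dderiv b (dderiv b \<zeta>))" for b
    using \<chi> lebesgue by (auto intro!: test_dderiv L2_continuous_test)
  have "(LINT z|MQ. v z * (\<psi> (fst z) * laplacian \<zeta> (snd z))) = (LINT z|MQ. (\<Sum>b\<in>Basis. v z * (\<psi> (fst z) * dderiv b (dderiv b \<zeta>) (snd z))))"
    by (simp add: laplacian_def sum_distrib_left)
  also have "\<dots> = (\<Sum>b\<in>Basis. (LINT z|MQ. v z * (\<psi> (fst z) * dderiv b (dderiv b \<zeta>) (snd z))))"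
    by (intro LINT_sum tensor_pairing(1) v test_I(1)[OF \<psi>] d)
  also have "\<dots> = - (\<Sum>b\<in>Basis. (LINT z|MQ. (G z \<bullet> b) * (\<psi> (fst z) * dderiv b \<zeta> (snd z))))"
    using e d(1) by (simp add: sum_negf)
  also have "(\<Sum>b\<in>Basis. (LINT z|MQ. (G z \<bullet> b) * (\<psi> (fst z) * dderiv b \<zeta> (snd z))))
      = (LINT z|MQ. (\<Sum>b\<in>Basis. (G z \<bullet> b) * (\<psi> (fst z) * dderiv b \<zeta> (snd z))))"
    by (intro LINT_sum[symmetric] tensor_pairing(1) L2_component G test_I(1)[OF \<psi>] d)
  also have "(\<lambda>z. \<Sum>b\<in>Basis. (G z \<bullet> b) * (\<psi> (fst z) * dderiv b \<zeta> (snd z))) = (\<lambda>z. \<psi> (fst z) * (G z \<bullet> grad \<zeta> (snd z)))"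
    by (simp add: grad_def inner_sum_right sum_distrib_left mult_ac)
  finally show "(LINT z|MQ. v z * (\<psi> (fst z) * laplacian \<zeta> (snd z))) = - (LINT z|MQ. \<psi> (fst z) * (G z \<bullet> grad \<zeta> (snd z)))" .
qed

end

locale heat_cylinder = bounded_cylinder \<Omega> T + eigenbasis \<Omega> \<phi> "form_test B \<Omega>" \<Gamma> \<Lambda>
  for \<Omega> :: "'a::euclidean_space set" and T \<phi> B \<Gamma> \<Lambda> +
  fixes q :: "real \<times> 'a \<Rightarrow> real" and Q :: real
  assumes C2: "C2_boundary \<Omega>"
    and \<Gamma>_approx: "B = Dirichlet \<Longrightarrow> k \<ge> 1 \<Longrightarrow> \<exists>\<zeta>. (\<forall>n::nat. \<zeta> n \<in> test_functions \<Omega>) \<and>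
        (\<lambda>n. LINT x|lebesgue_on \<Omega>. (norm (grad (\<zeta> n) x - \<Gamma> k x))\<^sup>2) \<longlonglongrightarrow> 0"
    and q_borel: "q \<in> borel_measurable borel" and q_le: "\<bar>q z\<bar> \<le> Q"
begin

lemma borel_coef_measurable:
  assumes g: "g \<in> borel_measurable borel" "\<And>z. \<bar>g z\<bar> \<le> C" and jk: "j \<ge> 1" "k \<ge> 1"
  shows "(\<lambda>t. LINT x|M\<Omega>. g (t, x) * (\<phi> j x * \<phi> k x)) \<in> borel_measurable (lebesgue_on {0..T})"
proof -
  have b: "{0..T} \<in> sets borel" by simp
  have "integrable (lebesgue_on {0..T}) (\<lambda>t. 1 :: real)" by (rule bdd_meas_LINT) simp
  from integrable_tensor[OF b borel(2) this L2_mult_integrable[OF L2_basis[OF jk(1)] L2_basis[OF jk(2)]]]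
  have i: "integrable (lebesgue_on ({0..T} \<times> \<Omega>)) (\<lambda>z. \<phi> j (snd z) * \<phi> k (snd z))" by simp
  have gm: "g \<in> borel_measurable (lebesgue_on ({0..T} \<times> \<Omega>))"
    using g(1) by (intro measurable_restrict_space1 measurable_completion) simp
  have "integrable (lebesgue_on ({0..T} \<times> \<Omega>)) (\<lambda>z. g z * (\<phi> j (snd z) * \<phi> k (snd z)))"
  proof (rule integrable_bound_real)
    show "integrable (lebesgue_on ({0..T} \<times> \<Omega>)) (\<lambda>z. C * \<bar>\<phi> j (snd z) * \<phi> k (snd z)\<bar>)"
      using i by (intro integrable_mult_right integrable_abs)
    show "(\<lambda>z. g z * (\<phi> j (snd z) * \<phi> k (snd z))) \<in> borel_measurable (lebesgue_on ({0..T} \<times> \<Omega>))"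
      using gm borel_measurable_integrable[OF i] by (rule borel_measurable_times)
    show "norm (g z * (\<phi> j (snd z) * \<phi> k (snd z))) \<le> C * \<bar>\<phi> j (snd z) * \<phi> k (snd z)\<bar>" for z
      unfolding real_norm_def abs_mult[of "g z"] using g(2) by (intro mult_right_mono) auto
  qed
  from Fubini_cylinder(2)[OF b borel(2) this] show ?thesis by simp
qed

sublocale heat_modes \<Omega> \<phi> "form_test B \<Omega>" \<Gamma> \<Lambda> T Q "\<lambda>t x. q (t, x)"
proof
  show "T > 0" by (rule T_pos)
  show "Q \<ge> 0" using q_le abs_ge_zero order_trans by blast
  show "(\<lambda>x. q (t, x)) \<in> borel_measurable (lebesgue_on \<Omega>)" for t
    using borel_slices(1)[OF _ _ q_borel, OF borel, of t]
    by (intro measurable_restrict_space1 measurable_completion) simp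
  show "\<bar>q (t, x)\<bar> \<le> Q" for t x by (rule q_le)
  fix k :: nat assume k: "1 \<le> k"
  show "(\<lambda>t. LINT x|lebesgue_on \<Omega>. q (t, x) * \<phi> j x * \<phi> k x) \<in> borel_measurable (lebesgue_on {0..T})" if "1 \<le> j" for j
    using borel_coef_measurable[OF q_borel q_le that k] by (simp add: mult.assoc)
  have "\<bar>(q z)\<^sup>2\<bar> \<le> Q\<^sup>2" for z using power_mono[OF q_le[of z], of 2] by simp
  from borel_coef_measurable[OF borel_measurable_power[OF q_borel] this k k]
  show "(\<lambda>t. LINT x|lebesgue_on \<Omega>. (q (t, x) * \<phi> k x)\<^sup>2) \<in> borel_measurable (lebesgue_on {0..T})"
    by (simp add: power2_eq_square mult_ac)
qed

context
  fixes v :: "real \<times> 'a \<Rightarrow> real" and G :: "real \<times> 'a \<Rightarrow> 'a"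
  assumes v: "L2 MQ v" and G: "L2 MQ G" and wg: "weak_space_grad (I \<times> \<Omega>) v G"
begin

text \<open>The time average of \<open>v\<close> is in \<open>H\<^sup>1(\<Omega>)\<close> with gradient the time average of \<open>G\<close>, so it can be inserted
  in the weak eigenvalue equation.\<close>

lemma energy_pairing_Neumann:
  assumes B: "B = Neumann" and \<psi>: "\<psi> \<in> test_functions I" and k: "k \<ge> 1"
  shows "(LINT x|M\<Omega>. time_average \<psi> G x \<bullet> \<Gamma> k x) = \<Lambda> k * (LINT t|MI. \<psi> t * coef (\<lambda>x. v (t, x)) k)"
proof -
  let ?u = "\<lambda>x. LINT t|MI. \<psi> t * v (t, x)"
  note L\<psi> = test_I(1)[OF \<psi>]
  have u: "L2 M\<Omega> ?u" by (rule L2_time_average[OF v L\<psi>])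
  have W: "L2 M\<Omega> (time_average \<psi> G)" by (rule L2_vector_time_average[OF G L\<psi>])
  have "weak_grad \<Omega> ?u (time_average \<psi> G)"
    unfolding weak_grad_def weak_dderiv_def
  proof (intro ballI conjI)
    fix b :: 'a assume b: "b \<in> Basis"
    show "L1_loc \<Omega> ?u" "L1_loc \<Omega> (\<lambda>x. time_average \<psi> G x \<bullet> b)"
      using lmeasurable_open[OF bounded_\<Omega> open_\<Omega>] by (intro L2_imp_L1_loc L2_component u W; assumption)+
    fix \<zeta> assume \<zeta>: "\<zeta> \<in> test_functions \<Omega>"
    have L\<zeta>: "L2 M\<Omega> \<zeta>" "L2 M\<Omega> (dderiv b \<zeta>)" using \<zeta> lebesgue by (auto intro!: test_dderiv L2_continuous_test)
    show "(LINT x|M\<Omega>. ?u x * dderiv b \<zeta> x) = - (LINT x|M\<Omega>. (time_average \<psi> G x \<bullet> b) * \<zeta> x)"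
      using space_grad_tensor_pairing(1)[OF wg v G \<psi> \<zeta> b] tensor_pairing(2)[OF v L\<psi> L\<zeta>(2)]
        tensor_pairing(2)[OF L2_component[OF G] L\<psi> L\<zeta>(1), of b]
      by (simp add: time_average_inner[OF b])
  qed
  then have "form_closure \<Omega> (form_test B \<Omega>) ?u (time_average \<psi> G)"
    using Neumann_form_closure[OF open_\<Omega> bounded_\<Omega> C2 _ u W] B by (simp add: form_test_def)
  from eigen_weak[OF k this]
  have "(LINT x|M\<Omega>. \<Gamma> k x \<bullet> time_average \<psi> G x) = \<Lambda> k * coef ?u k" .
  also have "coef ?u k = (LINT t|MI. \<psi> t * coef (\<lambda>x. v (t, x)) k)"
    using tensor_pairing(2,3)[OF v L\<psi> L2_basis[OF k]] by (simp add: coef_def)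
  finally show ?thesis by (simp add: inner_commute)
qed

text \<open>The boundary condition concerns almost every slice \<open>v(t)\<close>, which has a weak gradient \<open>H\<close> in
  the form domain; a priori \<open>H\<close> is unrelated to the slice \<open>G(t)\<close> of the space-time gradient. Both have the
  same pairing with \<open>\<nabla>\<zeta>\<close> for \<open>\<zeta>\<close> in a countable family of test functions, hence with \<open>\<Gamma> k\<close>, the limit
  of such gradients.\<close>

lemma energy_pairing_Dirichlet:
  assumes B: "B = Dirichlet" and \<psi>: "\<psi> \<in> test_functions I" and k: "k \<ge> 1"
    and H10: "AE t in MI. H10 \<Omega> (\<lambda>x. v (t, x))"
  shows "(LINT x|M\<Omega>. time_average \<psi> G x \<bullet> \<Gamma> k x) = \<Lambda> k * (LINT t|MI. \<psi> t * coef (\<lambda>x. v (t, x)) k)"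
proof -
  note L\<psi> = test_I(1)[OF \<psi>]
  obtain \<zeta> where \<zeta>: "\<And>n::nat. \<zeta> n \<in> test_functions \<Omega>"
    and lim: "(\<lambda>n. LINT x|M\<Omega>. (norm (grad (\<zeta> n) x - \<Gamma> k x))\<^sup>2) \<longlonglongrightarrow> 0"
    using \<Gamma>_approx[OF B k] by blast
  have L\<zeta>: "L2 M\<Omega> (grad (\<zeta> n))" "L2 M\<Omega> (laplacian (\<zeta> n))" for n
  proof -
    show "L2 M\<Omega> (grad (\<zeta> n))" using \<zeta> lebesgue by (intro L2_continuous_test)
    have "L2 M\<Omega> (\<lambda>x. \<Sum>b\<in>Basis. dderiv b (dderiv b (\<zeta> n)) x)"
      using lebesgue by (intro L2_sum L2_continuous_test(1)) (auto intro: test_dderiv \<zeta>)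
    then show "L2 M\<Omega> (laplacian (\<zeta> n))" by (simp add: laplacian_def[abs_def])
  qed
  have Il: "I \<in> lmeasurable" by (intro lmeasurable_open) auto
  have slice: "AE t in MI. (LINT x|M\<Omega>. v (t, x) * laplacian (\<zeta> n) x) = - (LINT x|M\<Omega>. G (t, x) \<bullet> grad (\<zeta> n) x)" for n
  proof (rule fundamental_lemma_eq)
    have L1: "L1_loc I f" if "integrable MI f" for f
      unfolding L1_loc_def using that
      by (auto intro!: integrable_lebesgue_on_subset[of I] simp: lmeasurable_compact fmeasurableD)
    show "L1_loc I (\<lambda>t. LINT x|M\<Omega>. v (t, x) * laplacian (\<zeta> n) x)"
      using tensor_pairing(4)[OF v L2_one(1) L\<zeta>(2)] by (intro L1) simp
    show "L1_loc I (\<lambda>t. - (LINT x|M\<Omega>. G (t, x) \<bullet> grad (\<zeta> n) x))"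
      using vector_tensor_pairing(4)[OF G L2_one(1) L\<zeta>(1)] by (intro L1) simp
    fix \<theta> assume \<theta>: "\<theta> \<in> test_functions I"
    note L\<theta> = test_I(1)[OF \<theta>]
    show "(LINT t|MI. (LINT x|M\<Omega>. v (t, x) * laplacian (\<zeta> n) x) * \<theta> t)
      = (LINT t|MI. - (LINT x|M\<Omega>. G (t, x) \<bullet> grad (\<zeta> n) x) * \<theta> t)"
      using space_grad_tensor_pairing(2)[OF wg v G \<theta> \<zeta>] tensor_pairing(3)[OF v L\<theta> L\<zeta>(2)]
        vector_tensor_pairing(3)[OF G L\<theta> L\<zeta>(1)]
      by (simp add: mult.commute[of _ "\<theta> _"])
  qed simp
  have "AE t in MI. \<forall>n. (LINT x|M\<Omega>. v (t, x) * laplacian (\<zeta> n) x) = - (LINT x|M\<Omega>. G (t, x) \<bullet> grad (\<zeta> n) x)"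
    unfolding AE_all_countable using slice by blast
  with H10 L2_slices[OF G] have ae: "AE t in MI. (LINT x|M\<Omega>. G (t, x) \<bullet> \<Gamma> k x) = \<Lambda> k * coef (\<lambda>x. v (t, x)) k"
  proof eventually_elim
    case (elim t)
    then obtain H \<eta> where H: "weak_grad \<Omega> (\<lambda>x. v (t, x)) H" "Lp 2 \<Omega> H" "\<And>n. \<eta> n \<in> test_functions \<Omega>"
      "(\<lambda>n. LINT x|M\<Omega>. (v (t, x) - \<eta> n x)\<^sup>2 + (norm (H x - grad (\<eta> n) x))\<^sup>2) \<longlonglongrightarrow> 0" "Lp 2 \<Omega> (\<lambda>x. v (t, x))"
      unfolding H10_def by blast
    have L: "L2 M\<Omega> H" "L2 M\<Omega> (\<lambda>x. v (t, x))" using H by (simp_all add: Lp2_iff_L2)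
    have "form_closure \<Omega> (form_test B \<Omega>) (\<lambda>x. v (t, x)) H"
      using H10_form_closure(1)[OF lebesgue H(5,2,3,4)] B by (simp add: form_test_def)
    from eigen_weak[OF k this] have e: "(LINT x|M\<Omega>. \<Gamma> k x \<bullet> H x) = \<Lambda> k * coef (\<lambda>x. v (t, x)) k" .
    have "(LINT x|M\<Omega>. grad (\<zeta> n) x \<bullet> G (t, x)) = (LINT x|M\<Omega>. grad (\<zeta> n) x \<bullet> H x)" for n
      using weak_grad_laplacian[OF H(1) L(2,1) \<zeta> lebesgue, of n] elim(3) by (simp add: inner_commute)
    then have "(\<lambda>n. LINT x|M\<Omega>. grad (\<zeta> n) x \<bullet> G (t, x)) \<longlonglongrightarrow> (LINT x|M\<Omega>. \<Gamma> k x \<bullet> H x)"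
      using L2_pairing_tendsto[OF L\<zeta>(1) L2_\<Gamma>[OF k] L(1) lim] by simp
    moreover have "(\<lambda>n. LINT x|M\<Omega>. grad (\<zeta> n) x \<bullet> G (t, x)) \<longlonglongrightarrow> (LINT x|M\<Omega>. \<Gamma> k x \<bullet> G (t, x))"
      by (rule L2_pairing_tendsto[OF L\<zeta>(1) L2_\<Gamma>[OF k] elim(2) lim])
    ultimately have "(LINT x|M\<Omega>. \<Gamma> k x \<bullet> H x) = (LINT x|M\<Omega>. \<Gamma> k x \<bullet> G (t, x))" by (rule LIMSEQ_unique)
    then show ?case using e by (simp add: inner_commute)
  qed
  have "(LINT x|M\<Omega>. time_average \<psi> G x \<bullet> \<Gamma> k x) = (LINT t|MI. \<psi> t * (LINT x|M\<Omega>. G (t, x) \<bullet> \<Gamma> k x))"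
    using vector_tensor_pairing(2,3)[OF G L\<psi> L2_\<Gamma>[OF k]] by simp
  also have "\<dots> = (LINT t|MI. \<Lambda> k * (\<psi> t * coef (\<lambda>x. v (t, x)) k))"
  proof (rule integral_cong_AE)
    show "(\<lambda>t. \<psi> t * (LINT x|M\<Omega>. G (t, x) \<bullet> \<Gamma> k x)) \<in> borel_measurable MI"
      by (rule borel_measurable_integrable[OF vector_tensor_pairing(4)[OF G L\<psi> L2_\<Gamma>[OF k]]])
    show "(\<lambda>t. \<Lambda> k * (\<psi> t * coef (\<lambda>x. v (t, x)) k)) \<in> borel_measurable MI"
      using borel_measurable_integrable[OF tensor_pairing(4)[OF v L\<psi> L2_basis[OF k]]]
      by (simp add: coef_def)
  qed (use ae in eventually_elim, simp)
  also have "\<dots> = \<Lambda> k * (LINT t|MI. \<psi> t * coef (\<lambda>x. v (t, x)) k)" by simp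
  finally show ?thesis .
qed

end


text \<open>The weak equation with a product \<open>\<psi>(t) \<zeta>(x)\<close> as test function. In the Neumann case the
  gradient and the source in the definition of the boundary condition are first identified with \<open>G\<close> and \<open>q v\<close>.\<close>

lemma weak_form:
  assumes sol: "heat_solution B T \<Omega> q0 h v" and q0: "q0 \<in> borel_measurable MQ" "AE z in MQ. q0 z = q z"
    and G: "L2 MQ G" and wg: "weak_space_grad (I \<times> \<Omega>) v G"
    and \<psi>: "\<psi> \<in> test_functions I" and \<chi>: "\<zeta> \<in> form_test B \<Omega>"
  shows "(LINT z|MQ. v z * (dderiv 1 \<psi> (fst z) * \<zeta> (snd z))) + (LINT z|MQ. (q z * v z) * (\<psi> (fst z) * \<zeta> (snd z)))
    = (LINT z|MQ. \<psi> (fst z) * (G z \<bullet> grad \<zeta> (snd z)))"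
proof -
  have cyl: "cylinder T \<Omega> = I \<times> \<Omega>" by (simp add: cylinder_def)
  have v: "L2 MQ v" using sol by (simp add: heat_solution_def Lp2_iff_L2 cyl)
  have qm: "q \<in> borel_measurable MQ"
    using q_borel by (intro measurable_restrict_space1 measurable_completion) simp
  have qv: "L2 MQ (\<lambda>z. q z * v z)" using q_le by (intro L2_bounded_mult v qm)
  have Lz: "\<zeta> \<in> test_functions UNIV" by (rule \<T>_test[OF \<chi>])
  note s = test_function_smooth[OF \<psi>] test_function_smooth[OF Lz]
  have L\<zeta>: "L2 M\<Omega> \<zeta>" "L2 M\<Omega> (grad \<zeta>)" using Lz lebesgue by (auto intro: L2_continuous_test)
  note L\<psi> = test_I(1,2)[OF \<psi>]
  note i = tensor_pairing(1)[OF v L\<psi>(2) L\<zeta>(1)] tensor_pairing(1)[OF qv L\<psi>(1) L\<zeta>(1)] vector_tensor_pairing(1)[OF G L\<psi>(1) L\<zeta>(2)]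
  let ?P = "\<lambda>z. \<psi> (fst z) * \<zeta> (snd z)"
  have Pm: "?P \<in> borel_measurable MQ" using L2_tensor[OF L\<psi>(1) L\<zeta>(1)] by (simp add: L2_def)
  show ?thesis
  proof (cases B)
    case Dirichlet
    then have \<chi>': "\<zeta> \<in> test_functions \<Omega>" using \<chi> by (simp add: form_test_def)
    have "L2 M\<Omega> (\<lambda>x. \<Sum>b\<in>Basis. dderiv b (dderiv b \<zeta>) x)"
      using lebesgue by (intro L2_sum L2_continuous_test(1)) (auto intro: test_dderiv \<chi>')
    then have Ll: "L2 M\<Omega> (laplacian \<zeta>)" by (simp add: laplacian_def[abs_def])
    have "?P \<in> test_functions (I \<times> \<Omega>)" using test_tensor[OF \<psi> \<chi>'] by (simp add: cyl)
    then have "(LINT z|MQ. v z * (- time_deriv ?P z - space_laplacian ?P z)) = (LINT z|MQ. q0 z * v z * ?P z)"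
      using sol unfolding heat_solution_def weak_heat_op_def cyl by blast
    also have "(LINT z|MQ. q0 z * v z * ?P z) = (LINT z|MQ. (q z * v z) * ?P z)"
    proof (rule integral_cong_AE)
      show "(\<lambda>z. q0 z * v z * ?P z) \<in> borel_measurable MQ" "(\<lambda>z. q z * v z * ?P z) \<in> borel_measurable MQ"
        using v by (auto intro!: borel_measurable_times q0 qm Pm simp: L2_def)
    qed (use q0(2) in eventually_elim, simp)
    also have "(\<lambda>z. v z * (- time_deriv ?P z - space_laplacian ?P z))
        = (\<lambda>z. - (v z * (dderiv 1 \<psi> (fst z) * \<zeta> (snd z))) - v z * (\<psi> (fst z) * laplacian \<zeta> (snd z)))"
      by (simp add: time_deriv_tensor[OF s] space_laplacian_tensor[OF s] algebra_simps)
    finally show ?thesis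
      using i(1) tensor_pairing(1)[OF v L\<psi>(1) Ll] space_grad_tensor_pairing(2)[OF wg v G \<psi> \<chi>'] by simp
  next
    case Neumann
    then obtain G2 F where G2: "weak_space_grad (I \<times> \<Omega>) v G2" "Lp 1 (I \<times> \<Omega>) G2"
      and F: "weak_heat_op (I \<times> \<Omega>) v F" "Lp 1 (I \<times> \<Omega>) F"
      and eq: "\<And>\<psi>. \<psi> \<in> test_functions (cylinder T UNIV) \<Longrightarrow>
          (LINT z|MQ. G2 z \<bullet> space_grad \<psi> z - v z * time_deriv \<psi> z - F z * \<psi> z) = 0"
      using sol unfolding heat_solution_def by (auto simp: lateral_normal_deriv_zero_def cyl)
    have "AE z in MQ. G2 z \<bullet> b = G z \<bullet> b" if b: "b \<in> Basis" for b
    proof (rule fundamental_lemma_eq[OF open_Q])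
      have w: "weak_dderiv (I \<times> \<Omega>) (0, b) v (\<lambda>z. G2 z \<bullet> b)" "weak_dderiv (I \<times> \<Omega>) (0, b) v (\<lambda>z. G z \<bullet> b)"
        using G2(1) wg b by (simp_all add: weak_space_grad_def)
      then show "L1_loc (I \<times> \<Omega>) (\<lambda>z. G2 z \<bullet> b)" "L1_loc (I \<times> \<Omega>) (\<lambda>z. G z \<bullet> b)" by (simp_all add: weak_dderiv_def)
      fix \<theta> assume "\<theta> \<in> test_functions (I \<times> \<Omega>)"
      then show "(LINT z|MQ. (G2 z \<bullet> b) * \<theta> z) = (LINT z|MQ. (G z \<bullet> b) * \<theta> z)"
        using w unfolding weak_dderiv_def by (metis (no_types, lifting) neg_equal_iff_equal)
    qed
    then have "AE z in MQ. \<forall>b\<in>Basis. G2 z \<bullet> b = G z \<bullet> b" by (intro AE_finite_allI) auto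
    then have aeG: "AE z in MQ. G2 z = G z" by eventually_elim (metis euclidean_eqI)
    have "AE z in MQ. F z = q0 z * v z"
    proof (rule fundamental_lemma_eq[OF open_Q])
      have w: "weak_heat_op (I \<times> \<Omega>) v (\<lambda>z. q0 z * v z)" using sol by (simp add: heat_solution_def cyl)
      show "L1_loc (I \<times> \<Omega>) F" using F(1) by (simp add: weak_heat_op_def)
      show "L1_loc (I \<times> \<Omega>) (\<lambda>z. q0 z * v z)" using w by (simp add: weak_heat_op_def)
      show "(LINT z|MQ. F z * \<theta> z) = (LINT z|MQ. q0 z * v z * \<theta> z)" if "\<theta> \<in> test_functions (I \<times> \<Omega>)" for \<theta>
        using w F(1) that unfolding weak_heat_op_def by (metis (no_types, lifting))
    qed
    with q0(2) have aeF: "AE z in MQ. F z = q z * v z" by eventually_elim simp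
    have "(LINT z|MQ. G2 z \<bullet> space_grad ?P z - v z * time_deriv ?P z - F z * ?P z)
      = (LINT z|MQ. \<psi> (fst z) * (G z \<bullet> grad \<zeta> (snd z)) - v z * (dderiv 1 \<psi> (fst z) * \<zeta> (snd z)) - (q z * v z) * ?P z)"
    proof (rule integral_cong_AE)
      have "(\<lambda>z. \<psi> (fst z) *\<^sub>R grad \<zeta> (snd z)) \<in> borel_measurable MQ"
        using s by (intro continuous_measurable_lebesgue_on continuous_intros continuous_on_compose2[OF smooth_continuous[of \<psi> UNIV]]
            continuous_on_compose2[OF smooth_grad_continuous[of \<zeta> UNIV]]) auto
      moreover have "G2 \<in> borel_measurable MQ" "F \<in> borel_measurable MQ" using G2 F by (simp_all add: Lp_def)
      ultimately show "(\<lambda>z. G2 z \<bullet> space_grad ?P z - v z * time_deriv ?P z - F z * ?P z) \<in> borel_measurable MQ"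
        unfolding space_grad_tensor[OF s] time_deriv_tensor[OF s] using i(1)
        by (intro borel_measurable_diff borel_measurable_inner borel_measurable_times[OF _ Pm]) auto
      show "(\<lambda>z. \<psi> (fst z) * (G z \<bullet> grad \<zeta> (snd z)) - v z * (dderiv 1 \<psi> (fst z) * \<zeta> (snd z)) - (q z * v z) * ?P z) \<in> borel_measurable MQ"
        using i by (intro borel_measurable_diff borel_measurable_integrable)
    qed (use aeG aeF in eventually_elim, simp add: space_grad_tensor[OF s] time_deriv_tensor[OF s])
    moreover have "?P \<in> test_functions (cylinder T UNIV)" by (rule test_tensor[OF \<psi> Lz])
    ultimately show ?thesis using eq[of ?P] i by simp
  qed
qed

text \<open>For fixed \<open>\<psi>\<close>, the weak equation says that a functional on \<open>L\<^sup>2 \<times> L\<^sup>2\<close> formed from time averages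
  annihilates all admissible \<open>\<zeta>\<close>; by \<^const>\<open>form_closure\<close> it annihilates \<open>\<phi> k\<close>. This is the
  distributional form of the mode equation, and continuity in time makes it an integral equation.\<close>

theorem heat_solution_modes:
  assumes sol: "heat_solution B T \<Omega> q0 h v" and q0: "q0 \<in> borel_measurable MQ" "AE z in MQ. q0 z = q z"
    and h: "L2 M\<Omega> h"
  shows "solution_modes h (\<lambda>t x. v (t, x))"
proof -
  have cyl: "cylinder T \<Omega> = I \<times> \<Omega>" by (simp add: cylinder_def)
  have v: "L2 MQ v" using sol by (simp add: heat_solution_def Lp2_iff_L2 cyl)
  obtain G where G: "L2 MQ G" and wg: "weak_space_grad (I \<times> \<Omega>) v G"
    using sol by (auto simp: heat_solution_def Lp2_iff_L2 cyl)
  have L: "L2 M\<Omega> (\<lambda>x. v (t, x))" if "t \<in> {0..T}" for t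
    using sol that by (simp add: heat_solution_def Lp2_iff_L2)
  have path: "((\<lambda>t. LINT x|M\<Omega>. (v (t, x) - v (s, x))\<^sup>2) \<longlongrightarrow> 0) (at s within {0..T})" if "s \<in> {0..T}" for s
    using sol that by (simp add: heat_solution_def)
  have v0: "AE x in M\<Omega>. v (0, x) = h x" using sol by (simp add: heat_solution_def)
  note cont = L2_path_continuous[where V="\<lambda>t x. v (t, x)", OF L path]
  have qm: "q \<in> borel_measurable MQ"
    using q_borel by (intro measurable_restrict_space1 measurable_completion) simp
  have qv: "L2 MQ (\<lambda>z. q z * v z)" using q_le by (intro L2_bounded_mult v qm)
  let ?c = "\<lambda>k t. coef (\<lambda>x. v (t, x)) k" and ?f = "\<lambda>k t. coef (\<lambda>x. q (t, x) * v (t, x)) k"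
  have c: "continuous_on {0..T} (?c k)" if "k \<ge> 1" for k
    unfolding coef_def by (rule cont(1)[OF _ _ L2_basis[OF that]])
  have f: "bdd_meas T (?f k)" if k: "k \<ge> 1" for k
  proof -
    have "bdd_meas T (\<lambda>t. nsq (\<lambda>x. v (t, x)))" by (rule bdd_meas_continuous[OF cont(2)])
    then obtain C where C: "\<And>t. t \<in> {0..T} \<Longrightarrow> \<bar>nsq (\<lambda>x. v (t, x))\<bar> \<le> C"
      using bdd_meas_bound by blast
    have "(\<lambda>t. 1 * (LINT x|M\<Omega>. (q (t, x) * v (t, x)) * \<phi> k x)) \<in> borel_measurable MI"
      by (rule borel_measurable_integrable[OF tensor_pairing(4)[OF qv L2_one(1) L2_basis[OF k]]])
    then show ?thesis
    proof (intro bdd_meas_of_open)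
      fix t assume t: "t \<in> {0..T}"
      have "(?f k t)\<^sup>2 \<le> nsq (\<lambda>x. q (t, x) * v (t, x))" by (rule coef_sq_le[OF L2_q[OF L[OF t] t] k])
      also have "\<dots> \<le> Q\<^sup>2 * nsq (\<lambda>x. v (t, x))" by (rule nsq_q[OF L[OF t] t])
      also have "\<dots> \<le> Q\<^sup>2 * C" using C[OF t] by (intro mult_left_mono) auto
      finally have "(?f k t)\<^sup>2 \<le> Q\<^sup>2 * C" .
      from real_sqrt_le_mono[OF this] show "\<bar>?f k t\<bar> \<le> sqrt (Q\<^sup>2 * C)" by simp
    qed (simp add: coef_def)
  qed
  have ode: "prim T (?c k) (\<lambda>t. - \<Lambda> k * ?c k t + ?f k t)" if k: "k \<ge> 1" for k
  proof (rule weak_derivative_imp_prim[OF T_pos c[OF k]])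
    have cb: "bdd_meas T (?c k)" using c[OF k] by (rule bdd_meas_continuous)
    show gb: "bdd_meas T (\<lambda>t. - \<Lambda> k * ?c k t + ?f k t)"
      by (intro bdd_meas_add bdd_meas_cmult cb f k)
    fix \<psi> assume \<psi>: "\<psi> \<in> test_functions I"
    note L\<psi> = test_I(1,2)[OF \<psi>] and b\<psi> = test_I(3,4)[OF \<psi>]
    let ?a = "\<lambda>x. LINT t|MI. dderiv 1 \<psi> t * v (t, x)" and ?b = "\<lambda>x. LINT t|MI. \<psi> t * (q (t, x) * v (t, x))"
    let ?W = "time_average \<psi> G"
    have La: "L2 M\<Omega> ?a" by (rule L2_time_average[OF v L\<psi>(2)])
    have Lb: "L2 M\<Omega> ?b" by (rule L2_time_average[OF qv L\<psi>(1)])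
    have LW: "L2 M\<Omega> ?W" by (rule L2_vector_time_average[OF G L\<psi>(1)])
    have split: "(LINT x|M\<Omega>. (- ?a x - ?b x) * \<rho> x + ?W x \<bullet> H x)
        = - (LINT x|M\<Omega>. ?a x * \<rho> x) - (LINT x|M\<Omega>. ?b x * \<rho> x) + (LINT x|M\<Omega>. ?W x \<bullet> H x)"
      if \<rho>: "L2 M\<Omega> \<rho>" "L2 M\<Omega> H" for \<rho> H
      using L2_mult_integrable[OF La \<rho>(1)] L2_mult_integrable[OF Lb \<rho>(1)] L2_inner_integrable[OF LW \<rho>(2)]
      by (simp add: left_diff_distrib)
    have "(LINT x|M\<Omega>. (- ?a x - ?b x) * \<phi> k x + ?W x \<bullet> \<Gamma> k x) = 0"
    proof (rule form_closureD[OF eigen_closure[OF k] _ LW])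
      have "L2 M\<Omega> (\<lambda>x. (-1) * ?a x - ?b x)" by (intro L2_diff L2_rcmult La Lb)
      then show "L2 M\<Omega> (\<lambda>x. - ?a x - ?b x)" by simp
      fix \<zeta> assume \<zeta>: "\<zeta> \<in> form_test B \<Omega>"
      have L\<zeta>: "L2 M\<Omega> \<zeta>" "L2 M\<Omega> (grad \<zeta>)" using \<T>_test[OF \<zeta>] lebesgue by (auto intro: L2_continuous_test)
      show "(LINT x|M\<Omega>. (- ?a x - ?b x) * \<zeta> x + ?W x \<bullet> grad \<zeta> x) = 0"
        unfolding split[OF L\<zeta>] using weak_form[OF sol q0 G wg \<psi> \<zeta>]
          tensor_pairing(2)[OF v L\<psi>(2) L\<zeta>(1)] tensor_pairing(2)[OF qv L\<psi>(1) L\<zeta>(1)]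
          vector_tensor_pairing(2)[OF G L\<psi>(1) L\<zeta>(2)] by simp
    qed
    moreover have "(LINT x|M\<Omega>. ?W x \<bullet> \<Gamma> k x) = \<Lambda> k * (LINT t|MI. \<psi> t * ?c k t)"
    proof (cases B)
      case Dirichlet
      then have "AE t in MI. H10 \<Omega> (\<lambda>x. v (t, x))" using sol by (simp add: heat_solution_def)
      with Dirichlet show ?thesis by (intro energy_pairing_Dirichlet[OF v G wg _ \<psi> k])
    qed (rule energy_pairing_Neumann[OF v G wg _ \<psi> k])
    moreover have "(LINT x|M\<Omega>. ?a x * \<phi> k x) = (LINT t|MI. dderiv 1 \<psi> t * ?c k t)"
      using tensor_pairing(2,3)[OF v L\<psi>(2) L2_basis[OF k]] by (simp add: coef_def)
    moreover have "(LINT x|M\<Omega>. ?b x * \<phi> k x) = (LINT t|MI. \<psi> t * ?f k t)"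
      using tensor_pairing(2,3)[OF qv L\<psi>(1) L2_basis[OF k]] by (simp add: coef_def)
    ultimately have "(LINT t|MI. dderiv 1 \<psi> t * ?c k t) = \<Lambda> k * (LINT t|MI. \<psi> t * ?c k t) - (LINT t|MI. \<psi> t * ?f k t)"
      unfolding split[OF L2_basis[OF k] L2_\<Gamma>[OF k]] by simp
    then have main: "integral {0..T} (\<lambda>t. dderiv 1 \<psi> t * ?c k t)
        = \<Lambda> k * integral {0..T} (\<lambda>t. \<psi> t * ?c k t) - integral {0..T} (\<lambda>t. \<psi> t * ?f k t)"
      by (simp add: LINT_open_interval bdd_meas_mult b\<psi> cb f[OF k])
    have "integral {0..T} (\<lambda>t. (- \<Lambda> k * ?c k t + ?f k t) * \<psi> t)
        = integral {0..T} (\<lambda>t. - \<Lambda> k * (\<psi> t * ?c k t) + \<psi> t * ?f k t)" by (simp add: algebra_simps)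
    also have "\<dots> = integral {0..T} (\<lambda>t. - \<Lambda> k * (\<psi> t * ?c k t)) + integral {0..T} (\<lambda>t. \<psi> t * ?f k t)"
      by (intro integral_bdd_meas_add bdd_meas_cmult bdd_meas_mult b\<psi> cb f k)
    finally show "integral {0..T} (\<lambda>t. ?c k t * dderiv 1 \<psi> t) = - integral {0..T} (\<lambda>t. (- \<Lambda> k * ?c k t + ?f k t) * \<psi> t)"
      using main by (simp add: mult.commute)
  qed
  have test: "bdd_meas T (\<lambda>t. nsq (\<lambda>x. \<zeta> x * v (t, x)))" if \<zeta>: "\<zeta> \<in> test_functions UNIV" for \<zeta>
  proof (rule bdd_meas_continuous[OF L2_path_continuous(2)])
    show Lz: "L2 M\<Omega> (\<lambda>x. \<zeta> x * v (t, x))" if "t \<in> {0..T}" for t by (rule L2_test_mult(1)[OF \<zeta> L[OF that]])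
    obtain C where C: "\<And>x. \<bar>\<zeta> x\<bar> \<le> C" "C \<ge> 0" using test_grad_bounded[OF \<zeta>] by metis
    fix s assume s: "s \<in> {0..T}"
    have le: "nsq (\<lambda>x. \<zeta> x * v (t, x) - \<zeta> x * v (s, x)) \<le> C\<^sup>2 * nsq (\<lambda>x. v (t, x) - v (s, x))" if t: "t \<in> {0..T}" for t
    proof -
      have "nsq (\<lambda>x. \<zeta> x * v (t, x) - \<zeta> x * v (s, x)) \<le> (LINT x|M\<Omega>. C\<^sup>2 * (v (t, x) - v (s, x))\<^sup>2)"
      proof (rule integral_mono)
        show "integrable M\<Omega> (\<lambda>x. (\<zeta> x * v (t, x) - \<zeta> x * v (s, x))\<^sup>2)" by (intro L2_real_sq L2_diff Lz s t)
        show "integrable M\<Omega> (\<lambda>x. C\<^sup>2 * (v (t, x) - v (s, x))\<^sup>2)" by (intro integrable_mult_right L2_real_sq L2_diff L s t)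
        show "(\<zeta> x * v (t, x) - \<zeta> x * v (s, x))\<^sup>2 \<le> C\<^sup>2 * (v (t, x) - v (s, x))\<^sup>2" for x
          using power_mono[OF C(1)[of x], of 2]
          by (simp add: power_mult_distrib mult_right_mono flip: right_diff_distrib)
      qed
      then show ?thesis by simp
    qed
    have "((\<lambda>t. C\<^sup>2 * nsq (\<lambda>x. v (t, x) - v (s, x))) \<longlongrightarrow> C\<^sup>2 * 0) (at s within {0..T})"
      by (intro tendsto_intros path s)
    then have z: "((\<lambda>t. C\<^sup>2 * nsq (\<lambda>x. v (t, x) - v (s, x))) \<longlongrightarrow> 0) (at s within {0..T})" by simp
    show "((\<lambda>t. nsq (\<lambda>x. \<zeta> x * v (t, x) - \<zeta> x * v (s, x))) \<longlongrightarrow> 0) (at s within {0..T})"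
      by (rule Lim_null_comparison[OF _ z]) (use le in \<open>auto simp: eventually_at_filter\<close>)
  qed
  have "?c k 0 = coef h k" if k: "k \<ge> 1" for k
    unfolding coef_def
  proof (rule integral_cong_AE)
    show "(\<lambda>x. v (0, x) * \<phi> k x) \<in> borel_measurable M\<Omega>" "(\<lambda>x. h x * \<phi> k x) \<in> borel_measurable M\<Omega>"
      using L[of 0] T_pos h L2_basis[OF k] by (auto simp: L2_def)
  qed (use v0 in eventually_elim, simp)
  then show ?thesis
    unfolding solution_modes_def
    using h L cont f ode test by (auto intro: bdd_meas_continuous)
qed

end

section \<open>Jordan decomposition and cluster points\<close>

lemma borel_sets_on_closed: "closed S \<Longrightarrow> A \<in> borel_sets_on S \<longleftrightarrow> A \<in> sets borel \<and> A \<subseteq> S"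
  by (auto simp: borel_sets_on_def sets_restrict_space_iff)

lemma measure_unit_ball_uminus: "\<mu> \<in> measure_unit_ball S \<Longrightarrow> (\<lambda>A. - \<mu> A) \<in> measure_unit_ball S"
  by (auto simp: measure_unit_ball_def signed_measure_def intro: sums_minus)

context
  fixes S :: "'b::euclidean_space set" and \<mu> :: "'b set \<Rightarrow> real"
  assumes S: "closed S" and \<mu>: "\<mu> \<in> measure_unit_ball S"
begin

abbreviation (input) "BS \<equiv> borel_sets_on S"

lemma BS_iff: "A \<in> BS \<longleftrightarrow> A \<in> sets borel \<and> A \<subseteq> S"
  by (rule borel_sets_on_closed[OF S])

lemma signed_sums:
  assumes "\<And>i::nat. A i \<in> BS" "disjoint_family A"
  shows "(\<lambda>i. \<mu> (A i)) sums \<mu> (\<Union>i. A i)"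
  using \<mu> assms unfolding measure_unit_ball_def signed_measure_def by blast

lemma signed_bound: "A \<in> BS \<Longrightarrow> \<bar>\<mu> A\<bar> \<le> 1"
proof -
  assume A: "A \<in> BS"
  have "(\<Sum>A\<in>\<A>. \<bar>\<mu> A\<bar>) \<le> 1" if "finite \<A>" "\<A> \<subseteq> BS" "disjoint \<A>" for \<A>
    using \<mu> that unfolding measure_unit_ball_def by blast
  from this[of "{A}"] A show ?thesis by simp
qed

lemma signed_empty: "\<mu> {} = 0"
proof -
  have "(\<lambda>i::nat. \<mu> {}) sums \<mu> (\<Union>i::nat. {})"
    by (rule signed_sums) (auto simp: BS_iff disjoint_family_on_def)
  then have "(\<lambda>i::nat. \<mu> {}) \<longlonglongrightarrow> 0" using summable_LIMSEQ_zero sums_summable by blast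
  then show ?thesis by (simp add: LIMSEQ_const_iff)
qed

lemma signed_Un:
  assumes "A \<in> BS" "C \<in> BS" "A \<inter> C = {}"
  shows "\<mu> (A \<union> C) = \<mu> A + \<mu> C"
proof -
  let ?F = "binaryset A C"
  have "(\<lambda>i. \<mu> (?F i)) sums \<mu> (\<Union>i. ?F i)"
    using assms by (intro signed_sums) (auto simp: binaryset_def BS_iff disjoint_family_on_def)
  moreover have "(\<lambda>i. \<mu> (?F i)) sums (\<mu> A + \<mu> C)"
    by (rule binaryset_sums) (rule signed_empty)
  ultimately show ?thesis using sums_unique2 by (metis UN_binaryset_eq)
qed

text \<open>Countable additivity of this supremum is proved directly, by cutting an arbitrary subset along
  a partition; no Hahn decomposition is constructed.\<close>

definition pos_sup :: "'b set \<Rightarrow> ennreal" where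
  "pos_sup A = (SUP E\<in>{E \<in> BS. E \<subseteq> A}. ennreal (\<mu> E))"

lemma pos_sup_upper: "E \<in> BS \<Longrightarrow> E \<subseteq> A \<Longrightarrow> ennreal (\<mu> E) \<le> pos_sup A"
  unfolding pos_sup_def by (rule SUP_upper) simp

lemma pos_sup_least: "(\<And>E. E \<in> BS \<Longrightarrow> E \<subseteq> A \<Longrightarrow> ennreal (\<mu> E) \<le> u) \<Longrightarrow> pos_sup A \<le> u"
  unfolding pos_sup_def by (rule SUP_least) simp

lemma pos_sup_mono: "A \<subseteq> C \<Longrightarrow> pos_sup A \<le> pos_sup C"
  by (intro pos_sup_least pos_sup_upper) auto

lemma pos_sup_le_1: "pos_sup A \<le> 1"
  using signed_bound by (intro pos_sup_least) (auto simp: abs_le_iff)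

lemma pos_sup_super_additive:
  assumes "A \<inter> C = {}"
  shows "pos_sup A + pos_sup C \<le> pos_sup (A \<union> C)"
proof -
  have ne: "{E \<in> BS. E \<subseteq> D} \<noteq> {}" for D by (auto simp: BS_iff intro!: exI[of _ "{}"])
  have "ennreal (\<mu> E) + ennreal (\<mu> F) \<le> pos_sup (A \<union> C)" if E: "E \<in> BS" "E \<subseteq> A" and F: "F \<in> BS" "F \<subseteq> C" for E F
  proof (cases "\<mu> E \<ge> 0 \<and> \<mu> F \<ge> 0")
    case True
    have "\<mu> (E \<union> F) = \<mu> E + \<mu> F" using E F assms by (intro signed_Un) auto
    moreover have "ennreal (\<mu> (E \<union> F)) \<le> pos_sup (A \<union> C)" using E F by (intro pos_sup_upper) (auto simp: BS_iff)
    ultimately show ?thesis using True by simp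
  next
    case False
    have "ennreal (\<mu> E) \<le> pos_sup (A \<union> C)" "ennreal (\<mu> F) \<le> pos_sup (A \<union> C)"
      using E F by (auto intro: pos_sup_upper)
    with False show ?thesis by (auto simp: ennreal_neg not_le)
  qed
  then have "pos_sup A + ennreal (\<mu> F) \<le> pos_sup (A \<union> C)" if "F \<in> BS" "F \<subseteq> C" for F
    unfolding pos_sup_def[of A] using that ne by (subst ennreal_SUP_add_left[symmetric]) (auto intro!: SUP_least)
  then show ?thesis
    unfolding pos_sup_def[of C] using ne by (subst ennreal_SUP_add_right) (auto intro!: SUP_least)
qed

lemma pos_sup_measure_space: "measure_space S BS pos_sup"
  unfolding measure_space_def
proof
  show "sigma_algebra S BS"
    using sets.sigma_algebra_axioms[of "restrict_space borel S"] by (simp add: borel_sets_on_def space_restrict_space)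
  have e: "pos_sup {} = 0"
    using signed_empty by (intro antisym pos_sup_least) auto
  have "countably_additive BS pos_sup"
    unfolding countably_additive_def
  proof (intro allI impI)
    fix A :: "nat \<Rightarrow> 'b set" assume A: "range A \<subseteq> BS" "disjoint_family A" "\<Union> (range A) \<in> BS"
    show "(\<Sum>i. pos_sup (A i)) = pos_sup (\<Union> (range A))"
    proof (rule antisym)
      have "(\<Sum>i<n. pos_sup (A i)) \<le> pos_sup (\<Union>i<n. A i)" for n
      proof (induction n)
        case (Suc n)
        have "(\<Sum>i<Suc n. pos_sup (A i)) \<le> pos_sup (A n) + pos_sup (\<Union>i<n. A i)"
          using Suc by (simp add: add.commute add_left_mono)
        also have "\<dots> \<le> pos_sup (A n \<union> (\<Union>i<n. A i))"
        proof (rule pos_sup_super_additive)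
          have "A n \<inter> A i = {}" if "i < n" for i using A(2) that by (auto simp: disjoint_family_on_def)
          then show "A n \<inter> (\<Union>i<n. A i) = {}" by blast
        qed
        finally show ?case by (simp add: lessThan_Suc)
      qed simp
      also have "pos_sup (\<Union>i<n. A i) \<le> pos_sup (\<Union> (range A))" for n by (rule pos_sup_mono) auto
      finally show "(\<Sum>i. pos_sup (A i)) \<le> pos_sup (\<Union> (range A))"
        by (intro suminf_le_const) auto
      show "pos_sup (\<Union> (range A)) \<le> (\<Sum>i. pos_sup (A i))"
      proof (rule pos_sup_least)
        fix E assume E: "E \<in> BS" "E \<subseteq> \<Union> (range A)"
        have "A i \<in> BS" for i using A(1) by blast
        then have m: "A i \<inter> E \<in> BS" for i using E(1) by (auto simp: BS_iff)
        have "(\<lambda>i. \<mu> (A i \<inter> E)) sums \<mu> (\<Union>i. A i \<inter> E)"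
          using A(2) m by (intro signed_sums) (auto simp: disjoint_family_on_def)
        moreover have "(\<Union>i. A i \<inter> E) = E" using E(2) by auto
        ultimately have "(\<lambda>n. \<Sum>i<n. \<mu> (A i \<inter> E)) \<longlonglongrightarrow> \<mu> E" by (simp add: sums_def)
        then have "(\<lambda>n. ennreal (\<Sum>i<n. \<mu> (A i \<inter> E))) \<longlonglongrightarrow> ennreal (\<mu> E)" by (rule tendsto_ennrealI)
        moreover have "ennreal (\<Sum>i<n. \<mu> (A i \<inter> E)) \<le> (\<Sum>i. pos_sup (A i))" for n
        proof -
          have "ennreal (\<Sum>i<n. \<mu> (A i \<inter> E)) \<le> ennreal (\<Sum>i<n. max 0 (\<mu> (A i \<inter> E)))"
            by (intro ennreal_leI sum_mono) simp
          also have "\<dots> = (\<Sum>i<n. ennreal (\<mu> (A i \<inter> E)))"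
            by (subst sum_ennreal[symmetric]) (auto simp: ennreal_max_0)
          also have "\<dots> \<le> (\<Sum>i<n. pos_sup (A i))" using m by (intro sum_mono pos_sup_upper) auto
          also have "\<dots> \<le> (\<Sum>i. pos_sup (A i))" by (rule sum_le_suminf) auto
          finally show ?thesis .
        qed
        ultimately show "ennreal (\<mu> E) \<le> (\<Sum>i. pos_sup (A i))" by (intro LIMSEQ_le_const2) auto
      qed
    qed
  qed
  with e show "positive BS pos_sup \<and> countably_additive BS pos_sup" by (simp add: positive_def)
qed

lemma positive_variation:
  shows "space (positive_variation S \<mu>) = S" and "sets (positive_variation S \<mu>) = BS"
    and "A \<in> BS \<Longrightarrow> emeasure (positive_variation S \<mu>) A = pos_sup A"
    and "finite_measure (positive_variation S \<mu>)"
proof -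
  have sa: "sigma_algebra S BS" using pos_sup_measure_space by (simp add: measure_space_def)
  have d: "positive_variation S \<mu> = measure_of S BS pos_sup"
    by (simp add: positive_variation_def pos_sup_def[abs_def])
  show sp: "space (positive_variation S \<mu>) = S" and st: "sets (positive_variation S \<mu>) = BS"
    using sa sigma_algebra.sets_measure_of_eq[OF sa] sigma_algebra.space_measure_of_eq[OF sa] by (simp_all add: d)
  show em: "emeasure (positive_variation S \<mu>) A = pos_sup A" if "A \<in> BS" for A
    using pos_sup_measure_space that unfolding d measure_space_def
    by (intro emeasure_measure_of_sigma) auto
  show "finite_measure (positive_variation S \<mu>)"
  proof
    have "S \<in> BS" using S by (simp add: BS_iff)
    then have "emeasure (positive_variation S \<mu>) S \<le> 1" using em pos_sup_le_1 by simp
    then show "emeasure (positive_variation S \<mu>) (space (positive_variation S \<mu>)) \<noteq> \<infinity>"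
      unfolding sp by (auto simp: top_unique)
  qed
qed

lemma signed_le_variations:
  assumes "A \<in> BS" "E \<in> BS" "E \<subseteq> A"
  shows "\<mu> E = \<mu> A - \<mu> (A - E)"
proof -
  have "\<mu> (E \<union> (A - E)) = \<mu> E + \<mu> (A - E)" using assms by (intro signed_Un) (auto simp: BS_iff)
  moreover have "E \<union> (A - E) = A" using assms by auto
  ultimately show ?thesis by simp
qed

end

text \<open>Since \<open>\<mu> E = \<mu> A - \<mu> (A - E)\<close>, the suprema of \<open>\<mu>\<close> and of \<open>- \<mu>\<close> over the subsets of \<open>A\<close> differ by
  \<open>\<mu> A\<close>.\<close>

lemma Jordan_decomposition:
  fixes S :: "'b::euclidean_space set"
  assumes S: "closed S" and \<mu>: "\<mu> \<in> measure_unit_ball S" and A: "A \<in> borel_sets_on S"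
  shows "\<mu> A = measure (positive_variation S \<mu>) A - measure (positive_variation S (\<lambda>A. - \<mu> A)) A"
proof -
  have le: "measure (positive_variation S \<mu>) A \<le> \<mu> A + measure (positive_variation S (\<lambda>A. - \<mu> A)) A"
    if \<mu>: "\<mu> \<in> measure_unit_ball S" for \<mu>
  proof -
    note m = measure_unit_ball_uminus[OF \<mu>]
    note P = positive_variation[OF S \<mu>] and N = positive_variation[OF S m]
    let ?n = "measure (positive_variation S (\<lambda>A. - \<mu> A)) A"
    have n: "- \<mu> E \<le> ?n" if "E \<in> borel_sets_on S" "E \<subseteq> A" for E
    proof -
      have "ennreal (- \<mu> E) \<le> emeasure (positive_variation S (\<lambda>A. - \<mu> A)) A"
        unfolding N(3)[OF A] by (rule pos_sup_upper[OF S m that])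
      also have "\<dots> = ennreal ?n" using N(4) by (rule finite_measure.emeasure_eq_measure)
      finally show ?thesis by (simp add: ennreal_le_iff)
    qed
    have "emeasure (positive_variation S \<mu>) A \<le> ennreal (\<mu> A + ?n)"
      unfolding P(3)[OF A]
    proof (rule pos_sup_least[OF S \<mu>])
      fix E assume E: "E \<in> borel_sets_on S" "E \<subseteq> A"
      have "A - E \<in> borel_sets_on S" using A E by (auto simp: borel_sets_on_closed[OF S])
      from n[OF this] signed_le_variations[OF S \<mu> A E] show "ennreal (\<mu> E) \<le> ennreal (\<mu> A + ?n)"
        by (intro ennreal_leI) auto
    qed
    moreover have "0 \<le> \<mu> A + ?n" using n[OF A] by simp
    ultimately show ?thesis by (simp add: finite_measure.emeasure_eq_measure[OF P(4)] ennreal_le_iff)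
  qed
  show ?thesis using le[OF \<mu>] le[OF measure_unit_ball_uminus[OF \<mu>]] by simp
qed

lemma bracket_one:
  fixes S :: "'b::euclidean_space set"
  assumes S: "closed S" and \<mu>: "\<mu> \<in> measure_unit_ball S"
  shows "bracket S \<mu> (\<lambda>z. 1) = \<mu> S"
  using Jordan_decomposition[OF S \<mu>, of S] S positive_variation(1)[OF S \<mu>] positive_variation(1)[OF S measure_unit_ball_uminus[OF \<mu>]]
  by (simp add: bracket_def borel_sets_on_closed)

lemma measurable_borel_sets_on:
  assumes "space M = S" "sets M = borel_sets_on S" "closed S"
  shows "continuous_on S f \<Longrightarrow> f \<in> borel_measurable M" and "(\<lambda>z. z) \<in> measurable M borel"
proof -
  have "sets M = sets (restrict_space borel S)" using assms by (simp add: borel_sets_on_def)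
  then show "continuous_on S f \<Longrightarrow> f \<in> borel_measurable M"
    using borel_measurable_continuous_on_restrict measurable_cong_sets by blast
  show "(\<lambda>z. z) \<in> measurable M borel"
    using assms by (auto simp: measurable_def borel_sets_on_closed)
qed

lemma compact_inner_approximation:
  fixes M :: "'b::euclidean_space measure"
  assumes M: "space M = S" "sets M = borel_sets_on S" "finite_measure M" and S: "closed S"
    and A: "A \<in> borel_sets_on S" and \<delta>: "\<delta> > 0"
  obtains C where "compact C" "C \<subseteq> A" "measure M A - \<delta> < measure M C"
proof -
  interpret finite_measure M by fact
  note id = measurable_borel_sets_on(2)[OF M(1,2) S]
  let ?M = "distr M borel (\<lambda>z. z)"
  interpret D: finite_measure ?M using id by (rule finite_measure_distr)
  have e: "measure ?M C = measure M C" if "C \<in> sets borel" "C \<subseteq> S" for C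
    using measure_distr[OF id that(1)] that M(1) by (simp add: inf.absorb1)
  have Ab: "A \<in> sets borel" "A \<subseteq> S" using A by (auto simp: borel_sets_on_closed[OF S])
  have "emeasure ?M A = (SUP C\<in>{C. C \<subseteq> A \<and> compact C}. emeasure ?M C)"
    by (rule inner_regular) (auto simp: Ab D.emeasure_eq_measure)
  show thesis
  proof (cases "measure M A = 0")
    case True
    then show thesis using \<delta> by (intro that[of "{}"]) auto
  next
    case False
    then have "ennreal (measure M A - \<delta>) < emeasure ?M A"
      using \<delta> measure_nonneg[of M A] by (auto simp: D.emeasure_eq_measure e[OF Ab] zero_less_measure_iff intro!: ennreal_lessI)
    also note \<open>emeasure ?M A = _\<close>
    finally obtain C where C: "C \<subseteq> A" "compact C" "ennreal (measure M A - \<delta>) < emeasure ?M C"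
      by (auto simp: less_SUP_iff)
    have Cb: "C \<in> sets borel" using C(2) by (simp add: compact_imp_closed borel_closed)
    have "measure M A - \<delta> < measure M C"
    proof (rule ccontr)
      assume "\<not> ?thesis"
      then have "ennreal (measure M C) \<le> ennreal (measure M A - \<delta>)" by (intro ennreal_leI) simp
      with C(3) show False using C(1) Ab(2) by (simp add: D.emeasure_eq_measure e[OF Cb])
    qed
    with C show thesis by (intro that)
  qed
qed

lemma integral_compact_approximation:
  fixes M :: "'b::euclidean_space measure"
  assumes M: "space M = S" "sets M = borel_sets_on S" "finite_measure M" and S: "closed S"
    and C: "compact C" "C \<subseteq> S" "C \<noteq> {}"
  shows "(\<lambda>n. LINT z|M. max 0 (1 - real n * infdist z C)) \<longlonglongrightarrow> measure M C"
proof -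
  interpret finite_measure M by fact
  have Cs: "C \<in> sets M" using C S by (auto simp: M borel_sets_on_closed compact_imp_closed borel_closed)
  have "(\<lambda>n. LINT z|M. max 0 (1 - real n * infdist z C)) \<longlonglongrightarrow> (LINT z|M. indicator C z)"
  proof (rule integral_dominated_convergence[where w="\<lambda>z. 1"])
    show "(\<lambda>z. max 0 (1 - real n * infdist z C)) \<in> borel_measurable M" for n
      by (intro measurable_borel_sets_on(1)[OF M(1,2) S] continuous_intros)
    show "AE z in M. (\<lambda>n. max 0 (1 - real n * infdist z C)) \<longlonglongrightarrow> indicator C z"
    proof (intro AE_I2)
      fix z
      show "(\<lambda>n. max 0 (1 - real n * infdist z C)) \<longlonglongrightarrow> indicator C z"
      proof (cases "z \<in> C")
        case False
        then have "infdist z C > 0"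
          using in_closed_iff_infdist_zero[OF compact_imp_closed[OF C(1)] C(3), of z] infdist_nonneg[of z C] by linarith
        moreover obtain N :: nat where "1 / infdist z C < real N" using reals_Archimedean2 by blast
        ultimately have "1 \<le> real n * infdist z C" if "n \<ge> N" for n
        proof -
          have "1 / infdist z C \<le> real n" using that \<open>1 / infdist z C < real N\<close> by linarith
          then show ?thesis using \<open>infdist z C > 0\<close> by (simp add: divide_le_eq)
        qed
        then have "\<forall>\<^sub>F n in sequentially. 0 = max 0 (1 - real n * infdist z C)"
          unfolding eventually_sequentially by (intro exI[of _ N]) auto
        then show ?thesis using False by (intro Lim_transform_eventually[OF tendsto_const]) simp_all
      qed simp
    qed
    show "AE z in M. norm (max 0 (1 - real n * infdist z C)) \<le> 1" for n
      by (intro AE_I2) (auto simp: infdist_nonneg)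
  qed (use Cs in auto)
  then show ?thesis using Cs sets.sets_into_space[OF Cs] by (simp add: inf.absorb1)
qed

text \<open>If \<open>\<mu> A < 0\<close>, inner regularity of the negative variation gives a compact \<open>C \<subseteq> A\<close> with \<open>\<mu> C < 0\<close>. The
  indicator of \<open>C\<close> is a decreasing limit of nonnegative continuous functions, whose brackets would become negative.\<close>

lemma nonneg_bracket_imp_nonneg:
  fixes S :: "'b::euclidean_space set"
  assumes S: "closed S" and \<mu>: "\<mu> \<in> measure_unit_ball S"
    and pos: "\<And>f. continuous_on S f \<Longrightarrow> (\<And>z. f z \<ge> 0) \<Longrightarrow> bracket S \<mu> f \<ge> 0"
    and A: "A \<in> borel_sets_on S"
  shows "\<mu> A \<ge> 0"
proof (rule ccontr)
  note P = positive_variation[OF S \<mu>] and N = positive_variation[OF S measure_unit_ball_uminus[OF \<mu>]]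
  let ?P = "positive_variation S \<mu>" and ?N = "positive_variation S (\<lambda>A. - \<mu> A)"
  interpret P: finite_measure ?P by (rule P(4))
  assume "\<not> ?thesis"
  then have neg: "\<mu> A < 0" by simp
  obtain C where C: "compact C" "C \<subseteq> A" "measure ?N A - (- \<mu> A) < measure ?N C"
    by (rule compact_inner_approximation[OF N(1,2,4) S A, of "- \<mu> A"]) (use neg in simp, rule that)
  have AS: "A \<subseteq> S" "A \<in> sets ?P" using A P(2) by (auto simp: borel_sets_on_closed[OF S])
  have CS: "C \<in> borel_sets_on S" using C AS by (auto simp: borel_sets_on_closed[OF S] compact_imp_closed borel_closed)
  have "measure ?P C \<le> measure ?P A" by (rule P.finite_measure_mono[OF C(2) AS(2)])
  with C(3) have "\<mu> C < 0" using Jordan_decomposition[OF S \<mu> A] Jordan_decomposition[OF S \<mu> CS] by simp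
  then have ne: "C \<noteq> {}" using signed_empty[OF S \<mu>] by auto
  have "(\<lambda>n. bracket S \<mu> (\<lambda>z. max 0 (1 - real n * infdist z C))) \<longlonglongrightarrow> measure ?P C - measure ?N C"
    unfolding bracket_def using C AS ne
    by (intro tendsto_diff integral_compact_approximation[OF P(1,2,4) S] integral_compact_approximation[OF N(1,2,4) S]) auto
  moreover have "bracket S \<mu> (\<lambda>z. max 0 (1 - real n * infdist z C)) \<ge> 0" for n
    by (intro pos continuous_intros) simp
  ultimately have "measure ?P C - measure ?N C \<ge> 0" by (intro LIMSEQ_le_const) auto
  with \<open>\<mu> C < 0\<close> show False using Jordan_decomposition[OF S \<mu> CS] by simp
qed

text \<open>For a nonnegative measure the suprema in the variations are attained at the whole set and at the
  empty set.\<close>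

lemma bracket_measure:
  fixes P :: "'b::euclidean_space measure"
  assumes P: "space P = S" "sets P = borel_sets_on S" "finite_measure P"
    and \<mu>: "\<And>A. A \<in> borel_sets_on S \<Longrightarrow> \<mu> A = measure P A"
  shows "bracket S \<mu> f = (LINT z|P. f z)"
proof -
  interpret finite_measure P by fact
  have sub: "borel_sets_on S \<subseteq> Pow S" using sets.space_closed[of P] P by simp
  have sig: "sigma_sets S (borel_sets_on S) = borel_sets_on S" using sets.sigma_sets_eq[of P] P by simp
  have "positive_variation S \<mu> = measure_of S (borel_sets_on S) (emeasure P)"
    unfolding positive_variation_def
  proof (rule measure_of_eq[OF sub], unfold sig)
    fix A assume A: "A \<in> borel_sets_on S"
    show "(SUP E\<in>{E \<in> borel_sets_on S. E \<subseteq> A}. ennreal (\<mu> E)) = emeasure P A"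
    proof (rule antisym[OF SUP_least])
      show "ennreal (\<mu> E) \<le> emeasure P A" if "E \<in> {E \<in> borel_sets_on S. E \<subseteq> A}" for E
        using that A P by (auto simp: \<mu> emeasure_eq_measure[symmetric] intro!: emeasure_mono)
      show "emeasure P A \<le> (SUP E\<in>{E \<in> borel_sets_on S. E \<subseteq> A}. ennreal (\<mu> E))"
        using A by (intro SUP_upper2[of A]) (auto simp: \<mu> emeasure_eq_measure)
    qed
  qed
  also have "\<dots> = P" using measure_of_of_measure[of P] P by simp
  finally have p: "positive_variation S \<mu> = P" .
  have "positive_variation S (\<lambda>A. - \<mu> A) = measure_of S (borel_sets_on S) (\<lambda>_. 0)"
    unfolding positive_variation_def
  proof (rule measure_of_eq[OF sub], unfold sig)
    fix A assume A: "A \<in> borel_sets_on S"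
    have "(SUP E\<in>{E \<in> borel_sets_on S. E \<subseteq> A}. ennreal (- \<mu> E)) \<le> 0"
      by (rule SUP_least) (simp add: \<mu> ennreal_neg)
    then show "(SUP E\<in>{E \<in> borel_sets_on S. E \<subseteq> A}. ennreal (- \<mu> E)) = 0" by simp
  qed
  also have "\<dots> = null_measure P" using P by (simp add: null_measure_def)
  finally show ?thesis by (simp add: bracket_def p)
qed

lemma bracket_normalized_square:
  fixes v :: "real \<times> 'a::euclidean_space \<Rightarrow> real"
  assumes \<Omega>: "open \<Omega>" and v: "L2 (lebesgue_on (cylinder T \<Omega>)) v"
    and pos: "(LINT z|lebesgue_on (cylinder T \<Omega>). (v z)\<^sup>2) > 0"
    and f: "continuous_on (closed_cylinder T \<Omega>) f"
  shows "bracket (closed_cylinder T \<Omega>) (normalized_square_measure T \<Omega> v) f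
    = (LINT z|lebesgue_on (cylinder T \<Omega>). f z * (v z)\<^sup>2) / (LINT z|lebesgue_on (cylinder T \<Omega>). (v z)\<^sup>2)"
proof -
  define Q S where "Q = cylinder T \<Omega>" and "S = closed_cylinder T \<Omega>"
  define N where "N = (LINT z|lebesgue_on Q. (v z)\<^sup>2)"
  define D where "D = density (lebesgue_on Q) (\<lambda>z. ennreal ((v z)\<^sup>2 / N))"
  define P where "P = distr D (restrict_space borel S) (\<lambda>z. z)"
  have N: "N > 0" using pos by (simp add: N_def Q_def)
  have v: "L2 (lebesgue_on Q) v" using v by (simp add: Q_def)
  have Qo: "open Q" using \<Omega> by (simp add: Q_def cylinder_def open_Times)
  have S: "closed S" by (simp add: S_def closed_cylinder_def closed_Times)
  have QS: "Q \<subseteq> S" using closure_subset[of \<Omega>] by (auto simp: Q_def S_def cylinder_def closed_cylinder_def)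
  have Sb: "S \<inter> space borel \<in> sets borel" using S by simp
  have mS: "g \<in> measurable (lebesgue_on Q) (restrict_space borel S)" if "g = (\<lambda>z. z)" for g
    unfolding that
  proof (rule measurable_restrict_space2)
    show "(\<lambda>z. z) \<in> space (lebesgue_on Q) \<rightarrow> S" using QS by auto
    show "(\<lambda>z. z) \<in> measurable (lebesgue_on Q) borel"
      by (intro measurable_restrict_space1 measurable_completion) simp
  qed
  have sp: "space P = S" and st: "sets P = borel_sets_on S"
    by (simp_all add: P_def space_restrict_space borel_sets_on_def)
  have m: "(\<lambda>z. z) \<in> measurable D (restrict_space borel S)" using mS by (simp add: D_def)
  have vm: "(\<lambda>z. (v z)\<^sup>2 / N) \<in> borel_measurable (lebesgue_on Q)" using v by (auto simp: L2_def)
  have int: "(LINT z|P. g z) = (LINT z|lebesgue_on Q. g z * (v z)\<^sup>2) / N" if g: "g \<in> borel_measurable (restrict_space borel S)"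
    for g :: "real \<times> 'a \<Rightarrow> real"
  proof -
    have gm: "g \<in> borel_measurable (lebesgue_on Q)"
      using measurable_compose[OF mS[OF refl] g] by simp
    have "(LINT z|P. g z) = (LINT z|D. g z)" unfolding P_def by (rule integral_distr[OF m g])
    also have "\<dots> = (LINT z|lebesgue_on Q. ((v z)\<^sup>2 / N) *\<^sub>R g z)"
      unfolding D_def using N by (intro integral_density gm vm) auto
    also have "\<dots> = (LINT z|lebesgue_on Q. g z * (v z)\<^sup>2 / N)" by (simp add: mult.commute)
    finally show ?thesis by simp
  qed
  have "emeasure P S = (\<integral>\<^sup>+z. ennreal ((v z)\<^sup>2 / N) \<partial>lebesgue_on Q)"
  proof -
    have "emeasure P S = emeasure D ((\<lambda>z. z) -` S \<inter> space D)"
      unfolding P_def using Sb by (intro emeasure_distr m) (simp add: sets_restrict_space_iff)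
    also have "(\<lambda>z. z) -` S \<inter> space D = space (lebesgue_on Q)" using QS by (auto simp: D_def)
    also have "emeasure D (space (lebesgue_on Q)) = (\<integral>\<^sup>+z. ennreal ((v z)\<^sup>2 / N) * indicator (space (lebesgue_on Q)) z \<partial>lebesgue_on Q)"
      unfolding D_def using vm by (intro emeasure_density) auto
    also have "\<dots> = (\<integral>\<^sup>+z. ennreal ((v z)\<^sup>2 / N) \<partial>lebesgue_on Q)"
      by (intro nn_integral_cong) (auto simp: indicator_def)
    finally show ?thesis .
  qed
  also have "\<dots> = ennreal (LINT z|lebesgue_on Q. (v z)\<^sup>2 / N)"
    using L2_real_sq[OF v] N by (intro nn_integral_eq_integral) auto
  finally have fin: "finite_measure P" by (intro finite_measureI) (simp add: sp)
  have "normalized_square_measure T \<Omega> v A = measure P A" if A: "A \<in> borel_sets_on S" for A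
  proof -
    have Ab: "A \<in> sets borel" using A by (simp add: borel_sets_on_closed[OF S])
    have AQ: "A \<inter> Q \<in> sets lebesgue" "Q \<in> sets lebesgue" using Ab Qo by auto
    have "measure P A = (LINT z|P. indicator A z)" using A sets.sets_into_space[of A P] st by (simp add: inf.absorb1)
    also have "\<dots> = (LINT z|lebesgue_on Q. indicator A z * (v z)\<^sup>2) / N"
      using A by (intro int borel_measurable_indicator) (simp add: borel_sets_on_def)
    also have "(LINT z|lebesgue_on Q. indicator A z * (v z)\<^sup>2) = (LINT z|lebesgue_on (A \<inter> Q). indicator A z * (v z)\<^sup>2)"
      by (rule integral_lebesgue_on_superset(1)[OF AQ]) (auto simp: indicator_def)
    also have "\<dots> = (LINT z|lebesgue_on (A \<inter> Q). (v z)\<^sup>2)"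
      by (intro LINT_cong) (auto simp: indicator_def)
    finally show ?thesis by (simp add: normalized_square_measure_def N_def Q_def)
  qed
  from bracket_measure[OF sp st fin this, of f] int[OF borel_measurable_continuous_on_restrict[of S f]] f
  show ?thesis by (simp add: N_def Q_def S_def)
qed

text \<open>The brackets with a fixed continuous function are continuous for the weak-* topology.\<close>

lemma closure_point_bracket:
  assumes cp: "sequence_closure_point (weak_star_ball S) s \<mu>" and f: "continuous_on S f" and e: "e > 0"
  shows "\<mu> \<in> measure_unit_ball S" and "\<exists>\<^sub>F K in sequentially. \<bar>bracket S (s K) f - bracket S \<mu> f\<bar> < e"
proof -
  have mem: "\<mu> \<in> topspace (weak_star_ball S)" using cp by (simp add: sequence_closure_point_def)
  then show \<mu>: "\<mu> \<in> measure_unit_ball S" by (simp add: weak_star_ball_def topspace_pullback_topology)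
  let ?X = "product_topology (\<lambda>_. euclideanreal) {\<phi>. continuous_on S \<phi>}"
  let ?b = "\<lambda>\<mu>. \<lambda>\<phi>\<in>{\<phi>. continuous_on S \<phi>}. bracket S \<mu> \<phi>"
  define V where "V = {g \<in> topspace ?X. g f \<in> ball (bracket S \<mu> f) e}"
  have "openin ?X V"
    unfolding V_def using f by (intro openin_continuous_map_preimage[where Y=euclideanreal] continuous_map_product_projection) auto
  then have "openin (weak_star_ball S) (?b -` V \<inter> measure_unit_ball S)"
    unfolding weak_star_ball_def openin_pullback_topology by blast
  moreover have "\<mu> \<in> ?b -` V \<inter> measure_unit_ball S" using \<mu> f e by (simp add: V_def)
  ultimately have "\<exists>\<^sub>F K in sequentially. s K \<in> ?b -` V \<inter> measure_unit_ball S"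
    using cp unfolding sequence_closure_point_def by blast
  then show "\<exists>\<^sub>F K in sequentially. \<bar>bracket S (s K) f - bracket S \<mu> f\<bar> < e"
    by (rule frequently_elim1) (use f in \<open>auto simp: V_def dist_real_def abs_minus_commute\<close>)
qed

section \<open>Concentration\<close>

text \<open>The set of \<open>x\<close> where \<open>|f(0, x)| \<ge> \<epsilon>/2\<close> is compact and does not meet the closure of \<open>\<omega>\<close>; take
  \<open>\<zeta> = 1\<close> on it. For \<open>x\<close> outside and small \<open>t\<close>, uniform continuity bounds \<open>f\<close> by \<open>\<epsilon>\<close>; for \<open>t \<ge> \<delta>\<close> the term \<open>M t\<^sup>2\<close>
  dominates.\<close>

lemma concentration_majorant:
  fixes f :: "real \<times> 'a::euclidean_space \<Rightarrow> real"
  assumes X: "compact X" and f: "continuous_on ({0..T} \<times> X) f" and T: "T > 0"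
    and zero: "\<And>x. x \<in> X \<Longrightarrow> x \<in> closure \<omega> \<Longrightarrow> f (0, x) = 0" and \<epsilon>: "\<epsilon> > 0"
  obtains \<zeta> M where "\<zeta> \<in> test_functions (- closure \<omega>)" "M \<ge> 0"
    "\<And>t x. t \<in> {0..T} \<Longrightarrow> x \<in> X \<Longrightarrow> \<bar>f (t, x)\<bar> \<le> \<epsilon> + M * (\<zeta> x)\<^sup>2 + M * t\<^sup>2"
proof -
  have cX: "compact ({0..T} \<times> X)" using X by (intro compact_Times) auto
  have "bounded (f ` ({0..T} \<times> X))" using cX f by (intro compact_imp_bounded compact_continuous_image)
  then obtain M where M: "\<And>z. z \<in> {0..T} \<times> X \<Longrightarrow> \<bar>f z\<bar> \<le> M" "M > 0"
    unfolding bounded_pos by auto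
  have "uniformly_continuous_on ({0..T} \<times> X) f" using f cX by (rule compact_uniformly_continuous)
  then obtain \<delta> where \<delta>: "\<delta> > 0" "\<And>z w. z \<in> {0..T} \<times> X \<Longrightarrow> w \<in> {0..T} \<times> X \<Longrightarrow> dist w z < \<delta> \<Longrightarrow> dist (f w) (f z) < \<epsilon> / 2"
    unfolding uniformly_continuous_on_def using \<epsilon> half_gt_zero by metis
  let ?K = "{x \<in> X. \<epsilon> / 2 \<le> \<bar>f (0, x)\<bar>}"
  have c0: "continuous_on X (\<lambda>x. f (0, x))"
    using T by (intro continuous_on_compose2[OF f] continuous_intros) auto
  have "closed (X \<inter> (\<lambda>x. \<bar>f (0, x)\<bar>) -` {\<epsilon> / 2..})"
    using X by (intro continuous_closed_preimage continuous_on_rabs c0 closed_atLeast) (rule compact_imp_closed)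
  moreover have "X \<inter> (X \<inter> (\<lambda>x. \<bar>f (0, x)\<bar>) -` {\<epsilon> / 2..}) = ?K" by auto
  ultimately have K: "compact ?K" using compact_Int_closed[OF X] by metis
  have Ks: "?K \<subseteq> - closure \<omega>" using zero \<epsilon> by auto
  obtain \<zeta> where \<zeta>: "\<zeta> \<in> test_functions (- closure \<omega>)" "\<And>x. x \<in> ?K \<Longrightarrow> \<zeta> x = 1"
    by (rule smooth_urysohn[OF K _ Ks]) (auto intro: that)
  have bound: "\<bar>f (t, x)\<bar> \<le> \<epsilon> + (M + M / \<delta>\<^sup>2) * (\<zeta> x)\<^sup>2 + (M + M / \<delta>\<^sup>2) * t\<^sup>2" if t: "t \<in> {0..T}" and x: "x \<in> X" for t x
  proof -
    have pos: "0 \<le> M * (\<zeta> x)\<^sup>2" "0 \<le> M / \<delta>\<^sup>2 * (\<zeta> x)\<^sup>2" "0 \<le> M * t\<^sup>2" "0 \<le> M / \<delta>\<^sup>2 * t\<^sup>2"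
      using M(2) by auto
    have e: "\<epsilon> + (M + M / \<delta>\<^sup>2) * (\<zeta> x)\<^sup>2 + (M + M / \<delta>\<^sup>2) * t\<^sup>2
        = \<epsilon> + M * (\<zeta> x)\<^sup>2 + M / \<delta>\<^sup>2 * (\<zeta> x)\<^sup>2 + M * t\<^sup>2 + M / \<delta>\<^sup>2 * t\<^sup>2"
      by (simp only: distrib_right add_ac)
    have fM: "\<bar>f (t, x)\<bar> \<le> M" using t x by (intro M) auto
    consider "\<delta> \<le> t" | "t < \<delta>" "x \<in> ?K" | "t < \<delta>" "x \<notin> ?K" by linarith
    then show ?thesis
    proof cases
      case 1
      then have "\<delta>\<^sup>2 \<le> t\<^sup>2" using \<delta>(1) by (intro power_mono) auto
      then have "M \<le> M / \<delta>\<^sup>2 * t\<^sup>2" using M(2) \<delta>(1) by (simp add: field_simps)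
      with fM pos \<epsilon> show ?thesis unfolding e by linarith
    next
      case 2
      with \<zeta>(2) have "M * (\<zeta> x)\<^sup>2 = M" by simp
      with fM pos \<epsilon> show ?thesis unfolding e by linarith
    next
      case 3
      then have "\<bar>f (0, x)\<bar> < \<epsilon> / 2" using x by auto
      moreover have "dist (f (t, x)) (f (0, x)) < \<epsilon> / 2"
        using t x 3 T by (intro \<delta>(2)) (auto simp: dist_prod_def)
      ultimately show ?thesis using pos unfolding e dist_real_def by linarith
    qed
  qed
  show thesis by (rule that[OF \<zeta>(1) _ bound]) (use M(2) in auto)
qed

context heat_cylinder
begin

lemma weighted_mass_eq:
  assumes sol: "solution_modes h (\<lambda>t x. v (t, x))" and v: "L2 MQ v"
    and \<theta>: "continuous_on UNIV \<theta>" and \<zeta>: "\<zeta> \<in> test_functions UNIV"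
  shows "integral {0..T} (\<lambda>t. (\<theta> t)\<^sup>2 * nsq (\<lambda>x. \<zeta> x * v (t, x))) = (LINT z|MQ. (\<theta> (fst z) * \<zeta> (snd z))\<^sup>2 * (v z)\<^sup>2)"
    and "integrable MQ (\<lambda>z. (\<theta> (fst z) * \<zeta> (snd z))\<^sup>2 * (v z)\<^sup>2)"
proof -
  have cz: "continuous_on UNIV \<zeta>" using \<zeta> by (intro smooth_continuous test_function_smooth)
  have c: "continuous_on UNIV (\<lambda>z::real \<times> 'a. \<theta> (fst z) * \<zeta> (snd z))"
    by (intro continuous_intros continuous_on_compose2[OF \<theta>] continuous_on_compose2[OF cz]) auto
  have b\<theta>: "bdd_meas T \<theta>" by (intro bdd_meas_continuous continuous_on_subset[OF \<theta>]) auto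
  obtain B1 where B1: "B1 \<ge> 0" "\<And>t. t \<in> {0..T} \<Longrightarrow> \<bar>\<theta> t\<bar> \<le> B1" by (rule bdd_meas_bound[OF b\<theta>]) (rule that)
  obtain B2 where B2: "\<And>x. \<bar>\<zeta> x\<bar> \<le> B2" using test_grad_bounded[OF \<zeta>] by metis
  have "L2 MQ (\<lambda>z. (\<theta> (fst z) * \<zeta> (snd z)) * v z)"
  proof (rule L2_bounded_mult[OF v continuous_measurable_lebesgue_on[OF c]])
    show "\<bar>\<theta> (fst z) * \<zeta> (snd z)\<bar> \<le> B1 * B2" if "z \<in> space MQ" for z
      using that B1 B2 unfolding abs_mult by (intro mult_mono) auto
  qed
  from L2_real_sq[OF this]
  show i: "integrable MQ (\<lambda>z. (\<theta> (fst z) * \<zeta> (snd z))\<^sup>2 * (v z)\<^sup>2)" by (simp add: power_mult_distrib)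
  have e: "(LINT x|M\<Omega>. (\<theta> t * \<zeta> x)\<^sup>2 * (v (t, x))\<^sup>2) = (\<theta> t)\<^sup>2 * nsq (\<lambda>x. \<zeta> x * v (t, x))" for t
    by (simp add: power_mult_distrib mult.assoc)
  have "bdd_meas T (\<lambda>t. (\<theta> t)\<^sup>2 * nsq (\<lambda>x. \<zeta> x * v (t, x)))"
    by (intro bdd_meas_mult bdd_meas_power b\<theta> nsq_test_bdd_meas[OF sol \<zeta>])
  from LINT_open_interval[OF this] Fubini_cylinder(3)[OF borel i]
  show "integral {0..T} (\<lambda>t. (\<theta> t)\<^sup>2 * nsq (\<lambda>x. \<zeta> x * v (t, x))) = (LINT z|MQ. (\<theta> (fst z) * \<zeta> (snd z))\<^sup>2 * (v z)\<^sup>2)"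
    by (simp add: e)
qed

lemma total_eq:
  assumes sol: "solution_modes h (\<lambda>t x. v (t, x))" and v: "L2 MQ v"
  shows "total (\<lambda>t x. v (t, x)) = (LINT z|MQ. (v z)\<^sup>2)"
  using LINT_open_interval[OF nsq_bdd_meas[OF sol]] Fubini_cylinder(3)[OF borel L2_real_sq[OF v]]
  by (simp add: total_def)

text \<open>The weight \<open>\<zeta>\<close> of the majorant kills the initial value and the weight \<open>t\<close> vanishes at the
  initial time, so both carry a negligible mass.\<close>

theorem concentration:
  fixes f :: "real \<times> 'a \<Rightarrow> real"
  assumes f: "continuous_on (closed_cylinder T \<Omega>) f"
    and zero: "\<And>x. x \<in> closure \<Omega> \<Longrightarrow> x \<in> closure \<omega> \<Longrightarrow> f (0, x) = 0" and \<epsilon>: "\<epsilon> > 0"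
  shows "\<forall>\<^sub>F K in sequentially. \<forall>h v. L2 MQ v \<longrightarrow> high_solution K h (\<lambda>t x. v (t, x)) \<longrightarrow>
    (AE x in M\<Omega>. h x * indicator \<omega> x = h x) \<longrightarrow> \<bar>LINT z|MQ. f z * (v z)\<^sup>2\<bar> \<le> \<epsilon> * (LINT z|MQ. (v z)\<^sup>2)"
proof -
  have X: "compact (closure \<Omega>)" using bounded_\<Omega> by simp
  obtain \<zeta> M where \<zeta>: "\<zeta> \<in> test_functions (- closure \<omega>)" and M: "M \<ge> 0"
    and maj: "\<And>t x. t \<in> {0..T} \<Longrightarrow> x \<in> closure \<Omega> \<Longrightarrow> \<bar>f (t, x)\<bar> \<le> \<epsilon> / 2 + M * (\<zeta> x)\<^sup>2 + M * t\<^sup>2"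
    by (rule concentration_majorant[OF X f[unfolded closed_cylinder_def] T_pos zero half_gt_zero[OF \<epsilon>]]) (assumption+, rule that)
  have \<zeta>U: "\<zeta> \<in> test_functions UNIV" using \<zeta> by (rule test_functions_mono) simp
  obtain \<eta> where \<eta>: "\<eta> \<in> test_functions UNIV" "\<And>x. x \<in> closure \<Omega> \<Longrightarrow> \<eta> x = 1"
    by (rule smooth_urysohn[OF X open_UNIV]) (auto intro: that)
  define \<epsilon>' where "\<epsilon>' = \<epsilon> / (4 * (M + 1))"
  have \<epsilon>': "\<epsilon>' > 0" "M * \<epsilon>' \<le> \<epsilon> / 4" using \<epsilon> M by (auto simp: \<epsilon>'_def field_simps)
  have pt: "prim T (\<lambda>t. t) (\<lambda>t. 1)" by (rule prim_smooth) (auto intro!: derivative_eq_intros)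
  show ?thesis
    using weighted_mass_small[OF \<zeta>U prim_const \<epsilon>'(1), of 1] weighted_mass_small[OF \<eta>(1) pt \<epsilon>'(1)]
  proof eventually_elim
    case (elim K)
    show ?case
    proof (intro allI impI)
      fix h v assume v: "L2 MQ v" and hs: "high_solution K h (\<lambda>t x. v (t, x))"
        and h\<omega>: "AE x in M\<Omega>. h x * indicator \<omega> x = h x"
      have sol: "solution_modes h (\<lambda>t x. v (t, x))" using hs by (simp add: high_solution_def)
      let ?S = "LINT z|MQ. (v z)\<^sup>2"
      have "AE x in M\<Omega>. \<zeta> x * h x = 0"
        using h\<omega>
      proof eventually_elim
        case (elim x)
        show ?case
        proof (cases "x \<in> \<omega>")
          case True
          then have "x \<in> closure \<omega>" using closure_subset by blast
          then have "\<zeta> x = 0" using \<zeta> closure_subset[of "{x. \<zeta> x \<noteq> 0}"] by (auto simp: test_functions_iff)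
          then show ?thesis by simp
        qed (use elim in simp)
      qed
      note W1 = weighted_mass_eq[OF sol v continuous_on_const[of _ 1] \<zeta>U]
      note W2 = weighted_mass_eq[OF sol v continuous_on_id[of UNIV] \<eta>(1)]
      have 1: "(LINT z|MQ. (1 * \<zeta> (snd z))\<^sup>2 * (v z)\<^sup>2) \<le> \<epsilon>' * ?S"
        unfolding W1(1)[symmetric] total_eq[OF sol v, symmetric]
        by (rule elim(1)[rule_format, OF hs]) (use \<open>AE x in M\<Omega>. \<zeta> x * h x = 0\<close> in simp)
      have 2: "(LINT z|MQ. (fst z * \<eta> (snd z))\<^sup>2 * (v z)\<^sup>2) \<le> \<epsilon>' * ?S"
        unfolding W2(1)[symmetric] total_eq[OF sol v, symmetric]
        by (rule elim(2)[rule_format, OF hs]) simp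
      have fm: "f \<in> borel_measurable MQ"
        using f closure_subset[of \<Omega>] lebesgue open_Q
        by (intro continuous_imp_measurable_on_sets_lebesgue continuous_on_subset[OF f]) (auto simp: closed_cylinder_def)
      let ?g = "\<lambda>z. \<epsilon> / 2 * (v z)\<^sup>2 + M * ((1 * \<zeta> (snd z))\<^sup>2 * (v z)\<^sup>2) + M * ((fst z * \<eta> (snd z))\<^sup>2 * (v z)\<^sup>2)"
      have gi: "integrable MQ ?g" using L2_real_sq[OF v] W1(2) W2(2) by simp
      have le: "norm (f z * (v z)\<^sup>2) \<le> ?g z" if "z \<in> space MQ" for z
      proof -
        have z: "fst z \<in> {0..T}" "snd z \<in> closure \<Omega>" using that closure_subset[of \<Omega>] by auto
        from mult_right_mono[OF maj[OF z], of "(v z)\<^sup>2"] \<eta>(2)[OF z(2)] show ?thesis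
          by (simp add: abs_mult algebra_simps)
      qed
      have fi: "integrable MQ (\<lambda>z. f z * (v z)\<^sup>2)"
        by (rule integrable_bound_real[OF gi]) (use fm v le in \<open>auto simp: L2_def\<close>)
      have "\<bar>LINT z|MQ. f z * (v z)\<^sup>2\<bar> \<le> (LINT z|MQ. norm (f z * (v z)\<^sup>2))"
        using integral_norm_bound[of MQ "\<lambda>z. f z * (v z)\<^sup>2"] by simp
      also have "\<dots> \<le> (LINT z|MQ. ?g z)" by (rule integral_mono[OF integrable_norm[OF fi] gi le])
      also have "\<dots> = \<epsilon> / 2 * ?S + M * (LINT z|MQ. (1 * \<zeta> (snd z))\<^sup>2 * (v z)\<^sup>2) + M * (LINT z|MQ. (fst z * \<eta> (snd z))\<^sup>2 * (v z)\<^sup>2)"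
        using L2_real_sq[OF v] W1(2) W2(2) by simp
      also have "\<dots> \<le> \<epsilon> / 2 * ?S + M * (\<epsilon>' * ?S) + M * (\<epsilon>' * ?S)"
        using 1 2 M by (intro add_mono mult_left_mono order_refl)
      also have "\<dots> \<le> \<epsilon> / 2 * ?S + \<epsilon> / 4 * ?S + \<epsilon> / 4 * ?S"
        unfolding mult.assoc[symmetric] by (intro add_mono mult_right_mono \<epsilon>'(2) order_refl) simp_all
      finally show "\<bar>LINT z|MQ. f z * (v z)\<^sup>2\<bar> \<le> \<epsilon> * ?S" by simp
    qed
  qed
qed

end

text \<open>A real sequence with a limit has no other cluster point.\<close>

lemma closure_point_bracket_limit:
  assumes cp: "sequence_closure_point (weak_star_ball S) s \<mu>" and f: "continuous_on S f"
    and lim: "\<And>e. e > 0 \<Longrightarrow> \<forall>\<^sub>F K in sequentially. \<bar>bracket S (s K) f - l\<bar> \<le> e"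
  shows "bracket S \<mu> f = l"
proof (rule ccontr)
  assume "\<not> ?thesis"
  then have e: "\<bar>bracket S \<mu> f - l\<bar> / 2 > 0" by simp
  have "\<exists>\<^sub>F K in sequentially. \<bar>bracket S (s K) f - l\<bar> \<le> \<bar>bracket S \<mu> f - l\<bar> / 2 \<and>
      \<bar>bracket S (s K) f - bracket S \<mu> f\<bar> < \<bar>bracket S \<mu> f - l\<bar> / 2"
    by (rule frequently_eventually_conj[OF closure_point_bracket(2)[OF cp f e] lim[OF e]])
  then obtain K where "\<bar>bracket S (s K) f - bracket S \<mu> f\<bar> < \<bar>bracket S \<mu> f - l\<bar> / 2"
      "\<bar>bracket S (s K) f - l\<bar> \<le> \<bar>bracket S \<mu> f - l\<bar> / 2"
    by (auto dest!: frequently_ex)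
  then show False by (simp add: abs_if split: if_splits)
qed

lemma closure_point_bracket_nonneg:
  assumes cp: "sequence_closure_point (weak_star_ball S) s \<mu>" and f: "continuous_on S f"
    and pos: "\<forall>\<^sub>F K in sequentially. bracket S (s K) f \<ge> 0"
  shows "bracket S \<mu> f \<ge> 0"
proof (rule ccontr)
  assume "\<not> ?thesis"
  then have e: "- bracket S \<mu> f > 0" by simp
  have "\<exists>\<^sub>F K in sequentially. bracket S (s K) f \<ge> 0 \<and> \<bar>bracket S (s K) f - bracket S \<mu> f\<bar> < - bracket S \<mu> f"
    by (rule frequently_eventually_conj[OF closure_point_bracket(2)[OF cp f e] pos])
  then show False by (auto dest!: frequently_ex)
qed


theorem theorem2:
  fixes \<Omega> \<omega> :: "'a::euclidean_space set"
    and T :: real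
    and B :: boundary_operator
    and \<Lambda> :: "nat \<Rightarrow> real"
    and \<phi> :: "nat \<Rightarrow> 'a \<Rightarrow> real"
    and q :: "real \<times> 'a \<Rightarrow> real"
    and a :: "nat \<Rightarrow> nat \<Rightarrow> real"
    and h :: "nat \<Rightarrow> 'a \<Rightarrow> real"
    and v :: "nat \<Rightarrow> real \<times> 'a \<Rightarrow> real"
    and \<nu> :: "(real \<times> 'a) set \<Rightarrow> real"
  assumes "open \<Omega>" and "bounded \<Omega>" and "C2_boundary \<Omega>" and "T > 0"
    and "laplace_eigenbasis B \<Omega> \<Lambda> \<phi>"
    and "Linfty (cylinder T \<Omega>) q"
    and "closedin (top_of_set \<Omega>) \<omega>" and "emeasure lebesgue \<omega> > 0"
    and "\<And>r. r \<ge> 1 \<Longrightarrow> \<exists>F. weak_heat_op (cylinder T \<Omega>) q F \<and> Lp r (cylinder T \<Omega>) F"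
    and "\<And>r. r \<ge> 1 \<Longrightarrow> \<exists>G. weak_space_grad (cylinder T \<Omega>) q G \<and> Lp r (cylinder T \<Omega>) G"
    and "B = Neumann \<Longrightarrow> lateral_boundary_cond B T \<Omega> q"
    and "\<And>K. K \<ge> 1 \<Longrightarrow> Lp 2 \<Omega> (h K)"
    and "\<And>K. K \<ge> 1 \<Longrightarrow>
           (\<lambda>n. LINT x|lebesgue_on \<Omega>. (h K x - (\<Sum>k=K..n. a K k * \<phi> k x))\<^sup>2) \<longlonglongrightarrow> 0"
    and "\<And>K. K \<ge> 1 \<Longrightarrow> (\<lambda>n. (a K (K + n))\<^sup>2) sums 1"
    and "\<And>K. K \<ge> 1 \<Longrightarrow> AE x in lebesgue_on \<Omega>. h K x * indicator \<omega> x = h K x"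
    and "\<And>K. K \<ge> 1 \<Longrightarrow> heat_solution B T \<Omega> q (h K) (v K)"
    and "sequence_closure_point (weak_star_ball (closed_cylinder T \<Omega>))
           (\<lambda>K. normalized_square_measure T \<Omega> (v K)) \<nu>"
  shows "(\<forall>f. continuous_on (closed_cylinder T \<Omega>) f \<and>
              closure {z \<in> closed_cylinder T \<Omega>. f z \<noteq> 0} \<inter> ({0} \<times> \<omega>) = {}
            \<longrightarrow> bracket (closed_cylinder T \<Omega>) \<nu> f = 0) \<and>
         \<nu> (closed_cylinder T \<Omega>) = 1 \<and>
         (\<forall>A \<in> borel_sets_on (closed_cylinder T \<Omega>). \<nu> A \<ge> 0)"
proof -
  note open_\<Omega> = assms(1) and bounded = assms(2) and C2 = assms(3) and hL = assms(12) and expansion = assms(13)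
    and normalized = assms(14) and supported = assms(15) and solution = assms(16) and cp = assms(17)
  let ?MQ = "lebesgue_on ({0<..<T} \<times> \<Omega>)"
  let ?S = "closed_cylinder T \<Omega>" and ?\<nu> = "\<lambda>K. normalized_square_measure T \<Omega> (v K)"
  interpret C: bounded_cylinder \<Omega> T by unfold_locales (use assms(1,2,4) in auto)
  have cyl: "cylinder T \<Omega> = {0<..<T} \<times> \<Omega>" by (simp add: cylinder_def)
  obtain p Q where p: "p \<in> borel_measurable borel" "\<And>z. \<bar>p z\<bar> \<le> Q" "AE z in ?MQ. q z = p z"
    using assms(6) unfolding cyl by (rule C.bounded_borel_representative) (rule that)
  obtain \<Gamma> where \<Gamma>: "eigenbasis \<Omega> \<phi> (form_test B \<Omega>) \<Gamma> \<Lambda>"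
    "\<And>k. B = Dirichlet \<Longrightarrow> k \<ge> 1 \<Longrightarrow> \<exists>\<zeta>. (\<forall>n::nat. \<zeta> n \<in> test_functions \<Omega>) \<and>
        (\<lambda>n. LINT x|lebesgue_on \<Omega>. (norm (grad (\<zeta> n) x - \<Gamma> k x))\<^sup>2) \<longlonglongrightarrow> 0"
    by (rule eigenbasis_exists[OF open_\<Omega> bounded C2 assms(5)]) (rule that)
  interpret E: eigenbasis \<Omega> \<phi> "form_test B \<Omega>" \<Gamma> \<Lambda> by (rule \<Gamma>(1))
  interpret H: heat_cylinder \<Omega> T \<phi> B \<Gamma> \<Lambda> p Q
    by unfold_locales (use C2 p(1,2) \<Gamma>(2) in auto)
  have qm: "q \<in> borel_measurable (?MQ)" using assms(6) by (simp add: Linfty_def cyl)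
  have h: "L2 (lebesgue_on \<Omega>) (h K)" if "K \<ge> 1" for K using hL[OF that] by (simp add: Lp2_iff_L2)
  have v: "L2 (?MQ) (v K)" if "K \<ge> 1" for K
    using solution[OF that] by (simp add: heat_solution_def Lp2_iff_L2 cyl)
  have modes: "H.solution_modes (h K) (\<lambda>t x. v K (t, x))" if "K \<ge> 1" for K
    by (rule H.heat_solution_modes[OF solution[OF that] qm p(3) h[OF that]])
  have coef: "E.coef (h K) k = (if K \<le> k then a K k else 0)" if K: "K \<ge> 1" and k: "k \<ge> 1" for K k
  proof -
    let ?s = "\<lambda>n x. \<Sum>k=K..n. a K k * \<phi> k x"
    have "(\<lambda>n. LINT x|lebesgue_on \<Omega>. ?s n x \<bullet> \<phi> k x) \<longlonglongrightarrow> (LINT x|lebesgue_on \<Omega>. h K x \<bullet> \<phi> k x)"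
    proof (rule L2_pairing_tendsto)
      show "L2 (lebesgue_on \<Omega>) (?s n)" for n using K by (intro E.L2_comb) auto
      show "(\<lambda>n. LINT x|lebesgue_on \<Omega>. (norm (?s n x - h K x))\<^sup>2) \<longlonglongrightarrow> 0"
        using expansion[OF K] by (simp add: power2_commute[of "h K _"])
    qed (use h K E.L2_basis k in auto)
    then have "(\<lambda>n. E.coef (?s n) k) \<longlonglongrightarrow> E.coef (h K) k" by (simp add: E.coef_def)
    moreover have "E.coef (?s n) k = (if K \<le> k then a K k else 0)" if "n \<ge> k" for n
      using K k that by (subst E.coef_comb) auto
    then have "\<forall>\<^sub>F n in sequentially. E.coef (?s n) k = (if K \<le> k then a K k else 0)"
      unfolding eventually_sequentially by blast
    then have "(\<lambda>n. E.coef (?s n) k) \<longlonglongrightarrow> (if K \<le> k then a K k else 0)" by (rule tendsto_eventually)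
    ultimately show ?thesis by (rule LIMSEQ_unique)
  qed
  have high: "H.high_solution K (h K) (\<lambda>t x. v K (t, x))" if "K \<ge> 1" for K
    unfolding H.high_solution_def using modes[OF that] coef[OF that] by auto
  have pos: "(LINT z|?MQ. (v K z)\<^sup>2) > 0" if K: "K \<ge> 1" for K
  proof -
    have "\<exists>n. a K (K + n) \<noteq> 0"
    proof (rule ccontr)
      assume "\<not> ?thesis"
      then have "(\<lambda>n. 0 :: real) sums 1" using normalized[OF K] by simp
      from sums_unique2[OF this sums_zero] show False by simp
    qed
    then obtain n where "a K (K + n) \<noteq> 0" by blast
    then have "E.coef (h K) (K + n) \<noteq> 0" using coef[of K "K + n"] K by simp
    then have "H.total (\<lambda>t x. v K (t, x)) > 0" using K by (intro H.total_pos[OF modes[OF K], of "K + n"]) auto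
    then show ?thesis by (simp add: H.total_eq[OF modes[OF K] v[OF K]])
  qed
  have br: "bracket ?S (?\<nu> K) f = (LINT z|?MQ. f z * (v K z)\<^sup>2) / (LINT z|?MQ. (v K z)\<^sup>2)"
    if "continuous_on ?S f" "K \<ge> 1" for f K
    using bracket_normalized_square[OF open_\<Omega> _ _ that(1), of "v K"] v[OF that(2)] pos[OF that(2)] by (simp add: cyl)
  have S: "closed ?S" by (simp add: closed_cylinder_def closed_Times)
  note ball = closure_point_bracket(1)[OF cp continuous_on_const zero_less_one]
  have "bracket ?S \<nu> f = 0" if f: "continuous_on ?S f"
    and disj: "closure {z \<in> ?S. f z \<noteq> 0} \<inter> ({0} \<times> \<omega>) = {}" for f
  proof (rule closure_point_bracket_limit[OF cp f])
    have c0: "continuous_on (closure \<Omega>) (\<lambda>x. f (0, x))"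
      by (rule continuous_on_compose2[OF f]) (use assms(4) in \<open>auto simp: closed_cylinder_def intro!: continuous_intros\<close>)
    have "closed {x \<in> closure \<Omega>. f (0, x) = 0}" by (rule continuous_closed_preimage_constant[OF c0]) simp
    moreover have "\<omega> \<subseteq> {x \<in> closure \<Omega>. f (0, x) = 0}"
    proof
      fix x assume x: "x \<in> \<omega>"
      then have "x \<in> \<Omega>" using closedin_subset[OF assms(7)] by auto
      then have x\<Omega>: "x \<in> closure \<Omega>" using closure_subset by blast
      have "(0, x) \<notin> {z \<in> ?S. f z \<noteq> 0}" using disj x closure_subset[of "{z \<in> ?S. f z \<noteq> 0}"] by blast
      with x\<Omega> assms(4) show "x \<in> {x \<in> closure \<Omega>. f (0, x) = 0}" by (simp add: closed_cylinder_def)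
    qed
    ultimately have zero: "closure \<omega> \<subseteq> {x \<in> closure \<Omega>. f (0, x) = 0}" by (rule closure_minimal[rotated])
    fix e :: real assume e: "e > 0"
    have "\<forall>\<^sub>F K in sequentially. \<forall>h v. L2 (?MQ) v \<longrightarrow> H.high_solution K h (\<lambda>t x. v (t, x)) \<longrightarrow>
        (AE x in lebesgue_on \<Omega>. h x * indicator \<omega> x = h x) \<longrightarrow>
        \<bar>LINT z|?MQ. f z * (v z)\<^sup>2\<bar> \<le> e * (LINT z|?MQ. (v z)\<^sup>2)"
      by (rule H.concentration[OF f _ e]) (use zero in auto)
    then show "\<forall>\<^sub>F K in sequentially. \<bar>bracket ?S (?\<nu> K) f - 0\<bar> \<le> e"
      using eventually_ge_at_top[of 1]
    proof eventually_elim
      case (elim K)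
      have "\<bar>LINT z|?MQ. f z * (v K z)\<^sup>2\<bar> \<le> e * (LINT z|?MQ. (v K z)\<^sup>2)"
        using elim(1) v[OF elim(2)] high[OF elim(2)] supported[OF elim(2)] by blast
      then show ?case using pos[OF elim(2)] by (simp add: br[OF f elim(2)] divide_le_eq)
    qed
  qed
  moreover have "\<nu> ?S = 1"
  proof -
    have "bracket ?S \<nu> (\<lambda>z. 1) = 1"
    proof (rule closure_point_bracket_limit[OF cp continuous_on_const])
      fix e :: real assume e: "e > 0"
      show "\<forall>\<^sub>F K in sequentially. \<bar>bracket ?S (?\<nu> K) (\<lambda>z. 1) - 1\<bar> \<le> e"
        using eventually_ge_at_top[of 1]
      proof eventually_elim
        case (elim K)
        then show ?case using br[OF continuous_on_const elim, of 1] pos[OF elim] e by simp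
      qed
    qed
    then show ?thesis using bracket_one[OF S ball] by simp
  qed
  moreover have "\<nu> A \<ge> 0" if A: "A \<in> borel_sets_on ?S" for A
  proof (rule nonneg_bracket_imp_nonneg[OF S ball _ A])
    fix f :: "real \<times> 'a \<Rightarrow> real" assume f: "continuous_on ?S f" "\<And>z. f z \<ge> 0"
    show "bracket ?S \<nu> f \<ge> 0"
    proof (rule closure_point_bracket_nonneg[OF cp f(1)])
      show "\<forall>\<^sub>F K in sequentially. bracket ?S (?\<nu> K) f \<ge> 0"
        using eventually_ge_at_top[of 1]
      proof eventually_elim
        case (elim K)
        then show ?case using f(2) by (simp add: br[OF f(1) elim])
      qed
    qed
  qed
  ultimately show ?thesis by blast
qed

end
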